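(* Let $\mathcal{C}$ be a category of Brauer type with parity sign $\epsilon$ whose parameters satisfy $f=0$, $f'=b\neq0$ and $\varsigma\neq0$. Then either $\lambda'=\lambda$, or $\lambda'\neq\lambda$ and $\lambda'=b-\lambda$. In both cases $e^2=-\epsilon$ and $$a=\lambda^2-b\lambda,\ c=0,\ \varsigma'=\epsilon\varsigma,\ \rho=\epsilon e\varsigma(\lambda-b),\ \delta=\epsilon e\varsigma(\lambda+\lambda'-b)/b,\ e'=-\epsilon e,\ d=-eb,\ d'=0,$$ $$D=(\lambda-b)b,\ E=b,\ D'=E'=0,\ F=-\epsilon ea,\ F'=ea .$$ Conversely, for all $\lambda,b,\varsigma\in\mathbb{K}\setminus\{0\}$ with $a=\lambda^2-b\lambda\ne0$, all $e\in\mathbb{K}$ with $e^2=-\epsilon$, and $\lambda'\in\{\lambda,b-\lambda\}$ (so $\lambda,b,\varsigma$ are independent), the monoidal supercategory presented by the defining relations with these parameter values (and $f=0$, $f'=b$) is a category of Brauer type; it is denoted $\mathcal{C}^{0,b}_{\lambda,\varsigma}(\epsilon,e,-\epsilon e)$ if $\lambda'=\lambda$ and $\mathcal{C}^{0,b}_{b-\lambda,\varsigma}(\epsilon,e,-\epsilon e)$ if $\lambda'=b-\lambda$.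
   Context: $\mathbb{K}$ is a field of characteristic different from 2; everything is $\mathbb{K}$-linear. A strict monoidal supercategory is a strict monoidal category enriched over $\mathbb{Z}/2$-graded vector spaces, with interchange law $(f\otimes g)\circ(h\otimes k)=(-1)^{|g||h|}(f\circ h)\otimes(g\circ k)$. A category of Brauer type is a strict monoidal supercategory whose objects are generated by one object $\bullet$ ($m\in\mathbb{N}$ denotes $\bullet^{\otimes m}$, $1_m$ its identity, $I=1_1$), whose morphisms are generated by an even $H\in\mathrm{Hom}(2,2)$ and $A\in\mathrm{Hom}(2,0)$, $U\in\mathrm{Hom}(0,2)$ which are both even ($\epsilon=1$) or both odd ($\epsilon=-1$), such that $H$ is an isomorphism satisfying the braid relation $(H\otimes I)(I\otimes H)(H\otimes I)=(I\otimes H)(H\otimes I)(I\otimes H)$, and such that for all $m,n$ the standard expressions of $(m,n)$-Brauer diagrams form a basis of $\mathrm{Hom}(m,n)$. Parameters. In a category of Brauer type there are unique scalars with (the defining relations, together with the braid relation): $HU=\lambda U$, $AH=\lambda'A$; $AU=\delta$; $(A\otimes I)(I\otimes U)=\varsigma I$, $(I\otimes A)(U\otimes I)=\varsigma' I$; $(A\otimes I)(I\otimes H)(U\otimes I)=\rho I$; $H^2=a1_2+bH+cUA$; $(H\otimes I)(I\otimes U)=d(U\otimes I)+e(I\otimes H)(U\otimes I)+f(I\otimes U)$; $(H\otimes I)(I\otimes H)(U\otimes I)=D(U\otimes I)+E(I\otimes H)(U\otimes I)+F(I\otimes U)$; $(I\otimes A)(H\otimes I)=d'(A\otimes I)+e'(A\otimes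 I)(I\otimes H)+f'(I\otimes A)$; $(A\otimes I)(I\otimes H)(H\otimes I)=D'(A\otimes I)+E'(A\otimes I)(I\otimes H)+F'(I\otimes A)$. Standard expressions: $s_i^n=1_{i-1}\otimes H\otimes 1_{n-i-1}$, $u_i^n=1_{i-1}\otimes U\otimes 1_{n-i+1}$, $\mathsf{a}_i^n=1_{i-1}\otimes A\otimes 1_{n-i+1}$; for $p\ge1$, $s\ge0$, $p+s\le n+1$ put $I_s^{n,p}=s_{p+s}^{n+2}\cdots s_{p+1}^{n+2}u_p^n$ and $J_s^{n,p}=\mathsf{a}_p^ns_{p+1}^{n+2}\cdots s_{p+s}^{n+2}$. For $n-r=2k\ge0$, $I(r,n)$ is the set of products $I_{s_1}^{n-2,p_1}\cdots I_{s_k}^{r,p_k}$ with $p_1>\dots>p_k$, $J(n,r)$ the set of products $J_{s_1}^{r,p_1}\cdots J_{s_k}^{n-2,p_k}$ with $p_1<\dots<p_k$, and $H(r)$ a fixed set of words in the $s_i^r$ with exactly one reduced expression for each element of $S_r$, none containing a consecutive subword $s_is_{i+1}s_i$. The standard expressions are the products $UXA$ with $U\in I(r,n)$, $X\in H(r)$, $A\in J(m,r)$, $r\ge0$. *)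

theory Defs
  imports
    "Jordan_Normal_Form.VS_Connect"
    "HOL-Library.Z2"
    "HOL-Combinatorics.Permutations"
begin

section \<open>Strict monoidal supercategories with object monoid \<open>(\<nat>, +, 0)\<close>\<close>

text \<open>
  The natural number \<open>m\<close> stands for the \<open>m\<close>-fold tensor power of the generating object.
  The scalars are a type \<open>'k\<close> of class \<open>field\<close>; \<^const>\<open>class_ring\<close> is that type regarded as a ring
  record. Morphism spaces are vector spaces in the sense of \<^locale>\<open>vectorspace\<close> (the record fields
  \<open>mult\<close> and \<open>one\<close> of a \<open>module\<close> record play no role).
  \<open>hdeg C m n q\<close> is the set of homogeneous morphisms of degree \<open>q\<close> in \<open>Hom(m, n)\<close>;
  \<open>cmp C l m n g f\<close> is the composite of \<open>f : l \<rightarrow> m\<close> with \<open>g : m \<rightarrow> n\<close>;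
  \<open>tns C m n m' n' f g : m + m' \<rightarrow> n + n'\<close> is the tensor product of \<open>f : m \<rightarrow> n\<close>
  and \<open>g : m' \<rightarrow> n'\<close>.
\<close>

record ('k, 'h) supercat =
  hom :: "nat \<Rightarrow> nat \<Rightarrow> ('k, 'h) module"
  hdeg :: "nat \<Rightarrow> nat \<Rightarrow> bit \<Rightarrow> 'h set"
  idm :: "nat \<Rightarrow> 'h"
  cmp :: "nat \<Rightarrow> nat \<Rightarrow> nat \<Rightarrow> 'h \<Rightarrow> 'h \<Rightarrow> 'h"
  tns :: "nat \<Rightarrow> nat \<Rightarrow> nat \<Rightarrow> nat \<Rightarrow> 'h \<Rightarrow> 'h \<Rightarrow> 'h"

definition psign :: "bit \<Rightarrow> 'k::ring_1" where
  "psign q = (if q = 0 then 1 else - 1)"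

locale strict_monoidal_supercategory =
  fixes C :: "('k::field, 'h) supercat"
  assumes hom_vectorspace: "vectorspace class_ring (hom C m n)"
    and hdeg_subspace: "VectorSpace.subspace class_ring (hdeg C m n q) (hom C m n)"
    and hdeg_direct_sum:
      "bij_betw (\<lambda>(x, y). x \<oplus>\<^bsub>hom C m n\<^esub> y) (hdeg C m n 0 \<times> hdeg C m n 1) (carrier (hom C m n))"
    and idm_even: "idm C n \<in> hdeg C n n 0"
    and cmp_linear_left: "f \<in> carrier (hom C l m) \<Longrightarrow>
      (\<lambda>g. cmp C l m n g f) \<in> LinearCombinations.module_hom class_ring (hom C m n) (hom C l n)"
    and cmp_linear_right: "g \<in> carrier (hom C m n) \<Longrightarrow>
      (\<lambda>f. cmp C l m n g f) \<in> LinearCombinations.module_hom class_ring (hom C l m) (hom C l n)"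
    and cmp_degree: "f \<in> hdeg C l m q \<Longrightarrow> g \<in> hdeg C m n q' \<Longrightarrow>
      cmp C l m n g f \<in> hdeg C l n (q' + q)"
    and cmp_assoc: "f \<in> carrier (hom C j l) \<Longrightarrow> g \<in> carrier (hom C l m) \<Longrightarrow>
      h \<in> carrier (hom C m n) \<Longrightarrow>
      cmp C j l n (cmp C l m n h g) f = cmp C j m n h (cmp C j l m g f)"
    and cmp_idm_left: "f \<in> carrier (hom C m n) \<Longrightarrow> cmp C m n n (idm C n) f = f"
    and cmp_idm_right: "f \<in> carrier (hom C m n) \<Longrightarrow> cmp C m m n f (idm C m) = f"
    and tns_linear_left: "g \<in> carrier (hom C m' n') \<Longrightarrow>
      (\<lambda>f. tns C m n m' n' f g) \<in> LinearCombinations.module_hom class_ring (hom C m n) (hom C (m + m') (n + n'))"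
    and tns_linear_right: "f \<in> carrier (hom C m n) \<Longrightarrow>
      (\<lambda>g. tns C m n m' n' f g) \<in> LinearCombinations.module_hom class_ring (hom C m' n') (hom C (m + m') (n + n'))"
    and tns_degree: "f \<in> hdeg C m n q \<Longrightarrow> g \<in> hdeg C m' n' q' \<Longrightarrow>
      tns C m n m' n' f g \<in> hdeg C (m + m') (n + n') (q + q')"
    and tns_assoc: "f \<in> carrier (hom C m n) \<Longrightarrow> g \<in> carrier (hom C m' n') \<Longrightarrow>
      h \<in> carrier (hom C m'' n'') \<Longrightarrow>
      tns C (m + m') (n + n') m'' n'' (tns C m n m' n' f g) h =
      tns C m n (m' + m'') (n' + n'') f (tns C m' n' m'' n'' g h)"
    and tns_unit_left: "f \<in> carrier (hom C m n) \<Longrightarrow> tns C 0 0 m n (idm C 0) f = f"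
    and tns_unit_right: "f \<in> carrier (hom C m n) \<Longrightarrow> tns C m n 0 0 f (idm C 0) = f"
    and tns_idm: "tns C m m n n (idm C m) (idm C n) = idm C (m + n)"
    and interchange:
      "h \<in> hdeg C l m q \<Longrightarrow> f \<in> carrier (hom C m n) \<Longrightarrow>
       k \<in> carrier (hom C l' m') \<Longrightarrow> g \<in> hdeg C m' n' q' \<Longrightarrow>
       cmp C (l + l') (m + m') (n + n') (tns C m n m' n' f g) (tns C l m l' m' h k) =
       psign (q' * q) \<odot>\<^bsub>hom C (l + l') (n + n')\<^esub>
         tns C l n l' n' (cmp C l m n f h) (cmp C l' m' n' g k)"

section \<open>Formal expressions in the generators \<open>H\<close>, \<open>A\<close>, \<open>U\<close>\<close>

datatype 'k expr =
    GenH | GenA | GenU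
  | Ident nat
  | Zero nat nat
  | Add "'k expr" "'k expr" (infixl \<open>+\<^sub>e\<close> 65)
  | Scale 'k "'k expr" (infixr \<open>*\<^sub>e\<close> 75)
  | Comp "'k expr" "'k expr" (infixr \<open>\<circ>\<^sub>e\<close> 70)
  | Tens "'k expr" "'k expr" (infixr \<open>\<otimes>\<^sub>e\<close> 80)

primrec src :: "'k expr \<Rightarrow> nat" where
  "src GenH = 2"
| "src GenA = 2"
| "src GenU = 0"
| "src (Ident n) = n"
| "src (Zero m n) = m"
| "src (s +\<^sub>e t) = src s"
| "src (c *\<^sub>e t) = src t"
| "src (s \<circ>\<^sub>e t) = src t"
| "src (s \<otimes>\<^sub>e t) = src s + src t"

primrec tgt :: "'k expr \<Rightarrow> nat" where
  "tgt GenH = 2"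
| "tgt GenA = 0"
| "tgt GenU = 2"
| "tgt (Ident n) = n"
| "tgt (Zero m n) = n"
| "tgt (s +\<^sub>e t) = tgt s"
| "tgt (c *\<^sub>e t) = tgt t"
| "tgt (s \<circ>\<^sub>e t) = tgt s"
| "tgt (s \<otimes>\<^sub>e t) = tgt s + tgt t"

primrec wf_expr :: "'k expr \<Rightarrow> bool" where
  "wf_expr GenH = True"
| "wf_expr GenA = True"
| "wf_expr GenU = True"
| "wf_expr (Ident n) = True"
| "wf_expr (Zero m n) = True"
| "wf_expr (s +\<^sub>e t) = (wf_expr s \<and> wf_expr t \<and> src s = src t \<and> tgt s = tgt t)"
| "wf_expr (c *\<^sub>e t) = wf_expr t"
| "wf_expr (s \<circ>\<^sub>e t) = (wf_expr s \<and> wf_expr t \<and> src s = tgt t)"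
| "wf_expr (s \<otimes>\<^sub>e t) = (wf_expr s \<and> wf_expr t)"

text \<open>
  \<open>homog p t q\<close>: the expression \<open>t\<close> is homogeneous of degree \<open>q\<close> when \<open>H\<close> is even and \<open>A\<close>, \<open>U\<close>
  have degree \<open>p\<close>.
\<close>

primrec homog :: "bit \<Rightarrow> 'k expr \<Rightarrow> bit \<Rightarrow> bool" where
  "homog p GenH q = (q = 0)"
| "homog p GenA q = (q = p)"
| "homog p GenU q = (q = p)"
| "homog p (Ident n) q = (q = 0)"
| "homog p (Zero m n) q = True"
| "homog p (s +\<^sub>e t) q = (homog p s q \<and> homog p t q)"
| "homog p (c *\<^sub>e t) q = homog p t q"
| "homog p (s \<circ>\<^sub>e t) q = (\<exists>q1 q2. q = q1 + q2 \<and> homog p s q1 \<and> homog p t q2)"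
| "homog p (s \<otimes>\<^sub>e t) q = (\<exists>q1 q2. q = q1 + q2 \<and> homog p s q1 \<and> homog p t q2)"

primrec ev :: "('k, 'h) supercat \<Rightarrow> 'h \<Rightarrow> 'h \<Rightarrow> 'h \<Rightarrow> 'k expr \<Rightarrow> 'h" where
  "ev C H A U GenH = H"
| "ev C H A U GenA = A"
| "ev C H A U GenU = U"
| "ev C H A U (Ident n) = idm C n"
| "ev C H A U (Zero m n) = \<zero>\<^bsub>hom C m n\<^esub>"
| "ev C H A U (s +\<^sub>e t) = ev C H A U s \<oplus>\<^bsub>hom C (src s) (tgt s)\<^esub> ev C H A U t"
| "ev C H A U (c *\<^sub>e t) = c \<odot>\<^bsub>hom C (src t) (tgt t)\<^esub> ev C H A U t"
| "ev C H A U (s \<circ>\<^sub>e t) = cmp C (src t) (tgt t) (tgt s) (ev C H A U s) (ev C H A U t)"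
| "ev C H A U (s \<otimes>\<^sub>e t) =
     tns C (src s) (tgt s) (src t) (tgt t) (ev C H A U s) (ev C H A U t)"

definition satisfies ::
    "('k, 'h) supercat \<Rightarrow> 'h \<Rightarrow> 'h \<Rightarrow> 'h \<Rightarrow> ('k expr \<times> 'k expr) set \<Rightarrow> bool" where
  "satisfies C H A U R \<longleftrightarrow> (\<forall>(s, t)\<in>R. ev C H A U s = ev C H A U t)"

section \<open>The defining relations\<close>

record 'k params =
  p_lam :: 'k    p_lam' :: 'k    p_del :: 'k    p_sig :: 'k    p_sig' :: 'k    p_rho :: 'k
  p_a :: 'k      p_b :: 'k       p_c :: 'k
  p_d :: 'k      p_e :: 'k       p_f :: 'k      p_D :: 'k      p_E :: 'k       p_F :: 'k
  p_d' :: 'k     p_e' :: 'k      p_f' :: 'k     p_D' :: 'k     p_E' :: 'k      p_F' :: 'k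

abbreviation I1 :: "'k expr" where
  "I1 \<equiv> Ident 1"

definition braid_relation :: "'k expr \<times> 'k expr" where
  "braid_relation =
    ((GenH \<otimes>\<^sub>e I1) \<circ>\<^sub>e (I1 \<otimes>\<^sub>e GenH) \<circ>\<^sub>e (GenH \<otimes>\<^sub>e I1),
     (I1 \<otimes>\<^sub>e GenH) \<circ>\<^sub>e (GenH \<otimes>\<^sub>e I1) \<circ>\<^sub>e (I1 \<otimes>\<^sub>e GenH))"

definition relations :: "'k params \<Rightarrow> ('k expr \<times> 'k expr) set" where
  "relations P = {
    braid_relation,
    (GenH \<circ>\<^sub>e GenU, p_lam P *\<^sub>e GenU),
    (GenA \<circ>\<^sub>e GenH, p_lam' P *\<^sub>e GenA),
    (GenA \<circ>\<^sub>e GenU, p_del P *\<^sub>e Ident 0),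
    ((GenA \<otimes>\<^sub>e I1) \<circ>\<^sub>e (I1 \<otimes>\<^sub>e GenU), p_sig P *\<^sub>e I1),
    ((I1 \<otimes>\<^sub>e GenA) \<circ>\<^sub>e (GenU \<otimes>\<^sub>e I1), p_sig' P *\<^sub>e I1),
    ((GenA \<otimes>\<^sub>e I1) \<circ>\<^sub>e (I1 \<otimes>\<^sub>e GenH) \<circ>\<^sub>e (GenU \<otimes>\<^sub>e I1), p_rho P *\<^sub>e I1),
    (GenH \<circ>\<^sub>e GenH, p_a P *\<^sub>e Ident 2 +\<^sub>e p_b P *\<^sub>e GenH +\<^sub>e p_c P *\<^sub>e (GenU \<circ>\<^sub>e GenA)),
    ((GenH \<otimes>\<^sub>e I1) \<circ>\<^sub>e (I1 \<otimes>\<^sub>e GenU),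
      p_d P *\<^sub>e (GenU \<otimes>\<^sub>e I1) +\<^sub>e p_e P *\<^sub>e ((I1 \<otimes>\<^sub>e GenH) \<circ>\<^sub>e (GenU \<otimes>\<^sub>e I1))
      +\<^sub>e p_f P *\<^sub>e (I1 \<otimes>\<^sub>e GenU)),
    ((GenH \<otimes>\<^sub>e I1) \<circ>\<^sub>e (I1 \<otimes>\<^sub>e GenH) \<circ>\<^sub>e (GenU \<otimes>\<^sub>e I1),
      p_D P *\<^sub>e (GenU \<otimes>\<^sub>e I1) +\<^sub>e p_E P *\<^sub>e ((I1 \<otimes>\<^sub>e GenH) \<circ>\<^sub>e (GenU \<otimes>\<^sub>e I1))
      +\<^sub>e p_F P *\<^sub>e (I1 \<otimes>\<^sub>e GenU)),
    ((I1 \<otimes>\<^sub>e GenA) \<circ>\<^sub>e (GenH \<otimes>\<^sub>e I1),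
      p_d' P *\<^sub>e (GenA \<otimes>\<^sub>e I1) +\<^sub>e p_e' P *\<^sub>e ((GenA \<otimes>\<^sub>e I1) \<circ>\<^sub>e (I1 \<otimes>\<^sub>e GenH))
      +\<^sub>e p_f' P *\<^sub>e (I1 \<otimes>\<^sub>e GenA)),
    ((GenA \<otimes>\<^sub>e I1) \<circ>\<^sub>e (I1 \<otimes>\<^sub>e GenH) \<circ>\<^sub>e (GenH \<otimes>\<^sub>e I1),
      p_D' P *\<^sub>e (GenA \<otimes>\<^sub>e I1) +\<^sub>e p_E' P *\<^sub>e ((GenA \<otimes>\<^sub>e I1) \<circ>\<^sub>e (I1 \<otimes>\<^sub>e GenH))
      +\<^sub>e p_F' P *\<^sub>e (I1 \<otimes>\<^sub>e GenA))}"

lemma relations_wf: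
  "(s, t) \<in> relations P \<Longrightarrow> wf_expr s \<and> wf_expr t \<and> src s = src t \<and> tgt s = tgt t"
  by (auto simp: relations_def braid_relation_def)

section \<open>Standard expressions\<close>

text \<open>
  Indices are 1-based. In \<open>expr_u\<close> and \<open>expr_a\<close> the index may be \<open>n + 1\<close>, so the number \<open>n - i + 1\<close>
  of identity strands on the right is written \<open>n + 1 - i\<close> to avoid truncated subtraction.
\<close>

definition expr_s :: "nat \<Rightarrow> nat \<Rightarrow> 'k expr" where
  "expr_s n i = Ident (i - 1) \<otimes>\<^sub>e GenH \<otimes>\<^sub>e Ident (n - i - 1)"

definition expr_u :: "nat \<Rightarrow> nat \<Rightarrow> 'k expr" where
  "expr_u n i = Ident (i - 1) \<otimes>\<^sub>e GenU \<otimes>\<^sub>e Ident (n + 1 - i)"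

definition expr_a :: "nat \<Rightarrow> nat \<Rightarrow> 'k expr" where
  "expr_a n i = Ident (i - 1) \<otimes>\<^sub>e GenA \<otimes>\<^sub>e Ident (n + 1 - i)"

primrec expr_I :: "nat \<Rightarrow> nat \<Rightarrow> nat \<Rightarrow> 'k expr" where
  "expr_I n p 0 = expr_u n p"
| "expr_I n p (Suc s) = expr_s (n + 2) (p + Suc s) \<circ>\<^sub>e expr_I n p s"

primrec expr_J :: "nat \<Rightarrow> nat \<Rightarrow> nat \<Rightarrow> 'k expr" where
  "expr_J n p 0 = expr_a n p"
| "expr_J n p (Suc s) = expr_J n p s \<circ>\<^sub>e expr_s (n + 2) (p + Suc s)"

text \<open>
  A pair \<open>(p, s)\<close> encodes a factor \<open>I\<^sub>s\<^sup>p\<close> or \<open>J\<^sub>s\<^sup>p\<close>; the remaining superscript is determined by the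
  position of the factor.
\<close>

fun cups :: "nat \<Rightarrow> (nat \<times> nat) list \<Rightarrow> 'k expr" where
  "cups n [] = Ident n"
| "cups n ((p, s) # us) = expr_I (n - 2) p s \<circ>\<^sub>e cups (n - 2) us"

fun caps :: "nat \<Rightarrow> (nat \<times> nat) list \<Rightarrow> 'k expr" where
  "caps r [] = Ident r"
| "caps r ((p, s) # js) = expr_J r p s \<circ>\<^sub>e caps (r + 2) js"

primrec word_expr :: "nat \<Rightarrow> nat list \<Rightarrow> 'k expr" where
  "word_expr r [] = Ident r"
| "word_expr r (i # w) = expr_s r i \<circ>\<^sub>e word_expr r w"

definition cups_index :: "nat \<Rightarrow> nat \<Rightarrow> (nat \<times> nat) list set" where
  "cups_index r n = {us. n = r + 2 * length us \<and> sorted_wrt (>) (map fst us) \<and>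
    (\<forall>i<length us. 1 \<le> fst (us ! i) \<and> fst (us ! i) + snd (us ! i) \<le> (n - 2 * (i + 1)) + 1)}"

definition caps_index :: "nat \<Rightarrow> nat \<Rightarrow> (nat \<times> nat) list set" where
  "caps_index m r = {js. m = r + 2 * length js \<and> sorted_wrt (<) (map fst js) \<and>
    (\<forall>i<length js. 1 \<le> fst (js ! i) \<and> fst (js ! i) + snd (js ! i) \<le> (r + 2 * i) + 1)}"

definition word_perm :: "nat list \<Rightarrow> nat \<Rightarrow> nat" where
  "word_perm w = foldr (\<lambda>i \<pi>. transpose i (Suc i) \<circ> \<pi>) w id"

definition reduced_word :: "nat \<Rightarrow> nat list \<Rightarrow> bool" where
  "reduced_word r w \<longleftrightarrow> set w \<subseteq> {1..<r} \<and>
    (\<forall>v. set v \<subseteq> {1..<r} \<and> word_perm v = word_perm w \<longrightarrow> length w \<le> length v)"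

text \<open>\<open>W r\<close> is a possible choice for the set \<open>H(r)\<close>; the word \<open>[i\<^sub>1, \<dots>, i\<^sub>l]\<close> encodes the product
  of the \<open>s\<^sub>i\<close> in this order.\<close>

definition reduced_word_system :: "(nat \<Rightarrow> nat list set) \<Rightarrow> bool" where
  "reduced_word_system W \<longleftrightarrow> (\<forall>r.
     (\<forall>w\<in>W r. reduced_word r w \<and> (\<nexists>u v i. w = u @ [i, Suc i, i] @ v)) \<and>
     (\<forall>\<pi>. \<pi> permutes {1..r} \<longrightarrow> (\<exists>!w. w \<in> W r \<and> word_perm w = \<pi>)))"

definition std_index ::
    "(nat \<Rightarrow> nat list set) \<Rightarrow> nat \<Rightarrow> nat \<Rightarrow> ((nat \<times> nat) list \<times> nat list \<times> (nat \<times> nat) list) set" where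
  "std_index W m n = (\<Union>r. cups_index r n \<times> W r \<times> caps_index m r)"

definition std_expr ::
    "nat \<Rightarrow> (nat \<times> nat) list \<times> nat list \<times> (nat \<times> nat) list \<Rightarrow> 'k expr" where
  "std_expr n = (\<lambda>(us, w, js). let r = n - 2 * length us in
     cups n us \<circ>\<^sub>e word_expr r w \<circ>\<^sub>e caps r js)"

lemma std_expr_wf:
  assumes W: "reduced_word_system W" and x: "x \<in> std_index W m n"
  shows "wf_expr (std_expr n x :: 'k expr) \<and> src (std_expr n x :: 'k expr) = m \<and> tgt (std_expr n x :: 'k expr) = n"
proof -
  have I: "wf_expr (expr_I n p s :: 'k expr) \<and> src (expr_I n p s :: 'k expr) = n \<and> tgt (expr_I n p s :: 'k expr) = n + 2"
    if "1 \<le> p" "p + s \<le> n + 1" for n p s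
    using that by (induction s) (auto simp: expr_s_def expr_u_def)
  have J: "wf_expr (expr_J n p s :: 'k expr) \<and> src (expr_J n p s :: 'k expr) = n + 2 \<and> tgt (expr_J n p s :: 'k expr) = n"
    if "1 \<le> p" "p + s \<le> n + 1" for n p s
    using that by (induction s) (auto simp: expr_s_def expr_a_def)
  have w: "wf_expr (word_expr r v :: 'k expr) \<and> src (word_expr r v :: 'k expr) = r \<and> tgt (word_expr r v :: 'k expr) = r"
    if "set v \<subseteq> {1..<r}" for r v
    using that by (induction v) (auto simp: expr_s_def)
  have cu: "wf_expr (cups n us :: 'k expr) \<and> src (cups n us :: 'k expr) = r \<and> tgt (cups n us :: 'k expr) = n"
    if "us \<in> cups_index r n" for us r n
    using that
  proof (induction us arbitrary: n)
    case (Cons y us)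
    obtain p s where y: "y = (p, s)" by force
    have n: "n = r + 2 * length us + 2" and ps: "1 \<le> p" "p + s \<le> n - 2 + 1"
      using Cons.prems by (auto simp: cups_index_def y)
    have "us \<in> cups_index r (n - 2)"
      unfolding cups_index_def
    proof (intro CollectI conjI allI impI)
      fix i assume "i < length us"
      then have "Suc i < length (y # us)" by simp
      then have "1 \<le> fst ((y # us) ! Suc i) \<and>
          fst ((y # us) ! Suc i) + snd ((y # us) ! Suc i) \<le> (n - 2 * (Suc i + 1)) + 1"
        using Cons.prems unfolding cups_index_def by blast
      then show "1 \<le> fst (us ! i)" "fst (us ! i) + snd (us ! i) \<le> n - 2 - 2 * (i + 1) + 1"
        by (auto simp: algebra_simps)
    qed (use Cons.prems n in \<open>auto simp: cups_index_def\<close>)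
    from Cons.IH[OF this] I[OF ps] n show ?case by (simp add: y)
  qed (auto simp: cups_index_def)
  have ca: "wf_expr (caps r js :: 'k expr) \<and> src (caps r js :: 'k expr) = m \<and> tgt (caps r js :: 'k expr) = r"
    if "js \<in> caps_index m r" for js r m
    using that
  proof (induction js arbitrary: r)
    case (Cons y js)
    obtain p s where y: "y = (p, s)" by force
    have ps: "1 \<le> p" "p + s \<le> r + 1"
      using Cons.prems by (auto simp: caps_index_def y)
    have "js \<in> caps_index m (r + 2)"
      unfolding caps_index_def
    proof (intro CollectI conjI allI impI)
      fix i assume "i < length js"
      then have "Suc i < length (y # js)" by simp
      then have "1 \<le> fst ((y # js) ! Suc i) \<and>
          fst ((y # js) ! Suc i) + snd ((y # js) ! Suc i) \<le> (r + 2 * Suc i) + 1"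
        using Cons.prems unfolding caps_index_def by blast
      then show "1 \<le> fst (js ! i)" "fst (js ! i) + snd (js ! i) \<le> r + 2 + 2 * i + 1"
        by (auto simp: algebra_simps)
    qed (use Cons.prems in \<open>auto simp: caps_index_def\<close>)
    from Cons.IH[OF this] J[OF ps] show ?case by (simp add: y)
  qed (auto simp: caps_index_def)
  obtain us v js r where xx: "x = (us, v, js)" and us: "us \<in> cups_index r n"
    and v: "v \<in> W r" and js: "js \<in> caps_index m r"
    using x by (auto simp: std_index_def)
  have r: "n - 2 * length us = r" using us by (simp add: cups_index_def)
  have "set v \<subseteq> {1..<r}"
    using W v by (auto simp: reduced_word_system_def reduced_word_def)
  with cu[OF us] ca[OF js] w[of v r] show ?thesis
    by (simp add: std_expr_def xx r)
qed

section \<open>Categories of Brauer type\<close>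

definition brauer_type ::
    "(nat \<Rightarrow> nat list set) \<Rightarrow> ('k::field, 'h) supercat \<Rightarrow> bit \<Rightarrow> 'h \<Rightarrow> 'h \<Rightarrow> 'h \<Rightarrow> bool" where
  "brauer_type W C p H A U \<longleftrightarrow>
     strict_monoidal_supercategory C \<and>
     H \<in> hdeg C 2 2 0 \<and> A \<in> hdeg C 2 0 p \<and> U \<in> hdeg C 0 2 p \<and>
     (\<forall>m n. \<forall>x\<in>carrier (hom C m n).
        \<exists>t. wf_expr t \<and> src t = m \<and> tgt t = n \<and> ev C H A U t = x) \<and>
     (\<exists>G\<in>carrier (hom C 2 2). cmp C 2 2 2 G H = idm C 2 \<and> cmp C 2 2 2 H G = idm C 2) \<and>
     satisfies C H A U {braid_relation} \<and>
     (\<forall>m n. inj_on (\<lambda>x. ev C H A U (std_expr n x)) (std_index W m n) \<and>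
        vectorspace.basis class_ring (hom C m n)
          ((\<lambda>x. ev C H A U (std_expr n x)) ` std_index W m n))"

section \<open>The monoidal supercategory presented by the relations\<close>

text \<open>
  \<open>cong_expr p R\<close> is the smallest congruence on well-formed expressions containing \<open>R\<close> and the axioms
  of a strict monoidal supercategory, where \<open>H\<close> is even and \<open>A\<close>, \<open>U\<close> have degree \<open>p\<close>.
\<close>

inductive cong_expr ::
    "bit \<Rightarrow> ('k::field expr \<times> 'k expr) set \<Rightarrow> 'k expr \<Rightarrow> 'k expr \<Rightarrow> bool"
  for p :: bit and R :: "('k expr \<times> 'k expr) set" where
  relI: "(s, t) \<in> R \<Longrightarrow> wf_expr s \<Longrightarrow> wf_expr t \<Longrightarrow> src s = src t \<Longrightarrow> tgt s = tgt t \<Longrightarrow>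
     cong_expr p R s t"
| refl: "wf_expr t \<Longrightarrow> cong_expr p R t t"
| sym: "cong_expr p R s t \<Longrightarrow> cong_expr p R t s"
| trans: "cong_expr p R s t \<Longrightarrow> cong_expr p R t u \<Longrightarrow> cong_expr p R s u"
| cong_add: "cong_expr p R s s' \<Longrightarrow> cong_expr p R t t' \<Longrightarrow> wf_expr (s +\<^sub>e t) \<Longrightarrow>
     cong_expr p R (s +\<^sub>e t) (s' +\<^sub>e t')"
| cong_scale: "cong_expr p R t t' \<Longrightarrow> cong_expr p R (c *\<^sub>e t) (c *\<^sub>e t')"
| cong_comp: "cong_expr p R s s' \<Longrightarrow> cong_expr p R t t' \<Longrightarrow> wf_expr (s \<circ>\<^sub>e t) \<Longrightarrow>
     cong_expr p R (s \<circ>\<^sub>e t) (s' \<circ>\<^sub>e t')"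
| cong_tens: "cong_expr p R s s' \<Longrightarrow> cong_expr p R t t' \<Longrightarrow>
     cong_expr p R (s \<otimes>\<^sub>e t) (s' \<otimes>\<^sub>e t')"
| add_assoc: "wf_expr ((s +\<^sub>e t) +\<^sub>e u) \<Longrightarrow> cong_expr p R ((s +\<^sub>e t) +\<^sub>e u) (s +\<^sub>e (t +\<^sub>e u))"
| add_comm: "wf_expr (s +\<^sub>e t) \<Longrightarrow> cong_expr p R (s +\<^sub>e t) (t +\<^sub>e s)"
| add_zero: "wf_expr t \<Longrightarrow> cong_expr p R (t +\<^sub>e Zero (src t) (tgt t)) t"
| scale_zero: "wf_expr t \<Longrightarrow> cong_expr p R (0 *\<^sub>e t) (Zero (src t) (tgt t))"
| scale_one: "wf_expr t \<Longrightarrow> cong_expr p R (1 *\<^sub>e t) t"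
| scale_scale: "wf_expr t \<Longrightarrow> cong_expr p R (c *\<^sub>e d *\<^sub>e t) ((c * d) *\<^sub>e t)"
| scale_add_left: "wf_expr t \<Longrightarrow> cong_expr p R ((c + d) *\<^sub>e t) (c *\<^sub>e t +\<^sub>e d *\<^sub>e t)"
| scale_add_right: "wf_expr (s +\<^sub>e t) \<Longrightarrow> cong_expr p R (c *\<^sub>e (s +\<^sub>e t)) (c *\<^sub>e s +\<^sub>e c *\<^sub>e t)"
| comp_add_left: "wf_expr ((s +\<^sub>e t) \<circ>\<^sub>e u) \<Longrightarrow>
     cong_expr p R ((s +\<^sub>e t) \<circ>\<^sub>e u) ((s \<circ>\<^sub>e u) +\<^sub>e (t \<circ>\<^sub>e u))"
| comp_add_right: "wf_expr (s \<circ>\<^sub>e (t +\<^sub>e u)) \<Longrightarrow>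
     cong_expr p R (s \<circ>\<^sub>e (t +\<^sub>e u)) ((s \<circ>\<^sub>e t) +\<^sub>e (s \<circ>\<^sub>e u))"
| comp_scale_left: "wf_expr (s \<circ>\<^sub>e t) \<Longrightarrow> cong_expr p R ((c *\<^sub>e s) \<circ>\<^sub>e t) (c *\<^sub>e (s \<circ>\<^sub>e t))"
| comp_scale_right: "wf_expr (s \<circ>\<^sub>e t) \<Longrightarrow> cong_expr p R (s \<circ>\<^sub>e (c *\<^sub>e t)) (c *\<^sub>e (s \<circ>\<^sub>e t))"
| comp_assoc: "wf_expr ((s \<circ>\<^sub>e t) \<circ>\<^sub>e u) \<Longrightarrow> cong_expr p R ((s \<circ>\<^sub>e t) \<circ>\<^sub>e u) (s \<circ>\<^sub>e (t \<circ>\<^sub>e u))"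
| comp_id_left: "wf_expr t \<Longrightarrow> cong_expr p R (Ident (tgt t) \<circ>\<^sub>e t) t"
| comp_id_right: "wf_expr t \<Longrightarrow> cong_expr p R (t \<circ>\<^sub>e Ident (src t)) t"
| tens_add_left: "wf_expr ((s +\<^sub>e t) \<otimes>\<^sub>e u) \<Longrightarrow>
     cong_expr p R ((s +\<^sub>e t) \<otimes>\<^sub>e u) ((s \<otimes>\<^sub>e u) +\<^sub>e (t \<otimes>\<^sub>e u))"
| tens_add_right: "wf_expr (s \<otimes>\<^sub>e (t +\<^sub>e u)) \<Longrightarrow>
     cong_expr p R (s \<otimes>\<^sub>e (t +\<^sub>e u)) ((s \<otimes>\<^sub>e t) +\<^sub>e (s \<otimes>\<^sub>e u))"
| tens_scale_left: "wf_expr (s \<otimes>\<^sub>e t) \<Longrightarrow> cong_expr p R ((c *\<^sub>e s) \<otimes>\<^sub>e t) (c *\<^sub>e (s \<otimes>\<^sub>e t))"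
| tens_scale_right: "wf_expr (s \<otimes>\<^sub>e t) \<Longrightarrow> cong_expr p R (s \<otimes>\<^sub>e (c *\<^sub>e t)) (c *\<^sub>e (s \<otimes>\<^sub>e t))"
| tens_assoc: "wf_expr ((s \<otimes>\<^sub>e t) \<otimes>\<^sub>e u) \<Longrightarrow> cong_expr p R ((s \<otimes>\<^sub>e t) \<otimes>\<^sub>e u) (s \<otimes>\<^sub>e (t \<otimes>\<^sub>e u))"
| tens_unit_left: "wf_expr t \<Longrightarrow> cong_expr p R (Ident 0 \<otimes>\<^sub>e t) t"
| tens_unit_right: "wf_expr t \<Longrightarrow> cong_expr p R (t \<otimes>\<^sub>e Ident 0) t"
| tens_id: "cong_expr p R (Ident m \<otimes>\<^sub>e Ident n) (Ident (m + n))"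
| interchange: "wf_expr (f \<circ>\<^sub>e h) \<Longrightarrow> wf_expr (g \<circ>\<^sub>e k) \<Longrightarrow> homog p g q' \<Longrightarrow> homog p h q \<Longrightarrow>
     cong_expr p R ((f \<otimes>\<^sub>e g) \<circ>\<^sub>e (h \<otimes>\<^sub>e k)) (psign (q' * q) *\<^sub>e ((f \<circ>\<^sub>e h) \<otimes>\<^sub>e (g \<circ>\<^sub>e k)))"

lemma cong_expr_wf:
  "cong_expr p R s t \<Longrightarrow> wf_expr s \<and> wf_expr t \<and> src s = src t \<and> tgt s = tgt t"
  by (induction rule: cong_expr.induct) auto

definition cls :: "bit \<Rightarrow> ('k::field expr \<times> 'k expr) set \<Rightarrow> 'k expr \<Rightarrow> 'k expr set" where
  "cls p R t = {s. cong_expr p R t s}"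

text \<open>Operations on classes are given by the union of the classes of the results on representatives,
  which all coincide.\<close>

definition presented ::
    "bit \<Rightarrow> ('k::field expr \<times> 'k expr) set \<Rightarrow> ('k, 'k expr set) supercat" where
  "presented p R = \<lparr>
     hom = (\<lambda>m n. \<lparr>
       carrier = {cls p R t | t. wf_expr t \<and> src t = m \<and> tgt t = n},
       mult = undefined,
       one = undefined,
       zero = cls p R (Zero m n),
       add = (\<lambda>X Y. \<Union>s\<in>X. \<Union>t\<in>Y. cls p R (s +\<^sub>e t)),
       smult = (\<lambda>c X. \<Union>t\<in>X. cls p R (c *\<^sub>e t)) \<rparr>),
     hdeg = (\<lambda>m n q. {cls p R t | t. wf_expr t \<and> src t = m \<and> tgt t = n \<and> homog p t q}),
     idm = (\<lambda>n. cls p R (Ident n)),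
     cmp = (\<lambda>l m n X Y. \<Union>s\<in>X. \<Union>t\<in>Y. cls p R (s \<circ>\<^sub>e t)),
     tns = (\<lambda>m n m' n' X Y. \<Union>s\<in>X. \<Union>t\<in>Y. cls p R (s \<otimes>\<^sub>e t)) \<rparr>"

end

theory Submission
  imports Defs
begin

text \<open>
  Necessity: composing the defining relations with each other and comparing coefficients with respect
  to the standard basis in low degrees yields polynomial equations between the parameters, and these
  force the stated values.

  Sufficiency: the relations rewrite every morphism as a combination of standard expressions, so the
  latter span. For independence, the presented category acts on the spaces \<open>NN k\<close> of functions on codes
  of perfect matchings of \<open>2 k\<close> points, an explicit deformed model of \<open>Hom(0, 2 k)\<close>. Bending the \<open>m\<close>
  inputs of a morphism \<open>m \<rightarrow> n\<close> around turns it into a vector of \<open>NN k\<close>, where \<open>m + n = 2 k\<close>, and every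
  vector arises in this way. There are at most as many standard expressions as matchings,
  namely \<open>(2 k - 1)!!\<close>, so a spanning set of that size must be linearly independent.
\<close>

section \<open>The presented supercategory\<close>

locale pres =
  fixes p :: bit and R :: "('k::field expr \<times> 'k expr) set"
begin

abbreviation cg :: "'k expr => 'k expr => bool" where "cg \<equiv> cong_expr p R"
abbreviation cl :: "'k expr => 'k expr set" where "cl \<equiv> cls p R"

definition "AD X Y = (\<Union>s\<in>X. \<Union>t\<in>Y. cl (s +\<^sub>e t))"
definition "SC c X = (\<Union>t\<in>X. cl (c *\<^sub>e t))"
definition "CM X Y = (\<Union>s\<in>X. \<Union>t\<in>Y. cl (s \<circ>\<^sub>e t))"
definition "TN X Y = (\<Union>s\<in>X. \<Union>t\<in>Y. cl (s \<otimes>\<^sub>e t))"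
abbreviation "ID n \<equiv> cl (Ident n)"
abbreviation "ZE m n \<equiv> cl (Zero m n)"
definition "Cl = range cl"
definition "TT m n = {cl t | t. wf_expr t \<and> src t = m \<and> tgt t = n}"
definition "TH m n q = {cl t | t. wf_expr t \<and> src t = m \<and> tgt t = n \<and> homog p t q}"

lemma cl_ill: "\<not> wf_expr t ==> cl t = {}"
  unfolding cls_def by (auto dest: cong_expr_wf)

lemma cl_eqI:
  assumes "cg s t"
  shows "cl s = cl t"
proof -
  have "cg s u \<longleftrightarrow> cg t u" for u
    using cong_expr.trans[OF assms, of u] cong_expr.trans[OF cong_expr.sym[OF assms], of u] by blast
  then show ?thesis by (simp add: cls_def)
qed

lemma cl_self: "wf_expr t ==> t \<in> cl t"
  by (simp add: cls_def cong_expr.refl)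

lemma cl_eq_iff: "wf_expr t ==> cl s = cl t \<longleftrightarrow> cg s t"
proof
  assume "wf_expr t" "cl s = cl t"
  then have "t \<in> cl s" using cl_self by simp
  then show "cg s t" by (simp add: cls_def)
qed (rule cl_eqI)

lemma cl_mem: "s \<in> cl t ==> cg t s" by (simp add: cls_def)

lemma cl_add: "AD (cl s) (cl t) = cl (s +\<^sub>e t)"
proof (cases "wf_expr (s +\<^sub>e t)")
  case True
  then have "cl (s' +\<^sub>e t') = cl (s +\<^sub>e t)" if "s' \<in> cl s" "t' \<in> cl t" for s' t'
    using that cong_expr_wf[OF cl_mem[OF that(1)]] cong_expr_wf[OF cl_mem[OF that(2)]]
    by (intro cl_eqI[symmetric] cong_add) (simp_all add: cl_mem)
  then have "(\<Union>s'\<in>cl s. \<Union>t'\<in>cl t. cl (s' +\<^sub>e t')) = (\<Union>s'\<in>cl s. \<Union>t'\<in>cl t. cl (s +\<^sub>e t))"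
    by (intro SUP_cong) (rule HOL.refl | assumption)+
  moreover have "cl s \<noteq> {}" "cl t \<noteq> {}" using cl_self[of s] cl_self[of t] True by auto
  ultimately show ?thesis unfolding AD_def by simp
next
  case False
  have "cl (s' +\<^sub>e t') = {}" if "s' \<in> cl s" "t' \<in> cl t" for s' t'
    using cong_expr_wf[OF cl_mem[OF that(1)]] cong_expr_wf[OF cl_mem[OF that(2)]] False
    by (intro cl_ill) auto
  then show ?thesis unfolding AD_def using cl_ill[OF False] by simp
qed

lemma cl_comp: "CM (cl s) (cl t) = cl (s \<circ>\<^sub>e t)"
proof (cases "wf_expr (s \<circ>\<^sub>e t)")
  case True
  then have "cl (s' \<circ>\<^sub>e t') = cl (s \<circ>\<^sub>e t)" if "s' \<in> cl s" "t' \<in> cl t" for s' t'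
    using that cong_expr_wf[OF cl_mem[OF that(1)]] cong_expr_wf[OF cl_mem[OF that(2)]]
    by (intro cl_eqI[symmetric] cong_comp) (simp_all add: cl_mem)
  then have "(\<Union>s'\<in>cl s. \<Union>t'\<in>cl t. cl (s' \<circ>\<^sub>e t')) = (\<Union>s'\<in>cl s. \<Union>t'\<in>cl t. cl (s \<circ>\<^sub>e t))"
    by (intro SUP_cong) (rule HOL.refl | assumption)+
  moreover have "cl s \<noteq> {}" "cl t \<noteq> {}" using cl_self[of s] cl_self[of t] True by auto
  ultimately show ?thesis unfolding CM_def by simp
next
  case False
  have "cl (s' \<circ>\<^sub>e t') = {}" if "s' \<in> cl s" "t' \<in> cl t" for s' t'
    using cong_expr_wf[OF cl_mem[OF that(1)]] cong_expr_wf[OF cl_mem[OF that(2)]] False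
    by (intro cl_ill) auto
  then show ?thesis unfolding CM_def using cl_ill[OF False] by simp
qed

lemma cl_tens: "TN (cl s) (cl t) = cl (s \<otimes>\<^sub>e t)"
proof (cases "wf_expr (s \<otimes>\<^sub>e t)")
  case True
  then have "cl (s' \<otimes>\<^sub>e t') = cl (s \<otimes>\<^sub>e t)" if "s' \<in> cl s" "t' \<in> cl t" for s' t'
    using that by (intro cl_eqI[symmetric] cong_tens) (simp_all add: cl_mem)
  then have "(\<Union>s'\<in>cl s. \<Union>t'\<in>cl t. cl (s' \<otimes>\<^sub>e t')) = (\<Union>s'\<in>cl s. \<Union>t'\<in>cl t. cl (s \<otimes>\<^sub>e t))"
    by (intro SUP_cong) (rule HOL.refl | assumption)+
  moreover have "cl s \<noteq> {}" "cl t \<noteq> {}" using cl_self[of s] cl_self[of t] True by auto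
  ultimately show ?thesis unfolding TN_def by simp
next
  case False
  then have "cl s = {} \<or> cl t = {}" using cl_ill by auto
  then show ?thesis unfolding TN_def using cl_ill[OF False] by auto
qed

lemma cl_scale: "SC c (cl t) = cl (c *\<^sub>e t)"
proof (cases "wf_expr t")
  case True
  then have "cl (c *\<^sub>e t') = cl (c *\<^sub>e t)" if "t' \<in> cl t" for t'
    using that by (intro cl_eqI[symmetric] cong_scale) (simp_all add: cl_mem)
  then have "(\<Union>t'\<in>cl t. cl (c *\<^sub>e t')) = (\<Union>t'\<in>cl t. cl (c *\<^sub>e t))"
    by (intro SUP_cong) (rule HOL.refl | assumption)+
  moreover have "cl t \<noteq> {}" using cl_self[of t] True by auto
  ultimately show ?thesis unfolding SC_def by simp
qed (simp add: SC_def cl_ill)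

lemma ClE: "X \<in> Cl ==> (\<And>t. X = cl t ==> thesis) ==> thesis"
  by (auto simp: Cl_def)
lemma cl_Cl [simp]: "cl t \<in> Cl" by (simp add: Cl_def)
lemma Cl_ops [simp]: "X \<in> Cl ==> Y \<in> Cl ==> AD X Y \<in> Cl" "X \<in> Cl ==> Y \<in> Cl ==> CM X Y \<in> Cl"
  "X \<in> Cl ==> Y \<in> Cl ==> TN X Y \<in> Cl" "X \<in> Cl ==> SC c X \<in> Cl"
  by (auto elim!: ClE simp: cl_add cl_comp cl_tens cl_scale)

lemma TT_Cl [simp]: "X \<in> TT m n ==> X \<in> Cl" by (auto simp: TT_def)
lemma TTE: "X \<in> TT m n ==> (\<And>t. X = cl t ==> wf_expr t ==> src t = m ==> tgt t = n ==> thesis) ==> thesis"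
  by (auto simp: TT_def)
lemma THE': "X \<in> TH m n q ==> (\<And>t. X = cl t ==> wf_expr t ==> src t = m ==> tgt t = n ==> homog p t q ==> thesis) ==> thesis"
  by (auto simp: TH_def)
lemma TH_TT: "X \<in> TH m n q ==> X \<in> TT m n" by (auto simp: TH_def TT_def)
lemma cl_TT: "wf_expr t ==> cl t \<in> TT (src t) (tgt t)" by (auto simp: TT_def)
lemma cl_TTI: "wf_expr t ==> src t = m ==> tgt t = n ==> cl t \<in> TT m n" by (auto simp: TT_def)
lemma cl_THI: "wf_expr t ==> src t = m ==> tgt t = n ==> homog p t q ==> cl t \<in> TH m n q" by (auto simp: TH_def)
lemma cl_TT_iff: "cl t \<in> TT m n \<longleftrightarrow> wf_expr t \<and> src t = m \<and> tgt t = n"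
proof
  assume "cl t \<in> TT m n"
  then obtain s where s: "cl t = cl s" "wf_expr s" "src s = m" "tgt s = n" by (auto elim: TTE)
  then have "cg t s" using cl_eq_iff by blast
  then show "wf_expr t \<and> src t = m \<and> tgt t = n" using cong_expr_wf s by metis
qed (auto intro: cl_TTI)

lemma TT_AD [simp, intro]: "X \<in> TT m n ==> Y \<in> TT m n ==> AD X Y \<in> TT m n"
  by (auto elim!: TTE simp: cl_add cl_TT_iff)
lemma TT_SC [simp, intro]: "X \<in> TT m n ==> SC c X \<in> TT m n"
  by (auto elim!: TTE simp: cl_scale cl_TT_iff)
lemma TT_CM [intro]: "X \<in> TT m n ==> Y \<in> TT l m ==> CM X Y \<in> TT l n"
  by (auto elim!: TTE simp: cl_comp cl_TT_iff)
lemma TT_TN [intro]: "X \<in> TT m n ==> Y \<in> TT m' n' ==> TN X Y \<in> TT (m + m') (n + n')"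
  by (auto elim!: TTE simp: cl_tens cl_TT_iff)
lemma TT_ID [simp, intro]: "ID n \<in> TT n n" and TT_ZE [simp, intro]: "ZE m n \<in> TT m n"
  by (auto intro: cl_TTI)
lemma TH_ID [simp, intro]: "ID n \<in> TH n n 0" by (auto intro: cl_THI)
lemma TH_TN: "X \<in> TH m n q ==> Y \<in> TH m' n' q' ==> TN X Y \<in> TH (m + m') (n + n') (q + q')"
  by (elim THE', hypsubst, simp only: cl_tens, rule cl_THI) (simp_all only: homog.simps src.simps tgt.simps wf_expr.simps, blast+)
lemma TH_CM: "X \<in> TH m n q ==> Y \<in> TH l m q' ==> CM X Y \<in> TH l n (q + q')"
  by (elim THE', hypsubst, simp only: cl_comp, rule cl_THI) (simp_all only: homog.simps src.simps tgt.simps wf_expr.simps, blast+)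

text \<open>An ill-formed expression has the empty class, so the laws of addition hold for all classes.\<close>

lemma cl_cong: "(wf_expr s ==> cg s t) ==> wf_expr s = wf_expr t ==> cl s = cl t"
  by (cases "wf_expr s") (simp_all add: cl_ill cl_eqI)

lemma AD_assoc: "X \<in> Cl ==> Y \<in> Cl ==> Z \<in> Cl ==> AD (AD X Y) Z = AD X (AD Y Z)"
  by (elim ClE, hypsubst, simp only: cl_add, rule cl_cong, rule cong_expr.add_assoc, auto)
lemma AD_comm: "X \<in> Cl ==> Y \<in> Cl ==> AD X Y = AD Y X"
  by (elim ClE, hypsubst, simp only: cl_add, rule cl_cong, rule cong_expr.add_comm, auto)
lemma AD_lcomm: "X \<in> Cl ==> Y \<in> Cl ==> Z \<in> Cl ==> AD X (AD Y Z) = AD Y (AD X Z)"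
  by (simp only: AD_assoc[symmetric] AD_comm[of X Y])
lemmas AD_ac = AD_assoc AD_comm AD_lcomm
lemma AD_ZE [simp]: "X \<in> TT m n ==> AD X (ZE m n) = X"
  by (elim TTE, hypsubst, simp only: cl_add, rule cl_cong, rule cong_expr.add_zero, auto)
lemma SC_0: "X \<in> TT m n ==> SC 0 X = ZE m n"
  by (elim TTE, hypsubst, simp only: cl_scale, rule cl_cong, rule cong_expr.scale_zero, auto)
lemma SC_1 [simp]: "X \<in> Cl ==> SC 1 X = X"
  by (elim ClE, hypsubst, simp only: cl_scale, rule cl_cong, rule cong_expr.scale_one, auto)
lemma SC_SC [simp]: "X \<in> Cl ==> SC c (SC d X) = SC (c * d) X"
  by (elim ClE, hypsubst, simp only: cl_scale, rule cl_cong, rule cong_expr.scale_scale, auto)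
lemma SC_plus: "X \<in> Cl ==> SC (c + d) X = AD (SC c X) (SC d X)"
  by (elim ClE, hypsubst, simp only: cl_scale cl_add, rule cl_cong, rule cong_expr.scale_add_left, auto)
lemma SC_AD [simp]: "X \<in> Cl ==> Y \<in> Cl ==> SC c (AD X Y) = AD (SC c X) (SC c Y)"
  by (elim ClE, hypsubst, simp only: cl_scale cl_add, rule cl_cong, rule cong_expr.scale_add_right, auto)
lemma CM_AD_l: "Z \<in> Cl ==> X \<in> TT m n ==> Y \<in> TT m n ==> CM (AD X Y) Z = AD (CM X Z) (CM Y Z)"
  by (elim ClE TTE, hypsubst, simp only: cl_comp cl_add, rule cl_cong, rule cong_expr.comp_add_left, auto)
lemma CM_AD_r: "X \<in> Cl ==> Y \<in> TT m n ==> Z \<in> TT m n ==> CM X (AD Y Z) = AD (CM X Y) (CM X Z)"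
  by (elim ClE TTE, hypsubst, simp only: cl_comp cl_add, rule cl_cong, rule cong_expr.comp_add_right, auto)
lemma CM_SC_l [simp]: "X \<in> Cl ==> Y \<in> Cl ==> CM (SC c X) Y = SC c (CM X Y)"
  by (elim ClE, hypsubst, simp only: cl_scale cl_comp, rule cl_cong, rule cong_expr.comp_scale_left, auto)
lemma CM_SC_r [simp]: "X \<in> Cl ==> Y \<in> Cl ==> CM X (SC c Y) = SC c (CM X Y)"
  by (elim ClE, hypsubst, simp only: cl_scale cl_comp, rule cl_cong, rule cong_expr.comp_scale_right, auto)
lemma CM_assoc: "X \<in> Cl ==> Y \<in> Cl ==> Z \<in> Cl ==> CM (CM X Y) Z = CM X (CM Y Z)"
  by (elim ClE, hypsubst, simp only: cl_comp, rule cl_cong, rule cong_expr.comp_assoc, auto)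
lemma CM_ID_l [simp]: "X \<in> TT m n ==> CM (ID n) X = X"
  by (elim TTE, hypsubst, simp only: cl_comp, rule cl_cong, rule cong_expr.comp_id_left, auto)
lemma CM_ID_r [simp]: "X \<in> TT m n ==> CM X (ID m) = X"
  by (elim TTE, hypsubst, simp only: cl_comp, rule cl_cong, rule cong_expr.comp_id_right, auto)
lemma TN_AD_l: "Z \<in> Cl ==> X \<in> TT m n ==> Y \<in> TT m n ==> TN (AD X Y) Z = AD (TN X Z) (TN Y Z)"
  by (elim ClE TTE, hypsubst, simp only: cl_tens cl_add, rule cl_cong, rule cong_expr.tens_add_left, auto)
lemma TN_AD_r: "X \<in> Cl ==> Y \<in> TT m n ==> Z \<in> TT m n ==> TN X (AD Y Z) = AD (TN X Y) (TN X Z)"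
  by (elim ClE TTE, hypsubst, simp only: cl_tens cl_add, rule cl_cong, rule cong_expr.tens_add_right, auto)
lemma TN_SC_l [simp]: "X \<in> Cl ==> Y \<in> Cl ==> TN (SC c X) Y = SC c (TN X Y)"
  by (elim ClE, hypsubst, simp only: cl_scale cl_tens, rule cl_cong, rule cong_expr.tens_scale_left, auto)
lemma TN_SC_r [simp]: "X \<in> Cl ==> Y \<in> Cl ==> TN X (SC c Y) = SC c (TN X Y)"
  by (elim ClE, hypsubst, simp only: cl_scale cl_tens, rule cl_cong, rule cong_expr.tens_scale_right, auto)
lemma TN_assoc: "X \<in> Cl ==> Y \<in> Cl ==> Z \<in> Cl ==> TN (TN X Y) Z = TN X (TN Y Z)"
  by (elim ClE, hypsubst, simp only: cl_tens, rule cl_cong, rule cong_expr.tens_assoc, auto)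
lemma TN_ID0_l [simp]: "X \<in> Cl ==> TN (ID 0) X = X"
  by (elim ClE, hypsubst, simp only: cl_tens, rule cl_cong, rule cong_expr.tens_unit_left, auto)
lemma TN_ID0_r [simp]: "X \<in> Cl ==> TN X (ID 0) = X"
  by (elim ClE, hypsubst, simp only: cl_tens, rule cl_cong, rule cong_expr.tens_unit_right, auto)
lemma TN_ID_ID [simp]: "TN (ID m) (ID n) = ID (m + n)"
  unfolding cl_tens by (rule cl_eqI, rule cong_expr.tens_id)

lemma interchange: "F \<in> TT m n ==> H \<in> TH l m q ==> G \<in> TH m' n' q' ==> K \<in> TT l' m' ==>
  CM (TN F G) (TN H K) = SC (psign (q' * q)) (TN (CM F H) (CM G K))"
  by (elim TTE THE', hypsubst, simp only: cl_tens cl_comp cl_scale, rule cl_cong, rule cong_expr.interchange, auto)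

lemma even_int_diff: "even (m + n) ==> \<exists>i. int n - int m = 2 * i" for m n :: nat
  by presburger

definition dg :: "nat => nat => bit" where
  "dg m n = p * of_bool (odd ((int n - int m) div 2))"

lemma bit_of_bool_add: "q * of_bool (odd (i + j)) = q * of_bool (odd i) + q * of_bool (odd j)" for q :: bit and i j :: int
  by (cases "odd i"; cases "odd j") auto

lemma dg_add: "even (l + m) ==> even (m + n) ==> dg l n = dg m n + dg l m"
proof -
  assume "even (l + m)" "even (m + n)"
  then obtain i j where "int m - int l = 2 * i" "int n - int m = 2 * j" using even_int_diff by metis
  then show ?thesis unfolding dg_def bit_of_bool_add[symmetric] by (simp add: algebra_simps)
qed

lemma dg_tens: "even (m + n) ==> even (m' + n') ==> dg (m + m') (n + n') = dg m n + dg m' n'"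
proof -
  assume "even (m + n)" "even (m' + n')"
  then obtain i j where ij: "int n - int m = 2 * i" "int n' - int m' = 2 * j" using even_int_diff by metis
  then have "int (n + n') - int (m + m') = 2 * (i + j)" by simp
  then show ?thesis unfolding dg_def ij bit_of_bool_add[symmetric] by simp
qed

lemma homog_ex_aux: "wf_expr t ==> (even (src t + tgt t) --> homog p t (dg (src t) (tgt t))) \<and>
  (odd (src t + tgt t) --> (\<forall>q. homog p t q))"
proof (induction t)
  case (Comp s t)
  then have s: "wf_expr s" and t: "wf_expr t" by auto
  show ?case
  proof (cases "even (src t + tgt t)")
    case et: True
    then have ht: "homog p t (dg (src t) (tgt t))" using Comp t by auto
    show ?thesis
    proof (cases "even (src s + tgt s)")
      case es: True
      then have "homog p s (dg (src s) (tgt s))" using Comp s by auto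
      moreover have m: "src s = tgt t" using Comp.prems by simp
      then have "dg (src t) (tgt s) = dg (src s) (tgt s) + dg (src t) (tgt t)"
        using dg_add[of "src t" "tgt t" "tgt s"] et es by simp
      moreover have "even (src t + tgt s)" using et es m by simp
      ultimately show ?thesis using ht unfolding homog.simps src.simps tgt.simps by blast
    next
      case es: False
      then have "\<forall>q. homog p s q" using Comp s by auto
      then have "homog p (s \<circ>\<^sub>e t) q" for q
        unfolding homog.simps using ht diff_add_cancel[of q "dg (src t) (tgt t)"] by metis
      then show ?thesis by blast
    qed
  next
    case et: False
    then have ht: "\<forall>q. homog p t q" using Comp t by auto
    have "\<exists>q. homog p s q" using Comp s by blast
    then obtain q' where "homog p s q'" ..
    then have "homog p (s \<circ>\<^sub>e t) q" for q
      unfolding homog.simps using ht \<open>homog p s q'\<close> diff_add_cancel[of q q'] add.commute by metis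
    then show ?thesis by blast
  qed
next
  case (Tens s t)
  then have s: "wf_expr s" and t: "wf_expr t" by auto
  show ?case
  proof (cases "even (src t + tgt t)")
    case et: True
    then have ht: "homog p t (dg (src t) (tgt t))" using Tens t by auto
    show ?thesis
    proof (cases "even (src s + tgt s)")
      case es: True
      then have "homog p s (dg (src s) (tgt s))" using Tens s by auto
      moreover have "dg (src s + src t) (tgt s + tgt t) = dg (src s) (tgt s) + dg (src t) (tgt t)"
        using dg_tens[of "src s" "tgt s" "src t" "tgt t"] et es by simp
      moreover have "even (src s + src t + (tgt s + tgt t))" using et es by presburger
      ultimately show ?thesis using ht unfolding homog.simps src.simps tgt.simps by blast
    next
      case es: False
      then have "\<forall>q. homog p s q" using Tens s by auto
      then have "homog p (s \<otimes>\<^sub>e t) q" for q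
        unfolding homog.simps using ht diff_add_cancel[of q "dg (src t) (tgt t)"] by metis
      then show ?thesis by blast
    qed
  next
    case et: False
    then have ht: "\<forall>q. homog p t q" using Tens t by auto
    have "\<exists>q. homog p s q" using Tens s by blast
    then obtain q' where "homog p s q'" ..
    then have "homog p (s \<otimes>\<^sub>e t) q" for q
      unfolding homog.simps using ht \<open>homog p s q'\<close> diff_add_cancel[of q q'] add.commute by metis
    then show ?thesis by blast
  qed
qed (auto simp: dg_def)

lemma homog_ex: "wf_expr t ==> \<exists>q. homog p t q"
  using homog_ex_aux by blast

lemma TT_TH: "X \<in> TT m n ==> \<exists>q. X \<in> TH m n q"
  using homog_ex by (metis TTE cl_THI)

lemma interchange_even:
  assumes "F \<in> TT m n" "H \<in> TT l m" "G \<in> TT m' n'" "K \<in> TT l' m'" "H \<in> TH l m 0 \<or> G \<in> TH m' n' 0"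
  shows "CM (TN F G) (TN H K) = TN (CM F H) (CM G K)"
proof -
  have c: "TN (CM F H) (CM G K) \<in> Cl" using assms by (auto intro!: Cl_ops)
  obtain q q' where q: "H \<in> TH l m q" "G \<in> TH m' n' q'" using assms TT_TH by meson
  show ?thesis
  proof (cases "H \<in> TH l m 0")
    case True
    then show ?thesis using interchange[OF assms(1) True q(2) assms(4)] c by (simp add: psign_def)
  next
    case False
    then have "G \<in> TH m' n' 0" using assms by simp
    then show ?thesis using interchange[OF assms(1) q(1) _ assms(4)] c by (simp add: psign_def)
  qed
qed

definition wh :: "nat => 'k expr set => nat => 'k expr set" where
  "wh i X j = TN (ID i) (TN X (ID j))"

lemma TT_wh [intro]: "X \<in> TT m n ==> wh i X j \<in> TT (i + m + j) (i + n + j)"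
  unfolding wh_def add.assoc by (intro TT_TN) auto
lemma Cl_wh [simp]: "X \<in> Cl ==> wh i X j \<in> Cl" by (simp add: wh_def)
lemma TH_wh [intro]: "X \<in> TH m n q ==> wh i X j \<in> TH (i + m + j) (i + n + j) q"
  unfolding wh_def add.assoc using TH_TN[OF TH_ID[of i] TH_TN[of X m n q "ID j" j j 0]]
  by (simp only: add_0_left add_0_right TH_ID)

lemma wh_CM: "X \<in> TT m n ==> Y \<in> TT l m ==> CM (wh i X j) (wh i Y j) = wh i (CM X Y) j"
proof -
  assume X: "X \<in> TT m n" and Y: "Y \<in> TT l m"
  have "CM (TN X (ID j)) (TN Y (ID j)) = TN (CM X Y) (CM (ID j) (ID j))"
    using X Y by (intro interchange_even) auto
  then have 1: "CM (TN X (ID j)) (TN Y (ID j)) = TN (CM X Y) (ID j)" by (simp add: CM_ID_l[of _ j])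
  have "CM (wh i X j) (wh i Y j) = TN (CM (ID i) (ID i)) (CM (TN X (ID j)) (TN Y (ID j)))"
    unfolding wh_def using X Y by (intro interchange_even) auto
  then show ?thesis unfolding 1 wh_def by (simp add: CM_ID_l[of _ i])
qed

lemma wh_AD: "X \<in> TT m n ==> Y \<in> TT m n ==> wh i (AD X Y) j = AD (wh i X j) (wh i Y j)"
  unfolding wh_def by (simp only: TN_AD_l[of "ID j" X m n Y] cl_Cl)
    (rule TN_AD_r[of _ _ "m + j" "n + j"], simp_all add: TT_TN)
lemma wh_SC [simp]: "X \<in> Cl ==> wh i (SC c X) j = SC c (wh i X j)"
  unfolding wh_def by simp
lemma wh_ID [simp]: "wh i (ID n) j = ID (i + n + j)"
  unfolding wh_def by (simp add: add.assoc)
lemma wh_TN_r: "X \<in> Cl ==> wh i (TN X (ID l)) j = wh i X (l + j)"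
  unfolding wh_def by (simp add: TN_assoc)
lemma wh_TN_l: "X \<in> Cl ==> wh i (TN (ID l) X) j = wh (i + l) X j"
  unfolding wh_def by (simp add: TN_assoc flip: TN_ID_ID)

lemma wh_far1:
  assumes X: "X \<in> TT m n" and Y: "Y \<in> TT m' n'"
  shows "CM (wh i X (g + n' + j)) (wh (i + m + g) Y j) = wh i (TN X (TN (ID g) Y)) j"
proof -
  have Yj: "TN (ID g) (TN Y (ID j)) \<in> TT (g + (m' + j)) (g + (n' + j))" using Y by (intro TT_TN) auto
  have 1: "CM (TN X (ID (g + (n' + j)))) (TN (ID m) (TN (ID g) (TN Y (ID j)))) = TN X (TN (ID g) (TN Y (ID j)))"
    using X Yj by (subst interchange_even[of _ m n _ m _ "g + (n' + j)" "g + (n' + j)"]) auto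
  have "CM (wh i X (g + n' + j)) (wh (i + m + g) Y j) =
    CM (TN (ID i) (TN X (ID (g + (n' + j))))) (TN (ID i) (TN (ID m) (TN (ID g) (TN Y (ID j)))))"
    unfolding wh_def using X Y by (simp add: add.assoc TN_assoc flip: TN_ID_ID)
  also have "... = TN (CM (ID i) (ID i)) (CM (TN X (ID (g + (n' + j)))) (TN (ID m) (TN (ID g) (TN Y (ID j)))))"
    using TT_TN[OF X TT_ID[of "g + (n' + j)"]] TT_TN[OF TT_ID[of m] Yj] by (intro interchange_even) auto
  also have "... = wh i (TN X (TN (ID g) Y)) j"
    unfolding 1 wh_def using X Y by (simp add: CM_ID_l[of _ i] TN_assoc)
  finally show ?thesis .
qed

lemma wh_far2:
  assumes X: "X \<in> TH m n q" and Y: "Y \<in> TH m' n' q'"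
  shows "CM (wh (i + n + g) Y j) (wh i X (g + m' + j)) = SC (psign (q' * q)) (wh i (TN X (TN (ID g) Y)) j)"
proof -
  note X' = TH_TT[OF X] and Y' = TH_TT[OF Y]
  have Yj: "TN (ID g) (TN Y (ID j)) \<in> TH (g + (m' + j)) (g + (n' + j)) q'"
    using TH_TN[OF TH_ID[of g] TH_TN[OF Y TH_ID[of j]]] by (simp only: add_0_left add_0_right)
  have "CM (TN (ID n) (TN (ID g) (TN Y (ID j)))) (TN X (ID (g + (m' + j)))) = SC (psign (q' * q)) (TN (CM (ID n) X) (CM (TN (ID g) (TN Y (ID j))) (ID (g + (m' + j)))))"
    using X Yj by (intro interchange) auto
  then have 1: "CM (TN (ID n) (TN (ID g) (TN Y (ID j)))) (TN X (ID (g + (m' + j)))) = SC (psign (q' * q)) (TN X (TN (ID g) (TN Y (ID j))))"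
    using X' TH_TT[OF Yj] by simp
  have "CM (wh (i + n + g) Y j) (wh i X (g + m' + j)) =
    CM (TN (ID i) (TN (ID n) (TN (ID g) (TN Y (ID j))))) (TN (ID i) (TN X (ID (g + (m' + j)))))"
    unfolding wh_def using X' Y' by (simp add: add.assoc TN_assoc flip: TN_ID_ID)
  also have "... = TN (CM (ID i) (ID i)) (CM (TN (ID n) (TN (ID g) (TN Y (ID j)))) (TN X (ID (g + (m' + j)))))"
    using TT_TN[OF X' TT_ID[of "g + (m' + j)"]] TT_TN[OF TT_ID[of n] TH_TT[OF Yj]] by (intro interchange_even) auto
  also have "... = SC (psign (q' * q)) (wh i (TN X (TN (ID g) Y)) j)"
    unfolding 1 wh_def using X' Y' by (simp add: CM_ID_l[of _ i] TN_assoc)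
  finally show ?thesis .
qed

end

locale bpres = fixes p :: bit and P :: "'k::field params"
begin

sublocale pres p "relations P" .

abbreviation "HC \<equiv> cl GenH"
abbreviation "AC \<equiv> cl GenA"
abbreviation "UC \<equiv> cl GenU"

definition "sG n i = wh (i - 1) HC (n - i - 1)"
definition "uG n i = wh (i - 1) UC (n + 1 - i)"
definition "cG n i = wh (i - 1) AC (n + 1 - i)"

lemma cl_expr_s: "cl (expr_s n i) = sG n i"
  and cl_expr_u: "cl (expr_u n i) = uG n i"
  and cl_expr_a: "cl (expr_a n i) = cG n i"
  by (simp_all only: expr_s_def expr_u_def expr_a_def sG_def uG_def cG_def wh_def cl_tens)

lemma TH_gen: "HC \<in> TH 2 2 0" "AC \<in> TH 2 0 p" "UC \<in> TH 0 2 p"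
  by (rule cl_THI; simp)+
lemmas TT_gen = TH_gen[THEN TH_TT]

lemma TH_sG: "1 <= i ==> i < n ==> sG n i \<in> TH n n 0"
  using TH_wh[OF TH_gen(1), of "i - 1" "n - i - 1"] by (simp add: sG_def)
lemma TH_uG: "1 <= i ==> i <= n + 1 ==> uG n i \<in> TH n (n + 2) p"
  using TH_wh[OF TH_gen(3), of "i - 1" "n + 1 - i"] by (simp add: uG_def)
lemma TH_cG: "1 <= i ==> i <= n + 1 ==> cG n i \<in> TH (n + 2) n p"
  using TH_wh[OF TH_gen(2), of "i - 1" "n + 1 - i"] by (simp add: cG_def)
lemmas TT_sG = TH_sG[THEN TH_TT] and TT_uG = TH_uG[THEN TH_TT] and TT_cG = TH_cG[THEN TH_TT]
lemma Cl_G [simp]: "sG n i \<in> Cl" "uG n i \<in> Cl" "cG n i \<in> Cl"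
  by (simp_all add: sG_def uG_def cG_def)

lemma rel: "(s, t) \<in> relations P ==> cl s = cl t"
  using relations_wf by (intro cl_eqI cong_expr.relI) blast+

lemma sG_S: "sG (i + (2 + j)) (Suc i) = wh i HC j" by (simp add: sG_def)
lemma uG_S: "uG (i + j) (Suc i) = wh i UC j" by (simp add: uG_def)
lemma cG_S: "cG (i + j) (Suc i) = wh i AC j" by (simp add: cG_def)

lemma nat_split: "1 <= i ==> i + d <= n ==> (\<And>i' j. i = Suc i' ==> n = i' + (d + 1 + j) ==> thesis) ==> thesis" for i d n :: nat
proof -
  assume h: "1 <= i" "i + d <= n" and t: "\<And>i' j. i = Suc i' ==> n = i' + (d + 1 + j) ==> thesis"
  show thesis using h by (intro t[of "i - 1" "n - i - d"]) auto
qed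

lemma HTN: "TN HC (ID 1) \<in> TT 3 3" "TN (ID 1) HC \<in> TT 3 3"
  "TN UC (ID 1) \<in> TT 1 3" "TN (ID 1) UC \<in> TT 1 3" "TN AC (ID 1) \<in> TT 3 1" "TN (ID 1) AC \<in> TT 3 1"
  using TT_TN[OF TT_gen(1) TT_ID[of 1]] TT_TN[OF TT_ID[of 1] TT_gen(1)]
    TT_TN[OF TT_gen(3) TT_ID[of 1]] TT_TN[OF TT_ID[of 1] TT_gen(3)]
    TT_TN[OF TT_gen(2) TT_ID[of 1]] TT_TN[OF TT_ID[of 1] TT_gen(2)]
  by (simp_all add: numeral_3_eq_3 numeral_2_eq_2)

lemma whs: "wh i (TN X (ID 1)) j = wh i X (Suc j)" "wh i (TN (ID 1) X) j = wh (Suc i) X j" if "X \<in> Cl"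
  using wh_TN_r[OF that, of i 1 j] wh_TN_l[OF that, of i 1 j] by simp_all

lemma law_braid: "1 <= i ==> i + 2 <= n ==> CM (sG n i) (CM (sG n (Suc i)) (sG n i)) = CM (sG n (Suc i)) (CM (sG n i) (sG n (Suc i)))"
proof -
  assume "1 <= i" "i + 2 <= n"
  then obtain i' j where e: "i = Suc i'" "n = i' + (2 + 1 + j)" by (rule nat_split)
  have s: "sG n i = wh i' (TN HC (ID 1)) j" "sG n (Suc i) = wh i' (TN (ID 1) HC) j"
    unfolding whs[OF cl_Cl] by (simp_all add: e sG_def)
  have "CM (TN HC (ID 1)) (CM (TN (ID 1) HC) (TN HC (ID 1))) = CM (TN (ID 1) HC) (CM (TN HC (ID 1)) (TN (ID 1) HC))"
    unfolding cl_tens cl_comp by (rule rel, simp add: relations_def braid_relation_def)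
  then have "wh i' (CM (TN HC (ID 1)) (CM (TN (ID 1) HC) (TN HC (ID 1)))) j = wh i' (CM (TN (ID 1) HC) (CM (TN HC (ID 1)) (TN (ID 1) HC))) j"
    by simp
  then show ?thesis unfolding s using HTN
    by (simp add: TT_CM wh_CM[symmetric, of _ 3 3 _ 3])
qed

lemma law_quad: "1 <= i ==> i + 1 <= n ==> CM (sG n i) (sG n i) =
  AD (AD (SC (p_a P) (ID n)) (SC (p_b P) (sG n i))) (SC (p_c P) (CM (uG (n - 2) i) (cG (n - 2) i)))"
proof -
  assume "1 <= i" "i + 1 <= n"
  then obtain i' j where e: "i = Suc i'" "n = i' + (1 + 1 + j)" by (rule nat_split)
  have s: "sG n i = wh i' HC j" "uG (n - 2) i = wh i' UC j" "cG (n - 2) i = wh i' AC j" "ID n = wh i' (ID 2) j"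
    by (simp_all add: e sG_def uG_def cG_def)
  have "CM HC HC = AD (AD (SC (p_a P) (ID 2)) (SC (p_b P) HC)) (SC (p_c P) (CM UC AC))"
    unfolding cl_tens cl_comp cl_scale cl_add by (rule rel, simp add: relations_def braid_relation_def)
  then have "wh i' (CM HC HC) j = wh i' (AD (AD (SC (p_a P) (ID 2)) (SC (p_b P) HC)) (SC (p_c P) (CM UC AC))) j" by simp
  then show ?thesis unfolding s using TT_gen
    by (simp add: TT_CM[of UC 0 2] wh_CM[symmetric, of _ 2 2 _ 2] wh_CM[symmetric, of UC 0 2 _ 2] wh_AD[of _ 2 2] del: wh_ID)
qed

lemma law_su: "1 <= i ==> i + 0 <= n + 1 ==> CM (sG (n + 2) i) (uG n i) = SC (p_lam P) (uG n i)"
proof -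
  assume "1 <= i" "i + 0 <= n + 1"
  then obtain i' j where e: "i = Suc i'" "n + 1 = i' + (0 + 1 + j)" by (rule nat_split)
  then have s: "sG (n + 2) i = wh i' HC j" "uG n i = wh i' UC j" by (simp_all add: sG_def uG_def)
  have "CM HC UC = SC (p_lam P) UC" unfolding cl_tens cl_comp cl_scale cl_add by (rule rel, simp add: relations_def braid_relation_def)
  then have "wh i' (CM HC UC) j = wh i' (SC (p_lam P) UC) j" by simp
  then show ?thesis unfolding s using TT_gen by (simp add: wh_CM[symmetric, of HC 2 2 UC 0])
qed

lemma law_cs: "1 <= i ==> i + 0 <= n + 1 ==> CM (cG n i) (sG (n + 2) i) = SC (p_lam' P) (cG n i)"
proof -
  assume "1 <= i" "i + 0 <= n + 1"
  then obtain i' j where e: "i = Suc i'" "n + 1 = i' + (0 + 1 + j)" by (rule nat_split)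
  then have s: "sG (n + 2) i = wh i' HC j" "cG n i = wh i' AC j" by (simp_all add: sG_def cG_def)
  have "CM AC HC = SC (p_lam' P) AC" unfolding cl_tens cl_comp cl_scale cl_add by (rule rel, simp add: relations_def braid_relation_def)
  then have "wh i' (CM AC HC) j = wh i' (SC (p_lam' P) AC) j" by simp
  then show ?thesis unfolding s using TT_gen by (simp add: wh_CM[symmetric, of AC 2 0 HC 2])
qed

lemma law_cu: "1 <= i ==> i + 0 <= n + 1 ==> CM (cG n i) (uG n i) = SC (p_del P) (ID n)"
proof -
  assume "1 <= i" "i + 0 <= n + 1"
  then obtain i' j where e: "i = Suc i'" "n + 1 = i' + (0 + 1 + j)" by (rule nat_split)
  then have s: "uG n i = wh i' UC j" "cG n i = wh i' AC j" "ID n = wh i' (ID 0) j" by (simp_all add: uG_def cG_def)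
  have "CM AC UC = SC (p_del P) (ID 0)" unfolding cl_tens cl_comp cl_scale cl_add by (rule rel, simp add: relations_def braid_relation_def)
  then have "wh i' (CM AC UC) j = wh i' (SC (p_del P) (ID 0)) j" by simp
  then show ?thesis unfolding s using TT_gen by (simp add: wh_CM[symmetric, of AC 2 0 UC 0] del: wh_ID)
qed

lemma split3:
  assumes "1 <= i" "i <= n"
  shows "\<exists>i' j. sG (n + 2) i = wh i' (TN HC (ID 1)) j \<and> sG (n + 2) (Suc i) = wh i' (TN (ID 1) HC) j \<and>
    uG n i = wh i' (TN UC (ID 1)) j \<and> uG n (Suc i) = wh i' (TN (ID 1) UC) j \<and>
    cG n i = wh i' (TN AC (ID 1)) j \<and> cG n (Suc i) = wh i' (TN (ID 1) AC) j \<and> ID n = wh i' (ID 1) j"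
proof -
  have "i + 0 <= n" using assms by simp
  with assms(1) obtain i' j where e: "i = Suc i'" "n = i' + (0 + 1 + j)" by (rule nat_split)
  have "sG (n + 2) i = wh i' (TN HC (ID 1)) j" "sG (n + 2) (Suc i) = wh i' (TN (ID 1) HC) j"
    "uG n i = wh i' (TN UC (ID 1)) j" "uG n (Suc i) = wh i' (TN (ID 1) UC) j"
    "cG n i = wh i' (TN AC (ID 1)) j" "cG n (Suc i) = wh i' (TN (ID 1) AC) j" "ID n = wh i' (ID 1) j"
    unfolding whs[OF cl_Cl] using e by (simp_all add: sG_def uG_def cG_def)
  then show ?thesis by blast
qed

lemmas wh3 = wh_CM[symmetric, of _ 3 3 _ 3] wh_CM[symmetric, of _ 3 3 _ 1] wh_CM[symmetric, of _ 3 1 _ 3] wh_CM[symmetric, of _ 3 1 _ 1]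
lemmas TT3 = TT_CM[of _ 3 3 _ 3] TT_CM[of _ 3 3 _ 1] TT_CM[of _ 3 1 _ 3] TT_CM[of _ 3 1 _ 1]

lemma law_su1: "1 <= i ==> i <= n ==> CM (sG (n + 2) i) (uG n (Suc i)) =
  AD (AD (SC (p_d P) (uG n i)) (SC (p_e P) (CM (sG (n + 2) (Suc i)) (uG n i)))) (SC (p_f P) (uG n (Suc i)))"
proof -
  assume "1 <= i" "i <= n"
  then obtain i' j where s: "sG (n + 2) i = wh i' (TN HC (ID 1)) j" "sG (n + 2) (Suc i) = wh i' (TN (ID 1) HC) j"
    "uG n i = wh i' (TN UC (ID 1)) j" "uG n (Suc i) = wh i' (TN (ID 1) UC) j"
    using split3[of i n] by blast
  have "CM (TN HC (ID 1)) (TN (ID 1) UC) = AD (AD (SC (p_d P) (TN UC (ID 1))) (SC (p_e P) (CM (TN (ID 1) HC) (TN UC (ID 1))))) (SC (p_f P) (TN (ID 1) UC))"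
    unfolding cl_tens cl_comp cl_scale cl_add by (rule rel, simp add: relations_def braid_relation_def)
  then have "wh i' (CM (TN HC (ID 1)) (TN (ID 1) UC)) j = wh i' (AD (AD (SC (p_d P) (TN UC (ID 1))) (SC (p_e P) (CM (TN (ID 1) HC) (TN UC (ID 1))))) (SC (p_f P) (TN (ID 1) UC))) j" by simp
  then show ?thesis unfolding s using HTN by (simp add: TT3 wh3 wh_AD[of _ 1 3] del: One_nat_def)
qed

lemma law_su2: "1 <= i ==> i <= n ==> CM (sG (n + 2) i) (CM (sG (n + 2) (Suc i)) (uG n i)) =
  AD (AD (SC (p_D P) (uG n i)) (SC (p_E P) (CM (sG (n + 2) (Suc i)) (uG n i)))) (SC (p_F P) (uG n (Suc i)))"
proof -
  assume "1 <= i" "i <= n"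
  then obtain i' j where s: "sG (n + 2) i = wh i' (TN HC (ID 1)) j" "sG (n + 2) (Suc i) = wh i' (TN (ID 1) HC) j"
    "uG n i = wh i' (TN UC (ID 1)) j" "uG n (Suc i) = wh i' (TN (ID 1) UC) j"
    using split3[of i n] by blast
  have "CM (TN HC (ID 1)) (CM (TN (ID 1) HC) (TN UC (ID 1))) = AD (AD (SC (p_D P) (TN UC (ID 1))) (SC (p_E P) (CM (TN (ID 1) HC) (TN UC (ID 1))))) (SC (p_F P) (TN (ID 1) UC))"
    unfolding cl_tens cl_comp cl_scale cl_add by (rule rel, simp add: relations_def braid_relation_def)
  then have "wh i' (CM (TN HC (ID 1)) (CM (TN (ID 1) HC) (TN UC (ID 1)))) j = wh i' (AD (AD (SC (p_D P) (TN UC (ID 1))) (SC (p_E P) (CM (TN (ID 1) HC) (TN UC (ID 1))))) (SC (p_F P) (TN (ID 1) UC))) j" by simp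
  then show ?thesis unfolding s using HTN by (simp add: TT3 wh3 wh_AD[of _ 1 3] del: One_nat_def)
qed

lemma law_cs1: "1 <= i ==> i <= n ==> CM (cG n (Suc i)) (sG (n + 2) i) =
  AD (AD (SC (p_d' P) (cG n i)) (SC (p_e' P) (CM (cG n i) (sG (n + 2) (Suc i))))) (SC (p_f' P) (cG n (Suc i)))"
proof -
  assume "1 <= i" "i <= n"
  then obtain i' j where s: "sG (n + 2) i = wh i' (TN HC (ID 1)) j" "sG (n + 2) (Suc i) = wh i' (TN (ID 1) HC) j"
    "cG n i = wh i' (TN AC (ID 1)) j" "cG n (Suc i) = wh i' (TN (ID 1) AC) j"
    using split3[of i n] by blast
  have "CM (TN (ID 1) AC) (TN HC (ID 1)) = AD (AD (SC (p_d' P) (TN AC (ID 1))) (SC (p_e' P) (CM (TN AC (ID 1)) (TN (ID 1) HC)))) (SC (p_f' P) (TN (ID 1) AC))"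
    unfolding cl_tens cl_comp cl_scale cl_add by (rule rel, simp add: relations_def braid_relation_def)
  then have "wh i' (CM (TN (ID 1) AC) (TN HC (ID 1))) j = wh i' (AD (AD (SC (p_d' P) (TN AC (ID 1))) (SC (p_e' P) (CM (TN AC (ID 1)) (TN (ID 1) HC)))) (SC (p_f' P) (TN (ID 1) AC))) j" by simp
  then show ?thesis unfolding s using HTN by (simp add: TT3 wh3 wh_AD[of _ 3 1] del: One_nat_def)
qed

lemma law_cs2: "1 <= i ==> i <= n ==> CM (cG n i) (CM (sG (n + 2) (Suc i)) (sG (n + 2) i)) =
  AD (AD (SC (p_D' P) (cG n i)) (SC (p_E' P) (CM (cG n i) (sG (n + 2) (Suc i))))) (SC (p_F' P) (cG n (Suc i)))"
proof -
  assume "1 <= i" "i <= n"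
  then obtain i' j where s: "sG (n + 2) i = wh i' (TN HC (ID 1)) j" "sG (n + 2) (Suc i) = wh i' (TN (ID 1) HC) j"
    "cG n i = wh i' (TN AC (ID 1)) j" "cG n (Suc i) = wh i' (TN (ID 1) AC) j"
    using split3[of i n] by blast
  have "CM (TN AC (ID 1)) (CM (TN (ID 1) HC) (TN HC (ID 1))) = AD (AD (SC (p_D' P) (TN AC (ID 1))) (SC (p_E' P) (CM (TN AC (ID 1)) (TN (ID 1) HC)))) (SC (p_F' P) (TN (ID 1) AC))"
    unfolding cl_tens cl_comp cl_scale cl_add by (rule rel, simp add: relations_def braid_relation_def)
  then have "wh i' (CM (TN AC (ID 1)) (CM (TN (ID 1) HC) (TN HC (ID 1)))) j = wh i' (AD (AD (SC (p_D' P) (TN AC (ID 1))) (SC (p_E' P) (CM (TN AC (ID 1)) (TN (ID 1) HC)))) (SC (p_F' P) (TN (ID 1) AC))) j" by simp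
  then show ?thesis unfolding s using HTN by (simp add: TT3 wh3 wh_AD[of _ 3 1] del: One_nat_def)
qed

lemma law_cu1: "1 <= i ==> i <= n ==> CM (cG n i) (uG n (Suc i)) = SC (p_sig P) (ID n)"
  and law_c1u: "1 <= i ==> i <= n ==> CM (cG n (Suc i)) (uG n i) = SC (p_sig' P) (ID n)"
  and law_csu: "1 <= i ==> i <= n ==> CM (cG n i) (CM (sG (n + 2) (Suc i)) (uG n i)) = SC (p_rho P) (ID n)"
proof -
  assume "1 <= i" "i <= n"
  then obtain i' j where s: "sG (n + 2) (Suc i) = wh i' (TN (ID 1) HC) j"
    "cG n i = wh i' (TN AC (ID 1)) j" "cG n (Suc i) = wh i' (TN (ID 1) AC) j"
    "uG n i = wh i' (TN UC (ID 1)) j" "uG n (Suc i) = wh i' (TN (ID 1) UC) j" "ID n = wh i' (ID 1) j"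
    using split3[of i n] by blast
  have "CM (TN AC (ID 1)) (TN (ID 1) UC) = SC (p_sig P) (ID 1)"
    "CM (TN (ID 1) AC) (TN UC (ID 1)) = SC (p_sig' P) (ID 1)"
    "CM (TN AC (ID 1)) (CM (TN (ID 1) HC) (TN UC (ID 1))) = SC (p_rho P) (ID 1)"
    unfolding cl_tens cl_comp cl_scale cl_add by (rule rel, simp add: relations_def braid_relation_def)+
  then have "wh i' (CM (TN AC (ID 1)) (TN (ID 1) UC)) j = wh i' (SC (p_sig P) (ID 1)) j"
    "wh i' (CM (TN (ID 1) AC) (TN UC (ID 1))) j = wh i' (SC (p_sig' P) (ID 1)) j"
    "wh i' (CM (TN AC (ID 1)) (CM (TN (ID 1) HC) (TN UC (ID 1)))) j = wh i' (SC (p_rho P) (ID 1)) j" by simp_all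
  then show "CM (cG n i) (uG n (Suc i)) = SC (p_sig P) (ID n)" "CM (cG n (Suc i)) (uG n i) = SC (p_sig' P) (ID n)"
    "CM (cG n i) (CM (sG (n + 2) (Suc i)) (uG n i)) = SC (p_rho P) (ID n)"
    unfolding s using HTN by (simp_all add: TT3 wh3 del: wh_ID One_nat_def)
qed

abbreviation "eps \<equiv> psign p :: 'k"

lemma eps_sq [simp]: "eps * eps = 1" "eps * (eps * x) = x" by (simp_all add: psign_def)
lemma bit_sq [simp]: "(q::bit) * q = q" by (cases q) auto
lemma psign_0 [simp]: "psign 0 = (1 :: 'k)" by (simp add: psign_def)

lemma wh_far: "X \<in> TH m n q ==> Y \<in> TH m' n' q' ==>
  CM (wh (i + n + g) Y j) (wh i X (g + m' + j)) = SC (psign (q' * q)) (CM (wh i X (g + n' + j)) (wh (i + m + g) Y j))"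
  using wh_far1[OF TH_TT TH_TT, of X m n q Y m' n' q' i g j] wh_far2[of X m n q Y m' n' q' i g j] by simp

lemma far_split:
  fixes i j n d :: nat
  assumes "1 <= i" "i <= j" "j + d <= n"
  obtains i' g r where "i = Suc i'" "j = Suc (i' + g)" "n = i' + g + r + Suc d"
proof -
  have "i = Suc (i - 1)" "j = Suc (i - 1 + (j - i))" "n = i - 1 + (j - i) + (n - j - d) + Suc d" using assms by auto
  then show thesis by (rule that)
qed

lemma law_ss: "1 <= i ==> i + 2 <= j ==> j < n ==> CM (sG n i) (sG n j) = CM (sG n j) (sG n i)"
proof -
  assume h: "1 <= i" "i + 2 <= j" "j < n"
  have hh: "1 <= i" "i <= j - 2" "j - 2 + 3 <= n" using h by auto
  obtain i' g r where e: "i = Suc i'" "j - 2 = Suc (i' + g)" "n = i' + g + r + Suc 3"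
    by (rule far_split[OF hh])
  have j: "j = i' + g + 3" using e(2) h by linarith
  have "sG n i = wh i' HC (g + 2 + r)" "sG n j = wh (i' + 2 + g) HC r" using e(1,3) j by (simp_all add: sG_def)
  then show ?thesis using wh_far[OF TH_gen(1) TH_gen(1), of i' g r] by simp
qed

lemma law_su_lo: "1 <= i ==> i + 2 <= j ==> j <= n + 1 ==> CM (sG (n + 2) i) (uG n j) = CM (uG n j) (sG n i)"
proof -
  assume h: "1 <= i" "i + 2 <= j" "j <= n + 1"
  have hh: "1 <= i" "i <= j - 2" "j - 2 + 1 <= n" using h by auto
  obtain i' g r where e: "i = Suc i'" "j - 2 = Suc (i' + g)" "n = i' + g + r + Suc 1"
    by (rule far_split[OF hh])
  have j: "j = i' + g + 3" using e(2) h by linarith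
  have "sG (n + 2) i = wh i' HC (g + 2 + r)" "uG n j = wh (i' + 2 + g) UC r" "sG n i = wh i' HC (g + 0 + r)"
    using e(1,3) j by (simp_all add: sG_def uG_def)
  then show ?thesis using wh_far[OF TH_gen(1) TH_gen(3), of i' g r] by simp
qed

lemma law_su_hi: "1 <= j ==> j <= i ==> i < n ==> CM (sG (n + 2) (i + 2)) (uG n j) = CM (uG n j) (sG n i)"
proof -
  assume h: "1 <= j" "j <= i" "i < n"
  then have "i + 1 <= n" by simp
  then obtain i' g r where e: "j = Suc i'" "i = Suc (i' + g)" "n = i' + g + r + Suc 1"
    using far_split[of j i 1 n] h by auto
  have "sG (n + 2) (i + 2) = wh (i' + 2 + g) HC r" "uG n j = wh i' UC (g + 2 + r)" "sG n i = wh (i' + 0 + g) HC r"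
    using e h by (simp_all add: sG_def uG_def)
  then show ?thesis using wh_far[OF TH_gen(3) TH_gen(1), of i' g r] by simp
qed

lemma law_cs_lo: "1 <= i ==> i + 2 <= j ==> j <= n + 1 ==> CM (cG n j) (sG (n + 2) i) = CM (sG n i) (cG n j)"
proof -
  assume h: "1 <= i" "i + 2 <= j" "j <= n + 1"
  have hh: "1 <= i" "i <= j - 2" "j - 2 + 1 <= n" using h by auto
  obtain i' g r where e: "i = Suc i'" "j - 2 = Suc (i' + g)" "n = i' + g + r + Suc 1"
    by (rule far_split[OF hh])
  have j: "j = i' + g + 3" using e(2) h by linarith
  have "sG (n + 2) i = wh i' HC (g + 2 + r)" "cG n j = wh (i' + 2 + g) AC r" "sG n i = wh i' HC (g + 0 + r)"
    using e(1,3) j by (simp_all add: sG_def cG_def)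
  then show ?thesis using wh_far[OF TH_gen(1) TH_gen(2), of i' g r] by simp
qed

lemma law_cs_hi: "1 <= j ==> j <= i ==> i < n ==> CM (cG n j) (sG (n + 2) (i + 2)) = CM (sG n i) (cG n j)"
proof -
  assume h: "1 <= j" "j <= i" "i < n"
  then have "i + 1 <= n" by simp
  then obtain i' g r where e: "j = Suc i'" "i = Suc (i' + g)" "n = i' + g + r + Suc 1"
    using far_split[of j i 1 n] h by auto
  have "sG (n + 2) (i + 2) = wh (i' + 2 + g) HC r" "cG n j = wh i' AC (g + 2 + r)" "sG n i = wh (i' + 0 + g) HC r"
    using e h by (simp_all add: sG_def cG_def)
  then show ?thesis using wh_far[OF TH_gen(2) TH_gen(1), of i' g r] by simp
qed

lemma law_uu: "1 <= i ==> i <= j ==> j <= n + 1 ==> CM (uG (n + 2) (j + 2)) (uG n i) = SC eps (CM (uG (n + 2) i) (uG n j))"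
proof -
  assume h: "1 <= i" "i <= j" "j <= n + 1"
  then have "j + 0 <= n + 1" by simp
  then obtain i' g r where e: "i = Suc i'" "j = Suc (i' + g)" "n + 1 = i' + g + r + Suc 0"
    using far_split[of i j 0 "n + 1"] h by auto
  have "uG (n + 2) (j + 2) = wh (i' + 2 + g) UC r" "uG n i = wh i' UC (g + 0 + r)" "uG (n + 2) i = wh i' UC (g + 2 + r)" "uG n j = wh (i' + 0 + g) UC r"
    using e h by (simp_all add: uG_def)
  then show ?thesis using wh_far[OF TH_gen(3) TH_gen(3), of i' g r] by simp
qed

lemma law_cc: "1 <= i ==> i <= j ==> j <= n + 1 ==> CM (cG n i) (cG (n + 2) (j + 2)) = SC eps (CM (cG n j) (cG (n + 2) i))"
proof -
  assume h: "1 <= i" "i <= j" "j <= n + 1"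
  then have "j + 0 <= n + 1" by simp
  then obtain i' g r where e: "i = Suc i'" "j = Suc (i' + g)" "n + 1 = i' + g + r + Suc 0"
    using far_split[of i j 0 "n + 1"] h by auto
  have "cG (n + 2) (j + 2) = wh (i' + 2 + g) AC r" "cG n i = wh i' AC (g + 0 + r)" "cG (n + 2) i = wh i' AC (g + 2 + r)" "cG n j = wh (i' + 0 + g) AC r"
    using e h by (simp_all add: cG_def)
  then show ?thesis using wh_far[OF TH_gen(2) TH_gen(2), of i' g r] by simp
qed

lemma law_cu_far1: "1 <= i ==> i <= j ==> j <= n + 1 ==> CM (cG (n + 2) i) (uG (n + 2) (j + 2)) = SC eps (CM (uG n j) (cG n i))"
proof -
  assume h: "1 <= i" "i <= j" "j <= n + 1"
  then have "j + 0 <= n + 1" by simp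
  then obtain i' g r where e: "i = Suc i'" "j = Suc (i' + g)" "n + 1 = i' + g + r + Suc 0"
    using far_split[of i j 0 "n + 1"] h by auto
  have "cG n i = wh i' AC (g + 0 + r)" "uG (n + 2) (j + 2) = wh (i' + 2 + g) UC r" "cG (n + 2) i = wh i' AC (g + 2 + r)" "uG n j = wh (i' + 0 + g) UC r"
    using e h by (simp_all add: cG_def uG_def)
  then show ?thesis using wh_far[OF TH_gen(2) TH_gen(3), of i' g r] by simp
qed

end

section \<open>Parameters of a category of Brauer type\<close>

context strict_monoidal_supercategory
begin

lemma hom_module: "module class_ring (hom C m n)"
  using hom_vectorspace by (simp add: vectorspace_def)
lemma hom_group: "abelian_group (hom C m n)"
  by (rule module.axioms(2)[OF hom_module])

lemma hdeg_carrier: "x \<in> hdeg C m n q ==> x \<in> carrier (hom C m n)"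
  using hdeg_subspace[of m n q] by (auto simp: subspace_def submodule_def)
lemma hdeg_add: "x \<in> hdeg C m n q ==> y \<in> hdeg C m n q ==> x \<oplus>\<^bsub>hom C m n\<^esub> y \<in> hdeg C m n q"
  using hdeg_subspace[of m n q] by (auto simp: subspace_def submodule_def)
lemma hdeg_smult: "x \<in> hdeg C m n q ==> c \<odot>\<^bsub>hom C m n\<^esub> x \<in> hdeg C m n q"
  using hdeg_subspace[of m n q] by (auto simp: subspace_def submodule_def)
lemma hdeg_zero: "\<zero>\<^bsub>hom C m n\<^esub> \<in> hdeg C m n q"
  using hdeg_subspace[of m n q] by (auto simp: subspace_def submodule_def)

lemma hom_smult_closed [simp]: "x \<in> carrier (hom C m n) ==> c \<odot>\<^bsub>hom C m n\<^esub> x \<in> carrier (hom C m n)"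
  using module.smult_closed[OF hom_module[of m n], of c x] by simp
lemma hom_add_closed [simp]: "x \<in> carrier (hom C m n) ==> y \<in> carrier (hom C m n) ==> x \<oplus>\<^bsub>hom C m n\<^esub> y \<in> carrier (hom C m n)"
  using abelian_groupE(1)[OF hom_group[of m n]] by simp
lemma hom_zero_closed [simp]: "\<zero>\<^bsub>hom C m n\<^esub> \<in> carrier (hom C m n)"
  using abelian_groupE(2)[OF hom_group[of m n]] by simp
lemma idm_closed [simp]: "idm C n \<in> carrier (hom C n n)"
  using idm_even hdeg_carrier by blast
lemma cmp_closed [simp]: "f \<in> carrier (hom C l m) ==> g \<in> carrier (hom C m n) ==> cmp C l m n g f \<in> carrier (hom C l n)"
  using cmp_linear_left[of f l m n] by (auto simp: LinearCombinations.module_hom_def)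
lemma tns_closed [simp]: "f \<in> carrier (hom C m n) ==> g \<in> carrier (hom C m' n') ==> tns C m n m' n' f g \<in> carrier (hom C (m + m') (n + n'))"
  using tns_linear_left[of g m' n' m n] by (auto simp: LinearCombinations.module_hom_def)

lemma sm_0: "x \<in> carrier (hom C m n) ==> 0 \<odot>\<^bsub>hom C m n\<^esub> x = \<zero>\<^bsub>hom C m n\<^esub>"
  using module.smult_l_null[OF hom_module[of m n], of x] by simp
lemma sm_1: "x \<in> carrier (hom C m n) ==> 1 \<odot>\<^bsub>hom C m n\<^esub> x = x"
  using module.smult_one[OF hom_module[of m n], of x] by simp
lemma sm_assoc: "x \<in> carrier (hom C m n) ==> c \<odot>\<^bsub>hom C m n\<^esub> (d \<odot>\<^bsub>hom C m n\<^esub> x) = (c * d) \<odot>\<^bsub>hom C m n\<^esub> x"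
  using module.smult_assoc1[OF hom_module[of m n], of c d x] by simp
lemma sm_add_l: "x \<in> carrier (hom C m n) ==> (c + d) \<odot>\<^bsub>hom C m n\<^esub> x = c \<odot>\<^bsub>hom C m n\<^esub> x \<oplus>\<^bsub>hom C m n\<^esub> d \<odot>\<^bsub>hom C m n\<^esub> x"
  using module.smult_l_distr[OF hom_module[of m n], of c d x] by simp
lemma sm_add_r: "x \<in> carrier (hom C m n) ==> y \<in> carrier (hom C m n) ==>
  c \<odot>\<^bsub>hom C m n\<^esub> (x \<oplus>\<^bsub>hom C m n\<^esub> y) = c \<odot>\<^bsub>hom C m n\<^esub> x \<oplus>\<^bsub>hom C m n\<^esub> c \<odot>\<^bsub>hom C m n\<^esub> y"
  using module.smult_r_distr[OF hom_module[of m n], of c x y] by simp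

end

locale interpretation_data = strict_monoidal_supercategory C for C :: "('k::field, 'h) supercat" +
  fixes H A U :: 'h and p :: bit and R :: "('k expr \<times> 'k expr) set"
  assumes gens: "H \<in> hdeg C 2 2 0" "A \<in> hdeg C 2 0 p" "U \<in> hdeg C 0 2 p"
    and sat: "satisfies C H A U R"
begin

abbreviation "evl \<equiv> ev C H A U"

lemma ev_closed: "wf_expr t ==> evl t \<in> carrier (hom C (src t) (tgt t))"
proof (induction t)
  case (Comp s t)
  then show ?case using cmp_closed[of "evl t" "src t" "tgt t" "evl s" "tgt s"] by auto
qed (use gens in \<open>auto intro: hdeg_carrier\<close>)

lemma ev_hdeg: "wf_expr t ==> homog p t q ==> evl t \<in> hdeg C (src t) (tgt t) q"
proof (induction t arbitrary: q)
  case (Comp s t)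
  then obtain q1 q2 where q: "q = q1 + q2" "homog p s q1" "homog p t q2" by auto
  then show ?case using Comp cmp_degree[of "evl t" "src t" "tgt t" q2 "evl s" "tgt s" q1]
    by (simp only: wf_expr.simps ev.simps src.simps tgt.simps)
next
  case (Tens s t)
  then obtain q1 q2 where q: "q = q1 + q2" "homog p s q1" "homog p t q2" by auto
  then show ?case using Tens tns_degree[of "evl s" "src s" "tgt s" q1 "evl t" "src t" "tgt t" q2]
    by (simp only: wf_expr.simps ev.simps src.simps tgt.simps)
next
  case (Add s t)
  then have "evl s \<in> hdeg C (src s) (tgt s) q" "evl t \<in> hdeg C (src s) (tgt s) q" by auto
  then show ?case by (simp add: hdeg_add)
qed (use gens in \<open>auto intro: hdeg_zero hdeg_smult idm_even\<close>)

lemmas ev_interchange = interchange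

lemma cong_ev: "cong_expr p R s t ==> evl s = evl t"
proof (induction rule: cong_expr.induct)
  case (relI s t)
  then show ?case using sat by (auto simp: satisfies_def)
next
  case (cong_add s s' t t')
  then show ?case using cong_expr_wf[OF cong_add(1)] cong_expr_wf[OF cong_add(2)] by simp
next
  case (cong_scale t t' c)
  then show ?case using cong_expr_wf[OF cong_scale(1)] by simp
next
  case (cong_comp s s' t t')
  then show ?case using cong_expr_wf[OF cong_comp(1)] cong_expr_wf[OF cong_comp(2)] by simp
next
  case (cong_tens s s' t t')
  then show ?case using cong_expr_wf[OF cong_tens(1)] cong_expr_wf[OF cong_tens(2)] by simp
next
  case (add_assoc s t u)
  then have "evl s \<in> carrier (hom C (src s) (tgt s))" "evl t \<in> carrier (hom C (src s) (tgt s))"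
    "evl u \<in> carrier (hom C (src s) (tgt s))" using ev_closed[of s] ev_closed[of t] ev_closed[of u] by auto
  then show ?case using add_assoc abelian_groupE(3)[OF hom_group[of "src s" "tgt s"], of "evl s" "evl t" "evl u"] by simp
next
  case (add_comm s t)
  then show ?case using abelian_groupE(4)[OF hom_group[of "src s" "tgt s"], of "evl s" "evl t"]
    ev_closed[of s] ev_closed[of t] by simp
next
  case (add_zero t)
  then show ?case using ev_closed[of t]
    by (simp add: abelian_monoid.r_zero[OF abelian_group.axioms(1)[OF hom_group]])
next
  case (scale_add_right s t c)
  then show ?case using sm_add_r[of "evl s" "src s" "tgt s" "evl t" c] ev_closed[of s] ev_closed[of t] by simp
next
  case (comp_add_left s t u)
  then have e: "src t = src s" "tgt t = tgt s" "tgt u = src s" and w: "wf_expr s" "wf_expr t" "wf_expr u" by auto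
  show ?case using ev_closed[OF w(1)] ev_closed[OF w(2)] ev_closed[OF w(3)]
      LinearCombinations.module_hom_add[OF cmp_linear_left[of "evl u" "src u" "src s" "tgt s"], of "evl s" "evl t"] by (simp add: e)
next
  case (comp_add_right s t u)
  then show ?case using ev_closed[of s] ev_closed[of t] ev_closed[of u]
      LinearCombinations.module_hom_add[OF cmp_linear_right[of "evl s" "src s" "tgt s" "src t"], of "evl t" "evl u"] by simp
next
  case (comp_scale_left s t c)
  then show ?case using ev_closed[of s] ev_closed[of t]
      LinearCombinations.module_hom_smult[OF cmp_linear_left[of "evl t" "src t" "tgt t" "tgt s"], of c "evl s"] by simp
next
  case (comp_scale_right s t c)
  then show ?case using ev_closed[of s] ev_closed[of t]
      LinearCombinations.module_hom_smult[OF cmp_linear_right[of "evl s" "src s" "tgt s" "src t"], of c "evl t"] by simp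
next
  case (comp_assoc s t u)
  then show ?case using ev_closed[of s] ev_closed[of t] ev_closed[of u]
      cmp_assoc[of "evl u" "src u" "tgt u" "evl t" "tgt t" "evl s" "tgt s"] by simp
next
  case (tens_add_left s t u)
  then show ?case using ev_closed[of s] ev_closed[of t] ev_closed[of u]
      LinearCombinations.module_hom_add[OF tns_linear_left[of "evl u" "src u" "tgt u" "src s" "tgt s"], of "evl s" "evl t"] by simp
next
  case (tens_add_right s t u)
  then show ?case using ev_closed[of s] ev_closed[of t] ev_closed[of u]
      LinearCombinations.module_hom_add[OF tns_linear_right[of "evl s" "src s" "tgt s" "src t" "tgt t"], of "evl t" "evl u"] by simp
next
  case (tens_scale_left s t c)
  then show ?case using ev_closed[of s] ev_closed[of t]
      LinearCombinations.module_hom_smult[OF tns_linear_left[of "evl t" "src t" "tgt t" "src s" "tgt s"], of c "evl s"] by simp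
next
  case (tens_scale_right s t c)
  then show ?case using ev_closed[of s] ev_closed[of t]
      LinearCombinations.module_hom_smult[OF tns_linear_right[of "evl s" "src s" "tgt s" "src t" "tgt t"], of c "evl t"] by simp
next
  case (tens_assoc s t u)
  then show ?case using ev_closed[of s] ev_closed[of t] ev_closed[of u]
      tns_assoc[of "evl s" "src s" "tgt s" "evl t" "src t" "tgt t" "evl u" "src u" "tgt u"] by simp
next
  case (tens_id m n)
  then show ?case by (simp add: tns_idm)
next
  case (interchange f h g k q' q)
  then show ?case using ev_closed[of f] ev_closed[of k] ev_hdeg[of g q'] ev_hdeg[of h q]
      ev_interchange[of "evl h" "src h" "tgt h" q "evl f" "tgt f" "evl k" "src k" "tgt k" "evl g" "tgt g" q'] by simp
qed (use ev_closed in \<open>auto simp: sm_0 sm_1 sm_assoc sm_add_l cmp_idm_left cmp_idm_right tns_unit_left tns_unit_right\<close>)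

end

lemma (in vectorspace) lin_indpt_finite:
  assumes "lin_indpt B" "finite A" "A \<subseteq> B" "a \<in> A \<rightarrow> carrier K" "lincomb a A = \<zero>\<^bsub>V\<^esub>" "v \<in> A"
  shows "a v = \<zero>\<^bsub>K\<^esub>"
  using assms unfolding lin_dep_def by blast

context strict_monoidal_supercategory
begin

lemma indep3:
  assumes B: "vectorspace.basis class_ring (hom C m n) B" and w: "w1 \<in> B" "w2 \<in> B" "w3 \<in> B"
    "w1 \<noteq> w2" "w1 \<noteq> w3" "w2 \<noteq> w3"
    and eq: "x \<odot>\<^bsub>hom C m n\<^esub> w1 \<oplus>\<^bsub>hom C m n\<^esub> y \<odot>\<^bsub>hom C m n\<^esub> w2 \<oplus>\<^bsub>hom C m n\<^esub> z \<odot>\<^bsub>hom C m n\<^esub> w3 = \<zero>\<^bsub>hom C m n\<^esub>"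
  shows "x = 0 \<and> y = 0 \<and> z = 0"
proof -
  let ?M = "hom C m n"
  interpret V: vectorspace class_ring ?M by (rule hom_vectorspace)
  have li: "\<not> V.lin_dep B" and Bc: "B \<subseteq> carrier ?M"
    using B by (auto simp: V.basis_def)
  define a where "a v = (if v = w1 then x else if v = w2 then y else z)" for v
  have c: "w1 \<in> carrier ?M" "w2 \<in> carrier ?M" "w3 \<in> carrier ?M" using w Bc by auto
  have "V.lincomb a {w1, w2, w3} = \<zero>\<^bsub>?M\<^esub>"
    unfolding V.lincomb_def using w c eq by (simp add: a_def V.M.a_assoc Pi_def)
  then have "a v = \<zero>\<^bsub>class_ring\<^esub>" if "v \<in> {w1, w2, w3}" for v
    using V.lin_indpt_finite[OF li, of "{w1, w2, w3}" a v] that w by auto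
  from this[of w1] this[of w2] this[of w3] w show ?thesis by (auto simp: a_def)
qed

lemma indep1:
  assumes B: "vectorspace.basis class_ring (hom C m n) B" and w: "w \<in> B"
    and eq: "x \<odot>\<^bsub>hom C m n\<^esub> w = \<zero>\<^bsub>hom C m n\<^esub>"
  shows "x = 0"
proof -
  let ?M = "hom C m n"
  interpret V: vectorspace class_ring ?M by (rule hom_vectorspace)
  have li: "\<not> V.lin_dep B" and Bc: "B \<subseteq> carrier ?M"
    using B by (auto simp: V.basis_def)
  have c: "w \<in> carrier ?M" using w Bc by auto
  have "V.lincomb (\<lambda>_. x) {w} = \<zero>\<^bsub>?M\<^esub>"
    unfolding V.lincomb_def using c eq by (simp add: Pi_def)
  then show ?thesis
    using V.lin_indpt_finite[OF li, of "{w}" "\<lambda>_. x" w] w by auto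
qed

end

lemma reduced_systemD:
  assumes "reduced_word_system W"
  shows "w \<in> W r ==> reduced_word r w"
    and "\<pi> permutes {1..r} ==> \<exists>!w. w \<in> W r \<and> word_perm w = \<pi>"
proof -
  have *: "(\<forall>w\<in>W r. reduced_word r w \<and> (\<nexists>u v i. w = u @ [i, Suc i, i] @ v)) \<and>
     (\<forall>\<pi>. \<pi> permutes {1..r} --> (\<exists>!w. w \<in> W r \<and> word_perm w = \<pi>))"
    using assms unfolding reduced_word_system_def by (rule spec)
  show "w \<in> W r ==> reduced_word r w" by (rule conjunct1[OF bspec[OF conjunct1[OF *]]])
  show "\<pi> permutes {1..r} ==> \<exists>!w. w \<in> W r \<and> word_perm w = \<pi>"
    by (rule mp[OF spec[OF conjunct2[OF *]]])
qed

lemma reduced_wordD: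
  assumes "reduced_word r w"
  shows "set w \<subseteq> {1..<r}" "set v \<subseteq> {1..<r} ==> word_perm v = word_perm w ==> length w <= length v"
  using assms by (simp_all add: reduced_word_def)

lemma reduced_nil:
  assumes W: "reduced_word_system W"
  shows "[] \<in> W r"
proof -
  obtain w where w: "w \<in> W r" "word_perm w = id"
    using ex1_implies_ex[OF reduced_systemD(2)[OF W permutes_id[of "{1..r}"]]] by (elim exE conjE)
  have "length w <= length ([] :: nat list)"
    using w by (intro reduced_wordD(2)[OF reduced_systemD(1)[OF W w(1)]]) (simp_all add: word_perm_def)
  then show ?thesis using w by simp
qed

lemma reduced_one:
  assumes W: "reduced_word_system W"
  shows "[1] \<in> W 2"
proof -
  have t: "transpose 1 (2::nat) permutes {1..2}" by (rule permutes_swap_id) simp_all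
  obtain w where w: "w \<in> W 2" "word_perm w = transpose 1 2"
    using ex1_implies_ex[OF reduced_systemD(2)[OF W t]] by (elim exE conjE)
  note r = reduced_systemD(1)[OF W w(1)]
  have "length w <= length [1 :: nat]"
    using w by (intro reduced_wordD(2)[OF r]) (simp_all add: word_perm_def numeral_2_eq_2)
  moreover have "w \<noteq> []"
  proof
    assume "w = []"
    then have "transpose 1 (2::nat) = id" using w by (simp add: word_perm_def)
    then have "transpose 1 (2::nat) 1 = 1" by simp
    then show False by simp
  qed
  ultimately obtain i where i: "w = [i]" by (cases w) simp_all
  then have "i = 1" using reduced_wordD(1)[OF r] by simp
  then show ?thesis using i w by simp
qed

locale brauer_cat = interpretation_data C H A U p "relations P"
  for C :: "('k::field, 'h) supercat" and H A U p and P :: "'k params" +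
  fixes W :: "nat => nat list set"
  assumes W: "reduced_word_system W"
    and H_inv: "\<exists>G\<in>carrier (hom C 2 2). cmp C 2 2 2 G H = idm C 2 \<and> cmp C 2 2 2 H G = idm C 2"
    and inj: "inj_on (\<lambda>x. ev C H A U (std_expr n x)) (std_index W m n)"
    and bas: "vectorspace.basis class_ring (hom C m n) ((\<lambda>x. ev C H A U (std_expr n x)) ` std_index W m n)"
begin

sublocale bpres p P .

definition "KK v1 v2 v3 x y z = AD (AD (SC x v1) (SC y v2)) (SC z v3)"

lemma KK_TT: "v1 \<in> TT m n ==> v2 \<in> TT m n ==> v3 \<in> TT m n ==> KK v1 v2 v3 x y z \<in> TT m n"
  by (simp add: KK_def)

lemma KK_lin:
  assumes "v1 \<in> Cl" "v2 \<in> Cl" "v3 \<in> Cl"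
  shows "SC c (KK v1 v2 v3 x y z) = KK v1 v2 v3 (c * x) (c * y) (c * z)"
    "AD (KK v1 v2 v3 x y z) (KK v1 v2 v3 x' y' z') = KK v1 v2 v3 (x + x') (y + y') (z + z')"
  using assms by (simp_all add: KK_def SC_plus AD_ac)

lemma CM_KK:
  assumes "X \<in> TT n n'" "v1 \<in> TT m n" "v2 \<in> TT m n" "v3 \<in> TT m n" "w1 \<in> Cl" "w2 \<in> Cl" "w3 \<in> Cl"
    and "CM X v1 = KK w1 w2 w3 a1 b1 c1" "CM X v2 = KK w1 w2 w3 a2 b2 c2" "CM X v3 = KK w1 w2 w3 a3 b3 c3"
  shows "CM X (KK v1 v2 v3 x y z) = KK w1 w2 w3 (x * a1 + y * a2 + z * a3) (x * b1 + y * b2 + z * b3) (x * c1 + y * c2 + z * c3)"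
proof -
  have "CM X (KK v1 v2 v3 x y z) = AD (AD (SC x (CM X v1)) (SC y (CM X v2))) (SC z (CM X v3))"
    unfolding KK_def using assms(1-4) by (simp add: CM_AD_r[of X _ m n])
  then show ?thesis unfolding assms(8-10) using assms(5-7) by (simp add: KK_lin)
qed

lemma KK_CM:
  assumes "X \<in> TT m' m" "v1 \<in> TT m n" "v2 \<in> TT m n" "v3 \<in> TT m n" "w1 \<in> Cl" "w2 \<in> Cl" "w3 \<in> Cl"
    and "CM v1 X = KK w1 w2 w3 a1 b1 c1" "CM v2 X = KK w1 w2 w3 a2 b2 c2" "CM v3 X = KK w1 w2 w3 a3 b3 c3"
  shows "CM (KK v1 v2 v3 x y z) X = KK w1 w2 w3 (x * a1 + y * a2 + z * a3) (x * b1 + y * b2 + z * b3) (x * c1 + y * c2 + z * c3)"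
proof -
  have "CM (KK v1 v2 v3 x y z) X = AD (AD (SC x (CM v1 X)) (SC y (CM v2 X))) (SC z (CM v3 X))"
    unfolding KK_def using assms(1-4) by (simp add: CM_AD_l[of X _ m n])
  then show ?thesis unfolding assms(8-10) using assms(5-7) by (simp add: KK_lin)
qed

definition "EV X = evl (SOME t. t \<in> X)"

lemma EV_cl: "wf_expr t ==> EV (cl t) = evl t"
proof -
  assume "wf_expr t"
  then have "(SOME s. s \<in> cl t) \<in> cl t" using someI[of "\<lambda>s. s \<in> cl t" t] cl_self by blast
  then show ?thesis unfolding EV_def using cong_ev[OF cl_mem] by simp
qed

lemma EV_SC: "X \<in> TT m n ==> EV (SC c X) = c \<odot>\<^bsub>hom C m n\<^esub> EV X"
  by (elim TTE, hypsubst) (simp add: cl_scale EV_cl)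
lemma EV_AD: "X \<in> TT m n ==> Y \<in> TT m n ==> EV (AD X Y) = EV X \<oplus>\<^bsub>hom C m n\<^esub> EV Y"
  by (elim TTE, hypsubst) (simp add: cl_add EV_cl)
lemma EV_ZE: "EV (ZE m n) = \<zero>\<^bsub>hom C m n\<^esub>" by (simp add: EV_cl)

lemma stdwf: "x \<in> std_index W m n ==> wf_expr (std_expr n x :: 'k expr) \<and> src (std_expr n x :: 'k expr) = m \<and> tgt (std_expr n x :: 'k expr) = n"
  by (rule std_expr_wf[OF W])

lemma stdv_indep:
  assumes s: "x1 \<in> std_index W m n" "x2 \<in> std_index W m n" "x3 \<in> std_index W m n" "x1 \<noteq> x2" "x1 \<noteq> x3" "x2 \<noteq> x3"
    and v: "cl (std_expr n x1) = v1" "cl (std_expr n x2) = v2" "cl (std_expr n x3) = v3"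
    and eq: "KK v1 v2 v3 x y z = KK v1 v2 v3 x' y' z'"
  shows "x = x' \<and> y = y' \<and> z = z'"
proof -
  have wf: "wf_expr (std_expr n x :: 'k expr)" if "x \<in> {x1, x2, x3}" for x
    using stdwf[OF s(1)] stdwf[OF s(2)] stdwf[OF s(3)] that by blast
  have tt: "v1 \<in> TT m n" "v2 \<in> TT m n" "v3 \<in> TT m n"
    unfolding v[symmetric] using stdwf[OF s(1)] stdwf[OF s(2)] stdwf[OF s(3)] by (simp_all add: cl_TTI)
  have e: "EV v1 = evl (std_expr n x1)" "EV v2 = evl (std_expr n x2)" "EV v3 = evl (std_expr n x3)"
    unfolding v[symmetric] using wf by (simp_all add: EV_cl)
  have ne: "EV v1 \<noteq> EV v2" "EV v1 \<noteq> EV v3" "EV v2 \<noteq> EV v3"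
    unfolding e using inj_onD[OF inj[of n m]] s by blast+
  have "KK v1 v2 v3 (x - x') (y - y') (z - z') = AD (KK v1 v2 v3 x y z) (SC (-1) (KK v1 v2 v3 x' y' z'))"
    using tt by (simp add: KK_lin)
  also have "... = AD (KK v1 v2 v3 x' y' z') (SC (-1) (KK v1 v2 v3 x' y' z'))" by (simp add: eq)
  also have "... = KK v1 v2 v3 0 0 0" using tt by (simp add: KK_lin)
  also have "... = ZE m n" using tt by (simp add: KK_def SC_0[of _ m n] AD_ZE[of _ m n])
  finally have "EV (KK v1 v2 v3 (x - x') (y - y') (z - z')) = EV (ZE m n)" by simp
  then have "(x - x') \<odot>\<^bsub>hom C m n\<^esub> EV v1 \<oplus>\<^bsub>hom C m n\<^esub> (y - y') \<odot>\<^bsub>hom C m n\<^esub> EV v2 \<oplus>\<^bsub>hom C m n\<^esub> (z - z') \<odot>\<^bsub>hom C m n\<^esub> EV v3 = \<zero>\<^bsub>hom C m n\<^esub>"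
    unfolding KK_def using tt by (simp add: EV_AD[of _ m n] EV_SC[of _ m n] EV_ZE)
  moreover have "EV v1 \<in> (\<lambda>x. evl (std_expr n x)) ` std_index W m n" "EV v2 \<in> (\<lambda>x. evl (std_expr n x)) ` std_index W m n"
    "EV v3 \<in> (\<lambda>x. evl (std_expr n x)) ` std_index W m n"
    unfolding e using s by blast+
  ultimately have "x - x' = 0 \<and> y - y' = 0 \<and> z - z' = 0" using ne by (intro indep3[OF bas[of m n]])
  then show ?thesis by simp
qed

lemma stdv_indep1:
  assumes s: "x1 \<in> std_index W m n" and v: "cl (std_expr n x1) = v1" and eq: "SC x v1 = SC x' v1"
  shows "x = x'"
proof -
  have wf: "wf_expr (std_expr n x1 :: 'k expr)" using stdwf[OF s] by blast
  have tt: "v1 \<in> TT m n" unfolding v[symmetric] using stdwf[OF s] by (simp add: cl_TTI)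
  have e: "EV v1 = evl (std_expr n x1)" unfolding v[symmetric] using wf by (simp add: EV_cl)
  have "SC (x - x') v1 = AD (SC x v1) (SC (- x') v1)" using tt SC_plus[of v1 x "- x'"] by simp
  also have "... = AD (SC x' v1) (SC (- x') v1)" by (simp add: eq)
  also have "... = SC 0 v1" using tt SC_plus[of v1 x' "- x'"] by simp
  also have "... = ZE m n" using tt by (simp add: SC_0)
  finally have "EV (SC (x - x') v1) = EV (ZE m n)" by simp
  then have "(x - x') \<odot>\<^bsub>hom C m n\<^esub> EV v1 = \<zero>\<^bsub>hom C m n\<^esub>" using tt by (simp add: EV_SC EV_ZE)
  moreover have "EV v1 \<in> (\<lambda>x. evl (std_expr n x)) ` std_index W m n" unfolding e using s by blast
  ultimately have "x - x' = 0" by (intro indep1[OF bas[of m n]])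
  then show ?thesis by simp
qed

lemma nilW: "[] \<in> W r" by (rule reduced_nil[OF W])

lemma std_mem: "us \<in> cups_index r n ==> w \<in> W r ==> js \<in> caps_index m r ==> (us, w, js) \<in> std_index W m n"
  unfolding std_index_def by auto

lemmas cl_G = cl_expr_s cl_expr_u cl_expr_a

lemma idx: "([(1,0)],[],[]) \<in> std_index W 1 3" "([(2,0)],[],[]) \<in> std_index W 1 3" "([(1,1)],[],[]) \<in> std_index W 1 3"
  "([],[],[(1,0)]) \<in> std_index W 3 1" "([],[],[(2,0)]) \<in> std_index W 3 1" "([],[],[(1,1)]) \<in> std_index W 3 1"
  "([(3,0),(1,0)],[],[]) \<in> std_index W 0 4" "([(2,0),(1,0)],[],[]) \<in> std_index W 0 4" "([(2,1),(1,0)],[],[]) \<in> std_index W 0 4"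
  "([],[],[]) \<in> std_index W 2 2" "([],[1],[]) \<in> std_index W 2 2" "([(1,0)],[],[(1,0)]) \<in> std_index W 2 2"
  "([],[],[]) \<in> std_index W 1 1" "([],[],[(1,0)]) \<in> std_index W 2 0"
proof -
  have c: "[(1,0)] \<in> cups_index 1 3" "[(2,0)] \<in> cups_index 1 3" "[(1,1)] \<in> cups_index 1 3"
    "[(3,0),(1,0)] \<in> cups_index 0 4" "[(2,0),(1,0)] \<in> cups_index 0 4" "[(2,1),(1,0)] \<in> cups_index 0 4"
    "[(1,0)] \<in> cups_index 0 2" and c0: "[] \<in> cups_index r r" for r
    by (auto simp: cups_index_def less_Suc_eq)
  have j: "[(1,0)] \<in> caps_index 3 1" "[(2,0)] \<in> caps_index 3 1" "[(1,1)] \<in> caps_index 3 1"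
    "[(1,0)] \<in> caps_index 2 0" and j0: "[] \<in> caps_index r r" for r
    by (auto simp: caps_index_def less_Suc_eq)
  note m = std_mem[OF _ nilW]
  show "([(1,0)],[],[]) \<in> std_index W 1 3" "([(2,0)],[],[]) \<in> std_index W 1 3" "([(1,1)],[],[]) \<in> std_index W 1 3"
    "([],[],[(1,0)]) \<in> std_index W 3 1" "([],[],[(2,0)]) \<in> std_index W 3 1" "([],[],[(1,1)]) \<in> std_index W 3 1"
    "([(3,0),(1,0)],[],[]) \<in> std_index W 0 4" "([(2,0),(1,0)],[],[]) \<in> std_index W 0 4" "([(2,1),(1,0)],[],[]) \<in> std_index W 0 4"
    "([],[],[]) \<in> std_index W 2 2" "([(1,0)],[],[(1,0)]) \<in> std_index W 2 2"
    "([],[],[]) \<in> std_index W 1 1" "([],[],[(1,0)]) \<in> std_index W 2 0"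
    by (rule m[OF c(1) j0], rule m[OF c(2) j0], rule m[OF c(3) j0], rule m[OF c0 j(1)], rule m[OF c0 j(2)], rule m[OF c0 j(3)],
      rule m[OF c(4) j0], rule m[OF c(5) j0], rule m[OF c(6) j0], rule m[OF c0 j0], rule m[OF c(7) j(4)], rule m[OF c0 j0], rule m[OF c0 j(4)])
  show "([],[1],[]) \<in> std_index W 2 2"
    by (rule std_mem[OF c0 reduced_one[OF W] j0])
qed

end

context brauer_cat
begin
lemma n2: "1 + 2 = (3::nat)" "Suc 1 = 2" "2 + 2 = (4::nat)" "Suc 2 = 3" "0 + 2 = (2::nat)" "3 - 2 = (1::nat)" "4 - 2 = (2::nat)" "(1::nat) + 1 = 2" "0 + 1 = (1::nat)"
  by simp_all

lemma tG: "uG 1 1 \<in> TT 1 3" "uG 1 2 \<in> TT 1 3" "sG 3 1 \<in> TT 3 3" "sG 3 2 \<in> TT 3 3" "cG 1 1 \<in> TT 3 1" "cG 1 2 \<in> TT 3 1"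
    "uG 2 1 \<in> TT 2 4" "uG 2 3 \<in> TT 2 4" "uG 2 2 \<in> TT 2 4" "uG 0 1 \<in> TT 0 2" "sG 4 1 \<in> TT 4 4" "sG 4 2 \<in> TT 4 4" "sG 4 3 \<in> TT 4 4" "sG 2 1 \<in> TT 2 2"
    "cG 2 1 \<in> TT 4 2" "cG 2 2 \<in> TT 4 2" "cG 2 3 \<in> TT 4 2" "cG 0 1 \<in> TT 2 0"
  using TT_uG[of 1 1] TT_uG[of 2 1] TT_sG[of 1 3] TT_sG[of 2 3] TT_cG[of 1 1] TT_cG[of 2 1] TT_uG[of 1 2] TT_uG[of 3 2] TT_uG[of 2 2] TT_uG[of 1 0]
      TT_sG[of 1 4] TT_sG[of 2 4] TT_sG[of 3 4] TT_sG[of 1 2] TT_cG[of 1 2] TT_cG[of 2 2] TT_cG[of 3 2] TT_cG[of 1 0]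
  by (simp_all add: numeral_2_eq_2 numeral_3_eq_3 numeral_eq_Suc)

lemma cl_std:
  "cl (std_expr 3 ([(1,0)],[],[])) = uG 1 1" "cl (std_expr 3 ([(2,0)],[],[])) = uG 1 2" "cl (std_expr 3 ([(1,1)],[],[])) = CM (sG 3 2) (uG 1 1)"
  "cl (std_expr 1 ([],[],[(1,0)])) = cG 1 1" "cl (std_expr 1 ([],[],[(2,0)])) = cG 1 2" "cl (std_expr 1 ([],[],[(1,1)])) = CM (cG 1 1) (sG 3 2)"
  "cl (std_expr 4 ([(3,0),(1,0)],[],[])) = CM (uG 2 3) (uG 0 1)" "cl (std_expr 4 ([(2,0),(1,0)],[],[])) = CM (uG 2 2) (uG 0 1)"
  "cl (std_expr 4 ([(2,1),(1,0)],[],[])) = CM (sG 4 3) (CM (uG 2 2) (uG 0 1))"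
  "cl (std_expr 2 ([],[],[])) = ID 2" "cl (std_expr 2 ([],[1],[])) = sG 2 1" "cl (std_expr 2 ([(1,0)],[],[(1,0)])) = CM (uG 0 1) (cG 0 1)"
  "cl (std_expr 1 ([],[],[])) = ID 1" "cl (std_expr 0 ([],[],[(1,0)])) = cG 0 1"
proof -
  note t = tG
  note d = std_expr_def Let_def
  note cc = cl_comp[symmetric] cl_G
  show "cl (std_expr 3 ([(1,0)],[],[])) = uG 1 1" "cl (std_expr 3 ([(2,0)],[],[])) = uG 1 2" "cl (std_expr 3 ([(1,1)],[],[])) = CM (sG 3 2) (uG 1 1)"
    "cl (std_expr 1 ([],[],[(1,0)])) = cG 1 1" "cl (std_expr 1 ([],[],[(2,0)])) = cG 1 2" "cl (std_expr 1 ([],[],[(1,1)])) = CM (cG 1 1) (sG 3 2)"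
    "cl (std_expr 4 ([(3,0),(1,0)],[],[])) = CM (uG 2 3) (uG 0 1)" "cl (std_expr 4 ([(2,0),(1,0)],[],[])) = CM (uG 2 2) (uG 0 1)"
    "cl (std_expr 4 ([(2,1),(1,0)],[],[])) = CM (sG 4 3) (CM (uG 2 2) (uG 0 1))"
    "cl (std_expr 2 ([],[],[])) = ID 2" "cl (std_expr 2 ([],[1],[])) = sG 2 1" "cl (std_expr 2 ([(1,0)],[],[(1,0)])) = CM (uG 0 1) (cG 0 1)"
    "cl (std_expr 1 ([],[],[])) = ID 1" "cl (std_expr 0 ([],[],[(1,0)])) = cG 0 1"
    using t by (simp_all add: d cc CM_assoc CM_ID_r[of _ "Suc 0" 3] CM_ID_r[of _ 0 2] CM_ID_r[of _ 2 2] CM_ID_l[of _ 2 2]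
      CM_ID_l[of _ 3 "Suc 0"] CM_ID_l[of _ 2 0] CM_ID_r[of _ 3 "Suc 0"] CM_ID_r[of _ 2 0] CM_ID_l[of _ "Suc 0" "Suc 0"] CM_ID_l[of _ 0 0] TT_CM[of _ 3 3 _ "Suc 0"] TT_CM[of _ 3 "Suc 0" _ 3] numeral_2_eq_2[symmetric])
qed

lemma KK_unit: "v1 \<in> TT m n ==> v2 \<in> TT m n ==> v3 \<in> TT m n ==> KK v1 v2 v3 1 0 0 = v1"
  "v1 \<in> TT m n ==> v2 \<in> TT m n ==> v3 \<in> TT m n ==> KK v1 v2 v3 0 1 0 = v2"
  "v1 \<in> TT m n ==> v2 \<in> TT m n ==> v3 \<in> TT m n ==> KK v1 v2 v3 0 0 1 = v3"
  by (simp_all add: KK_def SC_0[of _ m n] AD_ZE[of _ m n] AD_comm[of "ZE m n"])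

lemma KK_sc: "v1 \<in> TT m n ==> v2 \<in> TT m n ==> v3 \<in> TT m n ==> KK v1 v2 v3 x 0 0 = SC x v1"
  "v1 \<in> TT m n ==> v2 \<in> TT m n ==> v3 \<in> TT m n ==> KK v1 v2 v3 0 x 0 = SC x v2"
  "v1 \<in> TT m n ==> v2 \<in> TT m n ==> v3 \<in> TT m n ==> KK v1 v2 v3 0 0 x = SC x v3"
  by (simp_all add: KK_def SC_0[of _ m n] AD_ZE[of _ m n] AD_comm[of "ZE m n"])

abbreviation "su \<equiv> CM (sG 3 2) (uG 1 1)"
abbreviation "K3 \<equiv> KK (uG 1 1) su (uG 1 2)"
abbreviation "cs \<equiv> CM (cG 1 1) (sG 3 2)"
abbreviation "K3' \<equiv> KK (cG 1 1) cs (cG 1 2)"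

lemma tsu: "su \<in> TT 1 3" "cs \<in> TT 3 1" using tG by auto

lemmas KT = KK_unit[of "uG 1 1" 1 3 su "uG 1 2", OF tG(1) tsu(1) tG(2)] KK_sc[of "uG 1 1" 1 3 su "uG 1 2", OF tG(1) tsu(1) tG(2)]
lemmas KT' = KK_unit[of "cG 1 1" 3 1 cs "cG 1 2", OF tG(5) tsu(2) tG(6)] KK_sc[of "cG 1 1" 3 1 cs "cG 1 2", OF tG(5) tsu(2) tG(6)]

lemma K3_inj: "K3 x y z = K3 x' y' z' ==> x = x' \<and> y = y' \<and> z = z'"
  by (rule stdv_indep[OF idx(1) idx(3) idx(2) _ _ _ cl_std(1) cl_std(3) cl_std(2)]) simp_all
lemma K3'_inj: "K3' x y z = K3' x' y' z' ==> x = x' \<and> y = y' \<and> z = z'"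
  by (rule stdv_indep[OF idx(4) idx(6) idx(5) _ _ _ cl_std(4) cl_std(6) cl_std(5)]) simp_all

lemma S_tab:
  "CM (sG 3 1) (uG 1 1) = K3 (p_lam P) 0 0" "CM (sG 3 1) su = K3 (p_D P) (p_E P) (p_F P)" "CM (sG 3 1) (uG 1 2) = K3 (p_d P) (p_e P) (p_f P)"
  "CM (sG 3 2) (uG 1 1) = K3 0 1 0" "CM (sG 3 2) su = K3 (p_a P) (p_b P) (p_c P * p_sig' P)" "CM (sG 3 2) (uG 1 2) = K3 0 0 (p_lam P)"
proof -
  show "CM (sG 3 1) (uG 1 1) = K3 (p_lam P) 0 0" using law_su[of 1 1] by (simp add: n2 KT del: One_nat_def)
  show "CM (sG 3 1) su = K3 (p_D P) (p_E P) (p_F P)" using law_su2[of 1 1] by (simp add: n2 KK_def del: One_nat_def)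
  show "CM (sG 3 1) (uG 1 2) = K3 (p_d P) (p_e P) (p_f P)" using law_su1[of 1 1] by (simp add: n2 KK_def del: One_nat_def)
  show "CM (sG 3 2) (uG 1 1) = K3 0 1 0" by (rule KT(2)[symmetric])
  show "CM (sG 3 2) (uG 1 2) = K3 0 0 (p_lam P)" using law_su[of 2 1] by (simp add: n2 KT del: One_nat_def)
  have "CM (sG 3 2) su = CM (CM (sG 3 2) (sG 3 2)) (uG 1 1)" by (simp add: CM_assoc)
  also have "CM (sG 3 2) (sG 3 2) = AD (AD (SC (p_a P) (ID 3)) (SC (p_b P) (sG 3 2))) (SC (p_c P) (CM (uG 1 2) (cG 1 2)))"
    using law_quad[of 2 3] by (simp add: numeral_2_eq_2[symmetric])
  also have "CM ... (uG 1 1) = AD (AD (SC (p_a P) (CM (ID 3) (uG 1 1))) (SC (p_b P) su)) (SC (p_c P) (CM (uG 1 2) (CM (cG 1 2) (uG 1 1))))"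
    using tG TT_CM[of "uG 1 2" 1 3 "cG 1 2" 3] by (simp add: CM_AD_l[of _ _ 3 3] CM_assoc del: One_nat_def)
  also have "CM (cG 1 2) (uG 1 1) = SC (p_sig' P) (ID 1)" using law_c1u[of 1 1] by (simp add: n2 del: One_nat_def)
  finally show "CM (sG 3 2) su = K3 (p_a P) (p_b P) (p_c P * p_sig' P)"
    using tG by (simp add: CM_ID_l[of _ 1 3] CM_ID_r[of _ 1 3] KK_def del: One_nat_def)
qed

lemma S_tab':
  "CM (cG 1 1) (sG 3 1) = K3' (p_lam' P) 0 0" "CM cs (sG 3 1) = K3' (p_D' P) (p_E' P) (p_F' P)" "CM (cG 1 2) (sG 3 1) = K3' (p_d' P) (p_e' P) (p_f' P)"
  "CM (cG 1 1) (sG 3 2) = K3' 0 1 0" "CM cs (sG 3 2) = K3' (p_a P) (p_b P) (p_c P * p_sig P)" "CM (cG 1 2) (sG 3 2) = K3' 0 0 (p_lam' P)"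
proof -
  show "CM (cG 1 1) (sG 3 1) = K3' (p_lam' P) 0 0" using law_cs[of 1 1] by (simp add: n2 KT' del: One_nat_def)
  show "CM cs (sG 3 1) = K3' (p_D' P) (p_E' P) (p_F' P)" using law_cs2[of 1 1] by (simp add: n2 KK_def CM_assoc del: One_nat_def)
  show "CM (cG 1 2) (sG 3 1) = K3' (p_d' P) (p_e' P) (p_f' P)" using law_cs1[of 1 1] by (simp add: n2 KK_def del: One_nat_def)
  show "CM (cG 1 1) (sG 3 2) = K3' 0 1 0" by (rule KT'(2)[symmetric])
  show "CM (cG 1 2) (sG 3 2) = K3' 0 0 (p_lam' P)" using law_cs[of 2 1] by (simp add: n2 KT' del: One_nat_def)
  have "CM cs (sG 3 2) = CM (cG 1 1) (CM (sG 3 2) (sG 3 2))" by (simp add: CM_assoc)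
  also have "CM (sG 3 2) (sG 3 2) = AD (AD (SC (p_a P) (ID 3)) (SC (p_b P) (sG 3 2))) (SC (p_c P) (CM (uG 1 2) (cG 1 2)))"
    using law_quad[of 2 3] by (simp add: numeral_2_eq_2[symmetric])
  also have "CM (cG 1 1) ... = AD (AD (SC (p_a P) (CM (cG 1 1) (ID 3))) (SC (p_b P) cs)) (SC (p_c P) (CM (CM (cG 1 1) (uG 1 2)) (cG 1 2)))"
    using tG TT_CM[of "uG 1 2" 1 3 "cG 1 2" 3] by (simp add: CM_AD_r[of _ _ 3 3] CM_assoc del: One_nat_def)
  also have "CM (cG 1 1) (uG 1 2) = SC (p_sig P) (ID 1)" using law_cu1[of 1 1] by (simp add: n2 del: One_nat_def)
  finally show "CM cs (sG 3 2) = K3' (p_a P) (p_b P) (p_c P * p_sig P)"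
    using tG by (simp add: CM_ID_l[of _ 3 1] CM_ID_r[of _ 3 1] KK_def del: One_nat_def)
qed

lemmas S1K = CM_KK[OF tG(3) tG(1) tsu(1) tG(2) Cl_G(2) TT_Cl[OF tsu(1)] Cl_G(2) S_tab(1) S_tab(2) S_tab(3)]
lemmas S2K = CM_KK[OF tG(4) tG(1) tsu(1) tG(2) Cl_G(2) TT_Cl[OF tsu(1)] Cl_G(2) S_tab(4) S_tab(5) S_tab(6)]
lemmas KS1 = KK_CM[OF tG(3) tG(5) tsu(2) tG(6) Cl_G(3) TT_Cl[OF tsu(2)] Cl_G(3) S_tab'(1) S_tab'(2) S_tab'(3)]
lemmas KS2 = KK_CM[OF tG(4) tG(5) tsu(2) tG(6) Cl_G(3) TT_Cl[OF tsu(2)] Cl_G(3) S_tab'(4) S_tab'(5) S_tab'(6)]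

lemma quad_u:
  assumes "w \<in> TT 1 3"
  shows "CM (sG 3 1) (CM (sG 3 1) w) = AD (AD (SC (p_a P) w) (SC (p_b P) (CM (sG 3 1) w))) (SC (p_c P) (CM (uG 1 1) (CM (cG 1 1) w)))"
proof -
  have "CM (sG 3 1) (CM (sG 3 1) w) = CM (CM (sG 3 1) (sG 3 1)) w" using assms by (simp add: CM_assoc)
  also have "CM (sG 3 1) (sG 3 1) = AD (AD (SC (p_a P) (ID 3)) (SC (p_b P) (sG 3 1))) (SC (p_c P) (CM (uG 1 1) (cG 1 1)))"
    using law_quad[of 1 3] by (simp add: numeral_2_eq_2[symmetric])
  finally show ?thesis using assms tG TT_CM[of "uG 1 1" 1 3 "cG 1 1" 3] by (simp add: CM_AD_l[of _ _ 3 3] CM_assoc CM_ID_l[of w 1 3] del: One_nat_def)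
qed

lemma quad_c:
  assumes "w \<in> TT 3 1"
  shows "CM (CM w (sG 3 1)) (sG 3 1) = AD (AD (SC (p_a P) w) (SC (p_b P) (CM w (sG 3 1)))) (SC (p_c P) (CM (CM w (uG 1 1)) (cG 1 1)))"
proof -
  have "CM (CM w (sG 3 1)) (sG 3 1) = CM w (CM (sG 3 1) (sG 3 1))" using assms by (simp add: CM_assoc)
  also have "CM (sG 3 1) (sG 3 1) = AD (AD (SC (p_a P) (ID 3)) (SC (p_b P) (sG 3 1))) (SC (p_c P) (CM (uG 1 1) (cG 1 1)))"
    using law_quad[of 1 3] by (simp add: numeral_2_eq_2[symmetric])
  finally show ?thesis using assms tG TT_CM[of "uG 1 1" 1 3 "cG 1 1" 3] by (simp add: CM_AD_r[of _ _ 3 3] CM_assoc CM_ID_r[of w 3 1] del: One_nat_def)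
qed

lemma cu_val: "CM (cG 1 1) (uG 1 1) = SC (p_del P) (ID 1)" "CM (cG 1 2) (uG 1 2) = SC (p_del P) (ID 1)"
  "CM (cG 1 1) (uG 1 2) = SC (p_sig P) (ID 1)" "CM (cG 1 2) (uG 1 1) = SC (p_sig' P) (ID 1)" "CM (cG 1 1) su = SC (p_rho P) (ID 1)"
  using law_cu[of 1 1] law_cu[of 2 1] law_cu1[of 1 1] law_c1u[of 1 1] law_csu[of 1 1] by (simp_all add: n2 del: One_nat_def)

lemma eqs_u:
  "p_lam P * p_lam P = p_a P + p_b P * p_lam P + p_c P * p_del P"
  "p_e P * p_E P + p_f P * p_e P = p_b P * p_e P" "p_e P * p_F P + p_f P * p_f P = p_a P + p_b P * p_f P"
  "p_lam P * p_E P = p_D P + p_E P * p_b P" "p_lam P * p_F P = p_E P * (p_c P * p_sig' P) + p_F P * p_lam P"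
proof -
  have "K3 (p_lam P * p_lam P) 0 0 = K3 (p_a P + p_b P * p_lam P + p_c P * p_del P) 0 0"
    using quad_u[OF tG(1)] tG unfolding S_tab(1) S1K cu_val by (simp add: KT(4-6)[unfolded One_nat_def] SC_plus CM_ID_r[of _ "Suc 0" 3])
  from K3_inj[OF this] show "p_lam P * p_lam P = p_a P + p_b P * p_lam P + p_c P * p_del P" by simp
  have "CM (sG 3 1) (CM (sG 3 1) (uG 1 2)) = AD (AD (SC (p_a P) (K3 0 0 1)) (SC (p_b P) (K3 (p_d P) (p_e P) (p_f P)))) (SC (p_c P) (K3 (p_sig P) 0 0))"
    using quad_u[OF tG(2)] tG unfolding S_tab(3) cu_val KT by (simp add: CM_ID_r[of _ "Suc 0" 3])
  then have "K3 (p_d P * p_lam P + p_e P * p_D P + p_f P * p_d P) (p_d P * 0 + p_e P * p_E P + p_f P * p_e P) (p_d P * 0 + p_e P * p_F P + p_f P * p_f P)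
    = K3 (p_a P * 0 + p_b P * p_d P + p_c P * p_sig P) (p_a P * 0 + p_b P * p_e P + p_c P * 0) (p_a P * 1 + p_b P * p_f P + p_c P * 0)"
    unfolding S_tab(3) S1K using tsu tG by (simp only: KK_lin Cl_G TT_Cl)
  from K3_inj[OF this] show "p_e P * p_E P + p_f P * p_e P = p_b P * p_e P" "p_e P * p_F P + p_f P * p_f P = p_a P + p_b P * p_f P"
    by simp_all
  have "CM (sG 3 1) (CM (sG 3 2) (CM (sG 3 1) (uG 1 1))) = CM (sG 3 2) (CM (sG 3 1) (CM (sG 3 2) (uG 1 1)))"
    using arg_cong[OF law_braid[of 1 3], of "\<lambda>X. CM X (uG 1 1)"] by (simp add: CM_assoc numeral_2_eq_2[symmetric])
  from K3_inj[OF this[unfolded S_tab(1) S_tab(2) S1K S2K]]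
  show "p_lam P * p_E P = p_D P + p_E P * p_b P" "p_lam P * p_F P = p_E P * (p_c P * p_sig' P) + p_F P * p_lam P" by simp_all
qed

lemma eqs_c:
  "p_e' P * p_E' P + p_f' P * p_e' P = p_b P * p_e' P" "p_e' P * p_F' P + p_f' P * p_f' P = p_a P + p_b P * p_f' P"
  "p_lam' P * p_E' P = p_D' P + p_E' P * p_b P"
  "(p_d' P + p_e' P * p_b P) * p_F' P + (p_e' P * (p_c P * p_sig P) + p_f' P * p_lam' P) * p_f' P = p_lam' P * (p_e' P * (p_c P * p_sig P) + p_f' P * p_lam' P)"
proof -
  have "CM (CM (cG 1 2) (sG 3 1)) (sG 3 1) = AD (AD (SC (p_a P) (K3' 0 0 1)) (SC (p_b P) (K3' (p_d' P) (p_e' P) (p_f' P)))) (SC (p_c P) (K3' (p_sig' P) 0 0))"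
    using quad_c[OF tG(6)] tG unfolding S_tab'(3) cu_val KT' by (simp add: CM_ID_l[of _ 3 "Suc 0"])
  then have "K3' (p_d' P * p_lam' P + p_e' P * p_D' P + p_f' P * p_d' P) (p_d' P * 0 + p_e' P * p_E' P + p_f' P * p_e' P) (p_d' P * 0 + p_e' P * p_F' P + p_f' P * p_f' P)
    = K3' (p_a P * 0 + p_b P * p_d' P + p_c P * p_sig' P) (p_a P * 0 + p_b P * p_e' P + p_c P * 0) (p_a P * 1 + p_b P * p_f' P + p_c P * 0)"
    unfolding S_tab'(3) KS1 using tsu tG by (simp only: KK_lin Cl_G TT_Cl)
  from K3'_inj[OF this] show "p_e' P * p_E' P + p_f' P * p_e' P = p_b P * p_e' P" "p_e' P * p_F' P + p_f' P * p_f' P = p_a P + p_b P * p_f' P"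
    by simp_all
  have br: "CM (CM (CM w (sG 3 1)) (sG 3 2)) (sG 3 1) = CM (CM (CM w (sG 3 2)) (sG 3 1)) (sG 3 2)" if "w \<in> TT 3 1" for w
    using arg_cong[OF law_braid[of 1 3], of "\<lambda>X. CM w X"] that by (simp add: CM_assoc numeral_2_eq_2[symmetric])
  from K3'_inj[OF br[OF tG(5), unfolded S_tab'(1) S_tab'(2) KS1 KS2]]
  show "p_lam' P * p_E' P = p_D' P + p_E' P * p_b P" by simp
  from K3'_inj[OF br[OF tG(6), unfolded S_tab'(3) S_tab'(6) KS1 KS2]]
  show "(p_d' P + p_e' P * p_b P) * p_F' P + (p_e' P * (p_c P * p_sig P) + p_f' P * p_lam' P) * p_f' P = p_lam' P * (p_e' P * (p_c P * p_sig P) + p_f' P * p_lam' P)"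
    by (simp add: algebra_simps)
qed

lemma CM_KK1:
  assumes "X \<in> TT n n'" "v1 \<in> TT m n" "v2 \<in> TT m n" "v3 \<in> TT m n" "w \<in> Cl"
    and "CM X v1 = SC a1 w" "CM X v2 = SC a2 w" "CM X v3 = SC a3 w"
  shows "CM X (KK v1 v2 v3 x y z) = SC (x * a1 + y * a2 + z * a3) w"
  unfolding KK_def using assms by (simp add: CM_AD_r[of X _ m n] SC_plus)

lemma KK1_CM:
  assumes "X \<in> TT m' m" "v1 \<in> TT m n" "v2 \<in> TT m n" "v3 \<in> TT m n" "w \<in> Cl"
    and "CM v1 X = SC a1 w" "CM v2 X = SC a2 w" "CM v3 X = SC a3 w"
  shows "CM (KK v1 v2 v3 x y z) X = SC (x * a1 + y * a2 + z * a3) w"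
  unfolding KK_def using assms by (simp add: CM_AD_l[of X _ m n] SC_plus)

lemma eqs_s:
  "p_lam' P * p_sig P = p_d P * p_del P + p_e P * p_rho P + p_f P * p_sig P"
  "p_d' P * p_sig P + p_e' P * (p_lam P * p_sig P) + p_f' P * p_del P = p_d P * p_sig' P + p_e P * (p_lam' P * p_sig' P) + p_f P * p_del P"
proof -
  note inj1 = stdv_indep1[OF idx(13) cl_std(13)]
  have c2su: "CM (cG 1 2) su = SC (p_lam' P * p_sig' P) (ID 1)"
  proof -
    have "CM (cG 1 2) su = CM (CM (cG 1 2) (sG 3 2)) (uG 1 1)" by (simp add: CM_assoc)
    then show ?thesis unfolding S_tab'(6) KT' using cu_val(4) by simp
  qed
  have csu2: "CM cs (uG 1 2) = SC (p_lam P * p_sig P) (ID 1)"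
  proof -
    have "CM cs (uG 1 2) = CM (cG 1 1) (CM (sG 3 2) (uG 1 2))" by (simp add: CM_assoc)
    then show ?thesis unfolding S_tab(6) KT using cu_val(3) by simp
  qed
  note L1 = CM_KK1[OF tG(5) tG(1) tsu(1) tG(2) cl_Cl cu_val(1) cu_val(5) cu_val(3)]
  note L2 = CM_KK1[OF tG(6) tG(1) tsu(1) tG(2) cl_Cl cu_val(4) c2su cu_val(2)]
  note R2 = KK1_CM[OF tG(2) tG(5) tsu(2) tG(6) cl_Cl cu_val(3) csu2 cu_val(2)]
  have "CM (CM (cG 1 1) (sG 3 1)) (uG 1 2) = CM (cG 1 1) (CM (sG 3 1) (uG 1 2))" by (simp add: CM_assoc)
  from inj1[OF this[unfolded S_tab'(1) S_tab(3) L1 R2]]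
  show "p_lam' P * p_sig P = p_d P * p_del P + p_e P * p_rho P + p_f P * p_sig P" by simp
  have "CM (CM (cG 1 2) (sG 3 1)) (uG 1 2) = CM (cG 1 2) (CM (sG 3 1) (uG 1 2))" by (simp add: CM_assoc)
  from inj1[OF this[unfolded S_tab'(3) S_tab(3) L2 R2]]
  show "p_d' P * p_sig P + p_e' P * (p_lam P * p_sig P) + p_f' P * p_del P = p_d P * p_sig' P + p_e P * (p_lam' P * p_sig' P) + p_f P * p_del P" .
qed

lemmas nn = n2 numeral_2_eq_2[symmetric] numeral_3_eq_3[symmetric]

lemma g_laws:
  "CM (cG 2 1) (uG 2 2) = SC (p_sig P) (ID 2)" "CM (cG 2 2) (uG 2 3) = SC (p_sig P) (ID 2)"
  "CM (cG 2 3) (uG 2 2) = SC (p_sig' P) (ID 2)"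
  "CM (cG 0 1) (cG 2 3) = SC eps (CM (cG 0 1) (cG 2 1))" "CM (uG 2 3) (uG 0 1) = SC eps (CM (uG 2 1) (uG 0 1))"
  "CM (cG 2 1) (uG 2 3) = SC eps (CM (uG 0 1) (cG 0 1))"
  "CM (sG 4 1) (uG 2 3) = CM (uG 2 3) (sG 2 1)" "CM (cG 2 1) (sG 4 3) = CM (sG 2 1) (cG 2 1)"
  "CM (sG 4 1) (sG 4 3) = CM (sG 4 3) (sG 4 1)" "CM (sG 2 1) (uG 0 1) = SC (p_lam P) (uG 0 1)" "CM (sG 4 3) (uG 2 3) = SC (p_lam P) (uG 2 3)"
  using law_cu1[of 1 2] law_cu1[of 2 2] law_c1u[of 2 2] law_cc[of 1 1 0] law_uu[of 1 1 0] law_cu_far1[of 1 1 0] law_su_lo[of 1 3 2]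
    law_cs_hi[of 1 1 2] law_ss[of 1 3 4] law_su[of 1 0] law_su[of 3 2]
  by (simp_all add: nn)

lemma eq_z: "p_sig P = eps * p_sig' P"
proof -
  have "SC (p_sig P) (cG 0 1) = CM (CM (cG 0 1) (cG 2 1)) (uG 2 2)" using g_laws(1) tG by (simp add: CM_assoc CM_ID_r[of _ 2 0])
  also have "CM (cG 0 1) (cG 2 1) = SC eps (CM (cG 0 1) (cG 2 3))" unfolding g_laws(4) by simp
  also have "CM ... (uG 2 2) = SC (eps * p_sig' P) (cG 0 1)" using g_laws(3) tG by (simp add: CM_assoc CM_ID_r[of _ 2 0])
  finally show ?thesis by (rule stdv_indep1[OF idx(14) cl_std(14)])
qed

lemma u_laws:
  assumes "p_f P = 0"
  shows "CM (sG 4 1) (uG 2 2) = AD (SC (p_d P) (uG 2 1)) (SC (p_e P) (CM (sG 4 2) (uG 2 1)))"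
    "CM (sG 4 2) (uG 2 3) = AD (SC (p_d P) (uG 2 2)) (SC (p_e P) (CM (sG 4 3) (uG 2 2)))"
proof -
  have t: "CM (sG 4 2) (uG 2 1) \<in> TT 2 4" "CM (sG 4 3) (uG 2 2) \<in> TT 2 4" using tG by auto
  show "CM (sG 4 1) (uG 2 2) = AD (SC (p_d P) (uG 2 1)) (SC (p_e P) (CM (sG 4 2) (uG 2 1)))"
    using law_su1[of 1 2, unfolded n2] t tG assms by (simp add: nn SC_0[of _ 2 4] AD_ZE[of _ 2 4])
  show "CM (sG 4 2) (uG 2 3) = AD (SC (p_d P) (uG 2 2)) (SC (p_e P) (CM (sG 4 3) (uG 2 2)))"
    using law_su1[of 2 2, unfolded n2] t tG assms by (simp add: nn SC_0[of _ 2 4] AD_ZE[of _ 2 4])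
qed

lemma eqs_22:
  assumes f: "p_f P = 0" and s: "p_sig P \<noteq> 0"
  shows "p_d' P = 0" "p_e' P * p_e P = 1" "p_e' P * p_d P + p_f' P = 0"
proof -
  let ?v1 = "ID 2 :: 'k expr set" and ?v2 = "sG 2 1" and ?v3 = "CM (uG 0 1) (cG 0 1)"
  have t: "?v1 \<in> TT 2 2" "?v2 \<in> TT 2 2" "?v3 \<in> TT 2 2" using tG by auto
  note Ki = stdv_indep[OF idx(10) idx(11) idx(12) _ _ _ cl_std(10) cl_std(11) cl_std(12)]
  have L: "CM (cG 2 1) (CM (sG 4 2) (uG 2 3)) = AD (SC (p_d P * p_sig P) ?v1) (SC (p_e P * p_sig P) ?v2)"
  proof -
    have "CM (cG 2 1) (CM (sG 4 3) (uG 2 2)) = CM (CM (cG 2 1) (sG 4 3)) (uG 2 2)" by (simp add: CM_assoc)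
    also have "... = SC (p_sig P) ?v2" unfolding g_laws(8) using g_laws(1) tG by (simp add: CM_assoc CM_ID_r[of _ 2 2])
    finally have e: "CM (cG 2 1) (CM (sG 4 3) (uG 2 2)) = SC (p_sig P) ?v2" .
    have "CM (sG 4 3) (uG 2 2) \<in> TT 2 4" using tG by auto
    then show ?thesis unfolding u_laws(2)[OF f] using tG e g_laws(1) by (simp add: CM_AD_r[of _ _ 2 4])
  qed
  have "CM (CM (cG 2 2) (sG 4 1)) (uG 2 3) = CM (cG 2 2) (CM (sG 4 1) (uG 2 3))" by (simp add: CM_assoc)
  also have "... = CM (CM (cG 2 2) (uG 2 3)) ?v2" unfolding g_laws(7) by (simp add: CM_assoc)
  also have "... = SC (p_sig P) ?v2" unfolding g_laws(2) using tG by (simp add: CM_ID_l[of _ 2 2])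
  also have "... = KK ?v1 ?v2 ?v3 0 (p_sig P) 0" by (rule KK_sc(2)[OF t, symmetric])
  finally have 1: "CM (CM (cG 2 2) (sG 4 1)) (uG 2 3) = ..." .
  have tc: "CM (cG 2 1) (sG 4 2) \<in> TT 4 2" using tG by auto
  have "CM (cG 2 2) (sG 4 1) = AD (AD (SC (p_d' P) (cG 2 1)) (SC (p_e' P) (CM (cG 2 1) (sG 4 2)))) (SC (p_f' P) (cG 2 2))"
    using law_cs1[of 1 2] by (simp add: nn)
  then have "CM (CM (cG 2 2) (sG 4 1)) (uG 2 3) = AD (AD (SC (p_d' P) (CM (cG 2 1) (uG 2 3))) (SC (p_e' P) (CM (cG 2 1) (CM (sG 4 2) (uG 2 3))))) (SC (p_f' P) (CM (cG 2 2) (uG 2 3)))"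
    using tc tG by (simp add: CM_AD_l[of _ _ 4 2] CM_assoc)
  also have "... = KK ?v1 ?v2 ?v3 (p_e' P * (p_d P * p_sig P) + p_f' P * p_sig P) (p_e' P * (p_e P * p_sig P)) (p_d' P * eps)"
    unfolding L g_laws KK_def using t by (simp add: SC_plus AD_ac)
  finally have "KK ?v1 ?v2 ?v3 0 (p_sig P) 0 = ..." unfolding 1 .
  from Ki[OF _ _ _ this] have q: "0 = p_e' P * (p_d P * p_sig P) + p_f' P * p_sig P" "p_sig P = p_e' P * (p_e P * p_sig P)" "0 = p_d' P * eps"
    by simp_all
  have e0: "eps \<noteq> 0" by (simp add: psign_def)
  show "p_d' P = 0" using q(3) e0 by simp
  have "(p_e' P * p_e P) * p_sig P = 1 * p_sig P" using q(2) by (simp add: algebra_simps)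
  then show "p_e' P * p_e P = 1" using s by (simp only: mult_cancel_right) simp
  have "(p_e' P * p_d P + p_f' P) * p_sig P = 0" using q(1) by (simp add: algebra_simps)
  then show "p_e' P * p_d P + p_f' P = 0" using s by (simp only: mult_eq_0_iff) simp
qed

lemma eq_04:
  assumes f: "p_f P = 0"
  shows "2 * (p_e P * p_e P * p_e P * p_d P) + p_e P * p_e P * p_e P * p_e P * p_b P = p_b P * (eps * (p_e P * p_e P))"
proof -
  define x1 where "x1 = CM (uG 2 3) (uG 0 1)"
  define x2 where "x2 = CM (uG 2 2) (uG 0 1)"
  define x3 where "x3 = CM (sG 4 3) x2"
  let ?K = "KK x1 x2 x3"
  have t: "x1 \<in> TT 0 4" "x2 \<in> TT 0 4" "x3 \<in> TT 0 4" unfolding x3_def x1_def x2_def using tG by (meson TT_CM)+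
  note tc = t[THEN TT_Cl]
  have ui: "x = x' \<and> y = y' \<and> z = z'" if "?K x y z = ?K x' y' z'" for x y z x' y' z'
    using that unfolding x3_def x1_def x2_def
    by (rule stdv_indep[OF idx(7) idx(8) idx(9) _ _ _ cl_std(7) cl_std(8) cl_std(9), rotated 3]) simp_all
  have u1: "CM (uG 2 1) (uG 0 1) = SC eps x1" unfolding x1_def g_laws(5) by simp
  have tt: "CM (sG 4 2) (uG 2 1) \<in> TT 2 4" "CM (sG 4 3) (uG 2 2) \<in> TT 2 4" using tG by auto
  have s2x1: "CM (sG 4 2) x1 = ?K 0 (p_d P) (p_e P)"
  proof -
    have "CM (sG 4 2) x1 = CM (CM (sG 4 2) (uG 2 3)) (uG 0 1)" unfolding x1_def by (simp add: CM_assoc)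
    also have "... = AD (SC (p_d P) x2) (SC (p_e P) x3)"
      unfolding u_laws(2)[OF f] x2_def x3_def using tt tG by (simp add: CM_AD_l[of _ _ 2 4] CM_assoc)
    also have "... = ?K 0 (p_d P) (p_e P)" unfolding KK_def using t by (simp add: SC_0[of _ 0 4] AD_comm[of "ZE 0 4"])
    finally show ?thesis .
  qed
  have A1: "CM (sG 4 1) x1 = ?K (p_lam P) 0 0"
  proof -
    have "CM (sG 4 1) x1 = CM (CM (sG 4 1) (uG 2 3)) (uG 0 1)" unfolding x1_def by (simp add: CM_assoc)
    also have "... = SC (p_lam P) x1" unfolding g_laws(7) x1_def using g_laws(10) by (simp add: CM_assoc)
    finally show ?thesis using t by (simp add: KK_sc)
  qed
  have A2: "CM (sG 4 1) x2 = ?K (eps * p_d P) (eps * p_e P * p_d P) (eps * p_e P * p_e P)"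
  proof -
    have "CM (sG 4 1) x2 = CM (CM (sG 4 1) (uG 2 2)) (uG 0 1)" unfolding x2_def by (simp add: CM_assoc)
    also have "... = AD (SC (p_d P) (SC eps x1)) (SC (p_e P) (CM (sG 4 2) (SC eps x1)))"
      unfolding u_laws(1)[OF f] u1[symmetric] using tt tG by (simp add: CM_AD_l[of _ _ 2 4] CM_assoc)
    also have "... = AD (SC (p_d P * eps) x1) (SC (p_e P * eps) (?K 0 (p_d P) (p_e P)))" using tc s2x1 KK_TT[OF t, THEN TT_Cl] by simp
    also have "SC (p_d P * eps) x1 = ?K (p_d P * eps) 0 0" using t by (simp add: KK_sc)
    finally show ?thesis using tc by (simp add: KK_lin mult_ac)
  qed
  have B1: "CM (sG 4 3) x1 = ?K (p_lam P) 0 0"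
  proof -
    have "CM (sG 4 3) x1 = CM (CM (sG 4 3) (uG 2 3)) (uG 0 1)" unfolding x1_def by (simp add: CM_assoc)
    also have "... = SC (p_lam P) x1" unfolding g_laws(11) x1_def by simp
    finally show ?thesis using t by (simp add: KK_sc)
  qed
  have B2: "CM (sG 4 3) x2 = ?K 0 0 1" using t by (simp add: KK_unit x3_def[symmetric])
  have q: "CM (sG 4 i) (CM (sG 4 i) x2) = AD (AD (SC (p_a P) x2) (SC (p_b P) (CM (sG 4 i) x2))) (SC (p_c P) (CM (uG 2 i) (CM (CM (cG 2 i) (uG 2 2)) (uG 0 1))))"
    if i: "i = 1 \<or> i = 3" for i
  proof -
    have ti: "sG 4 i \<in> TT 4 4" "uG 2 i \<in> TT 2 4" "cG 2 i \<in> TT 4 2" using i tG by auto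
    then have tuc: "CM (uG 2 i) (cG 2 i) \<in> TT 4 4" by auto
    have "CM (sG 4 i) (sG 4 i) = AD (AD (SC (p_a P) (ID 4)) (SC (p_b P) (sG 4 i))) (SC (p_c P) (CM (uG 2 i) (cG 2 i)))"
      using law_quad[of i 4] i by (auto simp add: nn)
    then have "CM (CM (sG 4 i) (sG 4 i)) x2 = AD (AD (SC (p_a P) x2) (SC (p_b P) (CM (sG 4 i) x2))) (SC (p_c P) (CM (CM (uG 2 i) (cG 2 i)) x2))"
      using ti tuc t by (simp add: CM_AD_l[of _ _ 4 4] CM_ID_l[of _ 0 4])
    then show ?thesis using tc unfolding x2_def by (simp add: CM_assoc)
  qed
  have B3: "CM (sG 4 3) x3 = ?K (p_c P * p_sig' P) (p_a P) (p_b P)"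
  proof -
    have "CM (sG 4 3) x3 = AD (AD (SC (p_a P) x2) (SC (p_b P) x3)) (SC (p_c P) (CM (uG 2 3) (CM (CM (cG 2 3) (uG 2 2)) (uG 0 1))))"
      using q[of 3] unfolding x3_def by simp
    also have "CM (uG 2 3) (CM (CM (cG 2 3) (uG 2 2)) (uG 0 1)) = SC (p_sig' P) x1"
      unfolding g_laws(3) x1_def using tG by (simp add: CM_ID_l[of _ 0 2])
    finally show ?thesis unfolding KK_def using tc by (simp add: AD_ac)
  qed
  have A3: "CM (sG 4 1) x3 = CM (sG 4 3) (CM (sG 4 1) x2)"
  proof -
    have "CM (sG 4 1) x3 = CM (CM (sG 4 1) (sG 4 3)) x2" unfolding x3_def using tc by (simp add: CM_assoc)
    then show ?thesis unfolding g_laws(9) using tc by (simp add: CM_assoc)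
  qed
  note A3' = A3[unfolded A2 CM_KK[OF tG(13) t tc B1 B2 B3]]
  have "CM (sG 4 1) (CM (sG 4 1) x2) = AD (AD (SC (p_a P) x2) (SC (p_b P) (CM (sG 4 1) x2))) (SC (p_c P) (CM (uG 2 1) (CM (CM (cG 2 1) (uG 2 2)) (uG 0 1))))"
    using q[of 1] by simp
  also have "CM (uG 2 1) (CM (CM (cG 2 1) (uG 2 2)) (uG 0 1)) = SC (p_sig P * eps) x1"
    unfolding g_laws(1) using tG u1 tc by (simp add: CM_ID_l[of _ 0 2])
  also have "SC (p_a P) x2 = ?K 0 (p_a P) 0" using t by (simp add: KK_sc)
  also have "SC (p_sig P * eps) x1 = ?K (p_sig P * eps) 0 0" using t by (simp add: KK_sc)
  finally have z: "CM (sG 4 1) (CM (sG 4 1) x2) = AD (AD (?K 0 (p_a P) 0) (SC (p_b P) (CM (sG 4 1) x2))) (SC (p_c P) (?K (p_sig P * eps) 0 0))" .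
  note z2 = z[unfolded A2 CM_KK[OF tG(11) t tc A1 A2 A3'] KK_lin[OF tc]]
  from ui[OF z2] have "eps * p_d P * 0 + eps * p_e P * p_d P * (eps * p_e P * p_e P) + eps * p_e P * p_e P * (eps * p_d P * 0 + eps * p_e P * p_d P * 1 + eps * p_e P * p_e P * p_b P)
    = 0 + p_b P * (eps * p_e P * p_e P) + p_c P * 0" by blast
  moreover have "eps * p_d P * 0 + eps * p_e P * p_d P * (eps * p_e P * p_e P) + eps * p_e P * p_e P * (eps * p_d P * 0 + eps * p_e P * p_d P * 1 + eps * p_e P * p_e P * p_b P)
    = (eps * eps) * (2 * (p_e P * p_e P * p_e P * p_d P) + p_e P * p_e P * p_e P * p_e P * p_b P)" by (simp add: algebra_simps del: eps_sq)
  ultimately show ?thesis by (simp add: mult.assoc)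
qed

end

lemma param_algebra:
  fixes lam lam' del sig sig' rho a b c d e D E F d' e' f' D' E' F' eps :: "'k::field"
  assumes eps: "eps * eps = 1" and b: "b \<noteq> 0" and sig: "sig \<noteq> 0"
    and u: "lam * lam = a + b * lam + c * del" "e * E = b * e" "e * F = a" "lam * E = D + E * b" "lam * F = E * (c * sig') + F * lam"
    and c: "e' * E' + b * e' = b * e'" "e' * F' + b * b = a + b * b" "lam' * E' = D' + E' * b"
      "(d' + e' * b) * F' + (e' * (c * sig) + b * lam') * b = lam' * (e' * (c * sig) + b * lam')"
    and s: "lam' * sig = d * del + e * rho" "d' * sig + e' * (lam * sig) + b * del = d * sig' + e * (lam' * sig')"
    and z: "sig = eps * sig'" and h: "d' = 0" "e' * e = 1" "e' * d + b = 0"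
    and q: "2 * (e * e * e * d) + e * e * e * e * b = b * (eps * (e * e))"
  shows "(lam' = lam \<or> lam' = b - lam) \<and> e^2 = - eps \<and> a = lam^2 - b * lam \<and> c = 0 \<and> sig' = eps * sig \<and>
    rho = eps * e * sig * (lam - b) \<and> del = eps * e * sig * (lam + lam' - b) / b \<and> e' = - eps * e \<and> d = - e * b \<and>
    D = (lam - b) * b \<and> E = b \<and> D' = 0 \<and> E' = 0 \<and> F = - eps * e * a \<and> F' = e * a"
proof -
  have e0: "e \<noteq> 0" "e' \<noteq> 0" using h(2) by auto
  have ep0: "eps \<noteq> 0" using eps by auto
  have sig': "sig' = eps * sig" unfolding z mult.assoc[symmetric] eps by simp
  have E: "E = b" using u(2) e0 by (simp add: mult.commute)
  have E': "E' = 0" using c(1) e0 by simp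
  have D': "D' = 0" using c(3) E' by simp
  have c0: "c = 0" using u(5) E b sig sig' ep0 by (simp add: mult.commute)
  have D: "D = (lam - b) * b" using u(4) E by (simp add: algebra_simps)
  have a: "a = lam^2 - b * lam" using u(1) c0 by (simp add: power2_eq_square algebra_simps)
  have "e * (e' * d + b) = d + e * b" using h(2) by (simp add: algebra_simps)
  then have d: "d = - e * b" using h(3) by (simp add: eq_neg_iff_add_eq_0)
  have "e * e * b * (e * e + eps) = 0" proof -
    have "e * e * b * (e * e + eps) = b * (eps * (e * e)) - (2 * (e * e * e * (- e * b)) + e * e * e * e * b)" by (simp add: algebra_simps)
    then show ?thesis unfolding q[unfolded d, symmetric] by simp
  qed
  then have "e * e + eps = 0" using e0 b by simp
  then have e2: "e * e = - eps" by (simp add: eq_neg_iff_add_eq_0)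
  have "e' = e' * (- eps * (e * e))" using e2 eps by simp
  also have "... = - eps * e * (e' * e)" by (simp add: mult_ac)
  finally have e': "e' = - eps * e" using h(2) by simp
  have "F = - eps * (e * e) * F" using e2 eps by simp
  also have "... = - eps * e * (e * F)" by (simp add: mult_ac)
  finally have F: "F = - eps * e * a" using u(3) by simp
  have F'a: "e' * F' = a" using c(2) by simp
  have "F' = e' * e * F'" using h(2) by simp
  also have "... = e * (e' * F')" by (simp add: mult_ac)
  finally have F': "F' = e * a" using F'a by simp
  have "b * (a + b * lam' - lam' * lam') = 0"
    using c(4) c0 h(1) F'a[symmetric] by (simp add: algebra_simps)
  then have "a + b * lam' = lam' * lam'" using b by simp
  then have "(lam' - lam) * (lam' - (b - lam)) = 0" unfolding a by (simp add: power2_eq_square algebra_simps)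
  then have lam': "lam' = lam \<or> lam' = b - lam" by simp
  have dl: "b * del = eps * e * sig * (lam + lam' - b)"
    using s(2) unfolding h(1) e' d sig' by (simp add: algebra_simps)
  then have del: "del = eps * e * sig * (lam + lam' - b) / b" using b by (simp add: field_simps)
  have "e * rho = lam' * sig + e * (b * del)" using s(1) d by (simp add: algebra_simps)
  also have "... = lam' * sig + eps * (e * e) * sig * (lam + lam' - b)" unfolding dl by (simp add: algebra_simps)
  also have "... = sig * (b - lam)" unfolding e2 using eps by (simp add: algebra_simps mult.assoc[symmetric])
  finally have er: "e * rho = sig * (b - lam)" .
  have "rho = - eps * (e * e) * rho" using e2 eps by simp
  also have "... = - eps * e * (e * rho)" by (simp add: mult_ac)
  finally have rho: "rho = eps * e * sig * (lam - b)" unfolding er by (simp add: algebra_simps)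
  show ?thesis using lam' e2 a c0 sig' rho del e' d D E D' E' F F' by (simp add: power2_eq_square)
qed

context pres
begin

lemma CM_ZE_r: "X \<in> TT m n ==> CM X (ZE l m) = ZE l n"
proof -
  assume X: "X \<in> TT m n"
  have z: "SC 0 (ZE l m) = ZE l m" by (rule SC_0) simp
  have "CM X (SC 0 (ZE l m)) = SC 0 (CM X (ZE l m))" using X by simp
  also have "... = ZE l n" by (rule SC_0) (rule TT_CM[OF X], simp)
  finally show ?thesis unfolding z .
qed

lemma CM_ZE_l: "X \<in> TT l m ==> CM (ZE m n) X = ZE l n"
proof -
  assume X: "X \<in> TT l m"
  have z: "SC 0 (ZE m n) = ZE m n" by (rule SC_0) simp
  have "CM (SC 0 (ZE m n)) X = SC 0 (CM (ZE m n) X)" using X by simp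
  also have "... = ZE l n" by (rule SC_0) (rule TT_CM[OF _ X], simp)
  finally show ?thesis unfolding z .
qed

lemma TN_ZE_r: "X \<in> TT m n ==> TN X (ZE m' n') = ZE (m + m') (n + n')"
proof -
  assume X: "X \<in> TT m n"
  have z: "SC 0 (ZE m' n') = ZE m' n'" by (rule SC_0) simp
  have "TN X (SC 0 (ZE m' n')) = SC 0 (TN X (ZE m' n'))" using X by simp
  also have "... = ZE (m + m') (n + n')" by (rule SC_0) (rule TT_TN[OF X], simp)
  finally show ?thesis unfolding z .
qed

lemma TN_ZE_l: "X \<in> TT m n ==> TN (ZE m' n') X = ZE (m' + m) (n' + n)"
proof -
  assume X: "X \<in> TT m n"
  have z: "SC 0 (ZE m' n') = ZE m' n'" by (rule SC_0) simp
  have "TN (SC 0 (ZE m' n')) X = SC 0 (TN (ZE m' n') X)" using X by simp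
  also have "... = ZE (m' + m) (n' + n)" by (rule SC_0) (rule TT_TN[OF _ X], simp)
  finally show ?thesis unfolding z .
qed

lemma off_degree:
  "wf_expr t ==> (homog p t q --> q \<noteq> dg (src t) (tgt t) --> cl t = ZE (src t) (tgt t)) \<and>
    (odd (src t + tgt t) --> cl t = ZE (src t) (tgt t))"
proof (induction t arbitrary: q)
  case (Add s t)
  have wf: "wf_expr s" "wf_expr t" "src s = src t" "tgt s = tgt t" using Add.prems by simp_all
  have z: "AD (ZE (src s) (tgt s)) (ZE (src s) (tgt s)) = ZE (src s) (tgt s)" by (rule AD_ZE) simp
  have zz: "cl (s +\<^sub>e t) = ZE (src s) (tgt s)" if "cl s = ZE (src s) (tgt s)" "cl t = ZE (src t) (tgt t)"
    unfolding cl_add[symmetric] that wf(3,4)[symmetric] by (rule z)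
  show ?case
  proof (intro conjI impI)
    assume h: "homog p (s +\<^sub>e t) q" "q \<noteq> dg (src (s +\<^sub>e t)) (tgt (s +\<^sub>e t))"
    then have "homog p s q" "homog p t q" "q \<noteq> dg (src s) (tgt s)" "q \<noteq> dg (src t) (tgt t)" using wf by simp_all
    note h' = this
    show "cl (s +\<^sub>e t) = ZE (src (s +\<^sub>e t)) (tgt (s +\<^sub>e t))" unfolding src.simps tgt.simps
      by (rule zz[OF Add.IH(1)[OF wf(1), THEN conjunct1, rule_format, OF h'(1,3)] Add.IH(2)[OF wf(2), THEN conjunct1, rule_format, OF h'(2,4)]])
  next
    assume "odd (src (s +\<^sub>e t) + tgt (s +\<^sub>e t))"
    then have "odd (src s + tgt s)" "odd (src t + tgt t)" using wf by simp_all
    note h' = this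
    show "cl (s +\<^sub>e t) = ZE (src (s +\<^sub>e t)) (tgt (s +\<^sub>e t))" unfolding src.simps tgt.simps
      by (rule zz[OF Add.IH(1)[OF wf(1), THEN conjunct2, rule_format, OF h'(1)] Add.IH(2)[OF wf(2), THEN conjunct2, rule_format, OF h'(2)]])
  qed
next
  case (Scale c t)
  have "SC c (ZE (src t) (tgt t)) = ZE (src t) (tgt t)"
  proof -
    have "SC c (SC 0 (ZE (src t) (tgt t))) = SC 0 (ZE (src t) (tgt t))" by simp
    then show ?thesis unfolding SC_0[OF TT_ZE] .
  qed
  then have zz: "cl (c *\<^sub>e t) = ZE (src t) (tgt t)" if "cl t = ZE (src t) (tgt t)" unfolding cl_scale[symmetric] that .
  show ?case
    using Scale.IH[of q] Scale.prems zz unfolding homog.simps src.simps tgt.simps wf_expr.simps by blast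
next
  case (Comp s t)
  have wf: "wf_expr s" "wf_expr t" "src s = tgt t" using Comp.prems by auto
  have c: "cl (s \<circ>\<^sub>e t) = CM (cl s) (cl t)" by (simp add: cl_comp)
  have m: "cl s \<in> TT (src s) (tgt s)" "cl t \<in> TT (src t) (tgt t)" by (intro cl_TT wf)+
  have zz: "cl (s \<circ>\<^sub>e t) = ZE (src t) (tgt s)" if "cl s = ZE (src s) (tgt s) \<or> cl t = ZE (src t) (tgt t)"
    using that CM_ZE_r[OF m(1), of "src t"] CM_ZE_l[OF m(2), of "tgt s"] unfolding c wf(3) by (elim disjE) simp_all
  have o: "cl (s \<circ>\<^sub>e t) = ZE (src t) (tgt s)" if "odd (src s + tgt s) \<or> odd (src t + tgt t)"
    using that Comp.IH(1)[OF wf(1), THEN conjunct2] Comp.IH(2)[OF wf(2), THEN conjunct2] by (intro zz) blast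
  show ?case
  proof (intro conjI impI)
    assume h: "homog p (s \<circ>\<^sub>e t) q" "q \<noteq> dg (src (s \<circ>\<^sub>e t)) (tgt (s \<circ>\<^sub>e t))"
    show "cl (s \<circ>\<^sub>e t) = ZE (src (s \<circ>\<^sub>e t)) (tgt (s \<circ>\<^sub>e t))"
    proof (cases "odd (src s + tgt s) \<or> odd (src t + tgt t)")
      case False
      obtain q1 q2 where q: "q = q1 + q2" "homog p s q1" "homog p t q2" using h(1) by auto
      have "dg (src t) (tgt s) = dg (src s) (tgt s) + dg (src t) (tgt t)"
        using False dg_add[of "src t" "src s" "tgt s"] wf by simp
      then have "q1 \<noteq> dg (src s) (tgt s) \<or> q2 \<noteq> dg (src t) (tgt t)" using h(2) q(1) by auto
      then show ?thesis using Comp.IH(1)[of q1] Comp.IH(2)[of q2] q wf(1,2) zz unfolding src.simps tgt.simps by blast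
    qed (use o in simp)
  next
    assume "odd (src (s \<circ>\<^sub>e t) + tgt (s \<circ>\<^sub>e t))"
    then have "odd (src s + tgt s) \<or> odd (src t + tgt t)" using wf by simp presburger
    then show "cl (s \<circ>\<^sub>e t) = ZE (src (s \<circ>\<^sub>e t)) (tgt (s \<circ>\<^sub>e t))" using o by simp
  qed
next
  case (Tens s t)
  have wf: "wf_expr s" "wf_expr t" using Tens.prems by auto
  have c: "cl (s \<otimes>\<^sub>e t) = TN (cl s) (cl t)" by (simp add: cl_tens)
  have m: "cl s \<in> TT (src s) (tgt s)" "cl t \<in> TT (src t) (tgt t)" by (intro cl_TT wf)+
  have zz: "cl (s \<otimes>\<^sub>e t) = ZE (src s + src t) (tgt s + tgt t)" if "cl s = ZE (src s) (tgt s) \<or> cl t = ZE (src t) (tgt t)"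
    using that TN_ZE_r[OF m(1), of "src t" "tgt t"] TN_ZE_l[OF m(2), of "src s" "tgt s"] unfolding c by (elim disjE) simp_all
  have o: "cl (s \<otimes>\<^sub>e t) = ZE (src s + src t) (tgt s + tgt t)" if "odd (src s + tgt s) \<or> odd (src t + tgt t)"
    using that Tens.IH(1)[OF wf(1), THEN conjunct2] Tens.IH(2)[OF wf(2), THEN conjunct2] by (intro zz) blast
  show ?case
  proof (intro conjI impI)
    assume h: "homog p (s \<otimes>\<^sub>e t) q" "q \<noteq> dg (src (s \<otimes>\<^sub>e t)) (tgt (s \<otimes>\<^sub>e t))"
    show "cl (s \<otimes>\<^sub>e t) = ZE (src (s \<otimes>\<^sub>e t)) (tgt (s \<otimes>\<^sub>e t))"
    proof (cases "odd (src s + tgt s) \<or> odd (src t + tgt t)")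
      case False
      obtain q1 q2 where q: "q = q1 + q2" "homog p s q1" "homog p t q2" using h(1) by auto
      have "dg (src s + src t) (tgt s + tgt t) = dg (src s) (tgt s) + dg (src t) (tgt t)"
        using False dg_tens[of "src s" "tgt s" "src t" "tgt t"] by simp
      then have "q1 \<noteq> dg (src s) (tgt s) \<or> q2 \<noteq> dg (src t) (tgt t)" using h(2) q(1) by auto
      then show ?thesis using Tens.IH(1)[of q1] Tens.IH(2)[of q2] q wf(1,2) zz unfolding src.simps tgt.simps by blast
    qed (use o in simp)
  next
    assume "odd (src (s \<otimes>\<^sub>e t) + tgt (s \<otimes>\<^sub>e t))"
    then have "odd (src s + tgt s) \<or> odd (src t + tgt t)" by simp presburger
    then show "cl (s \<otimes>\<^sub>e t) = ZE (src (s \<otimes>\<^sub>e t)) (tgt (s \<otimes>\<^sub>e t))" using o by simp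
  qed
qed (auto simp: dg_def)

lemma TT_graded: "\<exists>d. TH m n d = TT m n \<and> TH m n (1 + d) = {ZE m n}"
proof -
  define d where "d = dg m n"
  have zero: "ZE m n \<in> TH m n q" for q by (rule cl_THI) simp_all
  have "X \<in> TH m n d" if "X \<in> TT m n" for X
    using that
  proof (rule TTE)
    fix t assume t: "X = cl t" "wf_expr t" "src t = m" "tgt t = n"
    then have "homog p t d" using homog_ex_aux[of t] unfolding d_def by blast
    with t show ?thesis by (auto intro: cl_THI)
  qed
  note 1 = this
  have "X = ZE m n" if "X \<in> TH m n (1 + d)" for X
    using that
  proof (rule THE')
    fix t assume t: "X = cl t" "wf_expr t" "src t = m" "tgt t = n" "homog p t (1 + d)"
    have "1 + d \<noteq> d" by (cases d) auto
    with t show ?thesis using off_degree[of t "1 + d"] unfolding d_def by blast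
  qed
  note 2 = this
  have "TH m n d = TT m n" "TH m n (1 + d) = {ZE m n}"
    by (intro equalityI subsetI, erule TH_TT, erule 1, intro equalityI subsetI, drule 2, simp, simp add: zero)
  then show ?thesis by blast
qed

lemma TT_direct_sum: "bij_betw (\<lambda>(x, y). AD x y) (TH m n 0 \<times> TH m n 1) (TT m n)"
proof -
  obtain d where d: "TH m n d = TT m n" "TH m n (1 + d) = {ZE m n}" using TT_graded by blast
  have z: "AD (ZE m n) x = x" if "x \<in> TT m n" for x using that AD_comm[of "ZE m n" x] by simp
  show ?thesis
  proof (cases d)
    case zero
    then show ?thesis using d by (intro bij_betwI[where g = "\<lambda>x. (x, ZE m n)"]) auto
  next
    case one
    then show ?thesis using d z by (intro bij_betwI[where g = "\<lambda>x. (ZE m n, x)"]) auto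
  qed
qed

lemma presented_simps [simp]:
  "carrier (hom (presented p R) m n) = TT m n" "add (hom (presented p R) m n) = AD" "smult (hom (presented p R) m n) = SC"
  "zero (hom (presented p R) m n) = ZE m n" "hdeg (presented p R) = TH" "idm (presented p R) n = ID n"
  "cmp (presented p R) l m n = CM" "tns (presented p R) m n m' n' = TN"
  by (simp_all add: presented_def TT_def TH_def AD_def SC_def CM_def TN_def fun_eq_iff)

lemma TH_AD: "X \<in> TH m n q ==> Y \<in> TH m n q ==> AD X Y \<in> TH m n q"
  by (elim THE', hypsubst) (simp add: cl_add cl_THI)
lemma TH_SC: "X \<in> TH m n q ==> SC c X \<in> TH m n q"
  by (elim THE', hypsubst) (simp add: cl_scale cl_THI)

lemma presented_module: "module class_ring (hom (presented p R) m n)"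
proof (rule module_criteria)
  show "cring (class_ring :: 'k ring)" using class_field field.axioms(1) domain.axioms(1) by blast
  show "\<forall>v\<in>carrier (hom (presented p R) m n). \<exists>neg_v\<in>carrier (hom (presented p R) m n).
      v \<oplus>\<^bsub>hom (presented p R) m n\<^esub> neg_v = \<zero>\<^bsub>hom (presented p R) m n\<^esub>"
  proof
    fix v assume "v \<in> carrier (hom (presented p R) m n)"
    then have v: "v \<in> TT m n" by simp
    then have "AD v (SC (-1) v) = SC 0 v" using SC_plus[of v 1 "-1"] by simp
    with v show "\<exists>neg_v\<in>carrier (hom (presented p R) m n).
      v \<oplus>\<^bsub>hom (presented p R) m n\<^esub> neg_v = \<zero>\<^bsub>hom (presented p R) m n\<^esub>"
      by (intro bexI[of _ "SC (-1) v"]) (simp_all add: SC_0)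
  qed
qed (auto simp: AD_ac SC_plus)

lemma presented_vs: "vectorspace class_ring (hom (presented p R) m n)"
  by (intro vectorspace.intro presented_module class_field)

lemma presented_supercategory: "strict_monoidal_supercategory (presented p R)"
proof (rule strict_monoidal_supercategory.intro)
  fix m n q
  show "VectorSpace.subspace class_ring (hdeg (presented p R) m n q) (hom (presented p R) m n)"
    by (intro VectorSpace.subspace.intro submodule.intro presented_vs presented_module)
      (auto simp: TH_AD TH_SC dest: TH_TT intro: cl_THI)
next
  fix m n show "bij_betw (\<lambda>(x, y). x \<oplus>\<^bsub>hom (presented p R) m n\<^esub> y)
      (hdeg (presented p R) m n 0 \<times> hdeg (presented p R) m n 1) (carrier (hom (presented p R) m n))"
    using TT_direct_sum by simp
next
  fix f l m q g n q'
  assume "f \<in> hdeg (presented p R) l m q" "g \<in> hdeg (presented p R) m n q'"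
  then show "cmp (presented p R) l m n g f \<in> hdeg (presented p R) l n (q' + q)" unfolding presented_simps by (intro TH_CM)
next
  fix f m n q g m' n' q'
  assume "f \<in> hdeg (presented p R) m n q" "g \<in> hdeg (presented p R) m' n' q'"
  then show "tns (presented p R) m n m' n' f g \<in> hdeg (presented p R) (m + m') (n + n') (q + q')" unfolding presented_simps by (intro TH_TN)
next
  fix h l m q f n k l' m' g n' q'
  assume "h \<in> hdeg (presented p R) l m q" "f \<in> carrier (hom (presented p R) m n)"
    "k \<in> carrier (hom (presented p R) l' m')" "g \<in> hdeg (presented p R) m' n' q'"
  then show "cmp (presented p R) (l + l') (m + m') (n + n') (tns (presented p R) m n m' n' f g) (tns (presented p R) l m l' m' h k) =
       psign (q' * q) \<odot>\<^bsub>hom (presented p R) (l + l') (n + n')\<^esub>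
         tns (presented p R) l n l' n' (cmp (presented p R) l m n f h) (cmp (presented p R) l' m' n' g k)"
    using interchange[of f m n h l q g m' n' q' k l'] by simp
qed (auto simp: presented_vs LinearCombinations.module_hom_def CM_AD_l CM_AD_r TN_AD_l TN_AD_r CM_assoc TN_assoc
    intro: TT_CM TT_TN TH_CM TH_TN)

lemma ev_presented: "wf_expr t ==> ev (presented p R) (cl GenH) (cl GenA) (cl GenU) t = cl t"
  by (induction t) (simp_all add: cl_add cl_scale cl_comp cl_tens)

lemma presented_gens: "cl GenH \<in> TH 2 2 0" "cl GenA \<in> TH 2 0 p" "cl GenU \<in> TH 0 2 p"
  by (auto intro: cl_THI)

end

lemma brauer_parameters:
  fixes C :: "('k::field, 'h) supercat"
  assumes W: "reduced_word_system W" and B: "brauer_type W C p H A U" and R: "satisfies C H A U (relations P)"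
    and eps: "\<epsilon> = psign p" and f: "p_f P = 0" "p_f' P = p_b P" and b: "p_b P \<noteq> 0" and s: "p_sig P \<noteq> 0"
  shows "(p_lam' P = p_lam P \<or> p_lam' P = p_b P - p_lam P) \<and> (p_e P)^2 = - \<epsilon> \<and>
    p_a P = (p_lam P)^2 - p_b P * p_lam P \<and> p_c P = 0 \<and> p_sig' P = \<epsilon> * p_sig P \<and>
    p_rho P = \<epsilon> * p_e P * p_sig P * (p_lam P - p_b P) \<and>
    p_del P = \<epsilon> * p_e P * p_sig P * (p_lam P + p_lam' P - p_b P) / p_b P \<and>
    p_e' P = - \<epsilon> * p_e P \<and> p_d P = - p_e P * p_b P \<and>
    p_D P = (p_lam P - p_b P) * p_b P \<and> p_E P = p_b P \<and> p_D' P = 0 \<and> p_E' P = 0 \<and>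
    p_F P = - \<epsilon> * p_e P * p_a P \<and> p_F' P = p_e P * p_a P" "p_d' P = 0"
proof -
  have "strict_monoidal_supercategory C" "H \<in> hdeg C 2 2 0" "A \<in> hdeg C 2 0 p" "U \<in> hdeg C 0 2 p"
    and inv: "\<exists>G\<in>carrier (hom C 2 2). cmp C 2 2 2 G H = idm C 2 \<and> cmp C 2 2 2 H G = idm C 2"
    and bas: "\<forall>m n. inj_on (\<lambda>x. ev C H A U (std_expr n x)) (std_index W m n) \<and>
        vectorspace.basis class_ring (hom C m n) ((\<lambda>x. ev C H A U (std_expr n x)) ` std_index W m n)"
    by (rule B[unfolded brauer_type_def, THEN conjunct1] B[unfolded brauer_type_def, THEN conjunct2, THEN conjunct1]
        B[unfolded brauer_type_def, THEN conjunct2, THEN conjunct2, THEN conjunct1]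
        B[unfolded brauer_type_def, THEN conjunct2, THEN conjunct2, THEN conjunct2, THEN conjunct1]
        B[unfolded brauer_type_def, THEN conjunct2, THEN conjunct2, THEN conjunct2, THEN conjunct2, THEN conjunct2, THEN conjunct1]
        B[unfolded brauer_type_def, THEN conjunct2, THEN conjunct2, THEN conjunct2, THEN conjunct2, THEN conjunct2, THEN conjunct2, THEN conjunct2])+
  then have I: "interpretation_data C H A U p (relations P)"
    by (intro interpretation_data.intro interpretation_data_axioms.intro R)
  interpret brauer_cat C H A U p P W
    by (intro brauer_cat.intro brauer_cat_axioms.intro I W inv conjunct1[OF spec[OF spec[OF bas]]] conjunct2[OF spec[OF spec[OF bas]]])
  show "(p_lam' P = p_lam P \<or> p_lam' P = p_b P - p_lam P) \<and> (p_e P)^2 = - \<epsilon> \<and>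
    p_a P = (p_lam P)^2 - p_b P * p_lam P \<and> p_c P = 0 \<and> p_sig' P = \<epsilon> * p_sig P \<and>
    p_rho P = \<epsilon> * p_e P * p_sig P * (p_lam P - p_b P) \<and>
    p_del P = \<epsilon> * p_e P * p_sig P * (p_lam P + p_lam' P - p_b P) / p_b P \<and>
    p_e' P = - \<epsilon> * p_e P \<and> p_d P = - p_e P * p_b P \<and>
    p_D P = (p_lam P - p_b P) * p_b P \<and> p_E P = p_b P \<and> p_D' P = 0 \<and> p_E' P = 0 \<and>
    p_F P = - \<epsilon> * p_e P * p_a P \<and> p_F' P = p_e P * p_a P"
    unfolding eps
  proof (rule param_algebra[OF eps_sq(1) b s])
    show "p_lam P * p_lam P = p_a P + p_b P * p_lam P + p_c P * p_del P" by (rule eqs_u(1))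
    show "p_e P * p_E P = p_b P * p_e P" "p_e P * p_F P = p_a P" using eqs_u(2,3) by (simp_all add: f)
    show "p_lam P * p_E P = p_D P + p_E P * p_b P" "p_lam P * p_F P = p_E P * (p_c P * p_sig' P) + p_F P * p_lam P" by (rule eqs_u)+
    show "p_e' P * p_E' P + p_b P * p_e' P = p_b P * p_e' P" "p_e' P * p_F' P + p_b P * p_b P = p_a P + p_b P * p_b P"
      "p_lam' P * p_E' P = p_D' P + p_E' P * p_b P"
      "(p_d' P + p_e' P * p_b P) * p_F' P + (p_e' P * (p_c P * p_sig P) + p_b P * p_lam' P) * p_b P = p_lam' P * (p_e' P * (p_c P * p_sig P) + p_b P * p_lam' P)"
      by (rule eqs_c[unfolded f])+
    show "p_lam' P * p_sig P = p_d P * p_del P + p_e P * p_rho P" using eqs_s(1) f(1) by simp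
    show "p_d' P * p_sig P + p_e' P * (p_lam P * p_sig P) + p_b P * p_del P = p_d P * p_sig' P + p_e P * (p_lam' P * p_sig' P)"
      using eqs_s(2)[unfolded f] by simp
    show "p_sig P = eps * p_sig' P" by (rule eq_z)
    show "p_d' P = 0" "p_e' P * p_e P = 1" "p_e' P * p_d P + p_b P = 0" by (rule eqs_22[OF f(1) s, unfolded f])+
    show "2 * (p_e P * p_e P * p_e P * p_d P) + p_e P * p_e P * p_e P * p_e P * p_b P = p_b P * (eps * (p_e P * p_e P))"
      by (rule eq_04[OF f(1)])
  qed
  show "p_d' P = 0" by (rule eqs_22(1)[OF f(1) s])
qed

section \<open>Nested cups and caps\<close>

locale cup_module =
  fixes add :: "'m => 'm => 'm" and scl :: "'k => 'm => 'm" and G :: "nat => 'm set"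
    and s r u :: "nat => nat => 'm => 'm" and B :: "nat => 'm set"
    and lam a b e dd x z D E F eps kap al be al' be' g1 g2 g3 :: 'k
  assumes G_add: "y \<in> G n ==> y' \<in> G n ==> add y y' \<in> G n" and G_scl: "y \<in> G n ==> scl c y \<in> G n"
    and G_s: "1 <= i ==> i < n ==> y \<in> G n ==> s n i y \<in> G n"
    and G_r: "1 <= i ==> i < n ==> y \<in> G n ==> r n i y \<in> G n"
    and G_u: "1 <= i ==> i <= n + 1 ==> y \<in> G n ==> u n i y \<in> G (Suc (Suc n))"
    and G_B: "y \<in> B n ==> y \<in> G n"
    and B_s: "1 <= i ==> i < n ==> y \<in> B n ==> s n i y \<in> B n"
    and B_r: "1 <= i ==> i < n ==> y \<in> B n ==> r n i y \<in> B n"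
    and s_add: "1 <= i ==> i < n ==> y \<in> G n ==> y' \<in> G n ==> s n i (add y y') = add (s n i y) (s n i y')"
    and s_scl: "1 <= i ==> i < n ==> y \<in> G n ==> s n i (scl c y) = scl c (s n i y)"
    and r_add: "1 <= i ==> i < n ==> y \<in> G n ==> y' \<in> G n ==> r n i (add y y') = add (r n i y) (r n i y')"
    and r_scl: "1 <= i ==> i < n ==> y \<in> G n ==> r n i (scl c y) = scl c (r n i y)"
    and u_add: "1 <= i ==> i <= n + 1 ==> y \<in> G n ==> y' \<in> G n ==> u n i (add y y') = add (u n i y) (u n i y')"
    and u_scl: "1 <= i ==> i <= n + 1 ==> y \<in> G n ==> u n i (scl c y) = scl c (u n i y)"
    and r_s: "1 <= i ==> i < n ==> y \<in> G n ==> r n i y = add (scl al y) (scl be (s n i y))"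
    and s_r: "1 <= i ==> i < n ==> y \<in> G n ==> s n i y = add (scl al' y) (scl be' (r n i y))"
    and s_quad: "1 <= i ==> i < n ==> y \<in> G n ==> s n i (s n i y) = add (scl a y) (scl b (s n i y))"
    and r_quad: "1 <= i ==> i < n ==> y \<in> G n ==> r n i (r n i y) = add (scl D y) (scl E (r n i y))"
    and s_braid: "1 <= i ==> i + 1 < n ==> y \<in> G n ==> s n i (s n (Suc i) (s n i y)) = s n (Suc i) (s n i (s n (Suc i) y))"
    and r_braid: "1 <= i ==> i + 1 < n ==> y \<in> G n ==> r n i (r n (Suc i) (r n i y)) = r n (Suc i) (r n i (r n (Suc i) y))"
    and s_far: "1 <= i ==> i + 2 <= j ==> j < n ==> y \<in> G n ==> s n i (s n j y) = s n j (s n i y)"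
    and r_far: "1 <= i ==> i + 2 <= j ==> j < n ==> y \<in> G n ==> r n i (r n j y) = r n j (r n i y)"
    and s_r_far: "1 <= i ==> i + 2 <= j ==> j < n ==> y \<in> G n ==> s n i (r n j y) = r n j (s n i y)"
    and s_u: "1 <= i ==> i <= n + 1 ==> y \<in> G n ==> s (Suc (Suc n)) i (u n i y) = scl lam (u n i y)"
    and s_u_lo: "1 <= i ==> i + 2 <= j ==> j <= n + 1 ==> y \<in> G n ==> s (Suc (Suc n)) i (u n j y) = u n j (s n i y)"
    and s_u_hi: "1 <= j ==> j <= i ==> i < n ==> y \<in> G n ==> s (Suc (Suc n)) (Suc (Suc i)) (u n j y) = u n j (s n i y)"
    and r_u_hi: "1 <= j ==> j <= i ==> i < n ==> y \<in> G n ==> r (Suc (Suc n)) (Suc (Suc i)) (u n j y) = u n j (r n i y)"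
    and u_u: "1 <= i ==> i <= j ==> j <= n + 1 ==> y \<in> G n ==> u (Suc (Suc n)) i (u n j y) = scl eps (u (Suc (Suc n)) (Suc (Suc j)) (u n i y))"
    and s_u1: "1 <= i ==> i <= n ==> y \<in> G n ==>
      s (Suc (Suc n)) i (u n (Suc i) y) = add (scl dd (u n i y)) (scl e (s (Suc (Suc n)) (Suc i) (u n i y)))"
    and s_u1_r: "1 <= i ==> i <= n ==> y \<in> G n ==>
      s (Suc (Suc n)) i (u n (Suc i) y) = add (scl z (u n i y)) (scl x (r (Suc (Suc n)) (Suc i) (u n i y)))"
    and s_u2: "1 <= i ==> i <= n ==> y \<in> G n ==>
      s (Suc (Suc n)) i (s (Suc (Suc n)) (Suc i) (u n i y)) = add (add (scl g1 (u n i y)) (scl g2 (s (Suc (Suc n)) (Suc i) (u n i y)))) (scl g3 (u n (Suc i) y))"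
    and u_u1: "1 <= i ==> i <= n + 1 ==> y \<in> G n ==>
      u (Suc (Suc n)) (Suc i) (u n i y) = scl kap (s (Suc (Suc (Suc (Suc n)))) (Suc (Suc i)) (s (Suc (Suc (Suc (Suc n)))) (Suc i) (u (Suc (Suc n)) i (u n i y))))"
begin

primrec ch :: "nat => nat => nat => 'm => 'm" where
  "ch n j 0 y = y" | "ch n j (Suc t) y = s n (j + Suc t) (ch n j t y)"
primrec cr :: "nat => nat => nat => 'm => 'm" where
  "cr n j 0 y = y" | "cr n j (Suc t) y = r n (j + Suc t) (cr n j t y)"

lemma G_ch: "j + t < n ==> y \<in> G n ==> ch n j t y \<in> G n" by (induction t) (simp_all add: G_s)
lemma G_cr: "j + t < n ==> y \<in> G n ==> cr n j t y \<in> G n" by (induction t) (simp_all add: G_r)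
lemma ch_add: "j + t < n ==> y \<in> G n ==> y' \<in> G n ==> ch n j t (add y y') = add (ch n j t y) (ch n j t y')"
  by (induction t) (simp_all add: s_add G_ch)
lemma ch_scl: "j + t < n ==> y \<in> G n ==> ch n j t (scl c y) = scl c (ch n j t y)"
  by (induction t) (simp_all add: s_scl G_ch)
lemma cr_add: "j + t < n ==> y \<in> G n ==> y' \<in> G n ==> cr n j t (add y y') = add (cr n j t y) (cr n j t y')"
  by (induction t) (simp_all add: r_add G_cr)
lemma cr_scl: "j + t < n ==> y \<in> G n ==> cr n j t (scl c y) = scl c (cr n j t y)"
  by (induction t) (simp_all add: r_scl G_cr)

lemma s_ch_hi: "j + t + 2 <= i ==> i < n ==> y \<in> G n ==> s n i (ch n j t y) = ch n j t (s n i y)"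
proof (induction t)
  case (Suc t)
  have "s n i (s n (j + Suc t) (ch n j t y)) = s n (j + Suc t) (s n i (ch n j t y))"
    using Suc.prems by (intro s_far[symmetric] G_ch) simp_all
  with Suc show ?case by simp
qed simp

lemma s_ch_lo: "1 <= i ==> i + 1 <= j ==> j + t < n ==> y \<in> G n ==> s n i (ch n j t y) = ch n j t (s n i y)"
proof (induction t)
  case (Suc t)
  have "s n i (s n (j + Suc t) (ch n j t y)) = s n (j + Suc t) (s n i (ch n j t y))"
    using Suc.prems by (intro s_far G_ch) simp_all
  with Suc show ?case by simp
qed simp

lemma r_cr_hi: "j + t + 2 <= i ==> i < n ==> y \<in> G n ==> r n i (cr n j t y) = cr n j t (r n i y)"
proof (induction t)
  case (Suc t)
  have "r n i (r n (j + Suc t) (cr n j t y)) = r n (j + Suc t) (r n i (cr n j t y))"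
    using Suc.prems by (intro r_far[symmetric] G_cr) simp_all
  with Suc show ?case by simp
qed simp

lemma s_cr_lo: "1 <= i ==> i + 1 <= j ==> j + t < n ==> y \<in> G n ==> s n i (cr n j t y) = cr n j t (s n i y)"
proof (induction t)
  case (Suc t)
  have "s n i (r n (j + Suc t) (cr n j t y)) = r n (j + Suc t) (s n i (cr n j t y))"
    using Suc.prems by (intro s_r_far G_cr) simp_all
  with Suc show ?case by simp
qed simp

lemma s_ch_mid: "j + 1 <= i ==> i < j + t ==> j + t < n ==> y \<in> G n ==> s n i (ch n j t y) = ch n j t (s n (Suc i) y)"
proof (induction t)
  case (Suc t)
  have g: "ch n j t y \<in> G n" using Suc.prems by (intro G_ch) simp_all
  show ?case
  proof (cases "i < j + t")
    case True
    then have "s n i (ch n j (Suc t) y) = s n (j + Suc t) (s n i (ch n j t y))"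
      using Suc.prems g True s_far[of i "j + Suc t" n "ch n j t y"] by simp
    then show ?thesis using Suc True by simp
  next
    case False
    then have i: "i = j + t" using Suc.prems by simp
    then obtain t' where t: "t = Suc t'" using Suc.prems by (cases t) simp_all
    have g': "ch n j t' y \<in> G n" using Suc.prems t by (intro G_ch) simp_all
    have "s n i (ch n j (Suc t) y) = s n i (s n (Suc i) (s n i (ch n j t' y)))" using i t by simp
    also have "... = s n (Suc i) (s n i (s n (Suc i) (ch n j t' y)))" using Suc.prems i g' by (intro s_braid) simp_all
    also have "s n (Suc i) (ch n j t' y) = ch n j t' (s n (Suc i) y)" using Suc.prems i t by (intro s_ch_hi) simp_all
    finally show ?thesis using i t by simp
  qed
qed simp

lemma r_cr_mid: "j + 1 <= i ==> i < j + t ==> j + t < n ==> y \<in> G n ==> r n i (cr n j t y) = cr n j t (r n (Suc i) y)"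
proof (induction t)
  case (Suc t)
  have g: "cr n j t y \<in> G n" using Suc.prems by (intro G_cr) simp_all
  show ?case
  proof (cases "i < j + t")
    case True
    then have "r n i (cr n j (Suc t) y) = r n (j + Suc t) (r n i (cr n j t y))"
      using Suc.prems g True r_far[of i "j + Suc t" n "cr n j t y"] by simp
    then show ?thesis using Suc True by simp
  next
    case False
    then have i: "i = j + t" using Suc.prems by simp
    then obtain t' where t: "t = Suc t'" using Suc.prems by (cases t) simp_all
    have g': "cr n j t' y \<in> G n" using Suc.prems t by (intro G_cr) simp_all
    have "r n i (cr n j (Suc t) y) = r n i (r n (Suc i) (r n i (cr n j t' y)))" using i t by simp
    also have "... = r n (Suc i) (r n i (r n (Suc i) (cr n j t' y)))" using Suc.prems i g' by (intro r_braid) simp_all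
    also have "r n (Suc i) (cr n j t' y) = cr n j t' (r n (Suc i) y)" using Suc.prems i t by (intro r_cr_hi) simp_all
    finally show ?thesis using i t by simp
  qed
qed simp

text \<open>\<open>WW d n\<close> is spanned by the nested products whose indices exceed \<open>d\<close> and increase weakly from the
  outside to the inside, \<open>VV q P n\<close> by those whose indices lie in \<open>[q, P]\<close> and decrease strictly.\<close>

inductive WW :: "nat => nat => 'm => bool" where
  WB: "y \<in> B n ==> WW d n y"
| WI: "WW q n f ==> d <= q ==> q + t <= n ==> WW d (Suc (Suc n)) (ch (Suc (Suc n)) (Suc q) t (u n (Suc q) f))"
| Wadd: "WW d n y ==> WW d n y' ==> WW d n (add y y')"
| Wscl: "WW d n y ==> WW d n (scl c y)"

inductive YY :: "nat => nat => 'm => bool" where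
  YI: "WW q n f ==> q + t <= n ==> YY q (Suc (Suc n)) (ch (Suc (Suc n)) (Suc q) t (u n (Suc q) f))"
| Yadd: "YY q n y ==> YY q n y' ==> YY q n (add y y')"
| Yscl: "YY q n y ==> YY q n (scl c y)"

lemma W_G: "WW d n y ==> y \<in> G n"
  by (induction rule: WW.induct) (simp_all add: G_B G_add G_scl G_ch G_u)
lemma W_mono: "WW d n y ==> d' <= d ==> WW d' n y"
  by (induction arbitrary: d' rule: WW.induct) (auto intro: WB WI Wadd Wscl)
lemma YY_W: "YY q n y ==> d <= q ==> WW d n y"
  by (induction arbitrary: d rule: YY.induct) (auto intro: WI Wadd Wscl)
lemma YY_G: "YY q n y ==> y \<in> G n" using W_G YY_W by blast

lemma W_s_lo: "WW q n f ==> 1 <= i ==> i < q ==> i < n ==> WW q n (s n i f)"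
proof (induction rule: WW.induct)
  case (WI q n f d t)
  have f: "f \<in> G n" by (rule W_G[OF WI(1)])
  have "s (Suc (Suc n)) i (ch (Suc (Suc n)) (Suc q) t (u n (Suc q) f)) = ch (Suc (Suc n)) (Suc q) t (u n (Suc q) (s n i f))"
    using WI f by (simp add: s_ch_lo G_u s_u_lo)
  moreover have "WW q n (s n i f)" using WI by simp
  ultimately show ?case using WI by (simp add: WW.WI)
qed (simp_all add: WB Wadd Wscl B_s s_add s_scl W_G)

lemma YY_s:
  assumes P: "\<And>d f i. WW d n f ==> d < i ==> i < n ==> WW d n (s n i f)"
  shows "YY q m y ==> m = n + 2 ==> q + 2 <= i ==> i < n + 2 ==> YY q m (s m i y)"
proof (induction rule: YY.induct)
  case (YI q n' f t)
  then have n: "n' = n" by simp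
  let ?p = "Suc q" and ?m = "Suc (Suc n)"
  have f: "f \<in> G n" using W_G[OF YI(1)] n by simp
  have uf: "u n ?p f \<in> G ?m" using f YI n by (intro G_u) simp_all
  have W: "WW q n f" using YI n by simp
  consider "i = ?p + t + 1" | t' where "t = Suc t'" "i = ?p + t" | "i < ?p + t" | "i \<ge> ?p + t + 2"
    using YI by (cases t; cases "i = ?p + t"; cases "i = ?p + t + 1") force+
  then have "YY q ?m (s ?m i (ch ?m ?p t (u n ?p f)))"
  proof cases
    case 1
    then have "s ?m i (ch ?m ?p t (u n ?p f)) = ch ?m ?p (Suc t) (u n ?p f)" by simp
    then show ?thesis using YY.YI[OF W, of "Suc t"] 1 YI n by simp
  next
    case 2
    have g: "ch ?m ?p t' (u n ?p f) \<in> G ?m" using 2 YI n uf by (intro G_ch) simp_all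
    have "s ?m i (ch ?m ?p t (u n ?p f)) = add (scl a (ch ?m ?p t' (u n ?p f))) (scl b (ch ?m ?p t (u n ?p f)))"
      using 2 YI n s_quad[OF _ _ g, of i] by simp
    moreover have "YY q ?m (ch ?m ?p t' (u n ?p f))" "YY q ?m (ch ?m ?p t (u n ?p f))"
      using YY.YI[OF W, of t'] YY.YI[OF W, of t] 2 YI n by simp_all
    ultimately show ?thesis by (simp add: Yadd Yscl)
  next
    case 3
    have "s ?m i (ch ?m ?p t (u n ?p f)) = ch ?m ?p t (s ?m (Suc i) (u n ?p f))"
      using 3 YI n uf by (intro s_ch_mid) simp_all
    also have "s ?m (Suc i) (u n ?p f) = u n ?p (s n (i - 1) f)"
      using s_u_hi[of ?p "i - 1" n f] 3 YI n f by simp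
    finally show ?thesis using YY.YI[OF P[OF W, of "i - 1"], of t] 3 YI n by simp
  next
    case 4
    obtain i0 where i0: "i = Suc (Suc i0)" using 4 le_Suc_ex[of 2 i] by auto
    have "s ?m i (ch ?m ?p t (u n ?p f)) = ch ?m ?p t (s ?m i (u n ?p f))"
      using 4 YI n uf by (intro s_ch_hi) simp_all
    also have "s ?m i (u n ?p f) = u n ?p (s n i0 f)"
      using s_u_hi[of ?p i0 n f] 4 i0 YI n f by simp
    finally show ?thesis using YY.YI[OF P[OF W, of i0], of t] 4 i0 YI n by simp
  qed
  then show ?case using n by simp
next
  case (Yadd q m y y')
  have "s m i (add y y') = add (s m i y) (s m i y')"
    using Yadd.prems by (intro s_add YY_G[OF Yadd.hyps(1)] YY_G[OF Yadd.hyps(2)]) simp_all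
  then show ?case using Yadd.IH[OF Yadd.prems] by (simp add: YY.Yadd)
next
  case (Yscl q m y c)
  have "s m i (scl c y) = scl c (s m i y)"
    using Yscl.prems by (intro s_scl YY_G[OF Yscl.hyps(1)]) simp_all
  then show ?case using Yscl.IH[OF Yscl.prems] by (simp add: YY.Yscl)
qed

lemma YY_ch:
  assumes P: "\<And>d f i. WW d n f ==> d < i ==> i < n ==> WW d n (s n i f)"
    and y: "YY q (Suc (Suc n)) y" and j: "q + 1 <= j" "j + t < n + 2"
  shows "YY q (Suc (Suc n)) (ch (Suc (Suc n)) j t y)"
  using j
proof (induction t)
  case (Suc t)
  then show ?case using YY_s[OF P, of q "n + 2" "ch (Suc (Suc n)) j t y" "j + Suc t"] by simp
qed (use y in simp)

lemma W_u_Suc: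
  assumes P: "\<And>d f i. WW d n f ==> d < i ==> i < n ==> WW d n (s n i f)"
  shows "WW q m f ==> m = n ==> q + 2 + t <= n + 1 ==> WW q (Suc (Suc n)) (ch (Suc (Suc n)) (Suc (Suc q)) t (u n (Suc (Suc q)) f))"
proof (induction rule: WW.induct)
  case (WB y n' q)
  then show ?case using WW.WI[OF WW.WB[of y n "q + 1"], of q t] by simp
next
  case (WI q' n' f q t')
  have f: "f \<in> G n'" by (rule W_G[OF WI(1)])
  let ?F = "ch n (Suc q') t' (u n' (Suc q') f)"
  show ?case
  proof (cases "q' = q")
    case False
    then have "WW (Suc q) n ?F" using WW.WI[OF WI(1), of "q + 1" t'] WI by simp
    then show ?thesis using WW.WI[of "q + 1" n ?F q t] WI by simp
  next
    case True
    let ?p = "Suc q"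
    have n: "n = Suc (Suc n')" by (rule WI.prems(1)[symmetric])
    note hyp = WI.hyps WI.prems(2)
    have uf: "u n' ?p f \<in> G n" unfolding n using hyp True f by (intro G_u) simp_all
    have uuf: "u n ?p (u n' ?p f) \<in> G (Suc (Suc n))" using hyp True uf n by (intro G_u) simp_all
    have sh: "u n (Suc ?p) (ch n ?p k (u n' ?p f)) = ch (Suc (Suc n)) (Suc (Suc ?p)) k (u n (Suc ?p) (u n' ?p f))" if "k <= t'" for k
      using that
    proof (induction k)
      case (Suc k)
      have g: "ch n ?p k (u n' ?p f) \<in> G n" using Suc.prems hyp True n uf by (intro G_ch) simp_all
      have "u n (Suc ?p) (s n (?p + Suc k) (ch n ?p k (u n' ?p f))) = s (Suc (Suc n)) (?p + Suc k + 2) (u n (Suc ?p) (ch n ?p k (u n' ?p f)))"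
        using s_u_hi[of "Suc ?p" "?p + Suc k" n "ch n ?p k (u n' ?p f)"] Suc.prems hyp True n g by simp
      then show ?case using Suc by simp
    qed simp
    have cc: "ch (Suc (Suc n)) (Suc (Suc ?p)) k (ch (Suc (Suc n)) ?p (Suc (Suc 0)) w) = ch (Suc (Suc n)) ?p (Suc (Suc k)) w" for k w
      by (induction k) simp_all
    have "u n (Suc ?p) ?F = ch (Suc (Suc n)) (Suc (Suc ?p)) t' (scl kap (ch (Suc (Suc n)) ?p (Suc (Suc 0)) (u n ?p (u n' ?p f))))"
      using sh[of t'] u_u1[of ?p n' f] f hyp True n by simp
    also have "... = scl kap (ch (Suc (Suc n)) (Suc (Suc ?p)) t' (ch (Suc (Suc n)) ?p (Suc (Suc 0)) (u n ?p (u n' ?p f))))"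
      using hyp True n uuf by (intro ch_scl G_ch) simp_all
    also have "... = scl kap (ch (Suc (Suc n)) ?p (Suc (Suc t')) (u n ?p (u n' ?p f)))" unfolding cc ..
    finally have e: "u n (Suc ?p) ?F = ..." .
    have "WW q n (u n' ?p f)" using WW.WI[OF WI(1), of q 0] True hyp n by simp
    then have "YY q (Suc (Suc n)) (scl kap (ch (Suc (Suc n)) ?p (Suc (Suc t')) (u n ?p (u n' ?p f))))"
      using hyp True n by (intro YY.Yscl YY.YI) simp_all
    then have "YY q (Suc (Suc n)) (u n (Suc (Suc q)) ?F)" using e by simp
    then have "YY q (Suc (Suc n)) (ch (Suc (Suc n)) (Suc (Suc q)) t (u n (Suc (Suc q)) ?F))" using hyp by (intro YY_ch[OF P]) simp_all
    then have "WW q (Suc (Suc n)) (ch (Suc (Suc n)) (Suc (Suc q)) t (u n (Suc (Suc q)) ?F))" by (rule YY_W) simp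
    then show ?thesis by (simp add: n)
  qed
next
  case (Wadd q n' y y')
  have g: "y \<in> G n" "y' \<in> G n" using W_G[OF Wadd.hyps(1)] W_G[OF Wadd.hyps(2)] Wadd.prems(1) by simp_all
  have ug: "u n (Suc (Suc q)) y \<in> G (Suc (Suc n))" "u n (Suc (Suc q)) y' \<in> G (Suc (Suc n))"
    using g Wadd.prems(2) G_u[of "Suc (Suc q)" n] by simp_all
  have "ch (Suc (Suc n)) (Suc (Suc q)) t (u n (Suc (Suc q)) (add y y')) =
      add (ch (Suc (Suc n)) (Suc (Suc q)) t (u n (Suc (Suc q)) y)) (ch (Suc (Suc n)) (Suc (Suc q)) t (u n (Suc (Suc q)) y'))"
    using g ug Wadd.prems(2) by (simp add: u_add ch_add)
  then show ?case using Wadd.IH[OF Wadd.prems] by (simp add: WW.Wadd)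
next
  case (Wscl q n' y c)
  have g: "y \<in> G n" using W_G[OF Wscl.hyps(1)] Wscl.prems(1) by simp
  have ug: "u n (Suc (Suc q)) y \<in> G (Suc (Suc n))" using g Wscl.prems(2) G_u[of "Suc (Suc q)" n] by simp
  have "ch (Suc (Suc n)) (Suc (Suc q)) t (u n (Suc (Suc q)) (scl c y)) =
      scl c (ch (Suc (Suc n)) (Suc (Suc q)) t (u n (Suc (Suc q)) y))"
    using g ug Wscl.prems(2) by (simp add: u_scl ch_scl)
  then show ?case using Wscl.IH[OF Wscl.prems] by (simp add: WW.Wscl)
qed

lemma W_s: "WW d n f ==> d < i ==> i < n ==> WW d n (s n i f)"
proof (induction n arbitrary: d f i rule: less_induct)
  case (less n)
  have IH: "WW d n' f ==> d < i ==> i < n' ==> WW d n' (s n' i f)" if "n' < n" for n' d f i using less.IH that by blast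
  from less.prems IH show ?case
  proof (induction rule: WW.induct)
    case (WI q n f d t)
    have P: "WW d' n f' ==> d' < i' ==> i' < n ==> WW d' n (s n i' f')" for d' f' i'
      by (rule WI.prems(3)) simp_all
    note hyp = WI.hyps WI.prems(1,2)
    let ?p = "Suc q" and ?m = "Suc (Suc n)"
    have f: "f \<in> G n" by (rule W_G[OF WI(1)])
    have uf: "u n ?p f \<in> G ?m" using f hyp by (intro G_u) simp_all
    have Y: "YY q ?m (ch ?m ?p t (u n ?p f))" using hyp by (intro YY.YI) simp_all
    consider "q + 2 <= i" | "i < q" | "i = q" | "i = q + 1" by linarith
    then show ?case
    proof cases
      case 1
      then show ?thesis using YY_s[OF P Y] WI YY_W[of q ?m _ d] by simp
    next
      case 2
      then have "WW q ?m (ch ?m ?p t (u n ?p f))" using YY_W[OF Y] by simp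
      then have "WW q ?m (s ?m i (ch ?m ?p t (u n ?p f)))" using 2 hyp by (intro W_s_lo) simp_all
      then show ?thesis by (rule W_mono[OF _ WI(2)])
    next
      case 3
      obtain q0 where q0: "q = Suc q0" using 3 hyp by (cases q) simp_all
      have uq: "u n q f \<in> G ?m" using f hyp q0 by (intro G_u) simp_all
      have su: "s ?m (Suc q) (u n q f) \<in> G ?m" using uq hyp q0 by (intro G_s) simp_all
      have "s ?m i (ch ?m ?p t (u n ?p f)) = ch ?m ?p t (s ?m q (u n (Suc q) f))"
        unfolding 3 using hyp uf q0 by (intro s_ch_lo) simp_all
      also have "s ?m q (u n (Suc q) f) = add (scl dd (u n q f)) (scl e (s ?m (Suc q) (u n q f)))"
        using hyp f q0 by (intro s_u1) simp_all
      finally have e: "s ?m i (ch ?m ?p t (u n ?p f)) = add (scl dd (ch ?m ?p t (u n q f))) (scl e (ch ?m ?p t (s ?m (Suc q) (u n q f))))"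
        using hyp uq su by (simp add: ch_add ch_scl G_scl)
      have "WW q0 n f" using W_mono[OF WI(1), of q0] q0 by simp
      then have "YY q0 ?m (u n q f)" "YY q0 ?m (s ?m (Suc q) (u n q f))"
        using YY.YI[of q0 n f 0] YY.YI[of q0 n f 1] q0 hyp by simp_all
      then have "YY q0 ?m (add (scl dd (ch ?m ?p t (u n q f))) (scl e (ch ?m ?p t (s ?m (Suc q) (u n q f)))))"
        using hyp q0 by (intro YY.Yadd YY.Yscl YY_ch[OF P]) simp_all
      then show ?thesis using e YY_W[of q0 ?m _ d] 3 hyp q0 by simp
    next
      case 4
      then have i: "i = Suc q" by simp
      show ?thesis
      proof (cases t)
        case 0
        then have "s ?m i (ch ?m ?p t (u n ?p f)) = scl lam (ch ?m ?p t (u n ?p f))"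
          using 4 hyp f by (simp add: s_u)
        then show ?thesis using YY_W[OF Yscl[OF Y], of d] hyp by simp
      next
        case (Suc t')
        have cc: "ch ?m ?p (Suc k) w = ch ?m (Suc ?p) k (s ?m (Suc ?p) w)" for k w by (induction k) simp_all
        have su: "s ?m (Suc ?p) (u n ?p f) \<in> G ?m" using uf hyp Suc by (intro G_s) simp_all
        have u1: "u n (Suc ?p) f \<in> G ?m" using f hyp Suc by (intro G_u) simp_all
        have "s ?m i (ch ?m ?p t (u n ?p f)) = ch ?m (Suc ?p) t' (s ?m ?p (s ?m (Suc ?p) (u n ?p f)))"
          unfolding i Suc cc using hyp Suc su by (intro s_ch_lo) simp_all
        also have "s ?m ?p (s ?m (Suc ?p) (u n ?p f)) = add (add (scl g1 (u n ?p f)) (scl g2 (s ?m (Suc ?p) (u n ?p f)))) (scl g3 (u n (Suc ?p) f))"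
          using hyp Suc f by (intro s_u2) simp_all
        finally have e: "s ?m i (ch ?m ?p t (u n ?p f)) =
            add (add (scl g1 (ch ?m (Suc ?p) t' (u n ?p f))) (scl g2 (ch ?m (Suc ?p) t' (s ?m (Suc ?p) (u n ?p f))))) (scl g3 (ch ?m (Suc ?p) t' (u n (Suc ?p) f)))"
          using hyp Suc uf su u1 by (simp add: ch_add ch_scl G_scl G_add)
        have "YY q ?m (u n ?p f)" "YY q ?m (s ?m (Suc ?p) (u n ?p f))"
          using YY.YI[OF WI(1), of 0] YY.YI[OF WI(1), of 1] hyp Suc by simp_all
        then have "YY q ?m (ch ?m (Suc ?p) t' (u n ?p f))" "YY q ?m (ch ?m (Suc ?p) t' (s ?m (Suc ?p) (u n ?p f)))"
          using hyp Suc by (auto intro!: YY_ch[OF P])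
        then have "WW q ?m (ch ?m (Suc ?p) t' (u n ?p f))" "WW q ?m (ch ?m (Suc ?p) t' (s ?m (Suc ?p) (u n ?p f)))"
          by (auto intro: YY_W[OF _ order_refl])
        moreover have "WW q ?m (ch ?m (Suc ?p) t' (u n (Suc ?p) f))"
          using W_u_Suc[OF P WI(1), of t'] hyp Suc by simp
        ultimately have "WW q ?m (s ?m i (ch ?m ?p t (u n ?p f)))" unfolding e by (intro Wadd Wscl)
        then show ?thesis by (rule W_mono[OF _ WI(2)])
      qed
    qed
  next
    case (WB y n d)
    then show ?case by (intro WW.WB B_s) simp_all
  next
    case (Wadd d n y y')
    have "s n i (add y y') = add (s n i y) (s n i y')" using Wadd.prems by (intro s_add W_G[OF Wadd.hyps(1)] W_G[OF Wadd.hyps(2)]) simp_all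
    moreover have "WW d n (s n i y)" by (rule Wadd.IH(1)[OF Wadd.prems])
    moreover have "WW d n (s n i y')" by (rule Wadd.IH(2)[OF Wadd.prems])
    ultimately show ?case by (simp add: WW.Wadd)
  next
    case (Wscl d n y c)
    have "s n i (scl c y) = scl c (s n i y)" using Wscl.prems by (intro s_scl W_G[OF Wscl.hyps(1)]) simp_all
    moreover have "WW d n (s n i y)" by (rule Wscl.IH[OF Wscl.prems])
    ultimately show ?case by (simp add: WW.Wscl)
  qed
qed

inductive VV :: "nat => nat => nat => 'm => bool" where
  VB: "y \<in> B n ==> VV q P n y"
| VI: "VV q p n f ==> q <= Suc p ==> Suc p <= P ==> p + t <= n ==> VV q P (Suc (Suc n)) (cr (Suc (Suc n)) (Suc p) t (u n (Suc p) f))"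
| Vadd: "VV q P n y ==> VV q P n y' ==> VV q P n (add y y')"
| Vscl: "VV q P n y ==> VV q P n (scl c y)"

lemma V_G: "VV q P n y ==> y \<in> G n"
  by (induction rule: VV.induct) (simp_all add: G_B G_add G_scl G_cr G_u)

lemma V_mono: "VV q P n y ==> q' <= q ==> P <= P' ==> VV q' P' n y"
proof (induction arbitrary: P' rule: VV.induct)
  case (VI q p n f P t)
  show ?case using VI.prems VI.hyps by (intro VV.VI[OF VI.IH]) simp_all
qed (auto intro: VB Vadd Vscl)

lemma V_r: "VV q P n y ==> P < i ==> i < n ==> VV q P n (r n i y)"
proof (induction arbitrary: i rule: VV.induct)
  case (VI q p n f P t)
  let ?p = "Suc p" and ?m = "Suc (Suc n)"
  have f: "f \<in> G n" by (rule V_G[OF VI.hyps(1)])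
  have uf: "u n ?p f \<in> G ?m" using f VI by (intro G_u) simp_all
  consider "i = ?p + t + 1" | t' where "t = Suc t'" "i = ?p + t" | "i < ?p + t" | "i \<ge> ?p + t + 2"
    using VI by (cases t; cases "i = ?p + t"; cases "i = ?p + t + 1") force+
  then show ?case
  proof cases
    case 1
    then have "r ?m i (cr ?m ?p t (u n ?p f)) = cr ?m ?p (Suc t) (u n ?p f)" by simp
    then show ?thesis using VV.VI[OF VI.hyps(1), of P "Suc t"] 1 VI by simp
  next
    case 2
    have g: "cr ?m ?p t' (u n ?p f) \<in> G ?m" using 2 VI uf by (intro G_cr) simp_all
    have "r ?m i (cr ?m ?p t (u n ?p f)) = add (scl D (cr ?m ?p t' (u n ?p f))) (scl E (cr ?m ?p t (u n ?p f)))"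
      using 2 VI r_quad[OF _ _ g, of i] by simp
    moreover have "VV q P ?m (cr ?m ?p t' (u n ?p f))" "VV q P ?m (cr ?m ?p t (u n ?p f))"
      using VV.VI[OF VI.hyps(1), of P t'] VV.VI[OF VI.hyps(1), of P t] 2 VI by simp_all
    ultimately show ?thesis by (simp add: Vadd Vscl)
  next
    case 3
    obtain i0 where i0: "i = Suc i0" using 3 VI by (cases i) simp_all
    have "r ?m i (cr ?m ?p t (u n ?p f)) = cr ?m ?p t (r ?m (Suc i) (u n ?p f))"
      using 3 VI uf r_cr_mid[of ?p i t ?m "u n ?p f"] by simp
    also have "r ?m (Suc i) (u n ?p f) = u n ?p (r n i0 f)"
      using r_u_hi[of ?p i0 n f] 3 i0 VI f by simp
    finally show ?thesis using VV.VI[OF VI.IH[of i0], of P t] 3 i0 VI by simp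
  next
    case 4
    obtain i0 where i0: "i = Suc (Suc i0)" using 4 le_Suc_ex[of 2 i] by auto
    have "r ?m i (cr ?m ?p t (u n ?p f)) = cr ?m ?p t (r ?m i (u n ?p f))"
      using 4 VI uf by (intro r_cr_hi) simp_all
    also have "r ?m i (u n ?p f) = u n ?p (r n i0 f)"
      using r_u_hi[of ?p i0 n f] 4 i0 VI f by simp
    finally show ?thesis using VV.VI[OF VI.IH[of i0], of P t] 4 i0 VI by simp
  qed
next
  case (VB y n q P)
  then show ?case by (intro VV.VB B_r) simp_all
next
  case (Vadd q P n y y')
  have "r n i (add y y') = add (r n i y) (r n i y')" using Vadd.prems by (intro r_add V_G[OF Vadd.hyps(1)] V_G[OF Vadd.hyps(2)]) simp_all
  then show ?case using Vadd.IH[OF Vadd.prems] by (simp add: VV.Vadd)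
next
  case (Vscl q P n y c)
  have "r n i (scl c y) = scl c (r n i y)" using Vscl.prems by (intro r_scl V_G[OF Vscl.hyps(1)]) simp_all
  then show ?case using Vscl.IH[OF Vscl.prems] by (simp add: VV.Vscl)
qed

lemma V_s: "VV q P n y ==> P < i ==> i < n ==> VV q P n (s n i y)"
  using s_r[of i n y] V_G[of q P n y] V_r[of q P n y i] by (simp add: Vadd Vscl)

lemma V_cr: "VV q P n y ==> P <= j ==> j + t < n ==> VV q P n (cr n j t y)"
  by (induction t) (simp_all add: V_r)
lemma V_ch: "VV q P n y ==> P <= j ==> j + t < n ==> VV q P n (ch n j t y)"
  by (induction t) (simp_all add: V_s)

lemma ch_split: "ch n j (k + l) y = ch n (j + k) l (ch n j k y)"
  by (induction l) (simp_all add: add.assoc)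

lemma ch_cr_lo: "1 <= j ==> j + t < p ==> p + t' <= n ==> y \<in> G n ==>
    ch (Suc (Suc n)) j t (cr (Suc (Suc n)) (Suc p) t' (u n (Suc p) y)) = cr (Suc (Suc n)) (Suc p) t' (u n (Suc p) (ch n j t y))"
proof (induction t)
  case (Suc t)
  have g: "ch n j t y \<in> G n" using Suc.prems by (intro G_ch) simp_all
  have ug: "u n (Suc p) (ch n j t y) \<in> G (Suc (Suc n))" using Suc.prems g G_u[of "Suc p" n] by simp
  have "s (Suc (Suc n)) (j + Suc t) (cr (Suc (Suc n)) (Suc p) t' (u n (Suc p) (ch n j t y)))
    = cr (Suc (Suc n)) (Suc p) t' (s (Suc (Suc n)) (j + Suc t) (u n (Suc p) (ch n j t y)))"
    using Suc.prems ug by (intro s_cr_lo) simp_all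
  also have "s (Suc (Suc n)) (j + Suc t) (u n (Suc p) (ch n j t y)) = u n (Suc p) (s n (j + Suc t) (ch n j t y))"
    using Suc.prems g by (intro s_u_lo) simp_all
  finally show ?case using Suc by simp
qed simp

lemma V_u:
  "VV q P n v ==> 1 <= q ==> q + t <= n + 1 ==> q <= P' ==> P + 2 <= P' \<or> P + 1 <= P' \<and> P + 1 <= q + t ==>
    VV q P' (Suc (Suc n)) (ch (Suc (Suc n)) q t (u n q v))"
proof (induction arbitrary: t P' rule: VV.induct)
  case (VB y n q P)
  obtain q0 where q0: "q = Suc q0" using VB by (cases q) simp_all
  have "VV q q (Suc (Suc n)) (u n q y)"
    using VV.VI[OF VV.VB[OF VB.hyps], of q q0 q 0] q0 VB by simp
  then have "VV q q (Suc (Suc n)) (ch (Suc (Suc n)) q t (u n q y))" using VB by (intro V_ch) simp_all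
  then show ?case by (rule V_mono) (use VB in simp_all)
next
  case (VI q p n f P t')
  let ?p = "Suc p" and ?n = "Suc (Suc n)" and ?m = "Suc (Suc (Suc (Suc n)))"
  have f: "f \<in> G n" by (rule V_G[OF VI.hyps(1)])
  have uf: "u n q f \<in> G ?n" using f VI G_u[of q n f] by simp
  have upf: "u n ?p f \<in> G ?n" using f VI G_u[of ?p n f] by simp
  have sh: "k <= t' ==> u ?n q (cr ?n ?p k (u n ?p f)) = cr ?m (Suc (Suc ?p)) k (u ?n q (u n ?p f))" for k
  proof (induction k)
    case (Suc k)
    have g: "cr ?n ?p k (u n ?p f) \<in> G ?n" using Suc.prems VI upf by (intro G_cr) simp_all
    have "u ?n q (r ?n (?p + Suc k) (cr ?n ?p k (u n ?p f))) = r ?m (?p + Suc k + 2) (u ?n q (cr ?n ?p k (u n ?p f)))"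
      using r_u_hi[of q "?p + Suc k" ?n "cr ?n ?p k (u n ?p f)"] Suc.prems VI g by simp
    then show ?case using Suc by simp
  qed simp
  have uu: "u ?n q (u n ?p f) = scl eps (u ?n (Suc (Suc ?p)) (u n q f))" using u_u[of q ?p n f] VI f by simp
  have u3: "u ?n (Suc (Suc ?p)) (u n q f) \<in> G ?m" using G_u[of "Suc (Suc ?p)" ?n "u n q f"] uf VI by simp
  have c3: "cr ?m (Suc (Suc ?p)) t' (u ?n (Suc (Suc ?p)) (u n q f)) \<in> G ?m" using u3 VI by (intro G_cr) simp_all
  have "ch ?m q t (u ?n q (cr ?n ?p t' (u n ?p f))) = scl eps (ch ?m q t (cr ?m (Suc (Suc ?p)) t' (u ?n (Suc (Suc ?p)) (u n q f))))"
    using sh[of t'] uu u3 c3 VI by (simp add: cr_scl ch_scl)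
  moreover have "VV q P' ?m (ch ?m q t (cr ?m (Suc (Suc ?p)) t' (u ?n (Suc (Suc ?p)) (u n q f))))"
  proof (cases "q + t <= ?p")
    case True
    have y: "VV q (Suc ?p) ?n (ch ?n q t (u n q f))" using VI True by (intro VI.IH) simp_all
    have e: "ch ?m q t (cr ?m (Suc (Suc ?p)) t' (u ?n (Suc (Suc ?p)) (u n q f))) = cr ?m (Suc (Suc ?p)) t' (u ?n (Suc (Suc ?p)) (ch ?n q t (u n q f)))"
      using True VI uf by (intro ch_cr_lo) simp_all
    show ?thesis unfolding e using VI True by (intro VV.VI[OF y]) simp_all
  next
    case False
    define k where "k = ?p - q"
    define l where "l = q + t - ?p - 1"
    have qk: "q + k = ?p" "t = k + Suc l" using False VI by (simp_all add: k_def l_def)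
    define w where "w = ch ?n q k (u n q f)"
    have y: "VV q ?p ?n w" unfolding w_def using VI qk by (intro VI.IH) simp_all
    have yG: "w \<in> G ?n" by (rule V_G[OF y])
    have uw: "u ?n (Suc ?p) w \<in> G ?m" "u ?n (Suc (Suc ?p)) w \<in> G ?m" using G_u[of "Suc ?p" ?n w] G_u[of "Suc (Suc ?p)" ?n w] yG VI by simp_all
    have ruw: "r ?m (Suc (Suc ?p)) (u ?n (Suc ?p) w) \<in> G ?m" using uw VI by (intro G_r) simp_all
    have e1: "ch ?m q k (cr ?m (Suc (Suc ?p)) t' (u ?n (Suc (Suc ?p)) (u n q f))) = cr ?m (Suc (Suc ?p)) t' (u ?n (Suc (Suc ?p)) w)"
      unfolding w_def using qk VI uf by (intro ch_cr_lo) simp_all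
    have cc: "cr ?m (Suc (Suc ?p)) k (r ?m (Suc (Suc ?p)) v) = cr ?m (Suc ?p) (Suc k) v" for k v by (induction k) simp_all
    have "s ?m (Suc ?p) (cr ?m (Suc (Suc ?p)) t' (u ?n (Suc (Suc ?p)) w)) = cr ?m (Suc (Suc ?p)) t' (s ?m (Suc ?p) (u ?n (Suc (Suc ?p)) w))"
      using VI uw by (intro s_cr_lo) simp_all
    also have "s ?m (Suc ?p) (u ?n (Suc (Suc ?p)) w) = add (scl z (u ?n (Suc ?p) w)) (scl x (r ?m (Suc (Suc ?p)) (u ?n (Suc ?p) w)))"
      using VI yG by (intro s_u1_r) simp_all
    finally have e2: "s ?m (Suc ?p) (cr ?m (Suc (Suc ?p)) t' (u ?n (Suc (Suc ?p)) w)) =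
        add (scl z (cr ?m (Suc (Suc ?p)) t' (u ?n (Suc ?p) w))) (scl x (cr ?m (Suc ?p) (Suc t') (u ?n (Suc ?p) w)))"
      using VI uw ruw by (simp add: cr_add cr_scl G_scl cc del: cr.simps)
    have v0: "VV q (Suc ?p) ?m (u ?n (Suc ?p) w)" using VV.VI[OF y, of "Suc ?p" 0] VI by simp
    have v1: "VV q (Suc ?p) ?m (cr ?m (Suc (Suc ?p)) t' (u ?n (Suc ?p) w))" using v0 VI by (intro V_cr) simp_all
    have v2: "VV q (Suc ?p) ?m (cr ?m (Suc ?p) (Suc t') (u ?n (Suc ?p) w))" using VI by (intro VV.VI[OF y]) simp_all
    have "VV q (Suc ?p) ?m (s ?m (Suc ?p) (cr ?m (Suc (Suc ?p)) t' (u ?n (Suc (Suc ?p)) w)))"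
      unfolding e2 by (intro Vadd Vscl v1 v2)
    then have "VV q (Suc ?p) ?m (ch ?m (Suc ?p) l (s ?m (Suc ?p) (cr ?m (Suc (Suc ?p)) t' (u ?n (Suc (Suc ?p)) w))))"
      using VI qk by (intro V_ch) simp_all
    moreover have "ch ?m q t (cr ?m (Suc (Suc ?p)) t' (u ?n (Suc (Suc ?p)) (u n q f)))
      = ch ?m (Suc ?p) l (s ?m (Suc ?p) (cr ?m (Suc (Suc ?p)) t' (u ?n (Suc (Suc ?p)) w)))"
    proof -
      have "ch ?m ?p (Suc l) v = ch ?m (Suc ?p) l (s ?m (Suc ?p) v)" for v by (induction l) simp_all
      then show ?thesis unfolding qk(2) ch_split qk(1) e1 by simp
    qed
    ultimately have "VV q (Suc ?p) ?m (ch ?m q t (cr ?m (Suc (Suc ?p)) t' (u ?n (Suc (Suc ?p)) (u n q f))))" by simp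
    then show ?thesis by (rule V_mono) (use VI.hyps VI.prems in auto)
  qed
  ultimately show ?case by (simp add: Vscl)
next
  case (Vadd q P n y y')
  have g: "y \<in> G n" "y' \<in> G n" "u n q y \<in> G (Suc (Suc n))" "u n q y' \<in> G (Suc (Suc n))"
    using V_G[OF Vadd.hyps(1)] V_G[OF Vadd.hyps(2)] G_u[of q n] Vadd.prems by simp_all
  have "ch (Suc (Suc n)) q t (u n q (add y y')) = add (ch (Suc (Suc n)) q t (u n q y)) (ch (Suc (Suc n)) q t (u n q y'))"
    using g Vadd.prems by (simp add: u_add ch_add)
  then show ?case using Vadd.IH[OF Vadd.prems] by (simp add: VV.Vadd)
next
  case (Vscl q P n y c)
  have g: "y \<in> G n" "u n q y \<in> G (Suc (Suc n))"
    using V_G[OF Vscl.hyps(1)] G_u[of q n] Vscl.prems by simp_all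
  have "ch (Suc (Suc n)) q t (u n q (scl c y)) = scl c (ch (Suc (Suc n)) q t (u n q y))"
    using g Vscl.prems by (simp add: u_scl ch_scl)
  then show ?case using Vscl.IH[OF Vscl.prems] by (simp add: VV.Vscl)
qed

lemma W_V: "WW d n y ==> \<exists>P. VV (Suc d) P n y"
proof (induction rule: WW.induct)
  case (WB y n d)
  then show ?case by (intro exI VV.VB)
next
  case (WI q n f d t)
  then obtain P where P: "VV (Suc q) P n f" by blast
  have "VV (Suc q) (P + q + 2) (Suc (Suc n)) (ch (Suc (Suc n)) (Suc q) t (u n (Suc q) f))"
    using WI by (intro V_u[OF P]) simp_all
  then have "VV (Suc d) (P + q + 2) (Suc (Suc n)) (ch (Suc (Suc n)) (Suc q) t (u n (Suc q) f))"
    by (rule V_mono) (use WI in simp_all)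
  then show ?case by blast
next
  case (Wadd d n y y')
  then obtain P P' where P: "VV (Suc d) P n y" "VV (Suc d) P' n y'" by blast
  have "VV (Suc d) (P + P') n (add y y')"
    by (intro VV.Vadd V_mono[OF P(1)] V_mono[OF P(2)]) simp_all
  then show ?case by blast
next
  case (Wscl d n y c)
  then show ?case by (blast intro: VV.Vscl)
qed

end

section \<open>Words in the Hecke generators\<close>

inductive weq :: "nat list => nat list => bool" where
  weq_braid: "weq (x @ [i, Suc i, i] @ y) (x @ [Suc i, i, Suc i] @ y)"
| weq_far: "i + 2 <= j ==> weq (x @ [i, j] @ y) (x @ [j, i] @ y)"
| weq_refl: "weq x x"
| weq_sym: "weq x y ==> weq y x"
| weq_trans: "weq x y ==> weq y z ==> weq x z"

lemma weq_append: "weq u v ==> weq (x @ u @ y) (x @ v @ y)"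
proof (induction rule: weq.induct)
  case (weq_braid x' i y')
  then show ?case using weq.weq_braid[of "x @ x'" i "y' @ y"] by simp
next
  case (weq_far i j x' y')
  then show ?case using weq.weq_far[of i j "x @ x'" "y' @ y"] by simp
next
  case (weq_trans u v w)
  show ?case by (rule weq.weq_trans[OF weq_trans.IH])
qed (auto intro: weq_refl weq_sym)

lemma weq_cons: "weq u v ==> weq (i # u) (i # v)" using weq_append[of u v "[i]" "[]"] by simp
lemma weq_app_l: "weq u v ==> weq (x @ u) (x @ v)" using weq_append[of u v x "[]"] by simp
lemma weq_app_r: "weq u v ==> weq (u @ y) (v @ y)" using weq_append[of u v "[]" y] by simp

lemma weq_set: "weq u v ==> set u = set v" by (induction rule: weq.induct) auto
lemma weq_len: "weq u v ==> length u = length v" by (induction rule: weq.induct) auto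

lemma word_perm_append: "word_perm (u @ v) = word_perm u \<circ> word_perm v"
  unfolding word_perm_def by (induction u) (simp_all add: comp_assoc)
lemma word_perm_Cons: "word_perm (i # v) = transpose i (Suc i) \<circ> word_perm v" by (simp add: word_perm_def)
lemma word_perm_Nil [simp]: "word_perm [] = id" by (simp add: word_perm_def)

lemma weq_perm: "weq u v ==> word_perm u = word_perm v"
proof (induction rule: weq.induct)
  case (weq_braid x i y)
  have "word_perm [i, Suc i, i] = word_perm [Suc i, i, Suc i]"
    by (auto simp: word_perm_def fun_eq_iff transpose_def)
  then show ?case unfolding word_perm_append by simp
next
  case (weq_far i j x y)
  then have "word_perm [i, j] = word_perm [j, i]"
    by (auto simp: word_perm_def fun_eq_iff transpose_def)
  then show ?case unfolding word_perm_append by simp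
qed simp_all

lemma weq_move: "(\<And>k. k \<in> set u ==> i + 2 <= k \<or> k + 2 <= i) ==> weq (i # u) (u @ [i])"
proof (induction u)
  case (Cons k u)
  have "weq (i # k # u) (k # i # u)"
  proof (cases "i + 2 <= k")
    case True
    then show ?thesis using weq_far[of i k "[]" u] by simp
  next
    case False
    then have "k + 2 <= i" using Cons.prems[of k] by simp
    then show ?thesis using weq_sym[OF weq_far[of k i "[]" u]] by simp
  qed
  moreover have "weq (k # i # u) (k # u @ [i])" using Cons by (intro weq_cons Cons.IH) simp
  ultimately show ?case using weq_trans by simp
qed (simp add: weq_refl)

lemma weq_pass:
  assumes "j < i" "i < n"
  shows "weq (i # [j..<n]) ([j..<n] @ [i - 1])"
proof -
  obtain i0 where i: "i = Suc i0" using assms by (cases i) simp_all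
  let ?x = "[j..<i0]" and ?y = "[Suc (Suc i0)..<n]"
  have s: "[j..<n] = ?x @ [i0, Suc i0] @ ?y"
    using assms i upt_add_eq_append[of j i0 "n - i0"] by (simp add: upt_conv_Cons)
  have 1: "weq (i # ?x) (?x @ [i])" using i by (intro weq_move) auto
  have 3: "weq (i0 # ?y) (?y @ [i0])" by (intro weq_move) auto
  have "weq (i # [j..<n]) ((?x @ [i]) @ [i0, Suc i0] @ ?y)" using weq_app_r[OF 1, of "[i0, Suc i0] @ ?y"] s by simp
  moreover have "weq ((?x @ [i]) @ [i0, Suc i0] @ ?y) (?x @ [i0, Suc i0, i0] @ ?y)"
    using weq_sym[OF weq_braid[of ?x i0 ?y]] i by simp
  moreover have "weq (?x @ [i0, Suc i0, i0] @ ?y) (?x @ [i0, Suc i0] @ ?y @ [i0])"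
    using weq_app_l[OF 3, of "?x @ [i0, Suc i0]"] by simp
  ultimately have "weq (i # [j..<n]) (?x @ [i0, Suc i0] @ ?y @ [i0])" using weq_trans by blast
  then show ?thesis using s i by simp
qed

declare upt_Suc [simp del]

primrec NF :: "nat => nat list set" where
  "NF 0 = {[]}"
| "NF (Suc r) = {[j..<Suc r] @ v | j v. 1 <= j \<and> j <= Suc r \<and> v \<in> NF r}"

lemma NF_set: "v \<in> NF r ==> set v \<subseteq> {1..<r}"
proof (induction r arbitrary: v)
  case (Suc r)
  then obtain j w where "v = [j..<Suc r] @ w" "1 <= j" "w \<in> NF r" by auto
  with Suc.IH[of w] show ?case by auto
qed simp

lemma NF_nil: "[] \<in> NF r"
proof (induction r)
  case (Suc r)
  then show ?case unfolding NF.simps mem_Collect_eq by (intro exI[of _ "Suc r"] exI[of _ "[]"]) simp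
qed simp

lemma NF_step: "w \<in> NF r ==> 1 <= i ==> i < r ==> \<exists>w'\<in>NF r. weq (i # w) w' \<or> weq (i # w') w"
proof (induction r arbitrary: w i)
  case (Suc r)
  obtain j v where w: "w = [j..<Suc r] @ v" and j: "1 <= j" "j <= Suc r" and v: "v \<in> NF r" using Suc.prems by auto
  have mem: "[j'..<Suc r] @ v' \<in> NF (Suc r)" if "1 <= j'" "j' <= Suc r" "v' \<in> NF r" for j' v' using that by auto
  have key: "\<exists>w'\<in>NF (Suc r). weq (i # w) w' \<or> weq (i # w') w"
    if p: "weq (i # [j..<Suc r]) ([j..<Suc r] @ [i'])" and i': "1 <= i'" "i' < r" for i'
  proof -
    have q: "weq (i # [j..<Suc r] @ x) ([j..<Suc r] @ i' # x)" for x using weq_app_r[OF p, of x] by simp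
    obtain v' where v': "v' \<in> NF r" "weq (i' # v) v' \<or> weq (i' # v') v" using Suc.IH[OF v i'] by blast
    from v'(2) show ?thesis
    proof
      assume "weq (i' # v) v'"
      then have "weq (i # w) ([j..<Suc r] @ v')" unfolding w by (rule weq_trans[OF q weq_app_l])
      then show ?thesis using mem[OF j v'(1)] by blast
    next
      assume "weq (i' # v') v"
      then have "weq (i # [j..<Suc r] @ v') w" unfolding w by (rule weq_trans[OF q weq_app_l])
      then show ?thesis using mem[OF j v'(1)] by blast
    qed
  qed
  consider "i + 1 = j" | "i = j" | "i + 1 < j" | "j < i" by linarith
  then show ?case
  proof cases
    case 1
    then have "i # w = [i..<Suc r] @ v" using w Suc.prems by (simp add: upt_conv_Cons)
    then show ?thesis using mem[of i v] v Suc.prems weq_refl by (metis less_imp_le)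
  next
    case 2
    then have "i # [Suc j..<Suc r] @ v = w" using w Suc.prems by (simp add: upt_conv_Cons)
    then show ?thesis using mem[of "Suc j" v] 2 v Suc.prems weq_refl by (metis Suc_leI le_SucI)
  next
    case 3
    then have p: "weq (i # [j..<Suc r]) ([j..<Suc r] @ [i])" by (intro weq_move) auto
    show ?thesis by (rule key[OF p]) (use 3 j Suc.prems in linarith)+
  next
    case 4
    then have p: "weq (i # [j..<Suc r]) ([j..<Suc r] @ [i - 1])" using Suc.prems by (intro weq_pass)
    show ?thesis by (rule key[OF p]) (use 4 j Suc.prems in linarith)+
  qed
qed simp

lemma reduced_tail:
  assumes "reduced_word r (i # u)"
  shows "reduced_word r u"
proof -
  have i: "1 <= i" "i < r" "set u \<subseteq> {1..<r}" using reduced_wordD(1)[OF assms] by simp_all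
  have "length u <= length v" if v: "set v \<subseteq> {1..<r}" "word_perm v = word_perm u" for v
  proof -
    have "length (i # u) <= length (i # v)"
      using v i by (intro reduced_wordD(2)[OF assms]) (simp_all add: word_perm_Cons)
    then show ?thesis by simp
  qed
  then show ?thesis unfolding reduced_word_def using i by blast
qed

lemma reduced_NF: "reduced_word r u ==> \<exists>w\<in>NF r. weq u w"
proof (induction u)
  case Nil
  then show ?case using NF_nil weq_refl by blast
next
  case (Cons i u)
  have i: "1 <= i" "i < r" using reduced_wordD(1)[OF Cons.prems] by simp_all
  obtain w where w: "w \<in> NF r" "weq u w" using Cons.IH[OF reduced_tail[OF Cons.prems]] by blast
  obtain w' where w': "w' \<in> NF r" "weq (i # w) w' \<or> weq (i # w') w" using NF_step[OF w(1) i] by blast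
  from w'(2) show ?case
  proof
    assume "weq (i # w) w'"
    then show ?thesis using weq_trans[OF weq_cons[OF w(2)]] w'(1) by blast
  next
    assume d: "weq (i # w') w"
    have "word_perm u = transpose i (Suc i) \<circ> word_perm w'"
      using weq_perm[OF w(2)] weq_perm[OF d] by (simp add: word_perm_Cons)
    then have "word_perm w' = word_perm (i # u)" unfolding word_perm_Cons by (simp add: fun_eq_iff)
    then have "length (i # u) <= length w'"
      using NF_set[OF w'(1)] by (intro reduced_wordD(2)[OF Cons.prems]) simp_all
    then show ?thesis using weq_len[OF w(2)] weq_len[OF d] by simp
  qed
qed

lemma word_perm_inj: "inj (word_perm w)"
proof (induction w)
  case (Cons i w)
  show ?case unfolding word_perm_Cons by (rule inj_compose[OF inj_transpose Cons.IH])
qed simp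

lemma word_perm_permutes: "set w \<subseteq> {1..<r} ==> word_perm w permutes {1..r}"
proof (induction w)
  case (Cons i w)
  have "transpose i (Suc i) permutes {1..r}" using Cons.prems by (intro permutes_swap_id) auto
  then show ?case unfolding word_perm_Cons using Cons.prems by (intro permutes_compose Cons.IH) simp_all
qed (simp add: permutes_id)

lemma word_perm_block: "word_perm [j..<j + k] (j + k) = j"
proof (induction k arbitrary: j)
  case (Suc k)
  have "[j..<j + Suc k] = j # [Suc j..<Suc j + k]" by (simp add: upt_conv_Cons)
  then show ?case using Suc.IH[of "Suc j"] by (simp add: word_perm_Cons)
qed simp

lemma NF_inj: "v \<in> NF r ==> w \<in> NF r ==> word_perm v = word_perm w ==> v = w"
proof (induction r arbitrary: v w)
  case (Suc r)
  obtain j v' where v: "v = [j..<Suc r] @ v'" "1 <= j" "j <= Suc r" "v' \<in> NF r" using Suc.prems by auto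
  obtain l w' where w: "w = [l..<Suc r] @ w'" "1 <= l" "l <= Suc r" "w' \<in> NF r" using Suc.prems by auto
  have f: "word_perm x (Suc r) = Suc r" if "x \<in> NF r" for x
    using permutes_not_in[OF word_perm_permutes[OF NF_set[OF that]], of "Suc r"] by simp
  have "word_perm v (Suc r) = j" using word_perm_block[of j "Suc r - j"] v f[OF v(4)] by (simp add: word_perm_append)
  moreover have "word_perm w (Suc r) = l" using word_perm_block[of l "Suc r - l"] w f[OF w(4)] by (simp add: word_perm_append)
  ultimately have jl: "j = l" using Suc.prems by simp
  have "word_perm [j..<Suc r] \<circ> word_perm v' = word_perm [j..<Suc r] \<circ> word_perm w'"
    using Suc.prems(3) unfolding v(1) w(1) jl word_perm_append .
  note eq = fun_cong[OF this, unfolded comp_apply]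
  have "word_perm v' = word_perm w'" by (rule ext, rule injD[OF word_perm_inj eq])
  then show ?case using Suc.IH[OF v(4) w(4)] v w jl by simp
qed simp

lemma NF_system:
  assumes W: "reduced_word_system W" and w: "w \<in> NF r"
  shows "\<exists>w0\<in>W r. weq w0 w"
proof -
  obtain w0 where w0: "w0 \<in> W r" "word_perm w0 = word_perm w"
    using ex1_implies_ex[OF reduced_systemD(2)[OF W word_perm_permutes[OF NF_set[OF w]]]] by (elim exE conjE)
  obtain w1 where w1: "w1 \<in> NF r" "weq w0 w1" using reduced_NF[OF reduced_systemD(1)[OF W w0(1)]] by blast
  have "w1 = w" using NF_inj[OF w1(1) w] weq_perm[OF w1(2)] w0(2) by simp
  then show ?thesis using w0 w1 by blast
qed

context bpres
begin

primrec wd :: "nat => nat list => 'k expr set" where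
  "wd r [] = ID r" | "wd r (i # w) = CM (sG r i) (wd r w)"

lemma cl_word: "cl (word_expr r w) = wd r w"
  by (induction w) (simp_all add: cl_comp[symmetric] cl_expr_s)

lemma wd_TT: "set w \<subseteq> {1..<r} ==> wd r w \<in> TT r r"
  by (induction w) (auto intro!: TT_CM TT_sG)
lemma wd_append: "set u \<subseteq> {1..<r} ==> set v \<subseteq> {1..<r} ==> wd r (u @ v) = CM (wd r u) (wd r v)"
proof (induction u)
  case Nil
  then show ?case using wd_TT[of v r] by simp
next
  case (Cons i u)
  then show ?case using wd_TT[of u r] wd_TT[of v r] by (simp add: CM_assoc)
qed

lemma wd_weq: "weq u v ==> set u \<subseteq> {1..<r} ==> wd r u = wd r v"
proof (induction rule: weq.induct)
  case (weq_braid x i y)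
  have s: "1 <= i" "i + 2 <= r" using weq_braid by auto
  have "wd r [i, Suc i, i] = wd r [Suc i, i, Suc i]"
    using law_braid[OF s] TT_sG[of i r] TT_sG[of "Suc i" r] s by simp
  moreover have "set x \<subseteq> {1..<r}" "set y \<subseteq> {1..<r}" "set [i, Suc i, i] \<subseteq> {1..<r}" "set [Suc i, i, Suc i] \<subseteq> {1..<r}" using weq_braid by auto
  ultimately show ?case by (simp add: wd_append del: wd.simps append.simps set_simps)
next
  case (weq_far i j x y)
  have s: "1 <= i" "j < r" using weq_far by auto
  have "wd r [i, j] = wd r [j, i]"
    using law_ss[OF s(1) weq_far(1) s(2)] TT_sG[of i r] TT_sG[of j r] s weq_far(1) by simp
  moreover have "set x \<subseteq> {1..<r}" "set y \<subseteq> {1..<r}" "set [i, j] \<subseteq> {1..<r}" "set [j, i] \<subseteq> {1..<r}" using weq_far by auto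
  ultimately show ?case by (simp add: wd_append del: wd.simps append.simps set_simps)
next
  case (weq_sym x y)
  then show ?case using weq_set[OF weq_sym.hyps] by simp
next
  case (weq_trans x y z)
  then show ?case using weq_set[OF weq_trans.hyps(1)] by simp
qed simp

inductive_set spn :: "nat => nat => 'k expr set set => 'k expr set set" for m n and S :: "'k expr set set" where
  spn_gen: "x \<in> S ==> x \<in> spn m n S"
| spn_zero: "ZE m n \<in> spn m n S"
| spn_add: "x \<in> spn m n S ==> y \<in> spn m n S ==> AD x y \<in> spn m n S"
| spn_scl: "x \<in> spn m n S ==> SC c x \<in> spn m n S"

lemma spn_TT: "S \<subseteq> TT m n ==> x \<in> spn m n S ==> x \<in> TT m n"
  by (rotate_tac, induction rule: spn.induct) auto

definition "hecke r = spn r r {wd r w | w. set w \<subseteq> {1..<r}}"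

lemma hecke_TT: "x \<in> hecke r ==> x \<in> TT r r"
  unfolding hecke_def by (erule spn_TT[rotated]) (blast intro: wd_TT)

lemma hecke_l: "x \<in> hecke r ==> 1 <= i ==> i < r ==> CM (sG r i) x \<in> hecke r"
  unfolding hecke_def
proof (induction rule: spn.induct)
  case (spn_gen x)
  then obtain w where "x = wd r w" "set w \<subseteq> {1..<r}" by auto
  then have "CM (sG r i) x = wd r (i # w)" "set (i # w) \<subseteq> {1..<r}" using spn_gen by auto
  then show ?case by (intro spn.spn_gen) blast
next
  case spn_zero
  then show ?case using TT_sG[of i r] by (simp add: CM_ZE_r spn.spn_zero)
next
  case (spn_add x y)
  have "x \<in> TT r r" "y \<in> TT r r" using spn_add hecke_TT unfolding hecke_def by blast+
  then show ?case using spn_add by (simp add: CM_AD_r[of _ _ r r] spn.spn_add)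
next
  case (spn_scl x c)
  have "x \<in> TT r r" using spn_scl hecke_TT unfolding hecke_def by blast
  then show ?case using spn_scl by (simp add: spn.spn_scl)
qed

lemma hecke_r: "x \<in> hecke r ==> 1 <= i ==> i < r ==> CM x (sG r i) \<in> hecke r"
  unfolding hecke_def
proof (induction rule: spn.induct)
  case (spn_gen x)
  then obtain w where w: "x = wd r w" "set w \<subseteq> {1..<r}" by auto
  then have "CM x (sG r i) = wd r (w @ [i])" using spn_gen TT_sG[of i r] by (simp add: wd_append)
  moreover have "set (w @ [i]) \<subseteq> {1..<r}" using w spn_gen by auto
  ultimately show ?case by (intro spn.spn_gen) blast
next
  case spn_zero
  then show ?case using TT_sG[of i r] by (simp add: CM_ZE_l spn.spn_zero)
next
  case (spn_add x y)
  have "x \<in> TT r r" "y \<in> TT r r" using spn_add hecke_TT unfolding hecke_def by blast+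
  then show ?case using spn_add by (simp add: CM_AD_l[of _ _ r r] spn.spn_add)
next
  case (spn_scl x c)
  have "x \<in> TT r r" using spn_scl hecke_TT unfolding hecke_def by blast
  then show ?case using spn_scl by (simp add: spn.spn_scl)
qed

lemma hecke_ID: "ID r \<in> hecke r"
  unfolding hecke_def by (intro spn.spn_gen CollectI exI[of _ "[]"]) simp

lemma hecke_W:
  assumes c: "p_c P = 0" and W: "reduced_word_system W" and x: "x \<in> hecke r"
  shows "x \<in> spn r r (wd r ` W r)"
proof -
  let ?N = "spn r r (wd r ` W r)"
  have WT: "wd r ` W r \<subseteq> TT r r"
    by (intro image_subsetI wd_TT reduced_wordD(1)[OF reduced_systemD(1)[OF W]])
  have nf: "wd r w \<in> ?N" if "w \<in> NF r" for w
  proof -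
    obtain w0 where w0: "w0 \<in> W r" "weq w0 w" using NF_system[OF W \<open>w \<in> NF r\<close>] by blast
    then have "wd r w0 = wd r w" by (intro wd_weq reduced_wordD(1)[OF reduced_systemD(1)[OF W]])
    then show ?thesis using w0 by (intro spn.spn_gen) (metis imageI)
  qed
  let ?N' = "spn r r (wd r ` NF r)"
  have NT: "wd r ` NF r \<subseteq> TT r r" by (intro image_subsetI wd_TT NF_set)
  have cl: "y \<in> ?N' ==> CM (sG r i) y \<in> ?N'" if i: "1 <= i" "i < r" for i y
  proof (induction rule: spn.induct)
    case (spn_gen y)
    then obtain w where w: "y = wd r w" "w \<in> NF r" by auto
    note wT = wd_TT[OF NF_set[OF w(2)]]
    obtain w' where w': "w' \<in> NF r" "weq (i # w) w' \<or> weq (i # w') w" using NF_step[OF w(2) i] by blast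
    have s': "set (i # w) \<subseteq> {1..<r}" "set (i # w') \<subseteq> {1..<r}" using NF_set[OF w(2)] NF_set[OF w'(1)] i by auto
    from w'(2) show ?case
    proof
      assume "weq (i # w) w'"
      then have "wd r (i # w) = wd r w'" using s' by (intro wd_weq)
      then show ?thesis using w w' by (auto intro: spn.spn_gen)
    next
      assume "weq (i # w') w"
      then have e: "wd r w = CM (sG r i) (wd r w')" using wd_weq[of "i # w'" w r] s' by simp
      have r2: "r - 2 + 2 = r" using i by simp
      have t: "wd r w' \<in> TT r r" "sG r i \<in> TT r r" "CM (uG (r - 2) i) (cG (r - 2) i) \<in> TT r r"
        using wd_TT[OF NF_set[OF w'(1)]] TT_sG[OF i] TT_CM[OF TT_uG[of i "r - 2"] TT_cG[of i "r - 2"], unfolded r2] i by simp_all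
      have "CM (sG r i) (sG r i) = AD (SC (p_a P) (ID r)) (SC (p_b P) (sG r i))"
        using law_quad[of i r] i c t by (simp add: SC_0[of _ r r] AD_ZE[of _ r r])
      then have E: "CM (sG r i) (wd r w) = AD (SC (p_a P) (wd r w')) (SC (p_b P) (wd r w))"
        unfolding e using t by (simp add: CM_assoc[symmetric] CM_AD_l[of _ _ r r] CM_ID_l[of _ r r])
      show ?thesis unfolding w(1) E by (intro spn.spn_add spn.spn_scl spn.spn_gen imageI w(2) w'(1))
    qed
  next
    case spn_zero
    then show ?case using TT_sG[of i r] i by (simp add: CM_ZE_r spn.spn_zero)
  next
    case (spn_add x y)
    then show ?case using spn_TT[OF NT] by (simp add: CM_AD_r[of _ _ r r] spn.spn_add)
  next
    case (spn_scl x c)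
    have "x \<in> TT r r" by (rule spn_TT[OF NT spn_scl.hyps])
    then show ?case using spn_scl by (simp add: spn.spn_scl)
  qed
  have 1: "wd r w \<in> ?N'" if "set w \<subseteq> {1..<r}" for w
    using that
  proof (induction w)
    case Nil
    then show ?case using NF_nil by (auto intro!: spn.spn_gen image_eqI[of _ _ "[]"])
  next
    case (Cons i w)
    then show ?case using cl[of i "wd r w"] by simp
  qed
  have 2: "x \<in> ?N'" using x unfolding hecke_def
    by (induction rule: spn.induct) (auto intro: 1[unfolded One_nat_def] spn.spn_zero spn.spn_add spn.spn_scl)
  show ?thesis using 2
    by (induction rule: spn.induct) (auto intro: nf spn.spn_zero spn.spn_add spn.spn_scl)
qed

end

section \<open>Spanning by standard expressions\<close>

locale cup_module_gen = cup_module +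
  fixes h1 h2 h3
  assumes u_gen: "1 <= i ==> i <= n ==> y \<in> G n ==> u n (Suc i) y =
    add (add (scl h1 (u n i y)) (scl h2 (r (Suc (Suc n)) (Suc i) (u n i y)))) (scl h3 (r (Suc (Suc n)) i (r (Suc (Suc n)) (Suc i) (u n i y))))"
begin

lemma W_r: "WW d n y ==> d < i ==> i < n ==> WW d n (r n i y)"
  using r_s[of i n y] W_G[of d n y] W_s[of d n y i] by (simp add: Wadd Wscl)

lemma W_u: "WW 0 n y ==> 1 <= i ==> i <= n + 1 ==> WW 0 (Suc (Suc n)) (u n i y)"
proof (induction i)
  case (Suc i)
  show ?case
  proof (cases "i = 0")
    case True
    then show ?thesis using WI[OF Suc.prems(1), of 0 0] by simp
  next
    case False
    then have "WW 0 (Suc (Suc n)) (u n i y)" using Suc by simp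
    then show ?thesis using u_gen[OF _ _ W_G[OF Suc.prems(1)], of i] False Suc.prems by (simp add: Wadd Wscl W_r)
  qed
qed simp

lemma W_ch: "WW 0 n y ==> j + t < n ==> WW 0 n (ch n j t y)"
  by (induction t) (simp_all add: W_s)

end

locale good_pres = bpres p P for p and P :: "'k::field params" +
  assumes a0: "p_a P \<noteq> 0" and b0: "p_b P \<noteq> 0" and e2: "p_e P * p_e P = - psign p" and c0: "p_c P = 0" and d: "p_d P = - p_e P * p_b P"
    and f: "p_f P = 0" and F: "p_F P = - psign p * p_e P * p_a P" and lam': "p_lam' P \<noteq> 0"
    and d': "p_d' P = 0" and e': "p_e' P = - psign p * p_e P" and f': "p_f' P = p_b P"
    and D': "p_D' P = 0" and E': "p_E' P = 0" and F': "p_F' P = p_e P * p_a P"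
    and sig0: "p_sig P \<noteq> 0" and sig': "p_sig' P = psign p * p_sig P"
begin

abbreviation "a \<equiv> p_a P"
abbreviation "b \<equiv> p_b P"
abbreviation "e \<equiv> p_e P"

lemma eps0: "eps \<noteq> 0" by (simp add: psign_def)
lemma e0: "e \<noteq> 0" using e2 eps0 by auto
lemma F0: "p_F P \<noteq> 0" using F e0 a0 eps0 by simp

lemma CM2: "CM X Y = Z ==> X \<in> Cl ==> Y \<in> Cl ==> y \<in> Cl ==> CM X (CM Y y) = CM Z y"
  by (simp add: CM_assoc[symmetric])

lemma r2: "i < r ==> 1 <= i ==> r - 2 + 2 = (r::nat)" by simp

lemma quad0: "1 <= i ==> i < n ==> CM (sG n i) (sG n i) = AD (SC a (ID n)) (SC b (sG n i))"
proof -
  assume i: "1 <= i" "i < n"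
  note t = TT_sG[OF i] TT_CM[OF TT_uG[of i "n - 2"] TT_cG[of i "n - 2"], unfolded r2[OF i(2,1)]]
  then show ?thesis using law_quad[of i n] i c0 by (simp add: SC_0[of _ n n] AD_ZE[of _ n n])
qed

lemma su1: "1 <= i ==> i <= n ==> CM (sG (Suc (Suc n)) i) (uG n (Suc i)) = AD (SC (p_d P) (uG n i)) (SC e (CM (sG (Suc (Suc n)) (Suc i)) (uG n i)))"
proof -
  assume i: "1 <= i" "i <= n"
  have t: "uG n i \<in> TT n (Suc (Suc n))" "uG n (Suc i) \<in> TT n (Suc (Suc n))" "CM (sG (Suc (Suc n)) (Suc i)) (uG n i) \<in> TT n (Suc (Suc n))"
    using TT_uG[of i n] TT_uG[of "Suc i" n] TT_CM[OF TT_sG[of "Suc i" "Suc (Suc n)"] , of "uG n i" n] i by simp_all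
  then show ?thesis using law_su1[OF i] f by (simp add: SC_0[of _ n "Suc (Suc n)"] AD_ZE[of _ n "Suc (Suc n)"])
qed

lemma uu1: "1 <= i ==> i <= n + 1 ==> CM (uG (Suc (Suc n)) (Suc i)) (uG n i) =
  SC (1 / (eps * e * a)) (CM (sG (Suc (Suc (Suc (Suc n)))) (Suc (Suc i))) (CM (sG (Suc (Suc (Suc (Suc n)))) (Suc i)) (CM (uG (Suc (Suc n)) i) (uG n i))))"
proof -
  assume i: "1 <= i" "i <= n + 1"
  let ?m = "Suc (Suc (Suc (Suc n)))" and ?n = "Suc (Suc n)"
  let ?v = "CM (uG ?n (Suc i)) (uG n i)"
  have u: "uG n i \<in> TT n ?n" "uG ?n (Suc i) \<in> TT ?n ?m" "uG ?n i \<in> TT ?n ?m" using TT_uG[of i n] TT_uG[of "Suc i" ?n] TT_uG[of i ?n] i by simp_all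
  have s: "sG ?m (Suc (Suc i)) \<in> TT ?m ?m" using TT_sG[of "Suc (Suc i)" ?m] i by simp
  have t: "?v \<in> TT n ?m" "CM (sG ?m (Suc (Suc i))) ?v \<in> TT n ?m" "CM (sG ?m (Suc (Suc i))) (uG ?n (Suc i)) \<in> TT ?n ?m" using u s by (meson TT_CM)+
  have uu: "CM (uG ?n i) (uG n i) = SC eps (CM (uG ?n (Suc (Suc i))) (uG n i))"
    using law_uu[of i i n] i by simp
  have "CM (sG ?m (Suc i)) (CM (uG ?n i) (uG n i)) = SC eps (CM (CM (sG ?m (Suc i)) (uG ?n (Suc (Suc i)))) (uG n i))"
    unfolding uu by (simp add: CM_assoc)
  also have "CM (sG ?m (Suc i)) (uG ?n (Suc (Suc i))) = AD (SC (p_d P) (uG ?n (Suc i))) (SC e (CM (sG ?m (Suc (Suc i))) (uG ?n (Suc i))))"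
    using i by (intro su1) simp_all
  also have "CM ... (uG n i) = AD (SC (p_d P) ?v) (SC e (CM (sG ?m (Suc (Suc i))) ?v))"
    using u t by (simp add: CM_AD_l[of _ _ ?n ?m] CM_assoc)
  finally have 1: "CM (sG ?m (Suc i)) (CM (uG ?n i) (uG n i)) = SC eps (AD (SC (p_d P) ?v) (SC e (CM (sG ?m (Suc (Suc i))) ?v)))" .
  have q: "CM (sG ?m (Suc (Suc i))) (CM (sG ?m (Suc (Suc i))) ?v) = AD (SC a ?v) (SC b (CM (sG ?m (Suc (Suc i))) ?v))"
  proof -
    have "CM (sG ?m (Suc (Suc i))) (CM (sG ?m (Suc (Suc i))) ?v) = CM (AD (SC a (ID ?m)) (SC b (sG ?m (Suc (Suc i))))) ?v"
      using i by (intro CM2 quad0) simp_all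
    then show ?thesis using s t by (simp add: CM_AD_l[of _ _ ?m ?m] CM_ID_l[of _ n ?m])
  qed
  have "CM (sG ?m (Suc (Suc i))) (CM (sG ?m (Suc i)) (CM (uG ?n i) (uG n i))) =
      SC eps (AD (SC (p_d P) (CM (sG ?m (Suc (Suc i))) ?v)) (SC e (CM (sG ?m (Suc (Suc i))) (CM (sG ?m (Suc (Suc i))) ?v))))"
    unfolding 1 using t by (simp add: CM_AD_r[of _ _ n ?m])
  also have "... = AD (SC (eps * e * a) ?v) (SC (eps * (p_d P + e * b)) (CM (sG ?m (Suc (Suc i))) ?v))"
    unfolding q by (simp add: AD_ac SC_plus algebra_simps)
  also have "... = SC (eps * e * a) ?v" using t d by (simp add: SC_0[of _ n ?m] AD_ZE[of _ n ?m])
  finally show ?thesis using e0 a0 eps0 by simp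
qed

lemma u_gen0: "1 <= i ==> i <= n ==> uG n (Suc i) = AD (AD (SC (- p_D P / p_F P) (uG n i)) (SC (- p_E P / p_F P) (CM (sG (Suc (Suc n)) (Suc i)) (uG n i))))
    (SC (1 / p_F P) (CM (sG (Suc (Suc n)) i) (CM (sG (Suc (Suc n)) (Suc i)) (uG n i))))"
proof -
  assume i: "1 <= i" "i <= n"
  let ?n = "Suc (Suc n)"
  let ?x = "uG n i" and ?y = "CM (sG ?n (Suc i)) (uG n i)" and ?z = "uG n (Suc i)"
  have t: "?x \<in> TT n ?n" "?y \<in> TT n ?n" "?z \<in> TT n ?n"
    using TT_uG[of i n] TT_uG[of "Suc i" n] TT_CM[OF TT_sG[of "Suc i" ?n], of "uG n i" n] i by simp_all
  have e: "CM (sG ?n i) ?y = AD (AD (SC (p_D P) ?x) (SC (p_E P) ?y)) (SC (p_F P) ?z)" using law_su2[OF i] by simp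
  have n: "AD (SC (- (c / p_F P)) v) (SC (c / p_F P) v) = ZE n ?n" if "v \<in> TT n ?n" for c v
    using SC_plus[of v "- (c / p_F P)" "c / p_F P"] that by (simp add: SC_0)
  have "AD (AD (SC (- p_D P / p_F P) ?x) (SC (- p_E P / p_F P) ?y)) (SC (1 / p_F P) (AD (AD (SC (p_D P) ?x) (SC (p_E P) ?y)) (SC (p_F P) ?z)))
    = AD (AD (AD (SC (- (p_D P / p_F P)) ?x) (SC (p_D P / p_F P) ?x)) (AD (SC (- (p_E P / p_F P)) ?y) (SC (p_E P / p_F P) ?y))) ?z"
    using F0 by (simp add: AD_ac)
  also have "... = AD (AD (ZE n ?n) (ZE n ?n)) ?z" unfolding n[OF t(1)] n[OF t(2)] ..
  also have "... = ?z" using t AD_comm[of "ZE n ?n" ?z] by (simp add: AD_ZE[of _ n ?n])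
  finally show ?thesis unfolding e by simp
qed

abbreviation "Ls \<equiv> \<lambda>n i x. CM (sG n i) x"
abbreviation "Lu \<equiv> \<lambda>n i x. CM (uG n i) x"
abbreviation "LB r B \<equiv> \<lambda>n::nat. if n = r then B else {} :: 'k expr set set"

lemma L_inst:
  assumes B: "B \<subseteq> TT k r" and Bs: "\<forall>i y. 1 <= i --> i < r --> y \<in> B --> CM (sG r i) y \<in> B"
  shows "cup_module_gen AD SC (TT k) Ls Ls Lu (LB r B) (p_lam P) a b e (p_d P) e (p_d P) a b eps (1 / (eps * e * a)) 0 1 0 1
    (p_D P) (p_E P) (p_F P) (- p_D P / p_F P) (- p_E P / p_F P) (1 / p_F P)"
proof (intro cup_module_gen.intro cup_module.intro cup_module_gen_axioms.intro)
  fix n i j and y y' :: "'k expr set" and c :: 'k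
  have TC: "y \<in> TT k n ==> y \<in> Cl" for y n by simp
  show "y \<in> LB r B n ==> y \<in> TT k n" using B by (auto split: if_splits)
  show "1 <= i ==> i < n ==> y \<in> LB r B n ==> CM (sG n i) y \<in> LB r B n" using Bs by (auto split: if_splits)
  show "1 <= i ==> i < n ==> y \<in> LB r B n ==> CM (sG n i) y \<in> LB r B n" using Bs by (auto split: if_splits)
  show "1 <= i ==> i < n ==> y \<in> TT k n ==> CM (sG n i) y \<in> TT k n" by (intro TT_CM[OF TT_sG])
  show "1 <= i ==> i < n ==> y \<in> TT k n ==> CM (sG n i) y \<in> TT k n" by (intro TT_CM[OF TT_sG])
  show "1 <= i ==> i <= n + 1 ==> y \<in> TT k n ==> CM (uG n i) y \<in> TT k (Suc (Suc n))" by (intro TT_CM[OF TT_uG[of i n, simplified]]) simp_all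
  have q: "CM (sG n i) (CM (sG n i) y) = AD (SC a y) (SC b (CM (sG n i) y))" if "1 <= i" "i < n" "y \<in> TT k n"
  proof -
    have "CM (sG n i) (CM (sG n i) y) = CM (AD (SC a (ID n)) (SC b (sG n i))) y" using that by (intro CM2 quad0) simp_all
    then show ?thesis using that TT_sG[OF that(1,2)] by (simp add: CM_AD_l[of _ _ n n] CM_ID_l[of _ k n])
  qed
  show "1 <= i ==> i < n ==> y \<in> TT k n ==> CM (sG n i) (CM (sG n i) y) = AD (SC a y) (SC b (CM (sG n i) y))" by (rule q)
  show "1 <= i ==> i < n ==> y \<in> TT k n ==> CM (sG n i) (CM (sG n i) y) = AD (SC a y) (SC b (CM (sG n i) y))" by (rule q)
  have br: "CM (sG n i) (CM (sG n (Suc i)) (CM (sG n i) y)) = CM (sG n (Suc i)) (CM (sG n i) (CM (sG n (Suc i)) y))"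
    if "1 <= i" "i + 1 < n" "y \<in> TT k n"
    using arg_cong[OF law_braid[of i n], of "\<lambda>X. CM X y"] that by (simp add: CM_assoc)
  show "1 <= i ==> i + 1 < n ==> y \<in> TT k n ==> CM (sG n i) (CM (sG n (Suc i)) (CM (sG n i) y)) = CM (sG n (Suc i)) (CM (sG n i) (CM (sG n (Suc i)) y))" by (rule br)
  show "1 <= i ==> i + 1 < n ==> y \<in> TT k n ==> CM (sG n i) (CM (sG n (Suc i)) (CM (sG n i) y)) = CM (sG n (Suc i)) (CM (sG n i) (CM (sG n (Suc i)) y))" by (rule br)
  have fa: "CM (sG n i) (CM (sG n j) y) = CM (sG n j) (CM (sG n i) y)" if "1 <= i" "i + 2 <= j" "j < n" "y \<in> TT k n"
    using arg_cong[OF law_ss[OF that(1-3)], of "\<lambda>X. CM X y"] that by (simp add: CM_assoc)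
  show "1 <= i ==> i + 2 <= j ==> j < n ==> y \<in> TT k n ==> CM (sG n i) (CM (sG n j) y) = CM (sG n j) (CM (sG n i) y)" by (rule fa)
  show "1 <= i ==> i + 2 <= j ==> j < n ==> y \<in> TT k n ==> CM (sG n i) (CM (sG n j) y) = CM (sG n j) (CM (sG n i) y)" by (rule fa)
  show "1 <= i ==> i + 2 <= j ==> j < n ==> y \<in> TT k n ==> CM (sG n i) (CM (sG n j) y) = CM (sG n j) (CM (sG n i) y)" by (rule fa)
  show "1 <= i ==> i <= n + 1 ==> y \<in> TT k n ==> CM (sG (Suc (Suc n)) i) (CM (uG n i) y) = SC (p_lam P) (CM (uG n i) y)"
    using arg_cong[OF law_su[of i n], of "\<lambda>X. CM X y"] by (simp add: CM_assoc)
  show "1 <= i ==> i + 2 <= j ==> j <= n + 1 ==> y \<in> TT k n ==> CM (sG (Suc (Suc n)) i) (CM (uG n j) y) = CM (uG n j) (CM (sG n i) y)"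
    using arg_cong[OF law_su_lo[of i j n], of "\<lambda>X. CM X y"] by (simp add: CM_assoc)
  show "1 <= j ==> j <= i ==> i < n ==> y \<in> TT k n ==> CM (sG (Suc (Suc n)) (Suc (Suc i))) (CM (uG n j) y) = CM (uG n j) (CM (sG n i) y)"
    using arg_cong[OF law_su_hi[of j i n], of "\<lambda>X. CM X y"] by (simp add: CM_assoc)
  show "1 <= j ==> j <= i ==> i < n ==> y \<in> TT k n ==> CM (sG (Suc (Suc n)) (Suc (Suc i))) (CM (uG n j) y) = CM (uG n j) (CM (sG n i) y)"
    using arg_cong[OF law_su_hi[of j i n], of "\<lambda>X. CM X y"] by (simp add: CM_assoc)
  show "1 <= i ==> i <= j ==> j <= n + 1 ==> y \<in> TT k n ==> CM (uG (Suc (Suc n)) i) (CM (uG n j) y) = SC eps (CM (uG (Suc (Suc n)) (Suc (Suc j))) (CM (uG n i) y))"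
    using arg_cong[OF law_uu[of i j n], of "\<lambda>X. CM X y"] by (simp add: CM_assoc)
  have su: "CM (sG (Suc (Suc n)) i) (CM (uG n (Suc i)) y) = AD (SC (p_d P) (CM (uG n i) y)) (SC e (CM (sG (Suc (Suc n)) (Suc i)) (CM (uG n i) y)))"
    if "1 <= i" "i <= n" "y \<in> TT k n"
  proof -
    have t: "uG n i \<in> TT n (Suc (Suc n))" "CM (sG (Suc (Suc n)) (Suc i)) (uG n i) \<in> TT n (Suc (Suc n))"
      using TT_uG[of i n] TT_CM[OF TT_sG[of "Suc i" "Suc (Suc n)"], of "uG n i" n] that by simp_all
    show ?thesis using CM2[OF su1[OF that(1,2)], of y] that t by (simp add: CM_AD_l[of _ _ n "Suc (Suc n)"] CM_assoc)
  qed
  show "1 <= i ==> i <= n ==> y \<in> TT k n ==> CM (sG (Suc (Suc n)) i) (CM (uG n (Suc i)) y) = AD (SC (p_d P) (CM (uG n i) y)) (SC e (CM (sG (Suc (Suc n)) (Suc i)) (CM (uG n i) y)))" by (rule su)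
  show "1 <= i ==> i <= n ==> y \<in> TT k n ==> CM (sG (Suc (Suc n)) i) (CM (uG n (Suc i)) y) = AD (SC (p_d P) (CM (uG n i) y)) (SC e (CM (sG (Suc (Suc n)) (Suc i)) (CM (uG n i) y)))" by (rule su)
  show "CM (sG (Suc (Suc n)) i) (CM (sG (Suc (Suc n)) (Suc i)) (CM (uG n i) y)) =
      AD (AD (SC (p_D P) (CM (uG n i) y)) (SC (p_E P) (CM (sG (Suc (Suc n)) (Suc i)) (CM (uG n i) y)))) (SC (p_F P) (CM (uG n (Suc i)) y))"
    if "1 <= i" "i <= n" "y \<in> TT k n"
  proof -
    have t: "uG n i \<in> TT n (Suc (Suc n))" "uG n (Suc i) \<in> TT n (Suc (Suc n))" "CM (sG (Suc (Suc n)) (Suc i)) (uG n i) \<in> TT n (Suc (Suc n))"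
      using TT_uG[of i n] TT_uG[of "Suc i" n] TT_CM[OF TT_sG[of "Suc i" "Suc (Suc n)"], of "uG n i" n] that by simp_all
    show ?thesis using arg_cong[OF law_su2[OF that(1,2)], of "\<lambda>X. CM X y"] that t by (simp add: CM_AD_l[of _ _ n "Suc (Suc n)"] CM_assoc)
  qed
  show "1 <= i ==> i <= n + 1 ==> y \<in> TT k n ==> CM (uG (Suc (Suc n)) (Suc i)) (CM (uG n i) y) =
     SC (1 / (eps * e * a)) (CM (sG (Suc (Suc (Suc (Suc n)))) (Suc (Suc i))) (CM (sG (Suc (Suc (Suc (Suc n)))) (Suc i)) (CM (uG (Suc (Suc n)) i) (CM (uG n i) y))))"
    using CM2[OF uu1[of i n], of y] by (simp add: CM_assoc eval_nat_numeral)
  show "CM (uG n (Suc i)) y = AD (AD (SC (- p_D P / p_F P) (CM (uG n i) y)) (SC (- p_E P / p_F P) (CM (sG (Suc (Suc n)) (Suc i)) (CM (uG n i) y))))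
      (SC (1 / p_F P) (CM (sG (Suc (Suc n)) i) (CM (sG (Suc (Suc n)) (Suc i)) (CM (uG n i) y))))" if "1 <= i" "i <= n" "y \<in> TT k n"
  proof -
    have t: "uG n i \<in> TT n (Suc (Suc n))" "CM (sG (Suc (Suc n)) (Suc i)) (uG n i) \<in> TT n (Suc (Suc n))" "CM (sG (Suc (Suc n)) i) (CM (sG (Suc (Suc n)) (Suc i)) (uG n i)) \<in> TT n (Suc (Suc n))"
      using TT_uG[of i n] TT_CM[OF TT_sG[of "Suc i" "Suc (Suc n)"], of "uG n i" n]
        TT_CM[OF TT_sG[of i "Suc (Suc n)"], OF _ _ TT_CM[OF TT_sG[of "Suc i" "Suc (Suc n)"], of "uG n i" n]] that by simp_all
    show ?thesis using arg_cong[OF u_gen0[OF that(1,2)], of "\<lambda>X. CM X y"] that t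
      by (simp add: CM_AD_l[of _ _ n "Suc (Suc n)"] CM_assoc)
  qed
next
  fix n i and y :: "'k expr set"
  have z: "CM (sG n i) y = AD (SC 0 y) (SC 1 (CM (sG n i) y))" if "1 <= i" "i < n" "y \<in> TT k n"
    using that TT_CM[OF TT_sG[OF that(1,2)] that(3)] AD_comm[of "ZE k n"] by (simp add: SC_0[of _ k n] AD_ZE[of _ k n])
  show "1 <= i ==> i < n ==> y \<in> TT k n ==> CM (sG n i) y = AD (SC 0 y) (SC 1 (CM (sG n i) y))" by (rule z)
  show "1 <= i ==> i < n ==> y \<in> TT k n ==> CM (sG n i) y = AD (SC 0 y) (SC 1 (CM (sG n i) y))" by (rule z)
qed (use TT_sG TT_uG in \<open>simp_all add: CM_AD_r[of _ _ k] TT_CM\<close>)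

end

context good_pres
begin

definition "tG n i = AD (SC (1 / a) (sG n i)) (SC (- b / a) (ID n))"

lemma TT_tG: "1 <= i ==> i < n ==> tG n i \<in> TT n n" unfolding tG_def using TT_sG by simp
lemma Cl_tG [simp]: "tG n i \<in> Cl" by (simp add: tG_def)

lemma CM_tG: "1 <= i ==> i < n ==> y \<in> TT n k ==> CM y (tG n i) = AD (SC (1 / a) (CM y (sG n i))) (SC (- b / a) y)"
  unfolding tG_def using TT_sG[of i n] by (simp add: CM_AD_r[of _ _ n n] CM_ID_r[of _ n k])
lemma tG_CM: "1 <= i ==> i < n ==> y \<in> TT k n ==> CM (tG n i) y = AD (SC (1 / a) (CM (sG n i) y)) (SC (- b / a) y)"
  unfolding tG_def using TT_sG[of i n] by (simp add: CM_AD_l[of _ _ n n] CM_ID_l[of _ k n])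

lemma inv_sum: "1 <= i ==> i < n ==> AD (SC (1 / a) (AD (SC a (ID n)) (SC b (sG n i)))) (SC (- b / a) (sG n i)) = ID n"
proof -
  assume i: "1 <= i" "i < n"
  have "AD (SC (1 / a) (AD (SC a (ID n)) (SC b (sG n i)))) (SC (- b / a) (sG n i)) = AD (ID n) (SC (b / a + - b / a) (sG n i))"
    using a0 by (simp only: SC_plus Cl_G) (simp add: AD_assoc)
  then show ?thesis using TT_sG[OF i] by (simp add: SC_0[of _ n n] AD_ZE[of _ n n])
qed

lemma tS: "1 <= i ==> i < n ==> CM (tG n i) (sG n i) = ID n" "1 <= i ==> i < n ==> CM (sG n i) (tG n i) = ID n"
  using tG_CM[of i n "sG n i" n] CM_tG[of i n "sG n i" n] TT_sG[of i n] quad0[of i n] inv_sum[of i n] by simp_all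

lemma tS_cancel: "1 <= i ==> i < n ==> y \<in> TT k n ==> CM (tG n i) (CM (sG n i) y) = y"
    "1 <= i ==> i < n ==> y \<in> TT k n ==> CM (sG n i) (CM (tG n i) y) = y"
  using CM2[OF tS(1)[of i n], of y] CM2[OF tS(2)[of i n], of y] by (simp_all add: CM_ID_l[of _ k n])

lemma inv_unique: "X \<in> TT n n ==> Y \<in> TT n n ==> Z \<in> TT n n ==> CM X Y = ID n ==> CM Y Z = ID n ==> X = Z"
  using CM_assoc[of X Y Z] by (simp add: CM_ID_l[of _ n n] CM_ID_r[of _ n n])

lemma tG_braid: "1 <= i ==> Suc i < n ==> CM (tG n i) (CM (tG n (Suc i)) (tG n i)) = CM (tG n (Suc i)) (CM (tG n i) (tG n (Suc i)))"
proof -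
  assume i: "1 <= i" "Suc i < n"
  have t: "tG n i \<in> TT n n" "tG n (Suc i) \<in> TT n n" "sG n i \<in> TT n n" "sG n (Suc i) \<in> TT n n" using i by (simp_all add: TT_tG TT_sG)
  note tt = t TT_CM[OF t(3) TT_CM[OF t(4) t(3)]] TT_CM[OF t(1) t(2)] TT_CM[OF t(3) t(4)] TT_CM[OF t(4) t(3)] TT_CM[OF t(2) t(1)]
  show ?thesis
  proof (rule inv_unique)
    show "CM (CM (tG n i) (CM (tG n (Suc i)) (tG n i))) (CM (sG n i) (CM (sG n (Suc i)) (sG n i))) = ID n"
      using i tt by (simp add: CM_assoc tS_cancel[of _ _ _ n] tS)
    have "CM (CM (sG n (Suc i)) (CM (sG n i) (sG n (Suc i)))) (CM (tG n (Suc i)) (CM (tG n i) (tG n (Suc i)))) = ID n"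
      using i tt by (simp add: CM_assoc tS_cancel[of _ _ _ n] tS)
    then show "CM (CM (sG n i) (CM (sG n (Suc i)) (sG n i))) (CM (tG n (Suc i)) (CM (tG n i) (tG n (Suc i)))) = ID n"
      using law_braid[of i n] i by simp
  qed (meson tt TT_CM)+
qed

lemma t_s_far: "1 <= i ==> i + 2 <= j ==> j < n ==> CM (sG n j) (tG n i) = CM (tG n i) (sG n j)"
  using law_ss[of i j n] CM_tG[of i n "sG n j" n] tG_CM[of i n "sG n j" n] TT_sG[of j n] by simp
lemma t_t_far: "1 <= i ==> i + 2 <= j ==> j < n ==> CM (tG n j) (tG n i) = CM (tG n i) (tG n j)"
  using t_s_far[of i j n] tG_CM[of j n "tG n i" n] CM_tG[of j n "tG n i" n] TT_tG[of i n] by simp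

lemma c_t: "1 <= i ==> i <= n + 1 ==> CM (cG n i) (tG (Suc (Suc n)) i) = SC (1 / p_lam' P) (cG n i)"
proof -
  assume i: "1 <= i" "i <= n + 1"
  let ?m = "Suc (Suc n)"
  have "CM (cG n i) (ID ?m) = CM (CM (cG n i) (sG ?m i)) (tG ?m i)" using tS(2)[of i ?m] i by (simp add: CM_assoc)
  also have "CM (cG n i) (sG ?m i) = SC (p_lam' P) (cG n i)" using law_cs[of i n] i by simp
  finally have "cG n i = SC (p_lam' P) (CM (cG n i) (tG ?m i))" using TT_cG[of i n] i by (simp add: CM_ID_r[of _ ?m n])
  then have "SC (1 / p_lam' P) (cG n i) = SC (1 / p_lam' P) (SC (p_lam' P) (CM (cG n i) (tG ?m i)))" by simp
  then show ?thesis using lam' by simp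
qed

lemma c_t_lo: "1 <= i ==> i + 2 <= j ==> j <= n + 1 ==> CM (cG n j) (tG (Suc (Suc n)) i) = CM (tG n i) (cG n j)"
  using law_cs_lo[of i j n] CM_tG[of i "Suc (Suc n)" "cG n j" n] tG_CM[of i n "cG n j" "Suc (Suc n)"] TT_cG[of j n] by simp
lemma c_t_hi: "1 <= j ==> j <= i ==> i < n ==> CM (cG n j) (tG (Suc (Suc n)) (Suc (Suc i))) = CM (tG n i) (cG n j)"
  using law_cs_hi[of j i n] CM_tG[of "Suc (Suc i)" "Suc (Suc n)" "cG n j" n] tG_CM[of i n "cG n j" "Suc (Suc n)"] TT_cG[of j n] by simp

lemma c_TT: "1 <= i ==> i <= n ==> cG n i \<in> TT (Suc (Suc n)) n \<and> cG n (Suc i) \<in> TT (Suc (Suc n)) n \<and>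
    CM (cG n i) (sG (Suc (Suc n)) (Suc i)) \<in> TT (Suc (Suc n)) n \<and> CM (cG n i) (tG (Suc (Suc n)) (Suc i)) \<in> TT (Suc (Suc n)) n"
  using TT_cG[of i n] TT_cG[of "Suc i" n] TT_CM[of "cG n i" "Suc (Suc n)" n] TT_sG[of "Suc i" "Suc (Suc n)"] TT_tG[of "Suc i" "Suc (Suc n)"] by simp

lemma c_t1_r: "1 <= i ==> i <= n ==> CM (cG n (Suc i)) (tG (Suc (Suc n)) i) = SC (- eps * e / a) (CM (cG n i) (sG (Suc (Suc n)) (Suc i)))"
proof -
  assume i: "1 <= i" "i <= n"
  let ?m = "Suc (Suc n)"
  have t: "cG n i \<in> TT ?m n" "cG n (Suc i) \<in> TT ?m n" "CM (cG n i) (sG ?m (Suc i)) \<in> TT ?m n" using c_TT[OF i] by simp_all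
  have "CM (cG n (Suc i)) (sG ?m i) = AD (SC (- eps * e) (CM (cG n i) (sG ?m (Suc i)))) (SC b (cG n (Suc i)))"
    using law_cs1[OF i] d' e' f' t AD_comm[of "ZE ?m n"] by (simp add: SC_0[of _ ?m n] AD_ZE[of _ ?m n])
  then have "CM (cG n (Suc i)) (tG ?m i) = AD (SC (1 / a) (AD (SC (- eps * e) (CM (cG n i) (sG ?m (Suc i)))) (SC b (cG n (Suc i))))) (SC (- b / a) (cG n (Suc i)))"
    using CM_tG[of i ?m "cG n (Suc i)" n] t i by simp
  also have "... = AD (SC (- eps * e / a) (CM (cG n i) (sG ?m (Suc i)))) (SC (b / a + - b / a) (cG n (Suc i)))"
    by (simp only: SC_plus Cl_G) (simp add: AD_assoc)
  finally show ?thesis using t by (simp add: SC_0[of _ ?m n] AD_ZE[of _ ?m n])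
qed

lemma s_t: "1 <= i ==> i < n ==> y \<in> TT n k ==> CM y (sG n i) = AD (SC b y) (SC a (CM y (tG n i)))"
proof -
  assume i: "1 <= i" "i < n" "y \<in> TT n k"
  have t: "CM y (sG n i) \<in> TT n k" by (rule TT_CM[OF i(3) TT_sG[OF i(1,2)]])
  have "AD (SC b y) (SC a (CM y (tG n i))) = AD (AD (SC b y) (SC (- b) y)) (CM y (sG n i))"
    using CM_tG[OF i] i(3) t a0 by (simp add: AD_ac)
  also have "AD (SC b y) (SC (- b) y) = SC (b + - b) y" using i(3) by (simp only: SC_plus TT_Cl)
  finally show ?thesis using i(3) t AD_comm[of "ZE n k" "CM y (sG n i)"] by (simp add: SC_0[of _ n k] AD_ZE[of _ n k])
qed

lemma c_t1: "1 <= i ==> i <= n ==> CM (cG n (Suc i)) (tG (Suc (Suc n)) i) =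
   AD (SC (- eps * e * b / a) (cG n i)) (SC (- eps * e) (CM (cG n i) (tG (Suc (Suc n)) (Suc i))))"
  using c_t1_r[of i n] s_t[of "Suc i" "Suc (Suc n)" "cG n i" n] c_TT[of i n] a0 by (simp add: mult.commute)

lemma c_t2: "1 <= i ==> i <= n ==> CM (cG n i) (CM (tG (Suc (Suc n)) (Suc i)) (tG (Suc (Suc n)) i)) =
   AD (AD (SC (- b / a * (b / a + 1 / p_lam' P)) (cG n i)) (SC (- b / a) (CM (cG n i) (tG (Suc (Suc n)) (Suc i))))) (SC (- 1 / (a * eps * e)) (cG n (Suc i)))"
proof -
  assume i: "1 <= i" "i <= n"
  let ?m = "Suc (Suc n)"
  let ?X = "cG n i" and ?Y = "CM (cG n i) (tG ?m (Suc i))" and ?Z = "cG n (Suc i)"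
  let ?q = "- eps * e"
  have q0: "?q \<noteq> 0" using eps0 e0 by simp
  have t: "?X \<in> TT ?m n" "?Y \<in> TT ?m n" "?Z \<in> TT ?m n" using c_TT[OF i] by simp_all
  have tt: "tG ?m i \<in> TT ?m ?m" using i by (simp add: TT_tG)
  have Zt: "CM ?Z (tG ?m i) = AD (SC (?q * b / a) ?X) (SC ?q ?Y)" by (rule c_t1[OF i])
  have Ztt: "CM ?Z (tG ?m i) \<in> TT ?m n" using TT_CM[OF t(3) tt] .
  have "AD (SC (1 / ?q) (CM ?Z (tG ?m i))) (SC (- b / a) ?X) = AD (SC (b / a + - b / a) ?X) ?Y"
    unfolding Zt using q0 t by (simp only: SC_plus Cl_G) (simp add: AD_ac)
  also have "... = ?Y" using t AD_comm[of "ZE ?m n" ?Y] by (simp add: SC_0[of _ ?m n] AD_ZE[of _ ?m n])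
  finally have Y: "?Y = AD (SC (1 / ?q) (CM ?Z (tG ?m i))) (SC (- b / a) ?X)" by simp
  have qT: "CM (CM ?Z (tG ?m i)) (tG ?m i) = AD (SC (1 / a) ?Z) (SC (- b / a) (CM ?Z (tG ?m i)))"
  proof -
    have "CM (CM ?Z (tG ?m i)) (sG ?m i) = ?Z" using i t tS(1)[of i ?m] by (simp add: CM_assoc CM_ID_r[of _ ?m n])
    then show ?thesis using CM_tG[of i ?m "CM ?Z (tG ?m i)" n] Ztt i by simp
  qed
  have Xt: "CM ?X (tG ?m i) = SC (1 / p_lam' P) ?X" using c_t[of i n] i by simp
  have "CM ?Y (tG ?m i) = AD (SC (1 / ?q) (CM (CM ?Z (tG ?m i)) (tG ?m i))) (SC (- b / a) (CM ?X (tG ?m i)))"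
    by (subst Y) (use t Ztt in \<open>simp add: CM_AD_l[of _ _ ?m n]\<close>)
  also have "... = AD (SC (1 / ?q) (AD (SC (1 / a) ?Z) (SC (- b / a) (AD (SC (?q * b / a) ?X) (SC ?q ?Y))))) (SC (- b / a) (SC (1 / p_lam' P) ?X))"
    unfolding qT Xt unfolding Zt ..
  also have "... = AD (AD (AD (SC (- b / a * (b / a)) ?X) (SC (- b / a * (1 / p_lam' P)) ?X)) (SC (- b / a) ?Y)) (SC (- 1 / (a * eps * e)) ?Z)"
    using q0 t by (simp add: AD_ac mult_ac)
  also have "AD (SC (- b / a * (b / a)) ?X) (SC (- b / a * (1 / p_lam' P)) ?X) = SC (- b / a * (b / a + 1 / p_lam' P)) ?X"
    unfolding distrib_left by (simp only: SC_plus Cl_G)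
  finally show ?thesis by (simp add: CM_assoc)
qed

lemma c_c1: "1 <= i ==> i <= n + 1 ==> CM (cG n i) (cG (Suc (Suc n)) (Suc i)) =
  SC (- a / e) (CM (cG n i) (CM (cG (Suc (Suc n)) i) (CM (tG (Suc (Suc (Suc (Suc n)))) (Suc i)) (tG (Suc (Suc (Suc (Suc n)))) (Suc (Suc i))))))"
proof -
  assume i: "1 <= i" "i <= n + 1"
  let ?m = "Suc (Suc (Suc (Suc n)))" and ?n = "Suc (Suc n)"
  have c: "cG n i \<in> TT ?n n" "cG ?n (Suc i) \<in> TT ?m ?n" using TT_cG[of i n] TT_cG[of "Suc i" ?n] i by simp_all
  have cc: "CM (cG n i) (cG ?n i) = SC eps (CM (cG n i) (cG ?n (Suc (Suc i))))" using law_cc[of i i n] i by simp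
  have "CM (cG n i) (CM (cG ?n i) (CM (tG ?m (Suc i)) (tG ?m (Suc (Suc i))))) = CM (CM (cG n i) (cG ?n i)) (CM (tG ?m (Suc i)) (tG ?m (Suc (Suc i))))"
    by (simp add: CM_assoc)
  also have "... = SC eps (CM (cG n i) (CM (CM (cG ?n (Suc (Suc i))) (tG ?m (Suc i))) (tG ?m (Suc (Suc i)))))"
    unfolding cc by (simp add: CM_assoc)
  also have "CM (cG ?n (Suc (Suc i))) (tG ?m (Suc i)) = SC (- eps * e / a) (CM (cG ?n (Suc i)) (sG ?m (Suc (Suc i))))"
    using i by (intro c_t1_r) simp_all
  also have "SC eps (CM (cG n i) (CM (SC (- eps * e / a) (CM (cG ?n (Suc i)) (sG ?m (Suc (Suc i))))) (tG ?m (Suc (Suc i)))))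
    = SC (- e / a) (CM (cG n i) (cG ?n (Suc i)))"
    using tS(2)[of "Suc (Suc i)" ?m] c i by (simp add: CM_assoc CM_ID_r[of _ ?m ?n])
  finally show ?thesis using a0 e0 by simp
qed

abbreviation "Rs \<equiv> \<lambda>n i x. CM x (tG n i)"
abbreviation "Rr \<equiv> \<lambda>n i x. CM x (sG n i)"
abbreviation "Ru \<equiv> \<lambda>n i x. CM x (cG n i)"

lemma R_inst:
  assumes B: "B \<subseteq> TT r k" and Br: "\<forall>i y. 1 <= i --> i < r --> y \<in> B --> CM y (sG r i) \<in> B"
    and Bs: "\<forall>i y. 1 <= i --> i < r --> y \<in> B --> CM y (tG r i) \<in> B"
  shows "cup_module_gen AD SC (\<lambda>n. TT n k) Rs Rr Ru (LB r B) (1 / p_lam' P) (1 / a) (- b / a) (- eps * e) (- eps * e * b / a) (- eps * e / a) 0 a b eps (- a / e) b a (- b / a) (1 / a)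
    (- b / a * (b / a + 1 / p_lam' P)) (- b / a) (- 1 / (a * eps * e)) 0 0 (1 / (e * a))"
proof (intro cup_module_gen.intro cup_module.intro cup_module_gen_axioms.intro)
  fix n i j and y y' :: "'k expr set" and c :: 'k
  show "y \<in> LB r B n ==> y \<in> TT n k" using B by (auto split: if_splits)
  show "1 <= i ==> i < n ==> y \<in> LB r B n ==> CM y (sG n i) \<in> LB r B n" using Br by (auto split: if_splits)
  show "1 <= i ==> i < n ==> y \<in> LB r B n ==> CM y (tG n i) \<in> LB r B n" using Bs by (auto split: if_splits)
  show "1 <= i ==> i < n ==> y \<in> TT n k ==> CM y (sG n i) \<in> TT n k" by (intro TT_CM[OF _ TT_sG])
  show "1 <= i ==> i < n ==> y \<in> TT n k ==> CM y (tG n i) \<in> TT n k" by (intro TT_CM[OF _ TT_tG])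
  show "1 <= i ==> i <= n + 1 ==> y \<in> TT n k ==> CM y (cG n i) \<in> TT (Suc (Suc n)) k" using TT_CM[OF _ TT_cG[of i n]] by simp
  show "CM y (sG n i) = AD (SC b y) (SC a (CM y (tG n i)))" if "1 <= i" "i < n" "y \<in> TT n k" by (rule s_t[OF that])
  show "CM y (tG n i) = AD (SC (- b / a) y) (SC (1 / a) (CM y (sG n i)))" if "1 <= i" "i < n" "y \<in> TT n k"
    using CM_tG[OF that] that AD_comm by simp
  show "CM (CM y (tG n i)) (tG n i) = AD (SC (1 / a) y) (SC (- b / a) (CM y (tG n i)))" if "1 <= i" "i < n" "y \<in> TT n k"
  proof -
    have t: "CM y (tG n i) \<in> TT n k" by (rule TT_CM[OF that(3) TT_tG[OF that(1,2)]])
    have "CM (CM y (tG n i)) (sG n i) = y" using that tS(1)[OF that(1,2)] by (simp add: CM_assoc CM_ID_r[of _ n k])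
    then show ?thesis using CM_tG[OF that(1,2) t] by simp
  qed
  show "CM (CM y (sG n i)) (sG n i) = AD (SC a y) (SC b (CM y (sG n i)))" if "1 <= i" "i < n" "y \<in> TT n k"
    using quad0[OF that(1,2)] that TT_sG[OF that(1,2)] by (simp add: CM_assoc CM_AD_r[of _ _ n n] CM_ID_r[of _ n k])
  show "1 <= i ==> i + 1 < n ==> y \<in> TT n k ==> CM (CM (CM y (tG n i)) (tG n (Suc i))) (tG n i) = CM (CM (CM y (tG n (Suc i))) (tG n i)) (tG n (Suc i))"
    using tG_braid[of i n] by (simp add: CM_assoc)
  show "1 <= i ==> i + 1 < n ==> y \<in> TT n k ==> CM (CM (CM y (sG n i)) (sG n (Suc i))) (sG n i) = CM (CM (CM y (sG n (Suc i))) (sG n i)) (sG n (Suc i))"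
    using law_braid[of i n] by (simp add: CM_assoc)
  show "1 <= i ==> i + 2 <= j ==> j < n ==> y \<in> TT n k ==> CM (CM y (tG n j)) (tG n i) = CM (CM y (tG n i)) (tG n j)"
    using t_t_far[of i j n] by (simp add: CM_assoc)
  show "1 <= i ==> i + 2 <= j ==> j < n ==> y \<in> TT n k ==> CM (CM y (sG n j)) (sG n i) = CM (CM y (sG n i)) (sG n j)"
    using law_ss[of i j n] by (simp add: CM_assoc)
  show "1 <= i ==> i + 2 <= j ==> j < n ==> y \<in> TT n k ==> CM (CM y (sG n j)) (tG n i) = CM (CM y (tG n i)) (sG n j)"
    using t_s_far[of i j n] by (simp add: CM_assoc)
  show "1 <= i ==> i <= n + 1 ==> y \<in> TT n k ==> CM (CM y (cG n i)) (tG (Suc (Suc n)) i) = SC (1 / p_lam' P) (CM y (cG n i))"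
    using c_t[of i n] by (simp add: CM_assoc)
  show "1 <= i ==> i + 2 <= j ==> j <= n + 1 ==> y \<in> TT n k ==> CM (CM y (cG n j)) (tG (Suc (Suc n)) i) = CM (CM y (tG n i)) (cG n j)"
    using c_t_lo[of i j n] by (simp add: CM_assoc)
  show "1 <= j ==> j <= i ==> i < n ==> y \<in> TT n k ==> CM (CM y (cG n j)) (tG (Suc (Suc n)) (Suc (Suc i))) = CM (CM y (tG n i)) (cG n j)"
    using c_t_hi[of j i n] by (simp add: CM_assoc)
  show "1 <= j ==> j <= i ==> i < n ==> y \<in> TT n k ==> CM (CM y (cG n j)) (sG (Suc (Suc n)) (Suc (Suc i))) = CM (CM y (sG n i)) (cG n j)"
    using law_cs_hi[of j i n] by (simp add: CM_assoc)
  show "1 <= i ==> i <= j ==> j <= n + 1 ==> y \<in> TT n k ==> CM (CM y (cG n j)) (cG (Suc (Suc n)) i) = SC eps (CM (CM y (cG n i)) (cG (Suc (Suc n)) (Suc (Suc j))))"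
    using law_cc[of i j n] by (simp add: CM_assoc)
  show "CM (CM y (cG n (Suc i))) (tG (Suc (Suc n)) i) = AD (SC (- eps * e * b / a) (CM y (cG n i))) (SC (- eps * e) (CM (CM y (cG n i)) (tG (Suc (Suc n)) (Suc i))))"
    if "1 <= i" "i <= n" "y \<in> TT n k"
    using c_t1[OF that(1,2)] c_TT[OF that(1,2)] that(3) by (simp add: CM_assoc CM_AD_r[of _ _ "Suc (Suc n)" n])
  show "CM (CM y (cG n (Suc i))) (tG (Suc (Suc n)) i) = AD (SC 0 (CM y (cG n i))) (SC (- eps * e / a) (CM (CM y (cG n i)) (sG (Suc (Suc n)) (Suc i))))"
    if "1 <= i" "i <= n" "y \<in> TT n k"
  proof -
    have t: "CM y (cG n i) \<in> TT (Suc (Suc n)) k" "CM y (CM (cG n i) (sG (Suc (Suc n)) (Suc i))) \<in> TT (Suc (Suc n)) k"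
      using c_TT[OF that(1,2)] TT_CM[OF that(3)] by blast+
    show ?thesis using c_t1_r[OF that(1,2)] t that(3) AD_comm[of "ZE (Suc (Suc n)) k"]
      by (simp add: CM_assoc SC_0[of _ "Suc (Suc n)" k] AD_ZE[of _ "Suc (Suc n)" k])
  qed
  show "CM (CM (CM y (cG n i)) (tG (Suc (Suc n)) (Suc i))) (tG (Suc (Suc n)) i) =
      AD (AD (SC (- b / a * (b / a + 1 / p_lam' P)) (CM y (cG n i))) (SC (- b / a) (CM (CM y (cG n i)) (tG (Suc (Suc n)) (Suc i))))) (SC (- 1 / (a * eps * e)) (CM y (cG n (Suc i))))"
    if "1 <= i" "i <= n" "y \<in> TT n k"
  proof -
    have "CM (CM (CM y (cG n i)) (tG (Suc (Suc n)) (Suc i))) (tG (Suc (Suc n)) i) = CM y (CM (cG n i) (CM (tG (Suc (Suc n)) (Suc i)) (tG (Suc (Suc n)) i)))"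
      using that(3) by (simp add: CM_assoc)
    then show ?thesis unfolding c_t2[OF that(1,2)] using c_TT[OF that(1,2)] that(3) by (simp add: CM_assoc CM_AD_r[of _ _ "Suc (Suc n)" n])
  qed
  show "CM (CM y (cG n i)) (cG (Suc (Suc n)) (Suc i)) = SC (- a / e) (CM (CM (CM (CM y (cG n i)) (cG (Suc (Suc n)) i)) (tG (Suc (Suc (Suc (Suc n)))) (Suc i))) (tG (Suc (Suc (Suc (Suc n)))) (Suc (Suc i))))"
    if "1 <= i" "i <= n + 1" "y \<in> TT n k"
  proof -
    have "CM (CM y (cG n i)) (cG (Suc (Suc n)) (Suc i)) = CM y (CM (cG n i) (cG (Suc (Suc n)) (Suc i)))" using that(3) by (simp add: CM_assoc)
    then show ?thesis unfolding c_c1[OF that(1,2)] using that(3) by (simp add: CM_assoc)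
  qed
  show "CM y (cG n (Suc i)) = AD (AD (SC 0 (CM y (cG n i))) (SC 0 (CM (CM y (cG n i)) (sG (Suc (Suc n)) (Suc i)))))
      (SC (1 / (e * a)) (CM (CM (CM y (cG n i)) (sG (Suc (Suc n)) (Suc i))) (sG (Suc (Suc n)) i)))"
    if "1 <= i" "i <= n" "y \<in> TT n k"
  proof -
    let ?m = "Suc (Suc n)"
    have t: "cG n i \<in> TT ?m n" "CM (cG n i) (sG ?m (Suc i)) \<in> TT ?m n" "cG n (Suc i) \<in> TT ?m n" using c_TT[OF that(1,2)] by simp_all
    have t': "CM y (cG n i) \<in> TT ?m k" "CM y (CM (cG n i) (sG ?m (Suc i))) \<in> TT ?m k" "CM y (cG n (Suc i)) \<in> TT ?m k" using t TT_CM[OF that(3)] by blast+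
    have "CM (cG n i) (CM (sG ?m (Suc i)) (sG ?m i)) = SC (e * a) (cG n (Suc i))"
      using law_cs2[OF that(1,2)] t D' E' F' AD_comm[of "ZE ?m n"] by (simp add: SC_0[of _ ?m n] AD_ZE[of _ ?m n])
    then have "CM (CM (CM y (cG n i)) (sG ?m (Suc i))) (sG ?m i) = SC (e * a) (CM y (cG n (Suc i)))" using that(3) by (simp add: CM_assoc)
    then show ?thesis using t' that(3) a0 e0 AD_comm[of "ZE ?m k"] by (simp add: CM_assoc SC_0[of _ ?m k] AD_ZE[of _ ?m k])
  qed
qed (use TT_sG TT_tG TT_cG in \<open>simp_all add: CM_AD_l[of _ _ _ k]\<close>)

lemma hecke_AD: "x \<in> hecke r ==> y \<in> hecke r ==> AD x y \<in> hecke r" and hecke_SC: "x \<in> hecke r ==> SC c x \<in> hecke r"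
  unfolding hecke_def by (auto intro: spn.intros)

lemma hecke_t: "x \<in> hecke r ==> 1 <= i ==> i < r ==> CM x (tG r i) \<in> hecke r"
  using CM_tG[of i r x r] hecke_TT[of x r] by (simp add: hecke_AD hecke_SC hecke_r)

lemma hecke_sub: "hecke r \<subseteq> TT r r" using hecke_TT by blast

lemma hecke_rt: "\<forall>i x. 1 <= i --> i < r --> x \<in> hecke r --> CM x (sG r i) \<in> hecke r"
    "\<forall>i x. 1 <= i --> i < r --> x \<in> hecke r --> CM x (tG r i) \<in> hecke r"
  by (auto intro: hecke_r hecke_t)

lemmas R_i = R_inst[OF hecke_sub hecke_rt]
lemmas R_c = cup_module_gen.axioms(1)[OF R_i]

definition "RW r = cup_module.WW AD SC Rs Ru (LB r (hecke r))"
definition "RV r = cup_module.VV AD SC Rr Ru (LB r (hecke r))"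
abbreviation "Rch \<equiv> cup_module.ch Rs"
abbreviation "Rcr \<equiv> cup_module.cr Rr"

lemmas RW_B = cup_module.WB[OF R_c, folded RW_def]
lemmas RW_I = cup_module.WI[OF R_c, folded RW_def]
lemmas RW_add = cup_module.Wadd[OF R_c, folded RW_def]
lemmas RW_scl = cup_module.Wscl[OF R_c, folded RW_def]
lemmas RW_induct = cup_module.WW.induct[OF R_c, folded RW_def, consumes 1, case_names WB WI Wadd Wscl]
lemmas RW_TT = cup_module.W_G[OF R_c, folded RW_def]
lemmas RW_r = cup_module_gen.W_r[OF R_i, folded RW_def]
lemmas RW_u = cup_module_gen.W_u[OF R_i, folded RW_def]
lemmas RW_ch = cup_module_gen.W_ch[OF R_i, folded RW_def]
lemmas RW_RV = cup_module.W_V[OF R_c, folded RW_def RV_def]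
lemmas RV_induct = cup_module.VV.induct[OF R_c, folded RV_def, consumes 1, case_names VB VI Vadd Vscl]
lemmas RV_TT = cup_module.V_G[OF R_c, folded RV_def]
lemmas Rch_simps [simp] = cup_module.ch.simps[OF R_c]
lemmas Rcr_simps [simp] = cup_module.cr.simps[OF R_c]

lemma Rch_Cl [simp]: "y \<in> Cl ==> Rch n j t y \<in> Cl" by (induction t) simp_all
lemma Rcr_Cl [simp]: "y \<in> Cl ==> Rcr n j t y \<in> Cl" by (induction t) simp_all
lemma Rch_left: "X \<in> Cl ==> y \<in> Cl ==> CM X (Rch n j t y) = Rch n j t (CM X y)"
  by (induction t) (simp_all add: CM_assoc[symmetric])

lemma RW_left_s: "RW r d m x ==> 1 <= i ==> i < r ==> RW r d m (CM (sG r i) x)"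
proof (induction rule: RW_induct)
  case (WB y n d)
  then have n: "n = r" "y \<in> hecke r" by (simp_all split: if_splits)
  then have "CM (sG r i) y \<in> LB r (hecke r) n" using hecke_l WB by simp
  then show ?case by (rule RW_B)
next
  case (WI q n f d t)
  have f: "f \<in> TT n r" by (rule RW_TT[OF WI.hyps(1)])
  have "CM (sG r i) (Rch (Suc (Suc n)) (Suc q) t (CM f (cG n (Suc q)))) = Rch (Suc (Suc n)) (Suc q) t (CM (CM (sG r i) f) (cG n (Suc q)))"
    using f by (simp add: Rch_left CM_assoc)
  then show ?case using RW_I[OF WI.IH[OF WI.prems] WI.hyps(2,3)] by simp
next
  case (Wadd d n y y')
  then show ?case using RW_TT[OF Wadd.hyps(1)] RW_TT[OF Wadd.hyps(2)] RW_add[OF Wadd.IH(1)[OF Wadd.prems] Wadd.IH(2)[OF Wadd.prems]]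
    by (simp add: CM_AD_r[of _ _ n r])
next
  case (Wscl d n y c)
  then show ?case using RW_TT[OF Wscl.hyps(1)] RW_scl[OF Wscl.IH[OF Wscl.prems]] by simp
qed

lemma RW_ID: "RW r 0 r (ID r)" using hecke_ID by (intro RW_B) simp

lemma RW_word: "1 <= i ==> i <= r + 1 ==> set w \<subseteq> {1..<Suc (Suc r)} ==> RW r 0 (Suc (Suc r)) (CM (cG r i) (wd (Suc (Suc r)) w))"
proof (induction w rule: rev_induct)
  case Nil
  have "RW r 0 (Suc (Suc r)) (CM (ID r) (cG r i))" using Nil by (intro RW_u[OF RW_ID])
  then show ?case using TT_cG[of i r] Nil by (simp add: CM_ID_l[of _ "Suc (Suc r)" r] CM_ID_r[of _ "Suc (Suc r)" r])
next
  case (snoc j w)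
  have s: "set w \<subseteq> {1..<Suc (Suc r)}" "1 <= j" "j < Suc (Suc r)" using snoc.prems by auto
  have "RW r 0 (Suc (Suc r)) (CM (CM (cG r i) (wd (Suc (Suc r)) w)) (sG (Suc (Suc r)) j))"
    using s snoc by (intro RW_r) auto
  moreover have "wd (Suc (Suc r)) (w @ [j]) = CM (wd (Suc (Suc r)) w) (sG (Suc (Suc r)) j)"
    using s TT_sG[OF s(2,3)] by (simp add: wd_append)
  ultimately show ?case using wd_TT[OF s(1)] by (simp add: CM_assoc)
qed

lemma RW_hecke: "x \<in> hecke (Suc (Suc r)) ==> 1 <= i ==> i <= r + 1 ==> RW r 0 (Suc (Suc r)) (CM (cG r i) x)"
  unfolding hecke_def
proof (induction rule: spn.induct)
  case (spn_gen x)
  then obtain w where "x = wd (Suc (Suc r)) w" "set w \<subseteq> {1..<Suc (Suc r)}" by blast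
  then show ?case using RW_word[of i r w] spn_gen by simp
next
  case spn_zero
  have "SC 0 (CM (cG r i) (wd (Suc (Suc r)) [])) = CM (cG r i) (ZE (Suc (Suc r)) (Suc (Suc r)))"
    using TT_cG[of i r] spn_zero by (simp add: CM_ZE_r[of _ "Suc (Suc r)" r] CM_ID_r[of _ "Suc (Suc r)" r] SC_0[of _ "Suc (Suc r)" r])
  then show ?case using RW_scl[OF RW_word[of i r "[]"], of 0] spn_zero by simp
next
  case (spn_add x y)
  have "x \<in> TT (Suc (Suc r)) (Suc (Suc r))" "y \<in> TT (Suc (Suc r)) (Suc (Suc r))" using spn_add.hyps hecke_TT unfolding hecke_def by blast+
  then show ?case using RW_add[OF spn_add.IH(1)[OF spn_add.prems] spn_add.IH(2)[OF spn_add.prems]] by (simp add: CM_AD_r[of _ _ "Suc (Suc r)" "Suc (Suc r)"])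
next
  case (spn_scl x c)
  have "x \<in> TT (Suc (Suc r)) (Suc (Suc r))" using spn_scl.hyps hecke_TT unfolding hecke_def by blast
  then show ?case using RW_scl[OF spn_scl.IH[OF spn_scl.prems]] by simp
qed

lemma RW_left_c: "RW (Suc (Suc r)) d m x ==> 1 <= i ==> i <= r + 1 ==> RW r 0 m (CM (cG r i) x)"
proof (induction rule: RW_induct)
  case (WB y n d)
  then have n: "n = Suc (Suc r)" "y \<in> hecke (Suc (Suc r))" by (simp_all split: if_splits)
  then show ?case using RW_hecke WB by simp
next
  case (WI q n f d t)
  have f: "f \<in> TT n (Suc (Suc r))" by (rule RW_TT[OF WI.hyps(1)])
  have "CM (cG r i) (Rch (Suc (Suc n)) (Suc q) t (CM f (cG n (Suc q)))) = Rch (Suc (Suc n)) (Suc q) t (CM (CM (cG r i) f) (cG n (Suc q)))"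
    using f by (simp add: Rch_left CM_assoc)
  moreover have "RW r 0 (Suc (Suc n)) (Rch (Suc (Suc n)) (Suc q) t (CM (CM (cG r i) f) (cG n (Suc q))))"
    using WI.hyps by (intro RW_ch RW_u WI.IH[OF WI.prems]) simp_all
  ultimately show ?case by simp
next
  case (Wadd d n y y')
  then show ?case using RW_TT[OF Wadd.hyps(1)] RW_TT[OF Wadd.hyps(2)] RW_add[OF Wadd.IH(1)[OF Wadd.prems] Wadd.IH(2)[OF Wadd.prems]]
    by (simp add: CM_AD_r[of _ _ n "Suc (Suc r)"])
next
  case (Wscl d n y c)
  then show ?case using RW_TT[OF Wscl.hyps(1)] RW_scl[OF Wscl.IH[OF Wscl.prems]] by simp
qed

abbreviation "RB k r \<equiv> {y. RW r 0 k y}"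
lemma RB_sub: "RB k r \<subseteq> TT k r" using RW_TT by blast
lemma RB_s: "\<forall>i y. 1 <= i --> i < r --> y \<in> RB k r --> CM (sG r i) y \<in> RB k r" by (auto intro: RW_left_s)

lemmas L_i = L_inst[OF RB_sub RB_s]
lemmas L_c = cup_module_gen.axioms(1)[OF L_i]

definition "LW k r = cup_module.WW AD SC Ls Lu (LB r (RB k r))"
definition "LV k r = cup_module.VV AD SC Ls Lu (LB r (RB k r))"
abbreviation "Lch \<equiv> cup_module.ch Ls"
abbreviation "Lcr \<equiv> cup_module.cr Ls"

lemmas LW_B = cup_module.WB[OF L_c, folded LW_def]
lemmas LW_induct = cup_module.WW.induct[OF L_c, folded LW_def, consumes 1, case_names WB WI Wadd Wscl]
lemmas LW_TT = cup_module.W_G[OF L_c, folded LW_def]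
lemmas LW_s = cup_module.W_s[OF L_c, folded LW_def]
lemmas LW_u = cup_module_gen.W_u[OF L_i, folded LW_def]
lemmas LW_mono = cup_module.W_mono[OF L_c, folded LW_def]
lemmas LW_LV = cup_module.W_V[OF L_c, folded LW_def LV_def]
lemmas LV_induct = cup_module.VV.induct[OF L_c, folded LV_def, consumes 1, case_names VB VI Vadd Vscl]
lemmas LV_TT = cup_module.V_G[OF L_c, folded LV_def]
lemmas Lch_simps [simp] = cup_module.ch.simps[OF L_c]
lemmas Lcr_simps [simp] = cup_module.cr.simps[OF L_c]

definition "QQ k n = spn k n (\<Union>r. {x. LW k r 0 n x})"

lemma QQ_TT: "x \<in> QQ k n ==> x \<in> TT k n"
  unfolding QQ_def by (erule spn_TT[rotated]) (use LW_TT in blast)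
lemma QQ_AD: "x \<in> QQ k n ==> y \<in> QQ k n ==> AD x y \<in> QQ k n" and QQ_SC: "x \<in> QQ k n ==> SC c x \<in> QQ k n" and QQ_ZE: "ZE k n \<in> QQ k n"
  unfolding QQ_def by (auto intro: spn.intros)
lemma LW_QQ: "LW k r d n x ==> x \<in> QQ k n"
  unfolding QQ_def using LW_mono[of k r d n x 0] by (intro spn.spn_gen) blast

lemma QQ_op:
  assumes X: "X \<in> TT n n'" and L: "\<And>r x. LW k r 0 n x ==> CM X x \<in> QQ k n'"
  shows "x \<in> QQ k n ==> CM X x \<in> QQ k n'"
  unfolding QQ_def
proof (induction rule: spn.induct)
  case (spn_gen x)
  then show ?case using L unfolding QQ_def by blast
next
  case spn_zero
  then show ?case using X by (simp add: CM_ZE_r spn.spn_zero)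
next
  case (spn_add x y)
  have "x \<in> TT k n" "y \<in> TT k n" using spn_add.hyps QQ_TT unfolding QQ_def by blast+
  then show ?case using spn_add.IH X by (simp add: CM_AD_r[of _ _ k n] spn.spn_add)
next
  case (spn_scl x c)
  have "x \<in> TT k n" using spn_scl.hyps QQ_TT unfolding QQ_def by blast
  then show ?case using spn_scl.IH X by (simp add: spn.spn_scl)
qed

lemma QQ_s: "x \<in> QQ k n ==> 1 <= i ==> i < n ==> CM (sG n i) x \<in> QQ k n"
  by (rule QQ_op[OF TT_sG LW_QQ[OF LW_s]]) auto
lemma QQ_u: "x \<in> QQ k n ==> 1 <= i ==> i <= n + 1 ==> CM (uG n i) x \<in> QQ k (Suc (Suc n))"
  by (rule QQ_op[of _ n "Suc (Suc n)", OF _ LW_QQ[OF LW_u]]) (use TT_uG[of i n] in simp_all)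
lemma QQ_ch: "x \<in> QQ k n ==> j + t < n ==> Lch n j t x \<in> QQ k n"
  by (induction t) (simp_all add: QQ_s)

lemma Lch_Cl [simp]: "y \<in> Cl ==> Lch n j t y \<in> Cl" by (induction t) simp_all

lemma c_ch: "y \<in> Cl ==> j \<ge> 2 ==> j + t < Suc (Suc n) ==> CM (cG n 1) (Lch (Suc (Suc n)) j t y) = Lch n (j - 2) t (CM (cG n 1) y)"
proof (induction t)
  case (Suc t)
  obtain j0 where j: "j = Suc (Suc j0)" using Suc.prems by (cases j; cases "j - 1") simp_all
  have "CM (cG n 1) (sG (Suc (Suc n)) (Suc (Suc (j0 + Suc t)))) = CM (sG n (j0 + Suc t)) (cG n 1)"
    using law_cs_hi[of 1 "j0 + Suc t" n] Suc.prems j by simp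
  from CM2[OF this, of "Lch (Suc (Suc n)) j t y"] show ?case using Suc j by (simp add: CM_assoc)
qed simp

lemma LW_c1: "LW k r d m x ==> m = Suc (Suc n) ==> CM (cG n 1) x \<in> QQ k n"
proof (induction arbitrary: n rule: LW_induct)
  case (WB y m d)
  then have "m = r" "RW r 0 k y" by (simp_all split: if_splits)
  then have "RW n 0 k (CM (cG n 1) y)" using RW_left_c[of n 0 k y 1] WB by simp
  then have "LW k n 0 n (CM (cG n 1) y)" by (intro LW_B) simp
  then show ?case by (rule LW_QQ)
next
  case (WI q n' f d t)
  then have n: "n' = n" by simp
  have f: "LW k r q n f" using WI.hyps n by simp
  have fT: "f \<in> TT k n" by (rule LW_TT[OF f])
  have fQ: "f \<in> QQ k n" by (rule LW_QQ[OF f])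
  let ?m = "Suc (Suc n)"
  have split: "Lch ?m (Suc q) (Suc t') v = Lch ?m (Suc (Suc q)) t' (CM (sG ?m (Suc (Suc q))) v)" for t' v by (induction t') simp_all
  have "CM (cG n 1) (Lch ?m (Suc q) t (CM (uG n (Suc q)) f)) \<in> QQ k n"
  proof -
    consider "q = 0" "t = 0" | t' where "q = 0" "t = Suc t'" | "q = 1" | q0 where "q = Suc (Suc q0)"
      by (cases q; cases t; cases "q - 1") auto
    then show ?thesis
    proof cases
      case 1
      have "CM (cG n 1) (CM (uG n 1) f) = CM (SC (p_del P) (ID n)) f" using law_cu[of 1 n] fT by (intro CM2) simp_all
      then show ?thesis using 1 fT fQ by (simp add: CM_ID_l[of _ k n] QQ_SC)
    next
      case 2
      have n1: "1 <= n" using 2 WI.hyps(3) n by simp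
      have "CM (cG n 1) (CM (sG ?m 2) (CM (uG n 1) f)) = CM (CM (cG n 1) (CM (sG ?m 2) (uG n 1))) f" using fT by (simp add: CM_assoc)
      also have "CM (cG n 1) (CM (sG ?m 2) (uG n 1)) = SC (p_rho P) (ID n)" using law_csu[of 1 n] n1 by (simp add: numeral_2_eq_2)
      also have "CM ... f = SC (p_rho P) f" using fT by (simp add: CM_ID_l[of _ k n])
      finally have "CM (cG n 1) (Lch ?m 1 t (CM (uG n 1) f)) = Lch n 0 t' (SC (p_rho P) f)"
        using 2 WI.hyps(3) n fT c_ch[of "CM (sG ?m 2) (CM (uG n 1) f)" 2 t' n] split[of t' "CM (uG n 1) f"] by (simp add: numeral_2_eq_2)
      moreover have "Lch n 0 t' (SC (p_rho P) f) \<in> QQ k n" using fQ WI.hyps(3) n 2 by (intro QQ_ch QQ_SC) simp_all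
      ultimately show ?thesis using 2 by simp
    next
      case 3
      have n1: "1 <= n" using 3 WI.hyps(3) n by simp
      have "CM (cG n 1) (CM (uG n 2) f) = CM (SC (p_sig P) (ID n)) f" using law_cu1[of 1 n] n1 fT by (intro CM2) (simp_all add: numeral_2_eq_2)
      then have "CM (cG n 1) (CM (uG n 2) f) = SC (p_sig P) f" using fT by (simp add: CM_ID_l[of _ k n])
      then have "CM (cG n 1) (Lch ?m 2 t (CM (uG n 2) f)) = Lch n 0 t (SC (p_sig P) f)"
        using 3 WI.hyps(3) n fT c_ch[of "CM (uG n 2) f" 2 t n] by simp
      moreover have "Lch n 0 t (SC (p_sig P) f) \<in> QQ k n" using fQ WI.hyps(3) n 3 by (intro QQ_ch QQ_SC) simp_all
      ultimately show ?thesis using 3 by (simp add: numeral_2_eq_2)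
    next
      case 4
      obtain n0 where n0: "n = Suc (Suc n0)" using 4 WI.hyps(3) n by (cases n; cases "n - 1") simp_all
      have "CM (cG n 1) (CM (uG n (Suc q)) f) = CM (SC eps (CM (uG n0 (Suc q0)) (cG n0 1))) f"
        using law_cu_far1[of 1 "Suc q0" n0] 4 n0 WI.hyps(3) n fT by (intro CM2) simp_all
      then have "CM (cG n 1) (CM (uG n (Suc q)) f) = SC eps (CM (uG n0 (Suc q0)) (CM (cG n0 1) f))" using fT by (simp add: CM_assoc)
      moreover have "CM (uG n0 (Suc q0)) (CM (cG n0 1) f) \<in> QQ k n"
        unfolding n0 using WI.IH[of n0] n n0 4 WI.hyps(3) by (intro QQ_u) simp_all
      ultimately have "Lch n (q - 1) t (CM (cG n 1) (CM (uG n (Suc q)) f)) \<in> QQ k n"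
        using 4 WI.hyps(3) n by (intro QQ_ch) (simp_all add: QQ_SC)
      then show ?thesis using 4 WI.hyps(3) n fT c_ch[of "CM (uG n (Suc q)) f" "Suc q" t n] by simp
    qed
  qed
  then show ?case using n by simp
next
  case (Wadd d m y y')
  then show ?case using LW_TT[OF Wadd.hyps(1)] LW_TT[OF Wadd.hyps(2)] QQ_AD[OF Wadd.IH(1)[OF Wadd.prems] Wadd.IH(2)[OF Wadd.prems]]
    by (simp add: CM_AD_r[of _ _ k "Suc (Suc n)"])
next
  case (Wscl d m y c)
  then show ?case using LW_TT[OF Wscl.hyps(1)] QQ_SC[OF Wscl.IH[OF Wscl.prems]] by simp
qed

lemma QQ_c1: "x \<in> QQ k (Suc (Suc n)) ==> CM (cG n 1) x \<in> QQ k n"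
  by (rule QQ_op[of _ "Suc (Suc n)" n]) (use TT_cG[of 1 n] LW_c1 in simp_all)

lemma QQ_c: "x \<in> QQ k (Suc (Suc n)) ==> 1 <= i ==> i <= n + 1 ==> CM (cG n i) x \<in> QQ k n"
proof (induction i arbitrary: x)
  case (Suc i)
  show ?case
  proof (cases "i = 0")
    case True
    then show ?thesis using QQ_c1[OF Suc.prems(1)] by simp
  next
    case False
    let ?m = "Suc (Suc n)"
    have i: "1 <= i" "i <= n" using False Suc.prems by simp_all
    have t: "CM (cG n i) (sG ?m (Suc i)) \<in> TT ?m n" "cG n i \<in> TT ?m n" "cG n (Suc i) \<in> TT ?m n" using c_TT[OF i] by simp_all
    have "CM (cG n i) (CM (sG ?m (Suc i)) (sG ?m i)) = SC (e * a) (cG n (Suc i))"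
      using law_cs2[OF i] t D' E' F' AD_comm[of "ZE ?m n"] by (simp add: SC_0[of _ ?m n] AD_ZE[of _ ?m n])
    then have "SC (1 / (e * a)) (CM (CM (cG n i) (CM (sG ?m (Suc i)) (sG ?m i))) x) = CM (cG n (Suc i)) x"
      using a0 e0 QQ_TT[OF Suc.prems(1)] by simp
    moreover have "CM (cG n i) (CM (sG ?m (Suc i)) (CM (sG ?m i) x)) \<in> QQ k n"
      using i Suc.prems by (intro Suc.IH QQ_s) simp_all
    ultimately show ?thesis using QQ_TT[OF Suc.prems(1)] QQ_SC[of _ k n "1 / (e * a)"] by (metis CM_assoc Cl_G Cl_ops(2) TT_Cl)
  qed
qed simp

lemma QQ_expr: "wf_expr t ==> x \<in> QQ k (i + src t + j) ==> CM (wh i (cl t) j) x \<in> QQ k (i + tgt t + j)"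
proof (induction t arbitrary: i j x)
  case GenH
  then show ?case using QQ_s[of x k "i + (2 + j)" "Suc i", unfolded sG_S] by (simp add: add.assoc)
next
  case GenA
  then show ?case using QQ_c[of x k "i + j" "Suc i"] by (simp add: cG_S)
next
  case GenU
  then show ?case using QQ_u[of x k "i + j" "Suc i"] by (simp add: uG_S)
next
  case (Ident n)
  then show ?case using QQ_TT[of x k "i + n + j"] by (simp add: CM_ID_l[of _ k "i + n + j"])
next
  case (Zero m n)
  have "wh i (ZE m n) j = ZE (i + m + j) (i + n + j)"
    unfolding wh_def using TN_ZE_l[of "ID j" j j m n] TN_ZE_r[of "ID i" i i "m + j" "n + j"] by (simp add: add.assoc)
  then show ?case using Zero QQ_TT[of x k "i + m + j"] by (simp add: CM_ZE_l[of _ k "i + m + j"] QQ_ZE)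
next
  case (Add s t)
  have w: "wf_expr s" "wf_expr t" "src s = src t" "tgt s = tgt t" using Add.prems by simp_all
  have T: "cl s \<in> TT (src t) (tgt t)" "cl t \<in> TT (src t) (tgt t)" using w by (auto intro!: cl_TTI)
  have "CM (wh i (cl s) j) x \<in> QQ k (i + tgt t + j)" "CM (wh i (cl t) j) x \<in> QQ k (i + tgt t + j)"
    using Add.IH(1)[of x i j] Add.IH(2)[of x i j] w Add.prems by simp_all
  moreover have "wh i (cl (s +\<^sub>e t)) j = AD (wh i (cl s) j) (wh i (cl t) j)" unfolding cl_add[symmetric] by (rule wh_AD[OF T])
  moreover have "x \<in> Cl" using QQ_TT[OF Add.prems(2)] by simp
  ultimately show ?case using w T by (simp add: CM_AD_l[OF _ TT_wh TT_wh] QQ_AD)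
next
  case (Scale c t)
  have "wh i (cl (c *\<^sub>e t)) j = SC c (wh i (cl t) j)" unfolding cl_scale[symmetric] by simp
  moreover have "x \<in> Cl" using QQ_TT[OF Scale.prems(2)] by simp
  ultimately show ?case using Scale.IH[of x i j] Scale.prems by (simp add: QQ_SC)
next
  case (Comp s t)
  have w: "wf_expr s" "wf_expr t" "src s = tgt t" using Comp.prems by simp_all
  have T: "cl s \<in> TT (tgt t) (tgt s)" "cl t \<in> TT (src t) (tgt t)" using w by (auto intro!: cl_TTI)
  have "wh i (cl (s \<circ>\<^sub>e t)) j = CM (wh i (cl s) j) (wh i (cl t) j)" unfolding cl_comp[symmetric] by (rule wh_CM[OF T, symmetric])
  moreover have "x \<in> Cl" using QQ_TT[OF Comp.prems(2)] by simp
  ultimately have "CM (wh i (cl (s \<circ>\<^sub>e t)) j) x = CM (wh i (cl s) j) (CM (wh i (cl t) j) x)" by (simp add: CM_assoc)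
  then show ?case using Comp.IH(1)[of "CM (wh i (cl t) j) x" i j] Comp.IH(2)[of x i j] w Comp.prems by simp
next
  case (Tens s t)
  have w: "wf_expr s" "wf_expr t" using Tens.prems by simp_all
  have T: "cl s \<in> TT (src s) (tgt s)" "cl t \<in> TT (src t) (tgt t)" using w by (auto intro!: cl_TTI)
  have "wh i (cl (s \<otimes>\<^sub>e t)) j = CM (wh i (cl s) (tgt t + j)) (wh (i + src s) (cl t) j)"
    unfolding cl_tens[symmetric] using wh_far1[OF T, of i 0 j] by simp
  moreover have "x \<in> Cl" using QQ_TT[OF Tens.prems(2)] by simp
  ultimately have "CM (wh i (cl (s \<otimes>\<^sub>e t)) j) x = CM (wh i (cl s) (tgt t + j)) (CM (wh (i + src s) (cl t) j) x)" by (simp add: CM_assoc)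
  moreover have "CM (wh (i + src s) (cl t) j) x \<in> QQ k (i + src s + (tgt t + j))"
    using Tens.IH(2)[of x "i + src s" j] w Tens.prems by (simp add: add.assoc)
  ultimately show ?case using Tens.IH(1)[of "CM (wh (i + src s) (cl t) j) x" i "tgt t + j"] w by (simp add: add.assoc)
qed

lemma TT_QQ: "X \<in> TT m n ==> X \<in> QQ m n"
proof (erule TTE)
  fix t assume t: "X = cl t" "wf_expr t" "src t = m" "tgt t = n"
  have "LW m m 0 m (ID m)" using RW_ID by (intro LW_B) simp
  then have "CM (wh 0 (cl t) 0) (ID m) \<in> QQ m (0 + tgt t + 0)" using t by (intro QQ_expr LW_QQ[of m m 0]) simp_all
  then show "X \<in> QQ m n" using t cl_TTI[OF t(2-4)] by (simp add: wh_def CM_ID_r[of _ m n])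
qed

lemma spn_op:
  assumes "\<And>x. x \<in> S ==> h x \<in> spn m' n' S'" and "S \<subseteq> TT m n"
    and "h (ZE m n) = ZE m' n'" "\<And>x y. x \<in> TT m n ==> y \<in> TT m n ==> h (AD x y) = AD (h x) (h y)" "\<And>c x. x \<in> TT m n ==> h (SC c x) = SC c (h x)"
  shows "x \<in> spn m n S ==> h x \<in> spn m' n' S'"
proof (induction rule: spn.induct)
  case (spn_add x y)
  then show ?case using spn_TT[OF assms(2)] assms(4) by (simp add: spn.spn_add)
next
  case (spn_scl x c)
  then show ?case using spn_TT[OF assms(2)] assms(5) by (simp add: spn.spn_scl)
qed (auto simp: assms(1,3) spn.spn_zero)

end

lemma caps_index_snoc:
  assumes "js \<in> caps_index m r" "\<forall>y\<in>set js. fst y < p" "1 <= p" "p + t <= m + 1"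
  shows "js @ [(p, t)] \<in> caps_index (Suc (Suc m)) r"
proof -
  have m: "m = r + 2 * length js" and s: "sorted_wrt (<) (map fst js)" using assms(1) by (simp_all add: caps_index_def)
  have n: "1 <= fst (js ! i) \<and> fst (js ! i) + snd (js ! i) <= (r + 2 * i) + 1" if "i < length js" for i
    using assms(1) that unfolding caps_index_def by blast
  have "1 <= fst ((js @ [(p, t)]) ! i) \<and> fst ((js @ [(p, t)]) ! i) + snd ((js @ [(p, t)]) ! i) <= (r + 2 * i) + 1"
    if "i < length (js @ [(p, t)])" for i
  proof (cases "i < length js")
    case True
    then show ?thesis using n by (simp add: nth_append)
  next
    case False
    then have "i = length js" using that by simp
    then show ?thesis using assms(3,4) m by simp
  qed
  moreover have "sorted_wrt (<) (map fst (js @ [(p, t)]))" using s assms(2) by (simp add: sorted_wrt_append)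
  ultimately show ?thesis using m unfolding caps_index_def by simp
qed

lemma cups_index_Cons:
  assumes "us \<in> cups_index r n" "\<forall>y\<in>set us. fst y < p" "1 <= p" "p + t <= n + 1"
  shows "(p, t) # us \<in> cups_index r (Suc (Suc n))"
proof -
  have m: "n = r + 2 * length us" and s: "sorted_wrt (>) (map fst us)" using assms(1) by (simp_all add: cups_index_def)
  have n: "1 <= fst (us ! i) \<and> fst (us ! i) + snd (us ! i) <= (n - 2 * (i + 1)) + 1" if "i < length us" for i
    using assms(1) that unfolding cups_index_def by blast
  have "1 <= fst (((p, t) # us) ! i) \<and> fst (((p, t) # us) ! i) + snd (((p, t) # us) ! i) <= (Suc (Suc n) - 2 * (i + 1)) + 1"
    if "i < length ((p, t) # us)" for i
  proof (cases i)
    case 0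
    then show ?thesis using assms(3,4) by simp
  next
    case (Suc j)
    then show ?thesis using n[of j] that by simp
  qed
  moreover have "sorted_wrt (>) (map fst ((p, t) # us))" using s assms(2) by simp
  ultimately show ?thesis using m unfolding cups_index_def by simp
qed

context good_pres
begin

lemma cl_J: "cl (expr_J n h t) = Rcr (Suc (Suc n)) h t (cG n h)"
  by (induction t) (simp_all add: cl_comp[symmetric] cl_expr_s cl_expr_a)
lemma cl_Ix: "cl (expr_I n h t) = Lcr (Suc (Suc n)) h t (uG n h)"
  by (induction t) (simp_all add: cl_comp[symmetric] cl_expr_s cl_expr_u)
lemma Lcr_Cl [simp]: "y \<in> Cl ==> Lcr n j t y \<in> Cl" by (induction t) simp_all
lemma Rcr_CM: "X \<in> Cl ==> y \<in> Cl ==> CM X (Rcr n j t y) = Rcr n j t (CM X y)"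
  by (induction t) (simp_all add: CM_assoc[symmetric])
lemma Lcr_CM: "X \<in> Cl ==> y \<in> Cl ==> CM (Lcr n j t y) X = Lcr n j t (CM y X)"
  by (induction t) (simp_all add: CM_assoc)

lemma J_TT: "1 <= h ==> h + t <= n + 1 ==> cl (expr_J n h t) \<in> TT (Suc (Suc n)) n"
proof (induction t)
  case (Suc t)
  have "CM (cl (expr_J n h t)) (sG (Suc (Suc n)) (h + Suc t)) \<in> TT (Suc (Suc n)) n"
    by (rule TT_CM[OF Suc.IH TT_sG]) (use Suc.prems in simp_all)
  then show ?case by (simp add: cl_comp[symmetric] cl_expr_s)
qed (use TT_cG[of h n] in \<open>simp add: cl_expr_a\<close>)

lemma I_TT: "1 <= h ==> h + t <= n + 1 ==> cl (expr_I n h t) \<in> TT n (Suc (Suc n))"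
proof (induction t)
  case (Suc t)
  have "CM (sG (Suc (Suc n)) (h + Suc t)) (cl (expr_I n h t)) \<in> TT n (Suc (Suc n))"
    by (rule TT_CM[OF TT_sG Suc.IH]) (use Suc.prems in simp_all)
  then show ?case by (simp add: cl_comp[symmetric] cl_expr_s)
qed (use TT_uG[of h n] in \<open>simp add: cl_expr_u\<close>)

lemma caps_append:
  "1 <= h ==> h + t <= r + 2 * length js + 1 ==> cl (caps r (js @ [(h, t)])) = CM (cl (caps r js)) (cl (expr_J (r + 2 * length js) h t))"
proof (induction js arbitrary: r)
  case Nil
  then have J: "cl (expr_J r h t) \<in> TT (Suc (Suc r)) r" by (intro J_TT) simp_all
  then show ?case by (simp add: cl_comp[symmetric] CM_ID_l[of _ "Suc (Suc r)" r] CM_ID_r[of _ "Suc (Suc r)" r])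
next
  case (Cons y js)
  obtain h' t' where y: "y = (h', t')" by force
  have "cl (caps (r + 2) (js @ [(h, t)])) = CM (cl (caps (r + 2) js)) (cl (expr_J (r + 2 + 2 * length js) h t))"
    using Cons.prems by (intro Cons.IH) simp_all
  then show ?case by (simp add: y cl_comp[symmetric] CM_assoc)
qed

lemma caps_TT: "js \<in> caps_index m r ==> cl (caps r js) \<in> TT m r"
proof (induction js arbitrary: m rule: rev_induct)
  case Nil
  then show ?case by (simp add: caps_index_def)
next
  case (snoc y js)
  obtain h t where y: "y = (h, t)" by force
  define m' where "m' = r + 2 * length js"
  have m: "m = Suc (Suc m')" using snoc.prems by (simp add: caps_index_def m'_def)
  have all: "1 <= fst ((js @ [y]) ! i) \<and> fst ((js @ [y]) ! i) + snd ((js @ [y]) ! i) <= (r + 2 * i) + 1" if "i < length (js @ [y])" for i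
    using snoc.prems that unfolding caps_index_def by blast
  have pt: "1 <= h" "h + t <= m' + 1" using all[of "length js"] by (simp_all add: y m'_def)
  have "1 <= fst (js ! i) \<and> fst (js ! i) + snd (js ! i) <= (r + 2 * i) + 1" if "i < length js" for i
    using all[of i] that by (simp add: nth_append)
  moreover have "sorted_wrt (<) (map fst js)" using snoc.prems by (simp add: caps_index_def sorted_wrt_append)
  ultimately have "js \<in> caps_index m' r" unfolding caps_index_def m'_def by simp
  from snoc.IH[OF this] J_TT[OF pt] have "CM (cl (caps r js)) (cl (expr_J m' h t)) \<in> TT m r" unfolding m by (rule TT_CM)
  then show ?case using caps_append[of h t r js] pt by (simp add: y m'_def)
qed

lemma spn_mono: "x \<in> spn m n S ==> S \<subseteq> S' ==> x \<in> spn m n S'"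
  by (induction rule: spn.induct) (auto intro: spn.intros)

context
  fixes W assumes W: "reduced_word_system W"
begin

lemma W_set: "w \<in> W r ==> set w \<subseteq> {1..<r}"
  by (rule reduced_wordD(1)[OF reduced_systemD(1)[OF W]])

definition "SR r N m = {CM (wd r w) (cl (caps r js)) | w js. w \<in> W r \<and> js \<in> caps_index m r \<and> (\<forall>y\<in>set js. fst y <= N)}"

lemma SR_TT: "SR r N m \<subseteq> TT m r"
  unfolding SR_def using TT_CM[OF wd_TT[OF W_set] caps_TT] by blast

lemma RV_span: "RV r q N m x ==> x \<in> spn m r (SR r N m)"
proof (induction rule: RV_induct)
  case (VB y n q N)
  then have n: "n = r" "y \<in> hecke r" by (simp_all split: if_splits)
  have "wd r ` W r \<subseteq> SR r N r"
  proof
    fix x assume "x \<in> wd r ` W r"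
    then obtain w where w: "x = wd r w" "w \<in> W r" by blast
    have "[] \<in> caps_index r r" by (simp add: caps_index_def)
    moreover have "x = CM (wd r w) (cl (caps r []))" using wd_TT[OF W_set[OF w(2)]] w by (simp add: CM_ID_r[of _ r r])
    ultimately show "x \<in> SR r N r" unfolding SR_def using w(2) by (intro CollectI exI[of _ w] exI[of _ "[]"]) simp
  qed
  then show ?case unfolding n(1) by (rule spn_mono[OF hecke_W[OF c0 W n(2)]])
next
  case (VI q h n f N t)
  have JT: "cl (expr_J n (Suc h) t) \<in> TT (Suc (Suc n)) n" using VI.hyps by (intro J_TT) simp_all
  have fT: "f \<in> TT n r" by (rule RV_TT[OF VI.hyps(1)])
  have "CM f (cl (expr_J n (Suc h) t)) \<in> spn (Suc (Suc n)) r (SR r N (Suc (Suc n)))"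
  proof (rule spn_op[of "SR r h n" "\<lambda>x. CM x (cl (expr_J n (Suc h) t))", OF _ SR_TT _ _ _ VI.IH])
    fix x assume "x \<in> SR r h n"
    then obtain w js where x: "x = CM (wd r w) (cl (caps r js))" "w \<in> W r" "js \<in> caps_index n r" "\<forall>y\<in>set js. fst y <= h"
      unfolding SR_def by blast
    have n: "n = r + 2 * length js" using x(3) by (simp add: caps_index_def)
    have "CM x (cl (expr_J n (Suc h) t)) = CM (wd r w) (cl (caps r (js @ [(Suc h, t)])))"
      using caps_append[of "Suc h" t r js] VI.hyps n wd_TT[OF W_set[OF x(2)]] by (simp add: x(1) CM_assoc)
    moreover have "js @ [(Suc h, t)] \<in> caps_index (Suc (Suc n)) r"
      using x VI.hyps by (intro caps_index_snoc) auto
    moreover have "\<forall>y\<in>set (js @ [(Suc h, t)]). fst y <= N" using x(4) VI.hyps by auto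
    ultimately show "CM x (cl (expr_J n (Suc h) t)) \<in> spn (Suc (Suc n)) r (SR r N (Suc (Suc n)))"
      using x(2) unfolding SR_def by (intro spn.spn_gen CollectI exI conjI) assumption+
  qed (use JT in \<open>simp_all add: CM_ZE_l CM_AD_l[of _ _ n r]\<close>)
  then show ?case using fT by (simp add: cl_J Rcr_CM)
qed (auto intro: spn.spn_add spn.spn_scl)

definition "SL k r N n = {CM (cl (cups n us)) (CM (wd r w) (cl (caps r js))) | us w js.
   us \<in> cups_index r n \<and> w \<in> W r \<and> js \<in> caps_index k r \<and> (\<forall>y\<in>set us. fst y <= N)}"

lemma cups_TT: "us \<in> cups_index r n ==> cl (cups n us) \<in> TT r n"
proof (induction us arbitrary: n)
  case Nil
  then show ?case by (simp add: cups_index_def)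
next
  case (Cons y us)
  obtain h t where y: "y = (h, t)" by force
  define n' where "n' = r + 2 * length us"
  have n: "n = Suc (Suc n')" using Cons.prems by (simp add: cups_index_def n'_def)
  have all: "1 <= fst ((y # us) ! i) \<and> fst ((y # us) ! i) + snd ((y # us) ! i) <= (n - 2 * (i + 1)) + 1" if "i < length (y # us)" for i
    using Cons.prems that unfolding cups_index_def by blast
  have pt: "1 <= h" "h + t <= n' + 1" using all[of 0] by (simp_all add: y n)
  have "1 <= fst (us ! i) \<and> fst (us ! i) + snd (us ! i) <= (n' - 2 * (i + 1)) + 1" if "i < length us" for i
    using all[of "Suc i"] that by (simp add: n)
  moreover have "sorted_wrt (>) (map fst us)" using Cons.prems by (simp add: cups_index_def)
  ultimately have "us \<in> cups_index r n'" unfolding cups_index_def by (simp add: n'_def)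
  from TT_CM[OF I_TT[OF pt] Cons.IH[OF this]] show ?case by (simp add: y n cl_comp[symmetric])
qed

lemma SL_TT: "SL k r N n \<subseteq> TT k n"
  unfolding SL_def using TT_CM[OF cups_TT TT_CM[OF wd_TT[OF W_set] caps_TT]] by blast

lemma LV_span: "LV k r q N n x ==> x \<in> spn k n (SL k r N n)"
proof (induction rule: LV_induct)
  case (VB y n q N)
  then have n: "n = r" "RW r 0 k y" by (simp_all split: if_splits)
  obtain N' where N': "RV r (Suc 0) N' k y" using RW_RV[OF n(2)] by blast
  have "SR r N' k \<subseteq> SL k r N r"
  proof
    fix x assume "x \<in> SR r N' k"
    then obtain w js where x: "x = CM (wd r w) (cl (caps r js))" "w \<in> W r" "js \<in> caps_index k r" unfolding SR_def by blast
    have "[] \<in> cups_index r r" by (simp add: cups_index_def)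
    moreover have "x = CM (cl (cups r [])) (CM (wd r w) (cl (caps r js)))"
      using TT_CM[OF wd_TT[OF W_set[OF x(2)]] caps_TT[OF x(3)]] x(1) by (simp add: CM_ID_l[of _ k r])
    ultimately show "x \<in> SL k r N r" unfolding SL_def using x by (intro CollectI exI[of _ "[]"] exI[of _ w] exI[of _ js]) simp
  qed
  then show ?case unfolding n(1) by (rule spn_mono[OF RV_span[OF N']])
next
  case (VI q h n f N t)
  have IT: "cl (expr_I n (Suc h) t) \<in> TT n (Suc (Suc n))" using VI.hyps by (intro I_TT) simp_all
  have fT: "f \<in> TT k n" by (rule LV_TT[OF VI.hyps(1)])
  have "CM (cl (expr_I n (Suc h) t)) f \<in> spn k (Suc (Suc n)) (SL k r N (Suc (Suc n)))"
  proof (rule spn_op[of "SL k r h n" "\<lambda>x. CM (cl (expr_I n (Suc h) t)) x", OF _ SL_TT _ _ _ VI.IH])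
    fix x assume "x \<in> SL k r h n"
    then obtain us w js where x: "x = CM (cl (cups n us)) (CM (wd r w) (cl (caps r js)))" "us \<in> cups_index r n" "w \<in> W r" "js \<in> caps_index k r" "\<forall>y\<in>set us. fst y <= h"
      unfolding SL_def by blast
    have "CM (cl (expr_I n (Suc h) t)) x = CM (cl (cups (Suc (Suc n)) ((Suc h, t) # us))) (CM (wd r w) (cl (caps r js)))"
      using wd_TT[OF W_set[OF x(3)]] by (simp add: x(1) CM_assoc cl_comp[symmetric])
    moreover have "(Suc h, t) # us \<in> cups_index r (Suc (Suc n))"
      using x VI.hyps by (intro cups_index_Cons) auto
    moreover have "\<forall>y\<in>set ((Suc h, t) # us). fst y <= N" using x(5) VI.hyps by auto
    ultimately show "CM (cl (expr_I n (Suc h) t)) x \<in> spn k (Suc (Suc n)) (SL k r N (Suc (Suc n)))"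
      using x(3,4) unfolding SL_def by (intro spn.spn_gen CollectI exI conjI) assumption+
  qed (use IT in \<open>simp_all add: CM_ZE_r CM_AD_r[of _ _ k n]\<close>)
  then show ?case using fT by (simp add: cl_Ix Lcr_CM)
qed (auto intro: spn.spn_add spn.spn_scl)

lemma std_span: "X \<in> TT m n ==> X \<in> spn m n ((\<lambda>x. cl (std_expr n x)) ` std_index W m n)"
proof -
  let ?S = "(\<lambda>x. cl (std_expr n x)) ` std_index W m n"
  have sub: "SL m r N n \<subseteq> ?S" for r N
  proof
    fix x assume "x \<in> SL m r N n"
    then obtain us w js where x: "x = CM (cl (cups n us)) (CM (wd r w) (cl (caps r js)))" "us \<in> cups_index r n" "w \<in> W r" "js \<in> caps_index m r"
      unfolding SL_def by blast
    have r: "n - 2 * length us = r" using x(2) by (simp add: cups_index_def)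
    have "(us, w, js) \<in> std_index W m n" unfolding std_index_def using x by auto
    moreover have "x = cl (std_expr n (us, w, js))" unfolding std_expr_def Let_def using r x(1) by (simp add: cl_comp[symmetric] cl_word)
    ultimately show "x \<in> ?S" by (rule image_eqI[rotated])
  qed
  assume "X \<in> TT m n"
  then have "X \<in> QQ m n" by (rule TT_QQ)
  then show ?thesis unfolding QQ_def
  proof (induction rule: spn.induct)
    case (spn_gen x)
    then obtain r where "LW m r 0 n x" by blast
    then obtain N where "LV m r (Suc 0) N n x" using LW_LV by blast
    then show ?case by (rule spn_mono[OF LV_span sub])
  qed (auto intro: spn.spn_zero spn.spn_add spn.spn_scl)
qed

end
end

section \<open>Deformed matchings\<close>

typedef 'k vec = "UNIV :: (nat list => 'k) set" morphisms co Vec by simp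

lemma co_Vec [simp]: "co (Vec f) = f" by (simp add: Vec_inverse)
lemma vec_eq_iff: "f = g \<longleftrightarrow> (\<forall>x. co f x = co g x)"
  by (metis co_inverse ext)

instantiation vec :: (ab_group_add) ab_group_add
begin
definition "f + g = Vec (\<lambda>x. co f x + co g x)"
definition "f - g = Vec (\<lambda>x. co f x - co g x)"
definition "- f = Vec (\<lambda>x. - co f x)"
definition "0 = Vec (\<lambda>x. 0)"
instance by standard (auto simp: vec_eq_iff plus_vec_def minus_vec_def uminus_vec_def zero_vec_def algebra_simps)
end

lemma co_simps [simp]: "co (f + g) x = co f x + co g x" "co (f - g) x = co f x - co g x"
  "co (- f) x = - co f x" "co 0 x = 0"
  by (auto simp: plus_vec_def minus_vec_def uminus_vec_def zero_vec_def)

lemma co_sum: "co (sum f A) x = (\<Sum>i\<in>A. co (f i) x)"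
  by (induction A rule: infinite_finite_induct) auto

definition sc :: "'k::field => 'k vec => 'k vec" where
  "sc c f = Vec (\<lambda>x. c * co f x)"

definition ins :: "nat => 'k::field vec => 'k vec" where
  "ins j f = Vec (\<lambda>xs. case xs of [] => 0 | i # ys => if i = j then co f ys else 0)"

definition slice :: "nat => 'k::field vec => 'k vec" where
  "slice j f = Vec (\<lambda>xs. co f (j # xs))"

definition lin :: "('k::field vec => 'k vec) => bool" where
  "lin P \<longleftrightarrow> (\<forall>x y. P (x + y) = P x + P y) \<and> (\<forall>c x. P (sc c x) = sc c (P x))"

lemma co_sc [simp]: "co (sc c f) x = c * co f x" by (simp add: sc_def)
lemma co_slice [simp]: "co (slice j f) xs = co f (j # xs)" by (simp add: slice_def)
lemma co_ins: "co (ins j f) xs = (case xs of [] => 0 | i # ys => if i = j then co f ys else 0)"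
  by (simp add: ins_def)

lemma sc_simps [simp]:
  "sc c (x + y) = sc c x + sc c y" "sc c (sc d x) = sc (c * d) x" "sc 1 x = x" "sc 0 x = 0"
  "sc c 0 = 0" "sc c (x - y) = sc c x - sc c y" "sc c (- x) = - sc c x"
  by (auto simp: vec_eq_iff algebra_simps)

lemma sc_sum: "sc c (sum f A) = (\<Sum>i\<in>A. sc c (f i))"
  by (induction A rule: infinite_finite_induct) auto

lemma linI: "(\<And>x y. P (x + y) = P x + P y) ==> (\<And>c x. P (sc c x) = sc c (P x)) ==> lin P"
  by (simp add: lin_def)

lemma lin_add: "lin P ==> P (x + y) = P x + P y" by (simp add: lin_def)
lemma lin_sc: "lin P ==> P (sc c x) = sc c (P x)" by (simp add: lin_def)
lemma lin_0: "lin P ==> P 0 = 0" using lin_sc[of P 0 0] by simp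
lemma lin_sum: "lin P ==> P (sum f A) = (\<Sum>i\<in>A. P (f i))"
  by (induction A rule: infinite_finite_induct) (auto simp: lin_add lin_0)
lemma lin_minus: "lin P ==> P (- x) = - P x"
  proof -
  assume "lin P"
  then have "P (sc (- 1) x) = sc (- 1) (P x)" by (rule lin_sc)
  moreover have "sc (- 1) y = - y" for y :: "'a vec" by (simp add: vec_eq_iff)
  ultimately show ?thesis by simp
qed
lemma lin_diff: "lin P ==> P (x - y) = P x - P y"
  using lin_add[of P x "- y"] lin_minus[of P y] by simp
lemmas lin_simps = lin_add lin_sc lin_0 lin_minus lin_diff

lemma ins_lin: "lin (ins j)"
  by (rule linI) (auto simp: co_ins vec_eq_iff split: list.splits)
lemma slice_lin: "lin (slice j)"
  by (rule linI) (auto simp: vec_eq_iff)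
lemmas ins_simps [simp] = lin_simps[OF ins_lin]
lemmas slice_simps [simp] = lin_simps[OF slice_lin]

lemma lin_id: "lin (\<lambda>x. x)" by (rule linI) auto
lemma lin_comp: "lin P ==> lin Q ==> lin (\<lambda>x. P (Q x))" by (auto simp: lin_def)
lemma lin_plus: "lin P ==> lin Q ==> lin (\<lambda>x. P x + Q x)"
  by (auto simp: lin_def algebra_simps)
lemma lin_minus': "lin P ==> lin Q ==> lin (\<lambda>x. P x - Q x)"
  by (auto simp: lin_def algebra_simps)
lemma lin_scale: "lin P ==> lin (\<lambda>x. sc c (P x))"
  by (auto simp: lin_def mult.commute)
lemma lin_sum': "(\<And>i. i \<in> A ==> lin (P i)) ==> lin (\<lambda>x. \<Sum>i\<in>A. P i x)"
  by (auto simp: lin_def sum.distrib sc_sum)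
lemma lin_zero: "lin (\<lambda>x. 0)" by (rule linI) auto
lemmas lin_intros = lin_id lin_comp[OF ins_lin] lin_comp[OF slice_lin] lin_plus lin_minus' lin_scale
  lin_sum' lin_zero

lemma slice_ins: "slice i (ins j f) = (if i = j then f else 0)"
  by (auto simp: vec_eq_iff co_ins)

text \<open>The head of a code is the partner of the first point, the tail encodes the matching of the other
  points, renumbered.\<close>

fun codes :: "nat => nat list set" where
  "codes 0 = {[]}"
| "codes (Suc k) = (\<Union>j\<in>{2..2 * k + 2}. (#) j ` codes k)"

lemma codes_Cons [simp]: "j # ys \<in> codes (Suc k) \<longleftrightarrow> 2 <= j \<and> j <= 2 * k + 2 \<and> ys \<in> codes k"
  and codes_Nil [simp]: "[] \<notin> codes (Suc k)"
  by auto

declare codes.simps(2) [simp del] sum.cl_ivl_Suc [simp del]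

definition NN :: "nat => 'k::field vec set" where
  "NN k = {f. \<forall>xs. xs \<notin> codes k --> co f xs = 0}"

lemma NN_add [intro, simp]: "f \<in> NN k ==> g \<in> NN k ==> f + g \<in> NN k" by (auto simp: NN_def)
lemma NN_sc [intro, simp]: "f \<in> NN k ==> sc c f \<in> NN k" by (auto simp: NN_def)
lemma NN_0 [intro, simp]: "0 \<in> NN k" by (auto simp: NN_def)
lemma NN_diff [intro, simp]: "f \<in> NN k ==> g \<in> NN k ==> f - g \<in> NN k" by (auto simp: NN_def)
lemma NN_minus [intro, simp]: "f \<in> NN k ==> - f \<in> NN k" by (auto simp: NN_def)
lemma NN_sum [intro]: "(\<And>i. i \<in> A ==> f i \<in> NN k) ==> sum f A \<in> NN k"
  by (induction A rule: infinite_finite_induct) auto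
lemma NN_ins [intro, simp]: "f \<in> NN k ==> 2 <= j ==> j <= 2 * k + 2 ==> ins j f \<in> NN (Suc k)"
  by (auto simp: NN_def co_ins split: list.splits)
lemma NN_slice [intro]: "f \<in> NN (Suc k) ==> slice j f \<in> NN k"
  by (auto simp: NN_def)

lemma NN_decomp:
  assumes "f \<in> NN (Suc k)"
  shows "f = (\<Sum>j=2..2 * k + 2. ins j (slice j f))"
proof (subst vec_eq_iff, intro allI)
  fix xs
  show "co f xs = co (\<Sum>j=2..2 * k + 2. ins j (slice j f)) xs"
  proof (cases xs)
    case Nil then show ?thesis using assms by (auto simp: co_ins co_sum NN_def)
  next
    case (Cons i ys)
    then have "(\<Sum>j=2..2 * k + 2. co (ins j (slice j f)) xs) = (\<Sum>j=2..2 * k + 2. if i = j then co f xs else 0)"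
      by (intro sum.cong) (auto simp: co_ins)
    also have "... = co f xs" using assms Cons by (auto simp: NN_def)
    finally show ?thesis by (simp add: co_sum)
  qed
qed

lemma NN_ext:
  assumes "lin P" "lin Q" "\<And>j f. 2 <= j ==> j <= 2 * k + 2 ==> f \<in> NN k ==> P (ins j f) = Q (ins j f)"
    and "x \<in> NN (Suc k)"
  shows "P x = Q x"
proof -
  have "P x = (\<Sum>j=2..2 * k + 2. P (ins j (slice j x)))"
    by (subst NN_decomp[OF assms(4)]) (simp add: lin_sum[OF assms(1)])
  also have "... = (\<Sum>j=2..2 * k + 2. Q (ins j (slice j x)))"
    using assms(3,4) by (intro sum.cong) auto
  also have "... = Q (\<Sum>j=2..2 * k + 2. ins j (slice j x))"
    by (simp add: lin_sum[OF assms(2)])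
  also have "... = Q x" using NN_decomp[OF assms(4)] by simp
  finally show ?thesis .
qed

locale chord_params =
  fixes lam lam' b e sig a \<epsilon> :: "'k::field"
  assumes nz: "lam \<noteq> 0" "b \<noteq> 0" "sig \<noteq> 0" "a \<noteq> 0" and a_eq: "a = lam\<^sup>2 - b * lam"
    and e2: "e\<^sup>2 = - \<epsilon>" and eps: "\<epsilon> * \<epsilon> = 1" and lam': "lam' = lam \<or> lam' = b - lam"
begin

abbreviation "dD \<equiv> (lam - b) * b"
abbreviation "fF \<equiv> - \<epsilon> * e * a"
abbreviation "kap \<equiv> - (e / a)"
abbreviation "rho \<equiv> \<epsilon> * e * sig * (lam - b)"
abbreviation "del \<equiv> \<epsilon> * e * sig * (lam + lam' - b) / b"

lemma enz: "e \<noteq> 0" using e2 eps by auto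
lemma epsnz: "\<epsilon> \<noteq> 0" using eps by auto

definition Tg :: "(nat => 'k vec => 'k vec) => nat => nat => 'k vec => 'k vec" where
  "Tg S i j f = (if j < i then ins j (S (i - 2) f) else if i = j then ins (Suc j) f
     else if Suc i = j then sc a (ins i f) + sc b (ins j f) else ins j (S (i - 1) f))"

definition Gop :: "(nat => 'k vec => 'k vec) => nat => nat => 'k vec => 'k vec" where
  "Gop S k i F = (\<Sum>j=2..2 * k + 2. Tg S i j (slice j F))"

primrec Wop :: "(nat => 'k vec => 'k vec) => nat => nat => 'k vec => 'k vec" where
  "Wop S k 0 F = F"
| "Wop S k (Suc m) F = Gop S k (m + 3) (Wop S k m F)"

definition u2 :: "nat => 'k vec => 'k vec" where
  "u2 k f = (\<Sum>l=2..2 * k. sc kap (ins (l + 2) (ins 2 (slice l f))))"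

definition X3 :: "nat => 'k vec => 'k vec" where
  "X3 k f = sc dD (ins 2 f) + sc b (ins 3 f) + sc fF (u2 k f)"

primrec ss :: "nat => nat => 'k vec => 'k vec" where
  "ss 0 i F = 0"
| "ss (Suc k) i F = (if 2 <= i then Gop (ss k) k i F
     else sc lam (ins 2 (slice 2 F)) + (\<Sum>j=3..2 * k + 2. Wop (ss k) k (j - 3) (X3 k (slice j F))))"

lemma u2_lin: "lin (u2 k)" unfolding u2_def by (intro lin_intros)
lemma X3_lin: "lin (X3 k)" unfolding X3_def by (intro lin_intros u2_lin ins_lin)
lemma Tg_lin: "(\<And>i. lin (S i)) ==> lin (Tg S i j)" unfolding Tg_def by (cases "j < i"; cases "i = j"; cases "Suc i = j") (auto intro!: lin_intros ins_lin)
lemma Gop_lin: "(\<And>i. lin (S i)) ==> lin (Gop S k i)" unfolding Gop_def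
  by (intro lin_intros lin_comp[OF Tg_lin] slice_lin)
lemma Wop_lin: "(\<And>i. lin (S i)) ==> lin (Wop S k m)"
proof (induction m)
  case (Suc m)
  then show ?case using lin_comp[OF Gop_lin[of S k "m + 3"] Suc.IH] by (simp add: lin_def)
qed (simp add: lin_def)
lemma S_lin: "lin (ss k i)"
proof (induction k arbitrary: i)
  case (Suc k)
  then show ?case
    by (cases "2 <= i") (auto intro!: Gop_lin lin_intros slice_lin lin_comp[OF Wop_lin] lin_comp[OF X3_lin])
next
  case 0
  show ?case by (rule linI) simp_all
qed

lemmas S_simps [simp] = lin_simps[OF S_lin]
lemmas u2_simps [simp] = lin_simps[OF u2_lin]

lemma Tg_0: "Tg (ss k) i j 0 = 0" using lin_0[OF Tg_lin[OF S_lin]] .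

lemma S_ins: "2 <= i ==> 2 <= j ==> j <= 2 * k + 2 ==> ss (Suc k) i (ins j f) =
   (if j < i then ins j (ss k (i - 2) f) else if i = j then ins (Suc j) f
     else if Suc i = j then sc a (ins i f) + sc b (ins j f) else ins j (ss k (i - 1) f))"
proof -
  assume h: "2 <= i" "2 <= j" "j <= 2 * k + 2"
  have "ss (Suc k) i (ins j f) = (\<Sum>l=2..2 * k + 2. if l = j then Tg (ss k) i j f else 0)"
    unfolding ss.simps Gop_def using h by (simp only: if_True, intro sum.cong) (auto simp: slice_ins Tg_0)
  also have "... = Tg (ss k) i j f" using h by simp
  finally show ?thesis by (simp add: Tg_def)
qed

lemma S_ins_simps [simp]:
  "2 <= j ==> j <= 2 * k + 2 ==> j < i ==> ss (Suc k) i (ins j f) = ins j (ss k (i - 2) f)"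
  "2 <= j ==> j <= 2 * k + 2 ==> ss (Suc k) j (ins j f) = ins (Suc j) f"
  "2 <= i ==> i <= 2 * k + 1 ==> ss (Suc k) i (ins (Suc i) f) = sc a (ins i f) + sc b (ins (Suc i) f)"
  "2 <= i ==> j <= 2 * k + 2 ==> Suc i < j ==> ss (Suc k) i (ins j f) = ins j (ss k (i - 1) f)"
  by (subst S_ins; simp)+

lemma S1_ins2 [simp]: "ss (Suc k) (Suc 0) (ins 2 f) = sc lam (ins 2 f)"
  by (simp add: slice_ins lin_0[OF Wop_lin[OF S_lin]] lin_0[OF X3_lin])

lemma S1_ins': "3 <= j ==> j <= 2 * k + 2 ==> ss (Suc k) (Suc 0) (ins j f) = Wop (ss k) k (j - 3) (X3 k f)"
proof -
  assume h: "3 <= j" "j <= 2 * k + 2"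
  have "ss (Suc k) (Suc 0) (ins j f) = (\<Sum>l=3..2 * k + 2. if l = j then Wop (ss k) k (j - 3) (X3 k f) else 0)"
  proof -
    have "(\<Sum>l=3..2 * k + 2. Wop (ss k) k (l - 3) (X3 k (slice l (ins j f)))) =
        (\<Sum>l=3..2 * k + 2. if l = j then Wop (ss k) k (j - 3) (X3 k f) else 0)"
      by (intro sum.cong) (auto simp: slice_ins lin_0[OF Wop_lin[OF S_lin]] lin_0[OF X3_lin])
    then show ?thesis using h by (simp add: slice_ins)
  qed
  then show ?thesis using h by simp
qed

lemma S1_ins3: "1 <= k ==> ss (Suc k) (Suc 0) (ins 3 f) = sc dD (ins 2 f) + sc b (ins 3 f) + sc fF (u2 k f)"
  by (subst S1_ins') (auto simp: X3_def)

lemma S1_ins_Suc: "3 <= j ==> j <= 2 * k + 1 ==>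
    ss (Suc k) (Suc 0) (ins (Suc j) f) = ss (Suc k) j (ss (Suc k) (Suc 0) (ins j f))"
proof -
  assume h: "3 <= j" "j <= 2 * k + 1"
  obtain m where m: "j = m + 3" using h(1) by (metis add.commute le_Suc_ex)
  have "ss (Suc k) (Suc 0) (ins (Suc j) f) = Wop (ss k) k (Suc m) (X3 k f)"
    using h m by (subst S1_ins') (auto simp: Suc_diff_le)
  also have "... = ss (Suc k) j (Wop (ss k) k m (X3 k f))" using m by simp
  also have "Wop (ss k) k m (X3 k f) = ss (Suc k) (Suc 0) (ins j f)"
    using h m by (subst S1_ins') auto
  finally show ?thesis .
qed

declare ss.simps(2) [simp del]

lemma u2_ins [simp]: "2 <= l ==> l <= 2 * k ==> u2 k (ins l g) = sc kap (ins (l + 2) (ins 2 g))"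
proof -
  assume h: "2 <= l" "l <= 2 * k"
  have "u2 k (ins l g) = (\<Sum>i=2..2 * k. if i = l then sc kap (ins (l + 2) (ins 2 g)) else 0)"
    unfolding u2_def by (intro sum.cong) (auto simp: slice_ins)
  then show ?thesis using h by simp
qed

lemma NN_u2: "f \<in> NN (Suc k) ==> u2 (Suc k) f \<in> NN (Suc (Suc k))"
  unfolding u2_def by (intro NN_sum NN_sc NN_ins) auto

lemma NN_u2': "f \<in> NN k ==> u2 k f \<in> NN (Suc k)"
  by (cases k) (simp_all add: NN_u2, simp add: u2_def)

lemma NN_Tg: "(\<And>i f. 1 <= i ==> i < 2 * k ==> f \<in> NN k ==> S i f \<in> NN k) ==> 2 <= i ==> i < 2 * k + 2 ==>
   2 <= j ==> j <= 2 * k + 2 ==> f \<in> NN k ==> Tg S i j f \<in> NN (Suc k)"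
  unfolding Tg_def by auto

lemma NN_S: "1 <= i ==> i < 2 * k ==> f \<in> NN k ==> ss k i f \<in> NN k"
proof (induction k arbitrary: i f)
  case (Suc k)
  have G: "Gop (ss k) k i f \<in> NN (Suc k)" if "2 <= i" "i < 2 * k + 2" "f \<in> NN (Suc k)" for i f
    unfolding Gop_def using that Suc.IH by (intro NN_sum NN_Tg) auto
  have W: "m + 3 <= 2 * k + 2 ==> f \<in> NN (Suc k) ==> Wop (ss k) k m f \<in> NN (Suc k)" for m f
    by (induction m) (auto intro!: G)
  show ?case
  proof (cases "2 <= i")
    case False
    have "X3 k f \<in> NN (Suc k)" if "f \<in> NN k" "1 <= k" for f
      unfolding X3_def using that by (intro NN_add NN_sc NN_ins NN_u2') auto
    then show ?thesis using False Suc.prems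
      by (cases "1 <= k") (auto simp: ss.simps intro!: NN_add NN_sc NN_ins NN_sum W NN_slice)
  qed (use Suc.prems G in \<open>auto simp: ss.simps\<close>)
qed auto

lemma gen:
  assumes "lin P" "lin Q"
    and base: "\<And>j f. f \<in> NN k ==> 2 <= j ==> j <= t ==> j <= 2 * k + 2 ==> P (ins j f) = Q (ins j f)"
    and step: "\<And>j x. x \<in> NN (Suc k) ==> t <= j ==> j < 2 * k + 2 ==> P x = Q x ==> P (ss (Suc k) j x) = Q (ss (Suc k) j x)"
    and t: "2 <= t" and x: "x \<in> NN (Suc k)"
  shows "P x = Q x"
proof (rule NN_ext[OF assms(1,2) _ x])
  fix j f
  show "2 <= j ==> j <= 2 * k + 2 ==> f \<in> NN k ==> P (ins j f) = Q (ins j f)"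
  proof (induction j)
    case (Suc j)
    show ?case
    proof (cases "Suc j <= t")
      case False
      then have "t <= j" by simp
      then have j: "2 <= j" using t by simp
      have "P (ins j f) = Q (ins j f)" using Suc j by auto
      then have "P (ss (Suc k) j (ins j f)) = Q (ss (Suc k) j (ins j f))"
        using \<open>t <= j\<close> Suc.prems j by (intro step) auto
      then show ?thesis using j Suc.prems by simp
    qed (use base Suc.prems in auto)
  qed simp
qed

lemma S2_u2: "f \<in> NN k ==> 1 <= k ==> ss (Suc k) 2 (u2 k f) = sc lam (u2 k f)"
proof -
  assume f: "f \<in> NN k" and k: "1 <= k"
  obtain m where m: "k = Suc m" using k by (cases k) auto
  show ?thesis
  proof (rule NN_ext[where P = "\<lambda>f. ss (Suc k) 2 (u2 k f)" and Q = "\<lambda>f. sc lam (u2 k f)" and k = m])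
    fix j and g :: "'k vec" assume h: "2 <= j" "j <= 2 * m + 2" "g \<in> NN m"
    have "ss (Suc k) 2 (ins (j + 2) (ins 2 g)) = ins (j + 2) (ss k 1 (ins 2 g))"
      using h by (subst S_ins_simps(4)) (auto simp: m)
    then show "ss (Suc k) 2 (u2 k (ins j g)) = sc lam (u2 k (ins j g))"
      using h by (simp add: m mult.commute)
  qed (use f m in \<open>auto intro!: lin_intros lin_comp[OF S_lin] u2_lin\<close>)
qed

lemma Si_u2: "f \<in> NN k ==> 4 <= i ==> i < 2 * k + 2 ==> ss (Suc k) i (u2 k f) = u2 k (ss k (i - 2) f)"
proof -
  assume f: "f \<in> NN k" and i: "4 <= i" "i < 2 * k + 2"
  obtain m where m: "k = Suc m" using i by (cases k) auto
  show ?thesis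
  proof (rule NN_ext[where P = "\<lambda>f. ss (Suc k) i (u2 k f)" and Q = "\<lambda>f. u2 k (ss k (i - 2) f)" and k = m])
    fix l and g :: "'k vec" assume h: "2 <= l" "l <= 2 * m + 2" "g \<in> NN m"
    show "ss (Suc k) i (u2 k (ins l g)) = u2 k (ss k (i - 2) (ins l g))"
    proof -
      consider "l + 2 < i" | "i = l + 2" | "i = l + 1" | "i < l + 1" by linarith
      then show ?thesis
      proof cases
        case 1
        have "ss k (i - 2) (ins 2 g) = ins 2 (ss m (i - 4) g)" using 1 h i by (simp add: m)
        moreover have "ss k (i - 2) (ins l g) = ins l (ss m (i - 4) g)" using 1 h i by (simp add: m)
        ultimately show ?thesis using 1 h i by (simp add: m)
      next
        case 2 then show ?thesis using h i by (simp add: m)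
      next
        case 3
        have q: "ss (Suc k) (Suc l) (ins (Suc (Suc l)) (ins 2 g)) = sc a (ins (Suc l) (ins 2 g)) + sc b (ins (Suc (Suc l)) (ins 2 g))"
          using h i 3 by (subst S_ins_simps(3)) (auto simp: m)
        obtain l' where l': "l = Suc l'" using h by (cases l) auto
        have q': "ss k l' (ins (Suc l') g) = sc a (ins l' g) + sc b (ins (Suc l') g)"
          using h i 3 l' m by (subst m, subst S_ins_simps(3)) auto
        show ?thesis using h i 3 l' q q' by (simp add: m mult.commute)
      next
        case 4
        have "ss k (i - 1) (ins 2 g) = ins 2 (ss m (i - 3) g)" using 4 h i by (simp add: m numeral_3_eq_3)
        moreover have "ss k (i - 2) (ins l g) = ins l (ss m (i - 3) g)" using 4 h i by (simp add: m)
        ultimately show ?thesis using 4 h i by (simp add: m numeral_3_eq_3)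
      qed
    qed
  qed (use f m in \<open>auto intro!: lin_intros lin_comp[OF S_lin] lin_comp[OF u2_lin] S_lin u2_lin\<close>)
qed

definition hecke :: "nat => bool" where
  "hecke k \<longleftrightarrow>
    (\<forall>i x. 1 <= i \<and> i < 2 * k \<and> x \<in> NN k --> ss k i (ss k i x) = sc a x + sc b (ss k i x)) \<and>
    (\<forall>i x. 1 <= i \<and> Suc i < 2 * k \<and> x \<in> NN k -->
       ss k i (ss k (Suc i) (ss k i x)) = ss k (Suc i) (ss k i (ss k (Suc i) x))) \<and>
    (\<forall>i j x. 1 <= i \<and> i + 2 <= j \<and> j < 2 * k \<and> x \<in> NN k --> ss k i (ss k j x) = ss k j (ss k i x))"

lemma hecke_quad: "hecke k ==> 1 <= i ==> i < 2 * k ==> x \<in> NN k ==> ss k i (ss k i x) = sc a x + sc b (ss k i x)"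
  by (simp add: hecke_def)
lemma hecke_braid: "hecke k ==> 1 <= i ==> Suc i < 2 * k ==> x \<in> NN k ==>
  ss k i (ss k (Suc i) (ss k i x)) = ss k (Suc i) (ss k i (ss k (Suc i) x))"
  by (simp add: hecke_def)
lemma hecke_far: "hecke k ==> 1 <= i ==> i + 2 <= j ==> j < 2 * k ==> x \<in> NN k ==> ss k i (ss k j x) = ss k j (ss k i x)"
  unfolding hecke_def by blast

end

context chord_params begin

lemma fk: "fF * kap = -1" "kap * fF = -1"
proof -
  have "fF * kap = \<epsilon> * e\<^sup>2" using nz by (simp add: power2_eq_square)
  also have "... = -1" using e2 eps by simp
  finally show "fF * kap = -1" .
  then show "kap * fF = -1" by (simp only: mult.commute)
qed

lemma kf: "kap * (a * x) = - (e * x)" "kap * a = - e"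
  using nz by auto

lemmas lin_cl = lin_intros S_lin u2_lin X3_lin ins_lin slice_lin lin_comp[OF S_lin] lin_comp[OF u2_lin]

lemma ins_numerals [simp]:
  "1 <= k ==> ss (Suc k) 2 (ins 3 y) = sc a (ins 2 y) + sc b (ins 3 y)"
  "1 <= k ==> ss (Suc k) 3 (ins 4 y) = sc a (ins 3 y) + sc b (ins 4 y)"
  "2 <= k ==> ss (Suc k) 4 (ins 5 y) = sc a (ins 4 y) + sc b (ins 5 y)"
  "1 <= k ==> ss (Suc k) (Suc 0) (ins 4 y) = ss (Suc k) 3 (ss (Suc k) (Suc 0) (ins 3 y))"
  "2 <= k ==> ss (Suc k) (Suc 0) (ins 5 y) = ss (Suc k) 4 (ss (Suc k) (Suc 0) (ins 4 y))"
proof -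
  have n: "(3::nat) = Suc 2" "(4::nat) = Suc 3" "(5::nat) = Suc 4" by simp_all
  show "1 <= k ==> ss (Suc k) 2 (ins 3 y) = sc a (ins 2 y) + sc b (ins 3 y)"
    by (subst n(1), subst S_ins_simps(3)) simp_all
  show "1 <= k ==> ss (Suc k) 3 (ins 4 y) = sc a (ins 3 y) + sc b (ins 4 y)"
    by (subst n(2), subst S_ins_simps(3)) simp_all
  show "2 <= k ==> ss (Suc k) 4 (ins 5 y) = sc a (ins 4 y) + sc b (ins 5 y)"
    by (subst n(3), subst S_ins_simps(3)) simp_all
  show "1 <= k ==> ss (Suc k) (Suc 0) (ins 4 y) = ss (Suc k) 3 (ss (Suc k) (Suc 0) (ins 3 y))"
    by (subst n(2), subst S1_ins_Suc) simp_all
  show "2 <= k ==> ss (Suc k) (Suc 0) (ins 5 y) = ss (Suc k) 4 (ss (Suc k) (Suc 0) (ins 4 y))"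
    by (subst n(3), subst S1_ins_Suc) simp_all
qed

lemma sc_minus1 [simp]: "sc (- c) x = - sc c x"
  by (simp add: vec_eq_iff)

lemma S1_ins3_ins [simp]: "2 <= l ==> l <= 2 * k ==> ss (Suc k) (Suc 0) (ins 3 (ins l z)) =
    sc dD (ins 2 (ins l z)) + sc b (ins 3 (ins l z)) - ins (l + 2) (ins 2 z)"
proof -
  assume l: "2 <= l" "l <= 2 * k"
  then have "ss (Suc k) (Suc 0) (ins 3 (ins l z)) = sc dD (ins 2 (ins l z)) + sc b (ins 3 (ins l z)) + sc (fF * kap) (ins (l + 2) (ins 2 z))"
    by (simp add: S1_ins3 del: sc_minus1)
  also have "fF * kap = - 1" by (rule fk)
  finally show ?thesis by simp
qed

lemma quad2:
  assumes H: "hecke k" and i: "2 <= i" "i < 2 * k + 2" and x: "x \<in> NN (Suc k)"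
  shows "ss (Suc k) i (ss (Suc k) i x) = sc a x + sc b (ss (Suc k) i x)"
proof (rule NN_ext[OF _ _ _ x])
  fix j :: nat and f :: "'k vec" assume h: "2 <= j" "j <= 2 * k + 2" "f \<in> NN k"
  consider "j < i" | "j = i" | "j = Suc i" | "Suc i < j" by linarith
  then show "ss (Suc k) i (ss (Suc k) i (ins j f)) = sc a (ins j f) + sc b (ss (Suc k) i (ins j f))"
  proof cases
    case 1 then show ?thesis using h i hecke_quad[OF H, of "i - 2" f] by simp
  next
    case 2 then show ?thesis using h i by (simp add: mult.commute)
  next
    case 3 then show ?thesis using h i by (simp add: mult.commute)
  next
    case 4 then show ?thesis using h i hecke_quad[OF H, of "i - 1" f] by simp
  qed
qed (intro lin_cl)+

lemma braid2:
  assumes H: "hecke k" and i: "2 <= i" "Suc i < 2 * k + 2" and x: "x \<in> NN (Suc k)"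
  shows "ss (Suc k) i (ss (Suc k) (Suc i) (ss (Suc k) i x)) = ss (Suc k) (Suc i) (ss (Suc k) i (ss (Suc k) (Suc i) x))"
proof (rule NN_ext[OF _ _ _ x])
  fix j :: nat and f :: "'k vec" assume h: "2 <= j" "j <= 2 * k + 2" "f \<in> NN k"
  consider "j < i" | "j = i" | "j = Suc i" | "j = Suc (Suc i)" | "Suc (Suc i) < j" by linarith
  then show "ss (Suc k) i (ss (Suc k) (Suc i) (ss (Suc k) i (ins j f))) = ss (Suc k) (Suc i) (ss (Suc k) i (ss (Suc k) (Suc i) (ins j f)))"
  proof cases
    case 1
    then obtain l where l: "i = Suc (Suc l)" "1 <= l" using h by (intro that[of "i - 2"]) auto
    show ?thesis using 1 h i hecke_braid[OF H, of l f] l by simp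
  next
    case 2 then show ?thesis using h i by simp
  next
    case 3
    have "ss (Suc k) (Suc i) (ins i g) = ins i (ss k (i - 1) g)" for g using 3 h i by (simp add: numeral_2_eq_2)
    then show ?thesis using 3 h i by (simp add: mult.commute)
  next
    case 4
    then show ?thesis using h i hecke_quad[OF H, of "i - 1" f] by (simp add: numeral_2_eq_2 mult.commute add_ac)
  next
    case 5
    then obtain l where l: "i = Suc l" "1 <= l" using i by (cases i) auto
    show ?thesis using 5 h i hecke_braid[OF H, of l f] l by simp
  qed
qed (intro lin_cl)+

lemma far2:
  assumes H: "hecke k" and i: "2 <= i" "i + 2 <= l" "l < 2 * k + 2" and x: "x \<in> NN (Suc k)"
  shows "ss (Suc k) i (ss (Suc k) l x) = ss (Suc k) l (ss (Suc k) i x)"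
proof (rule NN_ext[OF _ _ _ x])
  fix j :: nat and f :: "'k vec" assume h: "2 <= j" "j <= 2 * k + 2" "f \<in> NN k"
  consider "j < i" | "j = i" | "j = Suc i" | "Suc i < j" "j < l" | "j = l" | "j = Suc l" | "Suc l < j" using i by linarith
  then show "ss (Suc k) i (ss (Suc k) l (ins j f)) = ss (Suc k) l (ss (Suc k) i (ins j f))"
  proof cases
    case 1 then show ?thesis using h i hecke_far[OF H, of "i - 2" "l - 2" f] by simp
  next
    case 4 then show ?thesis using h i hecke_far[OF H, of "i - 1" "l - 2" f] by simp
  next
    case 7 then show ?thesis using h i hecke_far[OF H, of "i - 1" "l - 1" f] by simp
  qed (use h i in \<open>auto simp: mult.commute\<close>)
qed (intro lin_cl)+

lemma S1_far:
  assumes H: "hecke k" and i: "3 <= i" "i < 2 * k + 2" and x: "x \<in> NN (Suc k)"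
  shows "ss (Suc k) 1 (ss (Suc k) i x) = ss (Suc k) i (ss (Suc k) 1 x)"
proof (rule NN_ext[OF _ _ _ x])
  let ?s = "ss (Suc k)"
  note H2 = quad2[OF H] braid2[OF H] far2[OF H]
  have cl: "?s i x \<in> NN (Suc k)" if "1 <= i" "i < 2 * k + 2" "x \<in> NN (Suc k)" for i x
    using that by (intro NN_S) auto
  have k1: "1 <= k" using i by simp
  have c3: "?s 1 (?s i (ins 3 f)) = ?s i (?s 1 (ins 3 f))" if "4 <= i" "i < 2 * k + 2" "f \<in> NN k" for i f
  proof -
    have "?s i (u2 k f) = u2 k (ss k (i - 2) f)" using that by (intro Si_u2) auto
    then show ?thesis using that k1 by (simp add: S1_ins3)
  qed
  have main: "?s 1 (?s i (ins j f)) = ?s i (?s 1 (ins j f))"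
    if "2 <= j" "j <= 2 * k + 2" "f \<in> NN k" "3 <= i" "i < 2 * k + 2" for i j f
    using that
  proof (induction j arbitrary: i f rule: less_induct)
    case (less j)
    consider "j = 2" | "j = 3" | "4 <= j" using less.prems(1) by linarith
    then show ?case
    proof cases
      case 1 then show ?thesis using less.prems by simp
    next
      case 2
      then show ?thesis
      proof (cases "i = 3")
        case True then show ?thesis using 2 less.prems by (simp add: S1_ins_Suc)
      next
        case False then show ?thesis using 2 less.prems c3[of i f] by simp
      qed
    next
      case 3
      then obtain l where l: "j = Suc l" "3 <= l" by (cases j) auto
      have lk: "l < 2 * k + 2" "2 <= l" using l less.prems by auto
      define y where "y = ins l f"
      have y: "y \<in> NN (Suc k)" unfolding y_def using less.prems l by (intro NN_ins) auto
      have j: "ins j f = ?s l y" unfolding y_def using l lk by simp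
      have 1: "?s 1 (ins j f) = ?s l (?s 1 y)" unfolding y_def using l lk by (simp add: S1_ins_Suc)
      have IH: "?s 1 (?s i (ins l f)) = ?s i (?s 1 (ins l f))" if "3 <= i" "i < 2 * k + 2" "f \<in> NN k" for i f
        using less.IH[of l f i] that l lk less.prems by auto
      note IHy = IH[OF _ _ less.prems(3), folded y_def]
      have y1: "?s 1 y \<in> NN (Suc k)" using y k1 by (intro cl) auto
      consider "l + 2 <= i" | "i = Suc l" | "i = l" | "i + 2 <= l" | "l = Suc i" by linarith
      then show ?thesis
      proof cases
        case 1
        have "?s 1 (?s i (ins j f)) = ?s 1 (ins (Suc l) (ss k (i - 2) f))" using 1 l lk less.prems by simp
        also have "... = ?s l (?s 1 (ins l (ss k (i - 2) f)))" using l lk by (simp add: S1_ins_Suc)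
        also have "ins l (ss k (i - 2) f) = ?s i y" unfolding y_def using 1 l lk by simp
        also have "?s 1 (?s i y) = ?s i (?s 1 y)" using less.prems by (intro IHy) auto
        also have "?s l (?s i (?s 1 y)) = ?s i (?s l (?s 1 y))" using H2(3)[of l i] 1 lk less.prems y1 by auto
        finally show ?thesis using \<open>?s 1 (ins j f) = _\<close> by simp
      next
        case 2
        then show ?thesis using l less.prems by (simp add: S1_ins_Suc)
      next
        case 3
        have "?s 1 (?s i (ins j f)) = ?s 1 (sc a y + sc b (?s l y))"
          using 3 H2(1)[of l y] lk y unfolding j by simp
        also have "... = sc a (?s 1 y) + sc b (?s l (?s 1 y))" using 1 j by simp
        also have "... = ?s l (?s l (?s 1 y))" using H2(1)[of l "?s 1 y"] lk y1 by simp
        finally show ?thesis using 1 3 by simp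
      next
        case 4
        have "?s 1 (?s i (ins j f)) = ?s 1 (ins (Suc l) (ss k (i - 1) f))" using 4 l lk less.prems by simp
        also have "... = ?s l (?s 1 (ins l (ss k (i - 1) f)))" using l lk by (simp add: S1_ins_Suc)
        also have "ins l (ss k (i - 1) f) = ?s i y" unfolding y_def using 4 l lk less.prems by simp
        also have "?s 1 (?s i y) = ?s i (?s 1 y)" using less.prems by (intro IHy) auto
        also have "?s l (?s i (?s 1 y)) = ?s i (?s l (?s 1 y))" using H2(3)[of i l] 4 lk less.prems y1 by auto
        finally show ?thesis using 1 by simp
      next
        case 5
        define z where "z = ins i f"
        have i3: "3 <= i" "i < 2 * k + 2" using less.prems by auto
        have z: "z \<in> NN (Suc k)" unfolding z_def using less.prems i3 by (intro NN_ins) auto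
        have z1: "?s 1 z \<in> NN (Suc k)" using z k1 by (intro cl) auto
        have yz: "y = ?s i z" unfolding y_def z_def using 5 i3 by simp
        have g: "ss k (i - 1) f \<in> NN k" using i3 less.prems 5 lk by (intro NN_S) auto
        have sz: "?s l z = ins i (ss k (i - 1) f)" unfolding z_def using 5 i3 less.prems by (simp add: numeral_2_eq_2)
        have "?s 1 (?s i (ins j f)) = ?s 1 (ins (Suc l) (ss k (i - 1) f))" using 5 l lk less.prems by simp
        also have "... = ?s l (?s 1 (ins l (ss k (i - 1) f)))" using l lk by (simp add: S1_ins_Suc)
        also have "?s 1 (ins l (ss k (i - 1) f)) = ?s i (?s 1 (ins i (ss k (i - 1) f)))"
          using 5 i3 lk by (simp add: S1_ins_Suc)
        also have "ins i (ss k (i - 1) f) = ?s l z" using sz by simp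
        also have "?s 1 (?s l z) = ?s l (?s 1 z)" unfolding z_def using less.IH[of i f l] 5 less.prems l lk by auto
        also have "?s l (?s i (?s l (?s 1 z))) = ?s i (?s l (?s i (?s 1 z)))"
          using H2(2)[of i "?s 1 z"] 5 i3 lk z1 by simp
        also have "?s i (?s 1 z) = ?s 1 y" unfolding y_def z_def using 5 i3 lk by (simp add: S1_ins_Suc)
        finally show ?thesis using 1 by simp
      qed
    qed
  qed
  fix j and f :: "'k vec" assume "2 <= j" "j <= 2 * k + 2" "f \<in> NN k"
  then show "?s 1 (?s i (ins j f)) = ?s i (?s 1 (ins j f))" using main i by blast
qed (intro lin_cl)+

lemma S1_u2:
  assumes H: "hecke k" and H': "hecke (k - 1)" and k: "1 <= k" and f: "f \<in> NN k"
  shows "ss (Suc k) 1 (u2 k f) = sc e (ins 3 f) - sc (e * b) (ins 2 f)"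
proof -
  obtain m where m: "k = Suc m" using k by (cases k) auto
  have cl: "ss k i x \<in> NN k" if "1 <= i" "i < 2 * k" "x \<in> NN k" for i x using that by (intro NN_S) auto
  show ?thesis
  proof (rule gen[where t = 2 and k = m and P = "\<lambda>f. ss (Suc k) 1 (u2 k f)" and Q = "\<lambda>f. sc e (ins 3 f) - sc (e * b) (ins 2 f)"])
    fix j :: nat and g :: "'k vec" assume h: "g \<in> NN m" "2 <= j" "j <= 2" "j <= 2 * m + 2"
    then have [simp]: "j = 2" by simp
    have "ss (Suc k) 1 (ins 4 (ins 2 g)) = sc (a * b) (ins 2 (ins 2 g)) - sc a (ins 3 (ins 2 g))"
      using m by simp (simp only: vec_eq_iff co_simps co_sc, intro allI, simp add: a_eq power2_eq_square algebra_simps)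
    then have q: "ss (Suc k) 1 (ins 4 (ins 2 g)) = sc (a * b) (ins 2 (ins 2 g)) - sc a (ins 3 (ins 2 g))" .
    show "ss (Suc k) 1 (u2 k (ins j g)) = sc e (ins 3 (ins j g)) - sc (e * b) (ins 2 (ins j g))"
    proof -
      have "u2 k (ins j g) = sc kap (ins 4 (ins 2 g))" using m by simp
      then have "ss (Suc k) 1 (u2 k (ins j g)) = sc kap (ss (Suc k) 1 (ins 4 (ins 2 g)))" by simp
      also have "... = sc (kap * (a * b)) (ins 2 (ins 2 g)) - sc (kap * a) (ins 3 (ins 2 g))"
        unfolding q by simp
      finally show ?thesis unfolding kf by (simp add: vec_eq_iff)
    qed
  next
    fix j and x :: "'k vec" assume h: "x \<in> NN (Suc m)" "2 <= j" "j < 2 * m + 2"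
      and IH: "ss (Suc k) 1 (u2 k x) = sc e (ins 3 x) - sc (e * b) (ins 2 x)"
    have "u2 k (ss k j x) = ss (Suc k) (j + 2) (u2 k x)" using Si_u2[of x k "j + 2"] h m by simp
    then have "ss (Suc k) 1 (u2 k (ss k j x)) = ss (Suc k) (j + 2) (ss (Suc k) 1 (u2 k x))"
      using S1_far[OF H, of "j + 2" "u2 k x"] h m NN_u2' by simp
    then show "ss (Suc k) 1 (u2 k (ss (Suc m) j x)) = sc e (ins 3 (ss (Suc m) j x)) - sc (e * b) (ins 2 (ss (Suc m) j x))"
      unfolding IH using h m by simp
  qed (use f m in \<open>auto intro!: lin_cl\<close>)
qed

lemma quad1:
  assumes H: "hecke k" and H': "hecke (k - 1)" and x: "x \<in> NN (Suc k)"
  shows "ss (Suc k) 1 (ss (Suc k) 1 x) = sc a x + sc b (ss (Suc k) 1 x)"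
proof (rule gen[where t = 3, OF _ _ _ _ _ x])
  fix j :: nat and f :: "'k vec" assume h: "f \<in> NN k" "2 <= j" "j <= 3" "j <= 2 * k + 2"
  show "ss (Suc k) 1 (ss (Suc k) 1 (ins j f)) = sc a (ins j f) + sc b (ss (Suc k) 1 (ins j f))"
  proof (cases "j = 2")
    case True
    then show ?thesis by simp (simp only: vec_eq_iff co_simps co_sc, intro allI, simp add: a_eq power2_eq_square algebra_simps)
  next
    case False
    then have [simp]: "j = 3" and k: "1 <= k" using h by auto
    have fe: "fF * e = a" using e2 eps nz by (simp add: power2_eq_square algebra_simps)
    have "ss (Suc k) 1 (ss (Suc k) 1 (ins 3 f)) = sc (dD * lam) (ins 2 f) + sc b (ss (Suc k) 1 (ins 3 f)) + (sc (fF * e) (ins 3 f) - sc (fF * e * b) (ins 2 f))"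
      using k S1_u2[OF H H' k h(1)] S1_ins3[OF k, of f] by (simp add: mult.assoc)
    then show ?thesis unfolding fe by (simp only: vec_eq_iff co_simps co_sc, intro allI) (simp add: a_eq power2_eq_square algebra_simps)
  qed
next
  fix j and x :: "'k vec" assume h: "x \<in> NN (Suc k)" "3 <= j" "j < 2 * k + 2"
    and IH: "ss (Suc k) 1 (ss (Suc k) 1 x) = sc a x + sc b (ss (Suc k) 1 x)"
  have "ss (Suc k) 1 x \<in> NN (Suc k)" using h by (intro NN_S) auto
  then show "ss (Suc k) 1 (ss (Suc k) 1 (ss (Suc k) j x)) = sc a (ss (Suc k) j x) + sc b (ss (Suc k) 1 (ss (Suc k) j x))"
    using h IH S1_far[OF H, of j] by simp
qed (auto intro!: lin_cl)

lemma braid1_432: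
  fixes n k :: nat and h :: "'k vec"
  defines "k \<equiv> Suc (Suc n)"
  shows "ss (Suc k) 1 (ss (Suc k) 2 (ss (Suc k) 1 (ins 4 (ins 3 (ins 2 h))))) =
     ss (Suc k) 2 (ss (Suc k) 1 (ss (Suc k) 2 (ins 4 (ins 3 (ins 2 h)))))"
  unfolding k_def by simp (simp only: vec_eq_iff co_simps co_sc, intro allI, simp add: a_eq power2_eq_square algebra_simps)

lemma braid1_42:
  fixes m k :: nat and g :: "'k vec"
  defines "k \<equiv> Suc m"
  shows "ss (Suc k) 1 (ss (Suc k) 2 (ss (Suc k) 1 (ins 4 (ins 2 g)))) =
     ss (Suc k) 2 (ss (Suc k) 1 (ss (Suc k) 2 (ins 4 (ins 2 g))))"
  unfolding k_def by simp (simp only: vec_eq_iff co_simps co_sc, intro allI, simp add: a_eq power2_eq_square algebra_simps)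

lemma S_far_low:
  assumes H: "hecke k" and "1 <= i" "i + 2 <= l" "l < 2 * k + 2" and x: "x \<in> NN (Suc k)"
  shows "ss (Suc k) i (ss (Suc k) l x) = ss (Suc k) l (ss (Suc k) i x)"
  using assms far2[OF H, of i l x] S1_far[OF H, of l x] by (cases "i = 1") auto

lemma braid1:
  assumes H: "hecke k" and H': "hecke (k - 1)" and k: "1 <= k" and x: "x \<in> NN (Suc k)"
  shows "ss (Suc k) 1 (ss (Suc k) 2 (ss (Suc k) 1 x)) = ss (Suc k) 2 (ss (Suc k) 1 (ss (Suc k) 2 x))"
proof -
  let ?s = "ss (Suc k)"
  have cl: "?s i x \<in> NN (Suc k)" if "1 <= i" "i < 2 * k + 2" "x \<in> NN (Suc k)" for i x
    using that by (intro NN_S) auto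
  have comm: "?s 1 (?s 2 (?s 1 (?s j x))) = ?s 2 (?s 1 (?s 2 (?s j x)))"
    if "x \<in> NN (Suc k)" "4 <= j" "j < 2 * k + 2" "?s 1 (?s 2 (?s 1 x)) = ?s 2 (?s 1 (?s 2 x))" for j x
  proof -
    have c: "?s i (?s j y) = ?s j (?s i y)" if "i \<in> {1, 2}" "y \<in> NN (Suc k)" for i y
      using S_far_low[OF H, of i j y] that \<open>4 <= j\<close> \<open>j < _\<close> by auto
    have y: "?s 1 x \<in> NN (Suc k)" "?s 2 x \<in> NN (Suc k)" using cl \<open>x \<in> _\<close> k by auto
    then have y': "?s 1 (?s 2 x) \<in> NN (Suc k)" "?s 2 (?s 1 x) \<in> NN (Suc k)" using cl k by auto
    have "?s 1 (?s 2 (?s 1 (?s j x))) = ?s j (?s 1 (?s 2 (?s 1 x)))"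
      using c[of 1] c[of 2] y y' that(1) by simp
    moreover have "?s 2 (?s 1 (?s 2 (?s j x))) = ?s j (?s 2 (?s 1 (?s 2 x)))"
      using c[of 1] c[of 2] y y' that(1) by simp
    ultimately show ?thesis using that(4) by simp
  qed
  have b2: "?s 1 (?s 2 (?s 1 (ins 2 f))) = ?s 2 (?s 1 (?s 2 (ins 2 f)))" if f: "f \<in> NN k" for f
  proof -
    have "?s 2 (?s 1 (?s 2 (ins 2 f))) = sc (dD + b * b) (ins 3 f) + sc (b * a) (ins 2 f) + sc (fF * lam) (u2 k f)"
    proof -
      have "?s 1 (?s 2 (ins 2 f)) = sc dD (ins 2 f) + sc b (ins 3 f) + sc fF (u2 k f)"
        using k by (simp add: S1_ins3)
      then have "?s 2 (?s 1 (?s 2 (ins 2 f))) = ?s 2 (sc dD (ins 2 f) + sc b (ins 3 f) + sc fF (u2 k f))"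
        by (simp only:)
      also have "... = sc dD (ins 3 f) + sc b (sc a (ins 2 f) + sc b (ins 3 f)) + sc fF (sc lam (u2 k f))"
        using k S2_u2[OF f k] by simp
      finally show ?thesis by (simp only: vec_eq_iff co_simps co_sc, simp add: algebra_simps)
    qed
    also have "... = sc lam (?s 1 (ins 3 f))"
      using S1_ins3[OF k, of f] k by (simp only: One_nat_def vec_eq_iff co_simps co_sc, simp add: a_eq power2_eq_square algebra_simps)
    also have "... = ?s 1 (?s 2 (?s 1 (ins 2 f)))" using k by simp
    finally show ?thesis ..
  qed
  have b3: "?s 1 (?s 2 (?s 1 (ins 3 f))) = ?s 2 (?s 1 (?s 2 (ins 3 f)))" if f: "f \<in> NN k" for f
  proof -
    have i3: "ins 3 f = ?s 2 (ins 2 f)" by simp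
    have n: "ins 2 f \<in> NN (Suc k)" "ins 3 f \<in> NN (Suc k)" using f k by auto
    have q: "?s 2 (?s 1 (ins 3 f)) = sc lam (?s 1 (ins 3 f))" using b2[OF f] by simp
    have "?s 1 (?s 2 (?s 1 (ins 3 f))) = sc lam (?s 1 (?s 1 (ins 3 f)))" unfolding q by simp
    also have "... = sc (lam * a) (ins 3 f) + sc (lam * b) (?s 1 (ins 3 f))"
      using quad1[OF H H' n(2)] by simp
    also have "... = ?s 2 (?s 1 (?s 2 (ins 3 f)))" using q k by (simp add: mult.commute)
    finally show ?thesis .
  qed
  have b4: "?s 1 (?s 2 (?s 1 (ins 4 f))) = ?s 2 (?s 1 (?s 2 (ins 4 f)))" if f: "f \<in> NN k" for f
  proof -
    obtain m where m: "k = Suc m" using k by (cases k) auto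
    show ?thesis
    proof (rule gen[where t = 3 and k = m and P = "\<lambda>f. ?s 1 (?s 2 (?s 1 (ins 4 f)))" and Q = "\<lambda>f. ?s 2 (?s 1 (?s 2 (ins 4 f)))"])
      fix j :: nat and g :: "'k vec" assume h: "g \<in> NN m" "2 <= j" "j <= 3" "j <= 2 * m + 2"
      show "?s 1 (?s 2 (?s 1 (ins 4 (ins j g)))) = ?s 2 (?s 1 (?s 2 (ins 4 (ins j g))))"
      proof (cases "j = 2")
        case True then show ?thesis using braid1_42[of m g] m by simp
      next
        case False
        then have [simp]: "j = 3" using h by simp
        then obtain n where n: "m = Suc n" using h by (cases m) auto
        show ?thesis
        proof (rule gen[where t = 2 and k = n and P = "\<lambda>g. ?s 1 (?s 2 (?s 1 (ins 4 (ins j g))))" and Q = "\<lambda>g. ?s 2 (?s 1 (?s 2 (ins 4 (ins j g))))"])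
          fix i :: nat and h :: "'k vec" assume i: "2 <= i" "i <= 2"
          then have "i = 2" by simp
          then show "?s 1 (?s 2 (?s 1 (ins 4 (ins j (ins i h))))) = ?s 2 (?s 1 (?s 2 (ins 4 (ins j (ins i h)))))"
            using braid1_432[of n h] m n by simp
        next
          fix i and y :: "'k vec" assume i: "y \<in> NN (Suc n)" "2 <= i" "i < 2 * n + 2"
            and IH: "?s 1 (?s 2 (?s 1 (ins 4 (ins j y)))) = ?s 2 (?s 1 (?s 2 (ins 4 (ins j y))))"
          have "ins 4 (ins j (ss (Suc n) i y)) = ?s (i + 4) (ins 4 (ins j y))" using i m n by simp
          then show "?s 1 (?s 2 (?s 1 (ins 4 (ins j (ss (Suc n) i y))))) = ?s 2 (?s 1 (?s 2 (ins 4 (ins j (ss (Suc n) i y)))))"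
            using comm[OF _ _ _ IH, of "i + 4"] i m n by simp
        qed (use h n in \<open>auto intro!: lin_cl\<close>)
      qed
    next
      fix j and y :: "'k vec" assume h: "y \<in> NN (Suc m)" "3 <= j" "j < 2 * m + 2"
        and IH: "?s 1 (?s 2 (?s 1 (ins 4 y))) = ?s 2 (?s 1 (?s 2 (ins 4 y)))"
      have "ins 4 (ss (Suc m) j y) = ?s (j + 2) (ins 4 y)" using h m by simp
      then show "?s 1 (?s 2 (?s 1 (ins 4 (ss (Suc m) j y)))) = ?s 2 (?s 1 (?s 2 (ins 4 (ss (Suc m) j y))))"
        using comm[OF _ _ _ IH, of "j + 2"] h m by simp
    qed (use f m in \<open>auto intro!: lin_cl\<close>)
  qed
  show ?thesis
  proof (rule gen[where t = 4, OF _ _ _ _ _ x])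
    fix j :: nat and f :: "'k vec" assume h: "f \<in> NN k" "2 <= j" "j <= 4"
    then consider "j = 2" | "j = 3" | "j = 4" by linarith
    then show "?s 1 (?s 2 (?s 1 (ins j f))) = ?s 2 (?s 1 (?s 2 (ins j f)))"
      by cases (use b2 b3 b4 h in blast)+
  next
    fix j and x :: "'k vec" assume "x \<in> NN (Suc k)" "4 <= j" "j < 2 * k + 2"
      "?s 1 (?s 2 (?s 1 x)) = ?s 2 (?s 1 (?s 2 x))"
    then show "?s 1 (?s 2 (?s 1 (?s j x))) = ?s 2 (?s 1 (?s 2 (?s j x)))" by (rule comm)
  qed (auto intro!: lin_cl)
qed

lemma hecke_Suc:
  assumes H: "hecke k" and H': "hecke (k - 1)"
  shows "hecke (Suc k)"
proof -
  have q: "ss (Suc k) i (ss (Suc k) i x) = sc a x + sc b (ss (Suc k) i x)"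
    if "1 <= i" "i < 2 * Suc k" "x \<in> NN (Suc k)" for i x
    using that quad1[OF H H', of x] quad2[OF H, of i x] by (cases "i = 1") auto
  have br: "ss (Suc k) i (ss (Suc k) (Suc i) (ss (Suc k) i x)) = ss (Suc k) (Suc i) (ss (Suc k) i (ss (Suc k) (Suc i) x))"
    if "1 <= i" "Suc i < 2 * Suc k" "x \<in> NN (Suc k)" for i x
    using that braid1[OF H H', of x] braid2[OF H, of i x] by (cases "i = 1") (auto simp: numeral_2_eq_2)
  show ?thesis unfolding hecke_def
    using q br S_far_low[OF H] by auto
qed

lemma hecke: "hecke k"
proof -
  have "hecke k \<and> hecke (k - 1)"
  proof (induction k)
    case 0 show ?case by (simp add: hecke_def)
  next
    case (Suc k) then show ?case using hecke_Suc by auto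
  qed
  then show ?thesis ..
qed

primrec desc :: "nat => nat => 'k vec => 'k vec" where
  "desc k 0 f = f"
| "desc k (Suc m) f = ss k (Suc m) (desc k m f)"

definition cap :: "nat => 'k vec => 'k vec" where
  "cap k F = sc del (slice 2 F) + (\<Sum>j=3..2 * k + 2. sc rho (desc k (j - 3) (slice j F)))"

lemma desc_lin: "lin (desc k m)"
  by (induction m) (auto simp: lin_def)
lemma cap_lin: "lin (cap k)" unfolding cap_def
  by (intro lin_intros slice_lin lin_comp[OF desc_lin])
lemmas desc_simps [simp] = lin_simps[OF desc_lin]
lemmas cap_simps [simp] = lin_simps[OF cap_lin]

lemma cap_ins2 [simp]: "cap k (ins 2 f) = sc del f"
  by (simp add: cap_def slice_ins)

lemma cap_ins: "3 <= j ==> j <= 2 * k + 2 ==> cap k (ins j f) = sc rho (desc k (j - 3) f)"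
proof -
  assume j: "3 <= j" "j <= 2 * k + 2"
  have "(\<Sum>l=3..2 * k + 2. sc rho (desc k (l - 3) (slice l (ins j f)))) =
      (\<Sum>l=3..2 * k + 2. if l = j then sc rho (desc k (j - 3) f) else 0)"
    by (intro sum.cong) (auto simp: slice_ins)
  then show ?thesis using j by (simp add: cap_def slice_ins)
qed

lemma cap_numerals [simp]:
  "1 <= k ==> cap k (ins 3 f) = sc rho f"
  "1 <= k ==> cap k (ins 4 f) = sc rho (ss k (Suc 0) f)"
  "2 <= k ==> cap k (ins 5 f) = sc rho (ss k 2 (ss k (Suc 0) f))"
  by (simp_all add: cap_ins eval_nat_numeral)

lemma NN_desc: "m < 2 * k ==> f \<in> NN k ==> desc k m f \<in> NN k"
  by (induction m) (auto intro: NN_S)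

lemma NN_cap: "f \<in> NN (Suc k) ==> cap k f \<in> NN k"
  unfolding cap_def by (intro NN_add NN_sc NN_sum NN_desc NN_slice) auto

lemmas quad = hecke_quad[OF hecke] and braid = hecke_braid[OF hecke] and far = hecke_far[OF hecke]

lemma far': "1 <= i ==> i < 2 * k ==> 1 <= j ==> j < 2 * k ==> i + 2 <= j \<or> j + 2 <= i ==> x \<in> NN k ==>
  ss k i (ss k j x) = ss k j (ss k i x)"
  using far[of i j k x] far[of j i k x] by auto

lemma desc_S_hi: "m + 2 <= i ==> i < 2 * k ==> f \<in> NN k ==> desc k m (ss k i f) = ss k i (desc k m f)"
  by (induction m) (auto simp: far' NN_desc)

lemma desc_S_lo: "1 <= i ==> i < m ==> m < 2 * k ==> f \<in> NN k ==> desc k m (ss k (Suc i) f) = ss k i (desc k m f)"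
proof (induction m)
  case (Suc m)
  show ?case
  proof (cases "i = m")
    case True
    then obtain l where l: "m = Suc l" using Suc.prems by (cases m) auto
    have "desc k (Suc m) (ss k (Suc i) f) = ss k (Suc m) (ss k m (ss k (Suc m) (desc k l f)))"
      using True l desc_S_hi[of l "Suc m" k f] Suc.prems by simp
    also have "... = ss k m (ss k (Suc m) (ss k m (desc k l f)))"
      using Suc.prems l by (intro braid[symmetric] NN_desc) auto
    finally show ?thesis using True l by simp
  next
    case False
    then show ?thesis using Suc by (auto simp: far' NN_desc)
  qed
qed auto

lemma cap_S:
  assumes i: "1 <= i" "i < 2 * k" and x: "x \<in> NN (Suc k)"
  shows "cap k (ss (Suc k) (i + 2) x) = ss k i (cap k x)"
proof (rule NN_ext[OF _ _ _ x])
  fix j :: nat and f :: "'k vec" assume h: "2 <= j" "j <= 2 * k + 2" "f \<in> NN k"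
  consider "j = 2" | "3 <= j" "j < i + 2" | "j = i + 2" | "j = i + 3" | "i + 3 < j" using h by linarith
  then show "cap k (ss (Suc k) (i + 2) (ins j f)) = ss k i (cap k (ins j f))"
  proof cases
    case 2
    then show ?thesis using h i desc_S_hi[of "j - 3" i k f] by (simp add: cap_ins)
  next
    case 3
    have e: "j - 3 = i - 1" "Suc j - 3 = Suc (i - 1)" "Suc (i - 1) = i" using 3 i by auto
    have "cap k (ss (Suc k) (i + 2) (ins j f)) = cap k (ins (Suc j) f)" using 3 h by simp
    also have "... = sc rho (desc k (Suc (i - 1)) f)" using 3 i h e(2) by (subst cap_ins) auto
    also have "... = sc rho (ss k i (desc k (i - 1) f))" using desc.simps(2)[of k "i - 1" f] e(3) by (simp only:)
    also have "ss k i (desc k (i - 1) f) = ss k i (desc k (j - 3) f)" using e by simp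
    finally show ?thesis using 3 i by (simp add: cap_ins)
  next
    case 4
    have e: "j = Suc (i + 2)" "j - 3 = i" "i + 2 - 3 = i - 1" using 4 by auto
    define g where "g = desc k (i - 1) f"
    have g: "g \<in> NN k" unfolding g_def using i h by (intro NN_desc) auto
    have d: "desc k i f = ss k i g" unfolding g_def using i by (cases i) auto
    have "cap k (ss (Suc k) (i + 2) (ins j f)) = cap k (sc a (ins (i + 2) f) + sc b (ins j f))"
      using h i unfolding e(1) by (subst S_ins_simps(3)) auto
    also have "... = sc (a * rho) g + sc (b * rho) (desc k i f)"
      using h i e by (simp add: cap_ins g_def)
    also have "... = sc rho (ss k i (desc k i f))"
      using quad[of i k g] g i unfolding d by (simp add: mult.commute)
    finally show ?thesis using h i 4 by (simp add: cap_ins)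
  next
    case 5
    then show ?thesis using h i desc_S_lo[of i "j - 3" k f] by (simp add: cap_ins)
  qed (use h i in auto)
qed (auto intro!: lin_cl lin_comp[OF cap_lin] cap_lin)

lemma params:
  "lam' * del = lam * del" "dD * del + b * rho + fF * sig = lam' * rho"
  "kap * (lam * rho) = sig" "e * (rho - b * del) = lam' * sig"
  "lam * rho = \<epsilon> * sig * (e * a)" "lam' \<noteq> 0" "b * del - \<epsilon> * e * lam' * sig = rho"
proof -
  have bd: "b * del = \<epsilon> * e * sig * (lam + lam' - b)" using nz by simp
  show "lam' * del = lam * del" using lam' by auto
  show "lam' \<noteq> 0" using lam' nz a_eq by (auto simp: power2_eq_square)
  have "dD * del = (lam - b) * (\<epsilon> * e * sig * (lam + lam' - b))" using bd by (simp only: mult.assoc)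
  then show "dD * del + b * rho + fF * sig = lam' * rho" by (simp add: a_eq power2_eq_square algebra_simps)
  have "e * (rho - b * del) = - (\<epsilon> * e\<^sup>2) * sig * lam'" unfolding bd by (simp add: power2_eq_square algebra_simps)
  then show "e * (rho - b * del) = lam' * sig" using e2 eps by simp
  show lr: "lam * rho = \<epsilon> * sig * (e * a)" by (simp add: a_eq power2_eq_square algebra_simps)
  have "kap * (lam * rho) = - (\<epsilon> * e\<^sup>2) * sig" unfolding lr using nz by (simp add: power2_eq_square)
  then show "kap * (lam * rho) = sig" using e2 eps by simp
  show "b * del - \<epsilon> * e * lam' * sig = rho" unfolding bd by (simp add: algebra_simps)
qed

lemma cap_u2:
  assumes k: "1 <= k" and f: "f \<in> NN k"
  shows "cap k (u2 k f) = sc sig f"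
proof -
  obtain m where m: "k = Suc m" using k by (cases k) auto
  show ?thesis
  proof (rule gen[where t = 2 and k = m and P = "\<lambda>f. cap k (u2 k f)"])
    fix j :: nat and g :: "'k vec" assume h: "2 <= j" "j <= 2"
    then have "j = 2" by simp
    moreover have "u2 k (ins 2 g) = sc kap (ins 4 (ins 2 g))" using m by simp
    then have "cap k (u2 k (ins 2 g)) = sc kap (cap k (ins 4 (ins 2 g)))" by simp
    moreover have "cap k (ins 4 (ins 2 g)) = sc rho (sc lam (ins 2 g))" using m by simp
    moreover have "kap * (rho * lam) = sig" using params(3) by (simp only: mult.commute)
    ultimately show "cap k (u2 k (ins j g)) = sc sig (ins j g)" by (simp only: sc_simps)
  next
    fix j and x :: "'k vec" assume h: "x \<in> NN (Suc m)" "2 <= j" "j < 2 * m + 2" and IH: "cap k (u2 k x) = sc sig x"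
    have "u2 k (ss k j x) = ss (Suc k) (j + 2) (u2 k x)" using Si_u2[of x k "j + 2"] h m by simp
    then show "cap k (u2 k (ss (Suc m) j x)) = sc sig (ss (Suc m) j x)"
      using cap_S[of j k "u2 k x"] h m IH NN_u2'[of x k] by simp
  qed (use f m in \<open>auto intro!: lin_cl lin_comp[OF cap_lin]\<close>)
qed

lemma cap_S1:
  assumes x: "x \<in> NN (Suc k)"
  shows "cap k (ss (Suc k) 1 x) = sc lam' (cap k x)"
proof (rule gen[where t = 3, OF _ _ _ _ _ x])
  fix j :: nat and f :: "'k vec" assume h: "f \<in> NN k" "2 <= j" "j <= 3" "j <= 2 * k + 2"
  show "cap k (ss (Suc k) 1 (ins j f)) = sc lam' (cap k (ins j f))"
  proof (cases "j = 2")
    case True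
    have "cap k (ss (Suc k) 1 (ins 2 f)) = sc (lam * del) f" by simp
    also have "... = sc lam' (cap k (ins 2 f))" by (simp only: params(1)[symmetric] cap_ins2 sc_simps)
    finally show ?thesis using True by simp
  next
    case False
    then have [simp]: "j = 3" and k: "1 <= k" using h by auto
    have "cap k (ss (Suc k) 1 (ins 3 f)) = sc (dD * del) f + sc (b * rho) f + sc (fF * sig) f"
      using k cap_u2[OF k h(1)] by (simp add: S1_ins3)
    also have "... = sc (dD * del + b * rho + fF * sig) f"
      by (simp only: vec_eq_iff co_simps co_sc distrib_right) simp
    finally show ?thesis unfolding params using k by simp
  qed
next
  fix j and x :: "'k vec" assume h: "x \<in> NN (Suc k)" "3 <= j" "j < 2 * k + 2"
    and IH: "cap k (ss (Suc k) 1 x) = sc lam' (cap k x)"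
  have j: "j - 2 + 2 = j" using h by simp
  have "ss (Suc k) 1 x \<in> NN (Suc k)" using h by (intro NN_S) auto
  then show "cap k (ss (Suc k) 1 (ss (Suc k) j x)) = sc lam' (cap k (ss (Suc k) j x))"
    using cap_S[of "j - 2" k] h IH S1_far[OF hecke, of j k x] unfolding j by simp
qed (auto intro!: lin_cl lin_comp[OF cap_lin] cap_lin)

definition ti :: "nat => nat => 'k vec => 'k vec" where
  "ti k i x = sc (1 / a) (ss k i x - sc b x)"

lemma ti_lin: "lin (ti k i)" unfolding ti_def by (intro lin_cl)
lemmas ti_simps [simp] = lin_simps[OF ti_lin]
lemma NN_ti: "1 <= i ==> i < 2 * k ==> f \<in> NN k ==> ti k i f \<in> NN k"
  unfolding ti_def by (intro NN_sc NN_diff NN_S)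

lemma s_ti: "1 <= i ==> i < 2 * k ==> x \<in> NN k ==> ss k i (ti k i x) = x"
  and ti_s: "1 <= i ==> i < 2 * k ==> x \<in> NN k ==> ti k i (ss k i x) = x"
  using nz by (simp_all add: ti_def quad)

lemma s_inj: "1 <= i ==> i < 2 * k ==> x \<in> NN k ==> y \<in> NN k ==> ss k i x = ss k i y ==> x = y"
  using ti_s by metis

lemma s_ti_far: "1 <= i ==> i < 2 * k ==> 1 <= j ==> j < 2 * k ==> i + 2 <= j \<or> j + 2 <= i ==> x \<in> NN k ==>
  ss k i (ti k j x) = ti k j (ss k i x)"
  unfolding ti_def using far'[of i k j x] by simp

lemma ti_far: "1 <= i ==> i < 2 * k ==> 1 <= j ==> j < 2 * k ==> i + 2 <= j \<or> j + 2 <= i ==> x \<in> NN k ==>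
  ti k i (ti k j x) = ti k j (ti k i x)"
  using s_ti_far[of i k j x] by (subst (1 2) ti_def) simp

lemma braid_ti1:
  assumes "1 <= i" "Suc i < 2 * k" "x \<in> NN k"
  shows "ss k (Suc i) (ti k i (ti k (Suc i) x)) = ti k i (ti k (Suc i) (ss k i x))"
proof -
  define y where "y = ti k i (ti k (Suc i) x)"
  have n: "y \<in> NN k" "ss k i y \<in> NN k" "ss k (Suc i) y \<in> NN k" "ss k i (ss k (Suc i) y) \<in> NN k"
    unfolding y_def using assms by (intro NN_S NN_ti; simp)+
  have "ss k (Suc i) (ss k i y) = x" unfolding y_def using assms by (simp add: s_ti NN_ti)
  then have "ti k i (ti k (Suc i) (ss k i x)) = ti k i (ti k (Suc i) (ss k (Suc i) (ss k i (ss k (Suc i) y))))"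
    using braid[of i k y] assms n by simp
  also have "... = ss k (Suc i) y" using assms n by (simp add: ti_s)
  finally show ?thesis unfolding y_def ..
qed

lemma braid_ti2:
  assumes "1 <= i" "Suc i < 2 * k" "x \<in> NN k"
  shows "ss k i (ti k (Suc i) (ti k i x)) = ti k (Suc i) (ti k i (ss k (Suc i) x))"
proof -
  define y where "y = ti k (Suc i) (ti k i x)"
  have n: "y \<in> NN k" "ss k i y \<in> NN k" "ss k (Suc i) y \<in> NN k" "ss k (Suc i) (ss k i y) \<in> NN k"
    unfolding y_def using assms by (intro NN_S NN_ti; simp)+
  have "ss k i (ss k (Suc i) y) = x" unfolding y_def using assms by (simp add: s_ti NN_ti)
  then have "ti k (Suc i) (ti k i (ss k (Suc i) x)) = ti k (Suc i) (ti k i (ss k i (ss k (Suc i) (ss k i y))))"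
    using braid[of i k y] assms n by simp
  also have "... = ss k i y" using assms n by (simp add: ti_s)
  finally show ?thesis unfolding y_def ..
qed

fun up :: "nat => nat => 'k vec => 'k vec" where
  "up k 0 x = 0"
| "up k (Suc 0) x = ins 2 x"
| "up k (Suc (Suc i)) x = sc (e * a) (ti (Suc k) (Suc i) (ti (Suc k) (Suc (Suc i)) (up k (Suc i) x)))"

fun dn :: "nat => nat => 'k vec => 'k vec" where
  "dn k 0 x = 0"
| "dn k (Suc 0) x = cap k x"
| "dn k (Suc (Suc i)) x = sc (1 / (e * a)) (dn k (Suc i) (ss (Suc k) (Suc (Suc i)) (ss (Suc k) (Suc i) x)))"

lemma up_Suc: "1 <= i ==> up k (Suc i) x = sc (e * a) (ti (Suc k) i (ti (Suc k) (Suc i) (up k i x)))"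
  by (cases i) auto
lemma dn_Suc: "1 <= i ==> dn k (Suc i) x = sc (1 / (e * a)) (dn k i (ss (Suc k) (Suc i) (ss (Suc k) i x)))"
  by (cases i) auto

lemma up_lin: "lin (up k i)"
  by (induction k i "0 :: 'k vec" rule: up.induct) (auto simp: lin_def mult.commute)
declare up.simps(3) [simp del]
lemma dn_lin: "lin (dn k i)"
proof (induction i)
  case (Suc i) then show ?case by (cases i) (auto simp: lin_def)
qed (auto simp: lin_def)
declare dn.simps(3) [simp del]
lemmas up_simps [simp] = lin_simps[OF up_lin]
lemmas dn_simps [simp] = lin_simps[OF dn_lin]

lemma NN_up: "1 <= i ==> i <= 2 * k + 1 ==> x \<in> NN k ==> up k i x \<in> NN (Suc k)"
proof (induction i)
  case (Suc i) then show ?case by (cases "i = 0") (auto simp: up_Suc intro!: NN_ti)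
qed auto
lemma NN_dn: "1 <= i ==> i <= 2 * k + 1 ==> x \<in> NN (Suc k) ==> dn k i x \<in> NN k"
proof (induction i arbitrary: x)
  case (Suc i) then show ?case by (cases "i = 0") (auto simp: dn_Suc NN_cap intro!: Suc.IH NN_S)
qed auto

lemma s_up: "1 <= i ==> i <= 2 * k + 1 ==> x \<in> NN k ==> ss (Suc k) i (up k i x) = sc lam (up k i x)"
proof (induction i)
  case (Suc i)
  show ?case
  proof (cases "i = 0")
    case False
    then show ?thesis using Suc braid_ti1[of i "Suc k" "up k i x"] NN_up[of i k x]
      by (simp add: up_Suc mult.commute)
  qed simp
qed simp

lemma s_up_hi: "1 <= i ==> i + 2 <= j ==> j < 2 * k + 2 ==> x \<in> NN k ==>
  ss (Suc k) j (up k i x) = up k i (ss k (j - 2) x)"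
proof (induction i)
  case (Suc i)
  show ?case
  proof (cases "i = 0")
    case False
    then show ?thesis using Suc by (simp add: up_Suc s_ti_far NN_ti NN_up)
  qed (use Suc in simp)
qed simp

lemma up_Suc_Suc: "1 <= i ==> up k (Suc (Suc i)) x = sc ((e * a)\<^sup>2) (ti (Suc k) (Suc i) (ti (Suc k) (Suc (Suc i)) (ti (Suc k) i (ti (Suc k) (Suc i) (up k i x)))))"
  by (simp add: up_Suc power2_eq_square)

lemma s_up_lo: "1 <= j ==> j + 2 <= i ==> i <= 2 * k + 1 ==> x \<in> NN k ==>
  ss (Suc k) j (up k i x) = up k i (ss k j x)"
proof (induction i)
  case (Suc i)
  show ?case
  proof (cases "j + 2 <= i")
    case True
    then show ?thesis using Suc by (simp add: up_Suc s_ti_far NN_ti NN_up)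
  next
    case False
    then have i: "i = Suc j" using Suc by simp
    let ?k = "Suc k"
    define y where "y = up k j x"
    have y: "y \<in> NN ?k" unfolding y_def using Suc i by (intro NN_up) auto
    have b: "j < 2 * ?k" "Suc j < 2 * ?k" "Suc (Suc j) < 2 * ?k" "1 <= j" using Suc i by auto
    have sy: "ss ?k (Suc (Suc j)) y = up k j (ss k j x)" unfolding y_def using s_up_hi[of j "Suc (Suc j)" k x] Suc i by simp
    let ?t = "ti ?k" and ?s = "ss ?k"
    have "?s j (?t (Suc j) (?t (Suc (Suc j)) (?t j (?t (Suc j) y)))) = ?s j (?t (Suc j) (?t j (?t (Suc (Suc j)) (?t (Suc j) y))))"
      using ti_far[of j ?k "Suc (Suc j)" "?t (Suc j) y"] b y by (simp add: NN_ti)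
    also have "... = ?t (Suc j) (?t j (?s (Suc j) (?t (Suc (Suc j)) (?t (Suc j) y))))"
      using b y by (intro braid_ti2) (auto simp: NN_ti)
    also have "... = ?t (Suc j) (?t j (?t (Suc (Suc j)) (?t (Suc j) (?s (Suc (Suc j)) y))))"
      using braid_ti2[of "Suc j" ?k y] b y by simp
    also have "... = ?t (Suc j) (?t (Suc (Suc j)) (?t j (?t (Suc j) (up k j (ss k j x)))))"
      unfolding sy[symmetric] using ti_far[of j ?k "Suc (Suc j)" "?t (Suc j) (?s (Suc (Suc j)) y)"] b y by (simp add: NN_ti NN_S)
    finally show ?thesis unfolding i up_Suc_Suc[OF b(4)] y_def by simp
  qed
qed simp

lemma s_up1: "1 <= i ==> i <= 2 * k ==> x \<in> NN k ==>
  ss (Suc k) i (up k (Suc i) x) = sc e (ss (Suc k) (Suc i) (up k i x)) - sc (e * b) (up k i x)"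
proof -
  assume h: "1 <= i" "i <= 2 * k" "x \<in> NN k"
  then have "ss (Suc k) i (up k (Suc i) x) = sc (e * a) (ti (Suc k) (Suc i) (up k i x))"
    by (simp add: up_Suc s_ti NN_ti NN_up)
  then show ?thesis unfolding ti_def using nz by simp
qed

lemma s_up2: "1 <= i ==> i <= 2 * k ==> x \<in> NN k ==>
  ss (Suc k) i (ss (Suc k) (Suc i) (up k i x)) = sc dD (up k i x) + sc b (ss (Suc k) (Suc i) (up k i x)) + sc fF (up k (Suc i) x)"
proof -
  assume h: "1 <= i" "i <= 2 * k" "x \<in> NN k"
  define y where "y = up k i x"
  define z where "z = up k (Suc i) x"
  have n: "z \<in> NN (Suc k)" unfolding z_def using h by (intro NN_up) auto
  note 1 = s_up1[OF h, folded y_def z_def]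
  have ie: "\<epsilon> * (e * (e * w)) = - w" for w
  proof -
    have "\<epsilon> * (e * (e * w)) = (\<epsilon> * e\<^sup>2) * w" by (simp add: power2_eq_square mult.assoc)
    then show ?thesis using e2 eps by simp
  qed
  have s1: "ss (Suc k) (Suc i) y = sc (- (\<epsilon> * e)) (ss (Suc k) i z) + sc b y"
    unfolding 1 by (simp only: vec_eq_iff co_simps co_sc) (simp add: ie right_diff_distrib mult.assoc)
  have "ss (Suc k) i (ss (Suc k) (Suc i) y) = sc (- (\<epsilon> * e)) (sc a z + sc b (ss (Suc k) i z)) + sc (b * lam) y"
    unfolding s1 using quad[of i "Suc k" z] n h s_up[of i k x] by (simp add: y_def)
  also have "... = sc dD y + sc b (ss (Suc k) (Suc i) y) + sc fF z"
    unfolding s1 by (simp only: vec_eq_iff co_simps co_sc) (simp add: algebra_simps)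
  finally show ?thesis unfolding y_def z_def .
qed

lemma up_2: "1 <= k ==> x \<in> NN k ==> up k (Suc (Suc 0)) x = u2 k x"
proof -
  assume h: "1 <= k" "x \<in> NN k"
  have n: "u2 k x \<in> NN (Suc k)" "ins 2 x \<in> NN (Suc k)" using h NN_u2' by auto
  have "ss (Suc k) 1 (u2 k x) = sc (e * a) (ti (Suc k) 2 (ins 2 x))"
    unfolding S1_u2[OF hecke hecke h] ti_def using nz by simp
  then have "ti (Suc k) 1 (ss (Suc k) 1 (u2 k x)) = sc (e * a) (ti (Suc k) 1 (ti (Suc k) 2 (ins 2 x)))" by simp
  then show ?thesis using h n by (simp add: ti_s numeral_2_eq_2 up.simps(3))
qed

lemma up_up: "1 <= i ==> i <= j ==> j <= 2 * k + 1 ==> x \<in> NN k ==>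
  up (Suc k) (j + 2) (up k i x) = sc \<epsilon> (up (Suc k) i (up k j x))"
proof -
  have t_up_hi: "ti (Suc k) j (up k i x) = up k i (ti k (j - 2) x)" if "1 <= i" "i + 2 <= j" "j < 2 * k + 2" "x \<in> NN k" for i j k x
    unfolding ti_def using s_up_hi[of i j k x] that by simp
  have t_up_lo: "ti (Suc k) j (up k i x) = up k i (ti k j x)" if "1 <= j" "j + 2 <= i" "i <= 2 * k + 1" "x \<in> NN k" for i j k x
    unfolding ti_def using s_up_lo[of j i k x] that by simp
  have b: "up (Suc k) 3 (up k 1 x) = sc \<epsilon> (up (Suc k) 1 (up k 1 x))" if x: "x \<in> NN k" for x
  proof -
    have n: "ins 2 x \<in> NN (Suc k)" "ins 2 (ins 2 x) \<in> NN (Suc (Suc k))" using x by auto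
    have e4: "ins 4 (ins 2 x) = ss (Suc (Suc k)) 3 (ss (Suc (Suc k)) 2 (ins 2 (ins 2 x)))" by simp
    have "up (Suc k) 3 (ins 2 x) = sc (e * a) (ti (Suc (Suc k)) 2 (ti (Suc (Suc k)) 3 (up (Suc k) (Suc (Suc 0)) (ins 2 x))))"
      by (simp add: numeral_3_eq_3 numeral_2_eq_2 up.simps(3))
    also have "up (Suc k) (Suc (Suc 0)) (ins 2 x) = sc kap (ins 4 (ins 2 x))" using up_2[of "Suc k" "ins 2 x"] n by simp
    also have "ti (Suc (Suc k)) 2 (ti (Suc (Suc k)) 3 (sc kap (ins 4 (ins 2 x)))) = sc kap (ins 2 (ins 2 x))"
      unfolding e4 using n by (simp add: ti_s NN_S del: S_ins_simps)
    also have "sc (e * a) (sc kap (ins 2 (ins 2 x))) = sc \<epsilon> (ins 2 (ins 2 x))"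
      using nz e2 by (simp add: power2_eq_square vec_eq_iff)
    finally show ?thesis by (simp add: numeral_3_eq_3)
  qed
  have c: "up (Suc k) (j + 2) (up k 1 x) = sc \<epsilon> (up (Suc k) 1 (up k j x))" if "1 <= j" "j <= 2 * k + 1" "x \<in> NN k" for j x
    using that
  proof (induction j)
    case (Suc j)
    show ?case
    proof (cases "j = 0")
      case True then show ?thesis using b Suc.prems by (simp add: numeral_3_eq_3)
    next
      case False
      have "up (Suc k) (Suc j + 2) (up k 1 x) = sc (e * a) (ti (Suc (Suc k)) (j + 2) (ti (Suc (Suc k)) (Suc (j + 2)) (sc \<epsilon> (up (Suc k) 1 (up k j x)))))"
        using Suc False by (simp add: up_Suc)
      also have "... = sc \<epsilon> (sc (e * a) (up (Suc k) 1 (ti (Suc k) j (ti (Suc k) (Suc j) (up k j x)))))"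
        using Suc False t_up_hi[of 1 "j + 2" "Suc k"] t_up_hi[of 1 "Suc (j + 2)" "Suc k"] by (simp add: NN_ti NN_up mult.commute)
      finally show ?thesis using False by (simp add: up_Suc)
    qed
  qed simp
  show "1 <= i ==> i <= j ==> j <= 2 * k + 1 ==> x \<in> NN k ==> ?thesis"
  proof (induction i)
    case (Suc i)
    show ?case
    proof (cases "i = 0")
      case True then show ?thesis using c Suc.prems by simp
    next
      case False
      have "up (Suc k) (j + 2) (up k (Suc i) x) = sc (e * a) (ti (Suc (Suc k)) i (ti (Suc (Suc k)) (Suc i) (sc \<epsilon> (up (Suc k) i (up k j x)))))"
      proof -
        have A: "up (Suc k) (j + 2) (ti (Suc k) l y) = ti (Suc (Suc k)) l (up (Suc k) (j + 2) y)"
          if "l \<in> {i, Suc i}" "y \<in> NN (Suc k)" for l y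
          using t_up_lo[of l "j + 2" "Suc k" y] that Suc.prems False by auto
        have n: "up k i x \<in> NN (Suc k)" "ti (Suc k) (Suc i) (up k i x) \<in> NN (Suc k)"
          using Suc.prems False by (auto intro!: NN_ti NN_up)
        show ?thesis using Suc False A n by (simp add: up_Suc[of i k])
      qed
      then show ?thesis using Suc False by (simp add: up_Suc[of i "Suc k"] mult.commute)
    qed
  qed simp
qed

lemma dn_s: "1 <= i ==> i <= 2 * k + 1 ==> x \<in> NN (Suc k) ==> dn k i (ss (Suc k) i x) = sc lam' (dn k i x)"
proof (induction i arbitrary: x)
  case (Suc i)
  show ?case
  proof (cases "i = 0")
    case True then show ?thesis using cap_S1 Suc.prems by simp
  next
    case False
    then have "ss (Suc k) (Suc i) (ss (Suc k) i (ss (Suc k) (Suc i) x)) = ss (Suc k) i (ss (Suc k) (Suc i) (ss (Suc k) i x))"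
      using braid[of i "Suc k" x] Suc.prems by simp
    then show ?thesis using Suc False by (simp add: dn_Suc NN_S mult.commute)
  qed
qed simp

lemma dn_s_hi: "1 <= i ==> i + 2 <= j ==> j < 2 * k + 2 ==> x \<in> NN (Suc k) ==>
  dn k i (ss (Suc k) j x) = ss k (j - 2) (dn k i x)"
proof (induction i arbitrary: x)
  case (Suc i)
  show ?case
  proof (cases "i = 0")
    case True
    moreover obtain l where "j = l + 2" using Suc.prems by (metis add.commute le_Suc_ex add_leD2)
    ultimately show ?thesis using cap_S[of l k x] Suc.prems by simp
  next
    case False
    then show ?thesis using Suc by (simp add: dn_Suc far'[of _ "Suc k" j] NN_S)
  qed
qed simp

lemma dn_Suc_Suc: "1 <= i ==> dn k (Suc (Suc i)) x = sc ((1 / (e * a))\<^sup>2) (dn k i (ss (Suc k) (Suc i) (ss (Suc k) i (ss (Suc k) (Suc (Suc i)) (ss (Suc k) (Suc i) x)))))"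
  by (simp add: dn_Suc power2_eq_square)

lemma dn_s_lo: "1 <= j ==> j + 2 <= i ==> i <= 2 * k + 1 ==> x \<in> NN (Suc k) ==>
  dn k i (ss (Suc k) j x) = ss k j (dn k i x)"
proof (induction i arbitrary: x)
  case (Suc i)
  show ?case
  proof (cases "j + 2 <= i")
    case True
    then show ?thesis using Suc by (simp add: dn_Suc far'[of _ "Suc k" j] NN_S)
  next
    case False
    then have i: "i = Suc j" using Suc by simp
    let ?k = "Suc k" and ?s = "ss (Suc k)"
    have b: "j < 2 * ?k" "Suc j < 2 * ?k" "Suc (Suc j) < 2 * ?k" "1 <= j" using Suc i by auto
    have x: "x \<in> NN ?k" using Suc by simp
    have cl: "?s l y \<in> NN ?k" if "l \<in> {j, Suc j, Suc (Suc j)}" "y \<in> NN ?k" for l y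
      using that b by (auto intro!: NN_S)
    have "?s (Suc j) (?s j (?s (Suc (Suc j)) (?s (Suc j) (?s j x)))) = ?s (Suc j) (?s (Suc (Suc j)) (?s j (?s (Suc j) (?s j x))))"
      using far'[of j ?k "Suc (Suc j)" "?s (Suc j) (?s j x)"] b x by (simp add: cl)
    also have "... = ?s (Suc j) (?s (Suc (Suc j)) (?s (Suc j) (?s j (?s (Suc j) x))))"
      using braid[of j ?k x] b x by simp
    also have "... = ?s (Suc (Suc j)) (?s (Suc j) (?s (Suc (Suc j)) (?s j (?s (Suc j) x))))"
      using braid[of "Suc j" ?k "?s j (?s (Suc j) x)"] b x by (simp add: cl)
    also have "... = ?s (Suc (Suc j)) (?s (Suc j) (?s j (?s (Suc (Suc j)) (?s (Suc j) x))))"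
      using far'[of j ?k "Suc (Suc j)" "?s (Suc j) x"] b x by (simp add: cl)
    finally have "dn k i (ss (Suc k) (Suc i) (ss (Suc k) i (ss (Suc k) j x))) = dn k i (ss (Suc k) (Suc i) (ss (Suc k) i (ss (Suc k) j x)))" by simp
    have "dn k (Suc i) (?s j x) = sc ((1 / (e * a))\<^sup>2) (dn k j (?s (Suc (Suc j)) (?s (Suc j) (?s j (?s (Suc (Suc j)) (?s (Suc j) x))))))"
      unfolding i dn_Suc_Suc[OF b(4)] using \<open>?s (Suc j) (?s j (?s (Suc (Suc j)) (?s (Suc j) (?s j x)))) = ?s (Suc j) (?s (Suc (Suc j)) (?s j (?s (Suc j) (?s j x))))\<close>
        \<open>?s (Suc j) (?s (Suc (Suc j)) (?s j (?s (Suc j) (?s j x)))) = ?s (Suc j) (?s (Suc (Suc j)) (?s (Suc j) (?s j (?s (Suc j) x))))\<close>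
        \<open>?s (Suc j) (?s (Suc (Suc j)) (?s (Suc j) (?s j (?s (Suc j) x)))) = ?s (Suc (Suc j)) (?s (Suc j) (?s (Suc (Suc j)) (?s j (?s (Suc j) x))))\<close>
        \<open>?s (Suc (Suc j)) (?s (Suc j) (?s (Suc (Suc j)) (?s j (?s (Suc j) x)))) = ?s (Suc (Suc j)) (?s (Suc j) (?s j (?s (Suc (Suc j)) (?s (Suc j) x))))\<close>
      by metis
    also have "dn k j (?s (Suc (Suc j)) (?s (Suc j) (?s j (?s (Suc (Suc j)) (?s (Suc j) x))))) = ss k j (dn k j (?s (Suc j) (?s j (?s (Suc (Suc j)) (?s (Suc j) x)))))"
      using dn_s_hi[of j "Suc (Suc j)" k] b x Suc.prems i by (simp add: cl)
    finally show ?thesis unfolding i dn_Suc_Suc[OF b(4)] by simp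
  qed
qed simp

lemma dn_Suc_s: "1 <= i ==> i <= 2 * k ==> x \<in> NN (Suc k) ==>
  dn k (Suc i) (ss (Suc k) i x) = sc (- \<epsilon> * e) (dn k i (ss (Suc k) (Suc i) x)) + sc b (dn k (Suc i) x)"
proof -
  assume h: "1 <= i" "i <= 2 * k" "x \<in> NN (Suc k)"
  have ea: "1 / (e * a) * a = - \<epsilon> * e"
    using e2 eps nz enz by (simp add: power2_eq_square field_simps)
  have "dn k (Suc i) (ss (Suc k) i x) = sc (1 / (e * a) * a) (dn k i (ss (Suc k) (Suc i) x)) + sc b (dn k (Suc i) x)"
    using h quad[of i "Suc k" x] by (simp add: dn_Suc mult.commute)
  then show ?thesis unfolding ea .
qed

lemma dn_s_s: "1 <= i ==> dn k i (ss (Suc k) (Suc i) (ss (Suc k) i x)) = sc (e * a) (dn k (Suc i) x)"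
  using enz nz by (simp add: dn_Suc)

lemma dn_up: "1 <= i ==> i <= 2 * k + 1 ==> x \<in> NN k ==> dn k i (up k i x) = sc del x"
proof (induction i)
  case (Suc i)
  show ?case
  proof (cases "i = 0")
    case False
    then have "dn k (Suc i) (up k (Suc i) x) = dn k i (up k i x)"
      using Suc.prems nz enz by (simp add: dn_Suc up_Suc s_ti NN_ti NN_up)
    then show ?thesis using Suc False by simp
  qed simp
qed simp

lemma dn_s_up: "1 <= i ==> i <= 2 * k ==> x \<in> NN k ==> dn k i (ss (Suc k) (Suc i) (up k i x)) = sc rho x"
proof (induction i arbitrary: x)
  case (Suc i)
  show ?case
  proof (cases "i = 0")
    case True then show ?thesis using Suc.prems by (simp flip: numeral_2_eq_2)
  next
    case False
    let ?k = "Suc k" and ?s = "ss (Suc k)" and ?t = "ti (Suc k)"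
    define y where "y = up k i x"
    have y: "y \<in> NN ?k" unfolding y_def using Suc False by (intro NN_up) auto
    have b: "1 <= i" "i < 2 * ?k" "Suc i < 2 * ?k" "Suc (Suc i) < 2 * ?k" using Suc False by auto
    have x: "x \<in> NN k" using Suc by simp
    have "dn k (Suc i) (?s (Suc (Suc i)) (up k (Suc i) x)) = dn k i (?s (Suc i) (?s i (?s (Suc (Suc i)) (?t i (?t (Suc i) y)))))"
      using b nz enz by (simp add: dn_Suc up_Suc y_def)
    also have "?s i (?s (Suc (Suc i)) (?t i (?t (Suc i) y))) = ?s (Suc (Suc i)) (?t (Suc i) y)"
      using far'[of i ?k "Suc (Suc i)" "?t i (?t (Suc i) y)"] b y by (simp add: NN_ti s_ti)
    also have "?s (Suc i) (?s (Suc (Suc i)) (?t (Suc i) y)) = ?t (Suc (Suc i)) (?s (Suc i) (?s (Suc (Suc i)) y))"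
    proof (rule s_inj[of "Suc (Suc i)" ?k])
      show "?s (Suc (Suc i)) (?s (Suc i) (?s (Suc (Suc i)) (?t (Suc i) y))) = ?s (Suc (Suc i)) (?t (Suc (Suc i)) (?s (Suc i) (?s (Suc (Suc i)) y)))"
        using braid[of "Suc i" ?k "?t (Suc i) y"] b y by (simp add: NN_ti NN_S s_ti)
    qed (use b y in \<open>auto intro!: NN_S NN_ti\<close>)
    also have "dn k i (?t (Suc (Suc i)) (?s (Suc i) (?s (Suc (Suc i)) y))) = ti k i (dn k i (?s (Suc i) (?s (Suc (Suc i)) y)))"
      using dn_s_hi[of i "Suc (Suc i)" k "?s (Suc i) (?s (Suc (Suc i)) y)"] b y Suc.prems by (simp add: ti_def NN_S)
    also have "?s (Suc (Suc i)) y = up k i (ss k i x)" unfolding y_def using s_up_hi[of i "Suc (Suc i)" k x] b x Suc.prems by simp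
    also have "dn k i (?s (Suc i) (up k i (ss k i x))) = sc rho (ss k i x)" using Suc b x by (intro Suc.IH NN_S) auto
    also have "ti k i (sc rho (ss k i x)) = sc rho x" using Suc.prems b x by (simp add: ti_s)
    finally show ?thesis .
  qed
qed simp

lemma dn_up1: "1 <= i ==> i <= 2 * k ==> x \<in> NN k ==> dn k i (up k (Suc i) x) = sc sig x"
proof -
  assume h: "1 <= i" "i <= 2 * k" "x \<in> NN k"
  have "sc lam' (dn k i (up k (Suc i) x)) = dn k i (ss (Suc k) i (up k (Suc i) x))"
    using h NN_up[of "Suc i" k x] by (simp add: dn_s)
  also have "... = sc (e * rho) x - sc (e * b * del) x"
    using h by (simp only: s_up1 dn_simps dn_s_up dn_up sc_simps)
  also have "... = sc (e * (rho - b * del)) x"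
    by (simp only: vec_eq_iff co_simps co_sc) (simp only: right_diff_distrib left_diff_distrib mult.assoc simp_thms)
  also have "... = sc (lam' * sig) x" unfolding params ..
  finally have "sc (1 / lam') (sc lam' (dn k i (up k (Suc i) x))) = sc (1 / lam') (sc (lam' * sig) x)" by simp
  then show ?thesis using params(6) by simp
qed

lemma dn1_up: "1 <= i ==> i <= 2 * k ==> x \<in> NN k ==> dn k (Suc i) (up k i x) = sc (\<epsilon> * sig) x"
proof -
  assume h: "1 <= i" "i <= 2 * k" "x \<in> NN k"
  have "dn k (Suc i) (up k i x) = sc (1 / (e * a)) (sc (lam * rho) x)"
    using h dn_s_up[OF h] by (simp add: dn_Suc s_up)
  then show ?thesis unfolding params using nz enz by simp
qed

lemma ti_dn_hi: "1 <= i ==> i + 2 <= j ==> j < 2 * k + 2 ==> x \<in> NN (Suc k) ==>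
  dn k i (ti (Suc k) j x) = ti k (j - 2) (dn k i x)"
  unfolding ti_def using dn_s_hi[of i j k x] by simp
lemma ti_dn_lo: "1 <= j ==> j + 2 <= i ==> i <= 2 * k + 1 ==> x \<in> NN (Suc k) ==>
  dn k i (ti (Suc k) j x) = ti k j (dn k i x)"
  unfolding ti_def using dn_s_lo[of j i k x] by simp

lemma dn1_up3:
  assumes y: "y \<in> NN (Suc k)"
  shows "dn (Suc k) 1 (up (Suc k) 3 y) = sc \<epsilon> (up k 1 (dn k 1 y))"
proof (rule gen[where t = 3 and k = k and P = "\<lambda>y. dn (Suc k) 1 (up (Suc k) 3 y)" and Q = "\<lambda>y. sc \<epsilon> (up k 1 (dn k 1 y))"])
  fix j :: nat and f :: "'k vec" assume h: "f \<in> NN k" "2 <= j" "j <= 3" "j <= 2 * k + 2"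
  show "dn (Suc k) 1 (up (Suc k) 3 (ins j f)) = sc \<epsilon> (up k 1 (dn k 1 (ins j f)))"
  proof (cases "j = 2")
    case True
    have "up (Suc k) 3 (ins 2 f) = sc \<epsilon> (ins 2 (ins 2 f))"
      using up_up[of 1 1 k f] h by (simp add: numeral_3_eq_3)
    then show ?thesis using True by simp
  next
    case False
    then have [simp]: "j = 3" using h by simp
    obtain m where m: "k = Suc m" using h by (cases k) auto
    let ?w = "ss (Suc k) (Suc 0) (ins 3 f)"
    have n: "ins 3 f \<in> NN (Suc k)" "?w \<in> NN (Suc k)" "ins 2 f \<in> NN (Suc k)" using h by (auto intro!: NN_S)
    have 5: "(5::nat) = Suc (Suc 3)" "(3::nat) = Suc (Suc 1)" by simp_all
    have u: "up (Suc k) 3 (ins 3 f) = sc (e * a) (ti (Suc (Suc k)) 2 (ti (Suc (Suc k)) 3 (sc kap (ins 5 (ins 2 f)))))"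
      using up_2[of "Suc k" "ins 3 f"] n m by (simp add: up.simps(3) numeral_3_eq_3 numeral_2_eq_2 5(1) del: NN_ins)
    have s1: "ss (Suc (Suc k)) 3 (ins 5 y) = ins 5 (ss (Suc k) 2 y)" for y
      using m by (subst S_ins_simps(4)) auto
    have s2: "ss (Suc (Suc k)) 2 (ins 5 y) = ins 5 (ss (Suc k) 1 y)" for y
      using m by (subst S_ins_simps(4)) auto
    have t1: "ti (Suc (Suc k)) 3 (ins 5 (ins 2 f)) = sc (1 / a) (ins 5 (ins 3 f) - sc b (ins 5 (ins 2 f)))"
      unfolding ti_def s1 by simp
    have t2: "ti (Suc (Suc k)) 2 (ins 5 y) = sc (1 / a) (ins 5 (ss (Suc k) 1 y) - sc b (ins 5 y))" for y
      unfolding ti_def s2 by simp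
    have c5: "cap (Suc k) (ins 5 y) = sc rho (ss (Suc k) 2 (ss (Suc k) 1 y))" for y using m by simp
    have q: "ss (Suc k) 1 ?w = sc a (ins 3 f) + sc b ?w"
      using quad[of 1 "Suc k" "ins 3 f"] n by simp
    have "cap (Suc k) (ti (Suc (Suc k)) 2 (ti (Suc (Suc k)) 3 (ins 5 (ins 2 f)))) =
      sc (rho / (a * a)) (ss (Suc k) 2 (ss (Suc k) 1 (?w - sc b (ins 3 f) - sc (b * lam) (ins 2 f) + sc (b * b) (ins 2 f))))"
      unfolding t1 by (simp only: ti_simps t2 cap_simps c5) (simp add: vec_eq_iff divide_inverse algebra_simps)
    also have "ss (Suc k) 1 (?w - sc b (ins 3 f) - sc (b * lam) (ins 2 f) + sc (b * b) (ins 2 f)) = sc a (ins 3 f) - sc (b * a) (ins 2 f)"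
      using q by simp (simp only: vec_eq_iff co_simps co_sc, simp add: a_eq power2_eq_square algebra_simps)
    also have "ss (Suc k) 2 (sc a (ins 3 f) - sc (b * a) (ins 2 f)) = sc (a * a) (ins 2 f)"
      using m by simp (simp add: vec_eq_iff)
    finally have "cap (Suc k) (up (Suc k) 3 (ins 3 f)) = sc (e * a) (sc kap (sc (rho / (a * a)) (sc (a * a) (ins 2 f))))"
      unfolding u by (simp only: ti_simps cap_simps)
    also have "... = sc (e * a * kap * (rho / (a * a) * (a * a))) (ins 2 f)" by (simp only: sc_simps mult.assoc)
    also have "rho / (a * a) * (a * a) = rho" using nz by simp
    also have "e * a * kap = \<epsilon>" using nz e2 by (simp add: power2_eq_square)
    finally show ?thesis using m by simp
  qed
next
  fix j and x :: "'k vec" assume h: "x \<in> NN (Suc k)" "3 <= j" "j < 2 * k + 2"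
    and IH: "dn (Suc k) 1 (up (Suc k) 3 x) = sc \<epsilon> (up k 1 (dn k 1 x))"
  have 1: "up (Suc k) 3 (ss (Suc k) j x) = ss (Suc (Suc k)) (j + 2) (up (Suc k) 3 x)"
    using s_up_hi[of 3 "j + 2" "Suc k" x] h by simp
  have n: "up (Suc k) 3 x \<in> NN (Suc (Suc k))" "dn k 1 x \<in> NN k" using h by (auto intro!: NN_up NN_cap)
  obtain l where l: "j = l + 2" "1 <= l" using h by (intro that[of "j - 2"]) auto
  show "dn (Suc k) 1 (up (Suc k) 3 (ss (Suc k) j x)) = sc \<epsilon> (up k 1 (dn k 1 (ss (Suc k) j x)))"
    unfolding 1 using dn_s_hi[of 1 "j + 2" "Suc k"] dn_s_hi[of 1 j k x] s_up_hi[of 1 j k] IH h n l by simp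
qed (use y in \<open>auto intro!: lin_cl lin_comp[OF dn_lin] lin_comp[OF up_lin] up_lin dn_lin cap_lin lin_comp[OF cap_lin]\<close>)

lemma dn_up_far1: "1 <= i ==> i <= j ==> j <= 2 * k + 1 ==> y \<in> NN (Suc k) ==>
  dn (Suc k) i (up (Suc k) (j + 2) y) = sc \<epsilon> (up k j (dn k i y))"
proof -
  have c: "dn (Suc k) 1 (up (Suc k) (j + 2) y) = sc \<epsilon> (up k j (dn k 1 y))" if "1 <= j" "j <= 2 * k + 1" "y \<in> NN (Suc k)" for j y
    using that
  proof (induction j)
    case (Suc j)
    show ?case
    proof (cases "j = 0")
      case True then show ?thesis using dn1_up3 Suc.prems by (simp add: numeral_3_eq_3)
    next
      case False
      have n: "up (Suc k) (j + 2) y \<in> NN (Suc (Suc k))" using Suc.prems False by (intro NN_up) auto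
      have "dn (Suc k) 1 (up (Suc k) (Suc j + 2) y) = sc (e * a) (dn (Suc k) 1 (ti (Suc (Suc k)) (j + 2) (ti (Suc (Suc k)) (Suc (j + 2)) (up (Suc k) (j + 2) y))))"
        using up_Suc[of "j + 2" "Suc k" y] by simp
      also have "... = sc (e * a) (ti (Suc k) j (ti (Suc k) (Suc j) (dn (Suc k) 1 (up (Suc k) (j + 2) y))))"
        using Suc.prems False n ti_dn_hi[of 1 "j + 2" "Suc k"] ti_dn_hi[of 1 "Suc (j + 2)" "Suc k"] by (simp add: NN_ti)
      also have "dn (Suc k) 1 (up (Suc k) (j + 2) y) = sc \<epsilon> (up k j (dn k 1 y))" using Suc False by simp
      finally show ?thesis using False by (simp add: up_Suc mult.commute)
    qed
  qed simp
  show "1 <= i ==> i <= j ==> j <= 2 * k + 1 ==> y \<in> NN (Suc k) ==> ?thesis"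
  proof (induction i arbitrary: y)
    case (Suc i)
    show ?case
    proof (cases "i = 0")
      case True then show ?thesis using c Suc.prems by simp
    next
      case False
      have "dn (Suc k) (Suc i) (up (Suc k) (j + 2) y) = sc (1 / (e * a)) (dn (Suc k) i (up (Suc k) (j + 2) (ss (Suc k) (Suc i) (ss (Suc k) i y))))"
        using Suc.prems False s_up_lo[of "Suc i" "j + 2" "Suc k"] s_up_lo[of i "j + 2" "Suc k"] by (simp add: dn_Suc NN_S)
      also have "... = sc (1 / (e * a)) (sc \<epsilon> (up k j (dn k i (ss (Suc k) (Suc i) (ss (Suc k) i y)))))"
        using Suc False by (subst Suc.IH) (auto intro!: NN_S)
      finally show ?thesis using False by (simp add: dn_Suc mult.commute)
    qed
  qed simp
qed

lemma dn3_up1: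
  assumes y: "y \<in> NN (Suc k)"
  shows "dn (Suc k) 3 (up (Suc k) 1 y) = sc \<epsilon> (up k 1 (dn k 1 y))"
proof (rule gen[where t = 3 and k = k and P = "\<lambda>y. dn (Suc k) 3 (up (Suc k) 1 y)" and Q = "\<lambda>y. sc \<epsilon> (up k 1 (dn k 1 y))"])
  let ?s = "ss (Suc (Suc k))"
  have ie: "1 / \<epsilon> = \<epsilon>" using eps epsnz by (simp add: field_simps)
  have "(1 / (e * a))\<^sup>2 * - (a * a) = - (1 / e\<^sup>2)"
    using nz enz by (simp add: power2_eq_square)
  then have ea: "(1 / (e * a))\<^sup>2 * - (a * a) = \<epsilon>" using ie by (simp add: e2)
  fix j :: nat and f :: "'k vec" assume h: "f \<in> NN k" "2 <= j" "j <= 3" "j <= 2 * k + 2"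
  have d3: "dn (Suc k) 3 (up (Suc k) 1 y) = sc ((1 / (e * a))\<^sup>2) (cap (Suc k) (?s 2 (?s 1 (?s 3 (?s 2 (ins 2 y))))))" for y
    using dn_Suc_Suc[of 1 "Suc k" "ins 2 y"] by (simp add: numeral_3_eq_3 numeral_2_eq_2)
  show "dn (Suc k) 3 (up (Suc k) 1 (ins j f)) = sc \<epsilon> (up k 1 (dn k 1 (ins j f)))"
  proof (cases "j = 2")
    case True
    have "?s 2 (?s 1 (?s 3 (?s 2 (ins 2 (ins 2 f))))) = sc (- (a * a)) (ins 2 (ins 2 f))"
      by simp (simp only: vec_eq_iff co_simps co_sc, simp add: a_eq power2_eq_square algebra_simps)
    then have "dn (Suc k) 3 (up (Suc k) 1 (ins 2 f)) = sc ((1 / (e * a))\<^sup>2 * - (a * a)) (sc del (ins 2 f))"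
      unfolding d3 by (simp only: cap_simps cap_ins2 sc_simps mult.assoc)
    then show ?thesis unfolding ea using True by simp
  next
    case False
    then have [simp]: "j = 3" using h by simp
    obtain m where m: "k = Suc m" using h by (cases k) auto
    define w where "w = ss (Suc k) 1 (ins 3 f)"
    have n: "ins 3 f \<in> NN (Suc k)" "w \<in> NN (Suc k)" "ins 2 f \<in> NN (Suc k)" using h unfolding w_def by (auto intro!: NN_S)
    have q: "ss (Suc k) 1 w = sc a (ins 3 f) + sc b w"
      unfolding w_def using quad[of 1 "Suc k" "ins 3 f"] n by simp
    have w2: "ss (Suc k) 2 w = sc lam w"
      unfolding w_def using braid[of 1 "Suc k" "ins 2 f"] n m by (simp add: numeral_2_eq_2[symmetric])
    have s5: "?s 3 (ins 5 (ins 2 f)) = ins 5 (ins 3 f)" "?s 2 (ins 5 (ins 3 f)) = ins 5 w" "?s 2 (ins 4 (ins 3 f)) = ins 4 w"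
      unfolding w_def using m by (simp_all add: S_ins_simps(4))
    have "?s 2 (?s 1 (?s 3 (?s 2 (ins 2 (ins 3 f))))) = ?s 2 (sc dD (ins 2 w) + sc b (ins 4 (ins 3 f)) - ins 5 (ins 3 f))"
      using m s5 unfolding w_def by simp
    also have "... = sc dD (ins 3 w) + sc b (ins 4 w) - ins 5 w" using s5 by simp
    finally have "cap (Suc k) (?s 2 (?s 1 (?s 3 (?s 2 (ins 2 (ins 3 f)))))) = sc rho (sc dD w + sc b (ss (Suc k) 1 w) - ss (Suc k) 2 (ss (Suc k) 1 w))"
      using m by (simp add: mult.commute)
    also have "... = sc (- (a * a) * rho) (ins 2 f)"
      unfolding q using m w2 by simp (simp only: vec_eq_iff co_simps co_sc, simp add: a_eq power2_eq_square algebra_simps)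
    finally have "dn (Suc k) 3 (up (Suc k) 1 (ins 3 f)) = sc ((1 / (e * a))\<^sup>2 * - (a * a)) (sc rho (ins 2 f))"
      unfolding d3 by (simp only: sc_simps mult.assoc)
    then show ?thesis unfolding ea using m by simp
  qed
next
  fix j and x :: "'k vec" assume h: "x \<in> NN (Suc k)" "3 <= j" "j < 2 * k + 2"
    and IH: "dn (Suc k) 3 (up (Suc k) 1 x) = sc \<epsilon> (up k 1 (dn k 1 x))"
  have n: "up (Suc k) 1 x \<in> NN (Suc (Suc k))" "dn k 1 x \<in> NN k" using h by (auto intro!: NN_up NN_cap)
  obtain l where l: "j = l + 2" "1 <= l" using h by (intro that[of "j - 2"]) auto
  have 1: "up (Suc k) 1 (ss (Suc k) j x) = ss (Suc (Suc k)) (j + 2) (up (Suc k) 1 x)"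
    using s_up_hi[of 1 "j + 2" "Suc k" x] h by simp
  show "dn (Suc k) 3 (up (Suc k) 1 (ss (Suc k) j x)) = sc \<epsilon> (up k 1 (dn k 1 (ss (Suc k) j x)))"
  proof -
    have "dn (Suc k) 3 (up (Suc k) 1 (ss (Suc k) j x)) = ss (Suc k) j (dn (Suc k) 3 (up (Suc k) 1 x))"
      unfolding 1 by (subst dn_s_hi) (use h n in auto)
    also have "... = sc \<epsilon> (ss (Suc k) j (up k 1 (dn k 1 x)))" unfolding IH by (rule S_simps)
    also have "ss (Suc k) j (up k 1 (dn k 1 x)) = up k 1 (ss k (j - 2) (dn k 1 x))"
      by (subst s_up_hi) (use h n in auto)
    also have "ss k (j - 2) (dn k 1 x) = dn k 1 (ss (Suc k) j x)"
      by (subst dn_s_hi) (use h in auto)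
    finally show ?thesis .
  qed
qed (use y in \<open>auto intro!: lin_cl lin_comp[OF dn_lin] lin_comp[OF up_lin] up_lin dn_lin cap_lin lin_comp[OF cap_lin]\<close>)

lemma dn_up_far2: "1 <= i ==> i <= j ==> j <= 2 * k + 1 ==> y \<in> NN (Suc k) ==>
  dn (Suc k) (j + 2) (up (Suc k) i y) = sc \<epsilon> (up k i (dn k j y))"
proof -
  have c: "dn (Suc k) (j + 2) (up (Suc k) 1 y) = sc \<epsilon> (up k 1 (dn k j y))" if "1 <= j" "j <= 2 * k + 1" "y \<in> NN (Suc k)" for j y
    using that
  proof (induction j arbitrary: y)
    case (Suc j)
    show ?case
    proof (cases "j = 0")
      case True then show ?thesis using dn3_up1 Suc.prems by (simp add: numeral_3_eq_3)
    next
      case False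
      have "dn (Suc k) (Suc j + 2) (up (Suc k) 1 y) = sc (1 / (e * a)) (dn (Suc k) (j + 2) (up (Suc k) 1 (ss (Suc k) (Suc j) (ss (Suc k) j y))))"
        using dn_Suc[of "j + 2" "Suc k" "up (Suc k) 1 y"] s_up_hi[of 1 "j + 2" "Suc k" y] s_up_hi[of 1 "Suc (j + 2)" "Suc k" "ss (Suc k) j y"] Suc.prems False
        by (simp add: NN_S)
      also have "dn (Suc k) (j + 2) (up (Suc k) 1 (ss (Suc k) (Suc j) (ss (Suc k) j y))) = sc \<epsilon> (up k 1 (dn k j (ss (Suc k) (Suc j) (ss (Suc k) j y))))"
        using Suc False by (intro Suc.IH) (auto intro!: NN_S)
      finally show ?thesis using False by (simp add: dn_Suc mult.commute)
    qed
  qed simp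
  show "1 <= i ==> i <= j ==> j <= 2 * k + 1 ==> y \<in> NN (Suc k) ==> ?thesis"
  proof (induction i)
    case (Suc i)
    show ?case
    proof (cases "i = 0")
      case True then show ?thesis using c Suc.prems by simp
    next
      case False
      have n: "up (Suc k) i y \<in> NN (Suc (Suc k))" using Suc.prems False by (intro NN_up) auto
      have "dn (Suc k) (j + 2) (up (Suc k) (Suc i) y) = sc (e * a) (ti (Suc k) i (ti (Suc k) (Suc i) (dn (Suc k) (j + 2) (up (Suc k) i y))))"
        using Suc.prems False n ti_dn_lo[of i "j + 2" "Suc k"] ti_dn_lo[of "Suc i" "j + 2" "Suc k"] by (simp add: up_Suc NN_ti)
      also have "dn (Suc k) (j + 2) (up (Suc k) i y) = sc \<epsilon> (up k i (dn k j y))" using Suc False by simp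
      finally show ?thesis using False by (simp add: up_Suc mult.commute)
    qed
  qed simp
qed

lemma dn_dn1:
  assumes y: "y \<in> NN (Suc (Suc k))"
  shows "dn k 1 (dn (Suc k) 3 y) = sc \<epsilon> (dn k 1 (dn (Suc k) 1 y))"
proof (rule gen[where t = 5 and k = "Suc k" and P = "\<lambda>y. dn k 1 (dn (Suc k) 3 y)" and Q = "\<lambda>y. sc \<epsilon> (dn k 1 (dn (Suc k) 1 y))"])
  let ?s = "ss (Suc (Suc k))"
  have b2: "dn k 1 (dn (Suc k) 3 (ins 2 f)) = sc \<epsilon> (dn k 1 (dn (Suc k) 1 (ins 2 f)))" if "f \<in> NN (Suc k)" for f
    using dn3_up1[OF that] by (simp add: mult.commute)
  have b3: "dn k 1 (dn (Suc k) 3 (ins 3 f)) = sc \<epsilon> (dn k 1 (dn (Suc k) 1 (ins 3 f)))" if f: "f \<in> NN (Suc k)" for f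
  proof -
    have n: "ins 2 f \<in> NN (Suc (Suc k))" using f by auto
    have "dn (Suc k) 3 (ins 3 f) = dn (Suc k) (Suc 2) (?s 2 (ins 2 f))" by simp
    also have "... = sc (- \<epsilon> * e) (dn (Suc k) 2 (?s 3 (ins 2 f))) + sc b (dn (Suc k) 3 (ins 2 f))"
      using dn_Suc_s[of 2 "Suc k" "ins 2 f"] n by (simp add: numeral_3_eq_3)
    also have "?s 3 (ins 2 f) = ins 2 (ss (Suc k) 1 f)" by simp
    also have "dn (Suc k) 2 (ins 2 (ss (Suc k) 1 f)) = sc (\<epsilon> * sig) (ss (Suc k) 1 f)"
      using dn1_up[of 1 "Suc k" "ss (Suc k) 1 f"] f NN_S[of 1 "Suc k" f] by (simp add: numeral_2_eq_2)
    also have "dn (Suc k) 3 (ins 2 f) = sc \<epsilon> (ins 2 (cap k f))" using dn3_up1[OF f] by simp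
    finally have "dn k 1 (dn (Suc k) 3 (ins 3 f)) = sc (\<epsilon> * (b * del - \<epsilon> * e * lam' * sig)) (cap k f)"
      using cap_S1[OF f] by simp (simp only: vec_eq_iff co_simps co_sc, simp add: algebra_simps)
    then show ?thesis unfolding params(7) by simp
  qed
  have b4: "dn k 1 (dn (Suc k) 3 (ins 4 f)) = sc \<epsilon> (dn k 1 (dn (Suc k) 1 (ins 4 f)))" if f: "f \<in> NN (Suc k)" for f
  proof -
    have n: "ins 3 f \<in> NN (Suc (Suc k))" using f by auto
    have "dn (Suc k) 3 (ins 4 f) = sc lam' (dn (Suc k) 3 (ins 3 f))"
      using dn_s[of 3 "Suc k" "ins 3 f"] n by simp
    then have "dn k 1 (dn (Suc k) 3 (ins 4 f)) = sc lam' (sc \<epsilon> (dn k 1 (dn (Suc k) 1 (ins 3 f))))"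
      using b3[OF f] by simp
    moreover have "dn k 1 (dn (Suc k) 1 (ins 4 f)) = sc lam' (dn k 1 (dn (Suc k) 1 (ins 3 f)))"
      using cap_S1[OF f] by (simp add: mult.commute)
    ultimately show ?thesis by (simp only: sc_simps mult.commute)
  qed
  have b5: "dn k 1 (dn (Suc k) 3 (ins 5 f)) = sc \<epsilon> (dn k 1 (dn (Suc k) 1 (ins 5 f)))" if f: "f \<in> NN (Suc k)" and k: "1 <= k" for f
  proof -
    have n: "ins 3 f \<in> NN (Suc (Suc k))" "ins 2 f \<in> NN (Suc (Suc k))" "dn k 2 f \<in> NN k" using f k by (auto intro!: NN_dn)
    have "dn (Suc k) 3 (ins 5 f) = dn (Suc k) 3 (?s (Suc 3) (?s 3 (ins 3 f)))" using k by simp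
    also have "... = sc (e * a) (dn (Suc k) 4 (?s 2 (ins 2 f)))" using dn_s_s[of 3 "Suc k" "ins 3 f"] by simp
    also have "dn (Suc k) 4 (?s 2 (ins 2 f)) = ss (Suc k) 2 (dn (Suc k) (2 + 2) (up (Suc k) 1 f))"
      using dn_s_lo[of 2 4 "Suc k" "ins 2 f"] n k by simp
    also have "... = sc \<epsilon> (ins 3 (dn k 2 f))" using dn_up_far2[of 1 2 k f] f k by simp
    finally have 1: "dn k 1 (dn (Suc k) 3 (ins 5 f)) = sc (e * a * \<epsilon> * rho) (dn k 2 f)" using k by (simp add: mult.assoc)
    have "dn k 1 (dn (Suc k) 1 (ins 5 f)) = sc rho (dn k 1 (ss (Suc k) (Suc 1) (ss (Suc k) 1 f)))"
      using k by (simp add: numeral_2_eq_2)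
    also have "... = sc rho (sc (e * a) (dn k (Suc 1) f))" using dn_s_s[of 1 k f] by (simp only:)
    finally show ?thesis unfolding 1 by (simp add: numeral_2_eq_2 mult_ac)
  qed
  fix j :: nat and f :: "'k vec" assume h: "f \<in> NN (Suc k)" "2 <= j" "j <= 5" "j <= 2 * Suc k + 2"
  then consider "j = 2" | "j = 3" | "j = 4" | "j = 5" by linarith
  then show "dn k 1 (dn (Suc k) 3 (ins j f)) = sc \<epsilon> (dn k 1 (dn (Suc k) 1 (ins j f)))"
  proof cases
    case 4 then show ?thesis using b5 h by auto
  qed (use b2 b3 b4 h in blast)+
next
  fix j and x :: "'k vec" assume h: "x \<in> NN (Suc (Suc k))" "5 <= j" "j < 2 * Suc k + 2"
    and IH: "dn k 1 (dn (Suc k) 3 x) = sc \<epsilon> (dn k 1 (dn (Suc k) 1 x))"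
  have n: "dn (Suc k) 3 x \<in> NN (Suc k)" "dn (Suc k) 1 x \<in> NN (Suc k)" using h by (auto intro!: NN_dn NN_cap)
  obtain l where l: "j = l + 4" "1 <= l" using h by (intro that[of "j - 4"]) auto
  have s: "dn (Suc k) 3 (ss (Suc (Suc k)) j x) = ss (Suc k) (l + 2) (dn (Suc k) 3 x)"
    "dn (Suc k) 1 (ss (Suc (Suc k)) j x) = ss (Suc k) (l + 2) (dn (Suc k) 1 x)"
    using dn_s_hi[of 3 j "Suc k" x] dn_s_hi[of 1 j "Suc k" x] h l by simp_all
  show "dn k 1 (dn (Suc k) 3 (ss (Suc (Suc k)) j x)) = sc \<epsilon> (dn k 1 (dn (Suc k) 1 (ss (Suc (Suc k)) j x)))"
    unfolding s using dn_s_hi[of 1 "l + 2" k] IH h n l by simp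
qed (use y in \<open>auto intro!: lin_cl lin_comp[OF dn_lin] dn_lin cap_lin lin_comp[OF cap_lin]\<close>)

lemma dn_dn: "1 <= i ==> i <= j ==> j <= 2 * k + 1 ==> y \<in> NN (Suc (Suc k)) ==>
  dn k i (dn (Suc k) (j + 2) y) = sc \<epsilon> (dn k j (dn (Suc k) i y))"
proof -
  have c: "dn k 1 (dn (Suc k) (j + 2) y) = sc \<epsilon> (dn k j (dn (Suc k) 1 y))" if "1 <= j" "j <= 2 * k + 1" "y \<in> NN (Suc (Suc k))" for j y
    using that
  proof (induction j arbitrary: y)
    case (Suc j)
    show ?case
    proof (cases "j = 0")
      case True then show ?thesis using dn_dn1 Suc.prems by (simp add: numeral_3_eq_3)
    next
      case False
      let ?y = "ss (Suc (Suc k)) (Suc (j + 2)) (ss (Suc (Suc k)) (j + 2) y)"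
      have n: "?y \<in> NN (Suc (Suc k))" using Suc.prems by (intro NN_S) auto
      have "dn k 1 (dn (Suc k) (Suc j + 2) y) = sc (1 / (e * a)) (dn k 1 (dn (Suc k) (j + 2) ?y))"
        using dn_Suc[of "j + 2" "Suc k" y] by simp
      also have "dn k 1 (dn (Suc k) (j + 2) ?y) = sc \<epsilon> (dn k j (dn (Suc k) 1 ?y))" using Suc False n by simp
      also have "dn (Suc k) 1 ?y = ss (Suc k) (Suc j) (ss (Suc k) j (dn (Suc k) 1 y))"
        using dn_s_hi[of 1 "j + 2" "Suc k" y] dn_s_hi[of 1 "Suc (j + 2)" "Suc k" "ss (Suc (Suc k)) (j + 2) y"] Suc.prems False
        by (simp add: NN_S)
      finally show ?thesis using False by (simp add: dn_Suc mult.commute)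
    qed
  qed simp
  show "1 <= i ==> i <= j ==> j <= 2 * k + 1 ==> y \<in> NN (Suc (Suc k)) ==> ?thesis"
  proof (induction i arbitrary: y)
    case (Suc i)
    show ?case
    proof (cases "i = 0")
      case True then show ?thesis using c Suc.prems by simp
    next
      case False
      have "dn k (Suc i) (dn (Suc k) (j + 2) y) = sc (1 / (e * a)) (dn k i (dn (Suc k) (j + 2) (ss (Suc (Suc k)) (Suc i) (ss (Suc (Suc k)) i y))))"
        using Suc.prems False dn_s_lo[of i "j + 2" "Suc k"] dn_s_lo[of "Suc i" "j + 2" "Suc k"] by (simp add: dn_Suc[of i k] NN_S)
      also have "... = sc (1 / (e * a)) (sc \<epsilon> (dn k j (dn (Suc k) i (ss (Suc (Suc k)) (Suc i) (ss (Suc (Suc k)) i y)))))"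
        using Suc False by (subst Suc.IH) (auto intro!: NN_S)
      finally show ?thesis using False by (simp add: dn_Suc[of i "Suc k"] mult.commute)
    qed
  qed simp
qed

end

section \<open>The action on matchings\<close>

definition lv :: "nat => nat => nat => nat" where "lv k m n = (2 * k + n - m) div 2"

lemma lv_even: "even (m + n) ==> m <= 2 * k + n ==> 2 * lv k m n + m = 2 * k + n"
  unfolding lv_def by (cases "even n") (auto elim!: evenE oddE)
lemma lv_same [simp]: "lv k m m = k" by (simp add: lv_def)
lemma lv_comp: "even (l + m) ==> l <= 2 * k ==> lv (lv k l m) m n = lv k l n"
  using lv_even[of l m k] by (simp add: lv_def)
lemma lv_swap: "even (m + n) ==> even (m' + n') ==> m + m' <= 2 * k ==> lv (lv k m n) m' n' = lv k (m' + m) (n' + n)"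
  using lv_even[of m n k] by (simp add: lv_def algebra_simps)

context chord_params
begin

primrec act :: "nat => nat => 'k expr => 'k vec => 'k vec" where
  "act i k GenH x = ss k (Suc i) x"
| "act i k GenA x = dn (k - 1) (Suc i) x"
| "act i k GenU x = up k (Suc i) x"
| "act i k (Ident n) x = x"
| "act i k (Zero m n) x = 0"
| "act i k (s +\<^sub>e t) x = act i k s x + act i k t x"
| "act i k (c *\<^sub>e t) x = sc c (act i k t x)"
| "act i k (s \<circ>\<^sub>e t) x = act i (lv k (src t) (tgt t)) s (act i k t x)"
| "act i k (s \<otimes>\<^sub>e t) x = act i (lv k (src t) (tgt t)) s (act (i + src s) k t x)"

lemma act_lin: "lin (act i k t)"
proof (induction t arbitrary: i k)
  case (Comp s t)
  show ?case using lin_comp[OF Comp.IH(1)[of i "lv k (src t) (tgt t)"] Comp.IH(2)[of i k]] by (simp add: lin_def)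
next
  case (Tens s t)
  show ?case using lin_comp[OF Tens.IH(1)[of i "lv k (src t) (tgt t)"] Tens.IH(2)[of "i + src s" k]] by (simp add: lin_def)
next
  case (Add s t)
  show ?case using lin_plus[OF Add.IH(1)[of i k] Add.IH(2)[of i k]] by (simp add: lin_def)
next
  case (Scale c t)
  show ?case using lin_scale[OF Scale.IH[of i k], of c] by (simp add: lin_def)
qed (auto simp: lin_def algebra_simps)

lemmas act_simps = lin_simps[OF act_lin]

lemma act_odd: "wf_expr t ==> odd (src t + tgt t) ==> act i k t x = 0"
proof (induction t arbitrary: i k x)
  case (Comp s t)
  then have "odd (src s + tgt s) \<or> odd (src t + tgt t)" by simp presburger
  then show ?case using Comp.IH Comp.prems by (elim disjE) (simp_all add: act_simps)
next
  case (Tens s t)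
  then have "odd (src s + tgt s) \<or> odd (src t + tgt t)" by simp presburger
  then show ?case using Tens.IH Tens.prems by (elim disjE) (simp_all add: act_simps)
qed simp_all

lemma act_NN: "wf_expr t ==> i + src t <= 2 * k ==> x \<in> NN k ==> act i k t x \<in> NN (lv k (src t) (tgt t))"
proof (induction t arbitrary: i k x)
  case GenH then show ?case by (simp add: NN_S)
next
  case GenA
  then obtain k' where k: "k = Suc k'" by (cases k) simp_all
  have "lv k 2 0 = k'" by (simp add: lv_def k)
  then show ?case using GenA k NN_dn[of "Suc i" k' x] by simp
next
  case GenU
  have "lv k 0 2 = Suc k" by (simp add: lv_def)
  then show ?case using GenU NN_up[of "Suc i" k x] by simp
next
  case (Comp s t)
  show ?case
  proof (cases "odd (src s + tgt s) \<or> odd (src t + tgt t)")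
    case True
    then have "act i k (s \<circ>\<^sub>e t) x = 0" using act_odd[of s] act_odd[of t] Comp.prems by (elim disjE) (simp_all add: act_simps)
    then show ?thesis by (simp add: NN_0)
  next
    case False
    have w: "wf_expr s" "wf_expr t" "src s = tgt t" using Comp.prems by simp_all
    have l: "2 * lv k (src t) (tgt t) + src t = 2 * k + tgt t" using False Comp.prems by (intro lv_even) simp_all
    have "act i (lv k (src t) (tgt t)) s (act i k t x) \<in> NN (lv (lv k (src t) (tgt t)) (src s) (tgt s))"
      using w l Comp.prems by (intro Comp.IH) simp_all
    then show ?thesis using w False Comp.prems by (simp add: lv_comp)
  qed
next
  case (Tens s t)
  show ?case
  proof (cases "odd (src s + tgt s) \<or> odd (src t + tgt t)")
    case True
    then have "act i k (s \<otimes>\<^sub>e t) x = 0" using act_odd[of s] act_odd[of t] Tens.prems by (elim disjE) (simp_all add: act_simps)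
    then show ?thesis by (simp add: NN_0)
  next
    case False
    have w: "wf_expr s" "wf_expr t" using Tens.prems by simp_all
    have l: "2 * lv k (src t) (tgt t) + src t = 2 * k + tgt t" using False Tens.prems by (intro lv_even) simp_all
    have l': "2 * lv (lv k (src t) (tgt t)) (src s) (tgt s) + src s = 2 * lv k (src t) (tgt t) + tgt s" using l False Tens.prems by (intro lv_even) simp_all
    have "2 * lv k (src s + src t) (tgt s + tgt t) + (src s + src t) = 2 * k + (tgt s + tgt t)" using False Tens.prems by (intro lv_even) simp_all
    with l l' have "lv (lv k (src t) (tgt t)) (src s) (tgt s) = lv k (src s + src t) (tgt s + tgt t)" by linarith
    moreover have "act i (lv k (src t) (tgt t)) s (act (i + src s) k t x) \<in> NN (lv (lv k (src t) (tgt t)) (src s) (tgt s))"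
      using w l Tens.prems by (intro Tens.IH) simp_all
    ultimately show ?thesis by simp
  qed
qed (simp_all add: NN_add NN_sc NN_0)

text \<open>Signed commutation of two expressions acting on disjoint strands; \<open>j\<close> is the gap between them.\<close>

definition sg :: "bit => bit => 'k" where "sg q' q = psign (q' * q)"

definition fc :: "bit => 'k expr => 'k expr => bool" where
  "fc p g h \<longleftrightarrow> (\<forall>q' q i j k x. homog p g q' --> homog p h q --> i + src h + j + src g <= 2 * k --> x \<in> NN k -->
    act (i + tgt h + j) (lv k (src h) (tgt h)) g (act i k h x) =
      sc (sg q' q) (act i (lv k (src g) (tgt g)) h (act (i + src h + j) k g x)))"

lemma fc_gen:
  assumes p: "\<epsilon> = psign p"
  shows "g \<in> {GenH, GenA, GenU} ==> h \<in> {GenH, GenA, GenU} ==> fc p g h"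
proof -
  assume gh: "g \<in> {GenH, GenA, GenU}" "h \<in> {GenH, GenA, GenU}"
  have pp: "psign (p * p) = \<epsilon>" using p by (cases p) simp_all
  have lvs: "lv k 0 2 = Suc k" "lv (Suc k) 2 0 = k" for k by (simp_all add: lv_def)
  have 1: "fc p GenH GenH" unfolding fc_def using far' by (auto simp: sg_def psign_def)
  have 2: "fc p GenH GenU" unfolding fc_def using s_up_hi by (auto simp: sg_def psign_def lvs)
  have 3: "fc p GenU GenH" unfolding fc_def using s_up_lo by (auto simp: sg_def psign_def lvs)
  have 4: "fc p GenU GenU" unfolding fc_def
  proof (intro allI impI)
    fix q' q i j k and x :: "'k vec"
    assume h: "homog p (GenU :: 'k expr) q'" "homog p (GenU :: 'k expr) q" "i + src (GenU :: 'k expr) + j + src (GenU :: 'k expr) <= 2 * k" "x \<in> NN k"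
    then show "act (i + tgt (GenU :: 'k expr) + j) (lv k (src (GenU :: 'k expr)) (tgt (GenU :: 'k expr))) GenU (act i k GenU x) =
      sc (sg q' q) (act i (lv k (src (GenU :: 'k expr)) (tgt (GenU :: 'k expr))) GenU (act (i + src (GenU :: 'k expr) + j) k GenU x))"
      using up_up[of "Suc i" "Suc (i + j)" k x] by (simp add: lvs sg_def pp p[symmetric])
  qed
  have k2: "\<exists>k'. k = Suc k'" if "m + 2 <= 2 * k" for m k using that by (cases k) simp_all
  have 5: "fc p GenH GenA" unfolding fc_def
  proof (intro allI impI)
    fix q' q i j k and x :: "'k vec"
    assume h: "homog p (GenH :: 'k expr) q'" "homog p (GenA :: 'k expr) q" "i + src (GenA :: 'k expr) + j + src (GenH :: 'k expr) <= 2 * k" "x \<in> NN k"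
    obtain k' where k: "k = Suc k'" using h(3) k2[of "i + j + 2" k] by auto
    then show "act (i + tgt (GenA :: 'k expr) + j) (lv k (src (GenA :: 'k expr)) (tgt (GenA :: 'k expr))) GenH (act i k GenA x) =
      sc (sg q' q) (act i (lv k (src (GenH :: 'k expr)) (tgt (GenH :: 'k expr))) GenA (act (i + src (GenA :: 'k expr) + j) k GenH x))"
      using h dn_s_hi[of "Suc i" "Suc (i + 2 + j)" k' x] by (simp add: lvs sg_def psign_def)
  qed
  have 6: "fc p GenA GenH" unfolding fc_def
  proof (intro allI impI)
    fix q' q i j k and x :: "'k vec"
    assume h: "homog p (GenA :: 'k expr) q'" "homog p (GenH :: 'k expr) q" "i + src (GenH :: 'k expr) + j + src (GenA :: 'k expr) <= 2 * k" "x \<in> NN k"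
    obtain k' where k: "k = Suc k'" using h(3) k2[of "i + j + 2" k] by auto
    then show "act (i + tgt (GenH :: 'k expr) + j) (lv k (src (GenH :: 'k expr)) (tgt (GenH :: 'k expr))) GenA (act i k GenH x) =
      sc (sg q' q) (act i (lv k (src (GenA :: 'k expr)) (tgt (GenA :: 'k expr))) GenH (act (i + src (GenH :: 'k expr) + j) k GenA x))"
      using h dn_s_lo[of "Suc i" "Suc (i + 2 + j)" k' x] by (simp add: lvs sg_def psign_def)
  qed
  have 7: "fc p GenA GenA" unfolding fc_def
  proof (intro allI impI)
    fix q' q i j k and x :: "'k vec"
    assume h: "homog p (GenA :: 'k expr) q'" "homog p (GenA :: 'k expr) q" "i + src (GenA :: 'k expr) + j + src (GenA :: 'k expr) <= 2 * k" "x \<in> NN k"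
    then obtain k' where k: "k = Suc (Suc k')" using k2[of "i + j + 2" k] k2[of "i + j" "k - 1"] by auto
    then show "act (i + tgt (GenA :: 'k expr) + j) (lv k (src (GenA :: 'k expr)) (tgt (GenA :: 'k expr))) GenA (act i k GenA x) =
      sc (sg q' q) (act i (lv k (src (GenA :: 'k expr)) (tgt (GenA :: 'k expr))) GenA (act (i + src (GenA :: 'k expr) + j) k GenA x))"
      using h dn_dn[of "Suc i" "Suc (i + j)" k' x] eps by (simp add: lvs sg_def pp p[symmetric])
  qed
  have 8: "fc p GenA GenU" unfolding fc_def
  proof (intro allI impI)
    fix q' q i j k and x :: "'k vec"
    assume h: "homog p (GenA :: 'k expr) q'" "homog p (GenU :: 'k expr) q" "i + src (GenU :: 'k expr) + j + src (GenA :: 'k expr) <= 2 * k" "x \<in> NN k"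
    obtain k' where k: "k = Suc k'" using h(3) k2[of "i + j" k] by auto
    then show "act (i + tgt (GenU :: 'k expr) + j) (lv k (src (GenU :: 'k expr)) (tgt (GenU :: 'k expr))) GenA (act i k GenU x) =
      sc (sg q' q) (act i (lv k (src (GenA :: 'k expr)) (tgt (GenA :: 'k expr))) GenU (act (i + src (GenU :: 'k expr) + j) k GenA x))"
      using h dn_up_far2[of "Suc i" "Suc (i + j)" k' x] by (simp add: lvs sg_def pp p[symmetric])
  qed
  have 9: "fc p GenU GenA" unfolding fc_def
  proof (intro allI impI)
    fix q' q i j k and x :: "'k vec"
    assume h: "homog p (GenU :: 'k expr) q'" "homog p (GenA :: 'k expr) q" "i + src (GenA :: 'k expr) + j + src (GenU :: 'k expr) <= 2 * k" "x \<in> NN k"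
    obtain k' where k: "k = Suc k'" using h(3) k2[of "i + j" k] by auto
    then show "act (i + tgt (GenA :: 'k expr) + j) (lv k (src (GenA :: 'k expr)) (tgt (GenA :: 'k expr))) GenU (act i k GenA x) =
      sc (sg q' q) (act i (lv k (src (GenU :: 'k expr)) (tgt (GenU :: 'k expr))) GenA (act (i + src (GenA :: 'k expr) + j) k GenU x))"
      using h dn_up_far1[of "Suc i" "Suc (i + j)" k' x] eps by (simp add: lvs sg_def pp p[symmetric])
  qed
  show "fc p g h" using gh 1 2 3 4 5 6 7 8 9 by (elim insertE emptyE) simp_all
qed

lemma sg_add: "sg q' (q1 + q2) = sg q' q1 * sg q' q2" "sg (q1 + q2) q' = sg q1 q' * sg q2 q'"
  by (cases q'; cases q1; cases q2; simp add: sg_def psign_def)+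

lemma sg_0: "sg 0 q = 1" "sg q 0 = 1" by (simp_all add: sg_def psign_def)

lemma fcD: "fc p g h ==> homog p g q' ==> homog p h q ==> i + src h + j + src g <= 2 * k ==> x \<in> NN k ==>
    act (i + tgt h + j) (lv k (src h) (tgt h)) g (act i k h x) =
      sc (sg q' q) (act i (lv k (src g) (tgt g)) h (act (i + src h + j) k g x))"
  unfolding fc_def by blast

lemma fc_comp_right:
  assumes f: "fc p g s" "fc p g t" and w: "wf_expr s" "wf_expr t" "src s = tgt t"
    and e: "even (src g + tgt g)" "even (src s + tgt s)" "even (src t + tgt t)"
  shows "fc p g (s \<circ>\<^sub>e t)"
  unfolding fc_def
proof (intro allI impI)
  fix q' q i j k and x :: "'k vec"
  assume h: "homog p g q'" "homog p (s \<circ>\<^sub>e t) q" "i + src (s \<circ>\<^sub>e t) + j + src g <= 2 * k" and x: "x \<in> NN k"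
  obtain q1 q2 where q: "q = q1 + q2" "homog p s q1" "homog p t q2" using h(2) by auto
  let ?k2 = "lv k (src t) (tgt t)"
  have l: "2 * ?k2 + src t = 2 * k + tgt t" using e h(3) by (intro lv_even) simp_all
  have y: "act i k t x \<in> NN ?k2" using w h(3) x by (intro act_NN) simp_all
  have 1: "act (i + tgt s + j) (lv ?k2 (src s) (tgt s)) g (act i ?k2 s (act i k t x)) =
      sc (sg q' q1) (act i (lv ?k2 (src g) (tgt g)) s (act (i + src s + j) ?k2 g (act i k t x)))"
    using l w h(3) by (intro fcD[OF f(1) h(1) q(2) _ y]) simp
  have 2: "act (i + tgt t + j) ?k2 g (act i k t x) =
      sc (sg q' q2) (act i (lv k (src g) (tgt g)) t (act (i + src t + j) k g x))"
    using h(3) by (intro fcD[OF f(2) h(1) q(3) _ x]) simp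
  have 3: "lv ?k2 (tgt t) (tgt s) = lv k (src t) (tgt s)" using lv_comp[of "src t" "tgt t" k "tgt s"] e w h(3) by simp
  have 4: "lv ?k2 (src g) (tgt g) = lv (lv k (src g) (tgt g)) (src t) (tgt t)"
    using lv_swap[of "src t" "tgt t" "src g" "tgt g" k] lv_swap[of "src g" "tgt g" "src t" "tgt t" k] e h(3) by (simp add: add.commute)
  show "act (i + tgt (s \<circ>\<^sub>e t) + j) (lv k (src (s \<circ>\<^sub>e t)) (tgt (s \<circ>\<^sub>e t))) g (act i k (s \<circ>\<^sub>e t) x) =
      sc (sg q' q) (act i (lv k (src g) (tgt g)) (s \<circ>\<^sub>e t) (act (i + src (s \<circ>\<^sub>e t) + j) k g x))"
    unfolding q(1) sg_add using 1[unfolded 3 4 w(3) 2] by (simp add: act_simps mult.commute)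
qed

lemma fc_tens_right:
  assumes f: "fc p g s" "fc p g t" and w: "wf_expr s" "wf_expr t"
    and e: "even (src g + tgt g)" "even (src s + tgt s)" "even (src t + tgt t)"
  shows "fc p g (s \<otimes>\<^sub>e t)"
  unfolding fc_def
proof (intro allI impI)
  fix q' q i j k and x :: "'k vec"
  assume h: "homog p g q'" "homog p (s \<otimes>\<^sub>e t) q" "i + src (s \<otimes>\<^sub>e t) + j + src g <= 2 * k" and x: "x \<in> NN k"
  obtain q1 q2 where q: "q = q1 + q2" "homog p s q1" "homog p t q2" using h(2) by auto
  let ?k2 = "lv k (src t) (tgt t)" and ?y = "act (i + src s) k t x"
  have l: "2 * ?k2 + src t = 2 * k + tgt t" using e h(3) by (intro lv_even) simp_all
  have y: "?y \<in> NN ?k2" using w h(3) x by (intro act_NN) simp_all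
  have 1: "act (i + tgt s + (tgt t + j)) (lv ?k2 (src s) (tgt s)) g (act i ?k2 s ?y) =
      sc (sg q' q1) (act i (lv ?k2 (src g) (tgt g)) s (act (i + src s + (tgt t + j)) ?k2 g ?y))"
    using l w h(3) by (intro fcD[OF f(1) h(1) q(2) _ y]) simp
  have 2: "act (i + src s + tgt t + j) ?k2 g ?y =
      sc (sg q' q2) (act (i + src s) (lv k (src g) (tgt g)) t (act (i + src s + src t + j) k g x))"
    using h(3) by (intro fcD[OF f(2) h(1) q(3) _ x]) simp
  have 3: "lv ?k2 (src s) (tgt s) = lv k (src s + src t) (tgt s + tgt t)" using e w h(3) by (intro lv_swap) simp_all
  have 4: "lv ?k2 (src g) (tgt g) = lv (lv k (src g) (tgt g)) (src t) (tgt t)"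
    using lv_swap[of "src t" "tgt t" "src g" "tgt g" k] lv_swap[of "src g" "tgt g" "src t" "tgt t" k] e h(3) by (simp add: add.commute)
  have 5: "i + src s + (tgt t + j) = i + src s + tgt t + j" by simp
  show "act (i + tgt (s \<otimes>\<^sub>e t) + j) (lv k (src (s \<otimes>\<^sub>e t)) (tgt (s \<otimes>\<^sub>e t))) g (act i k (s \<otimes>\<^sub>e t) x) =
      sc (sg q' q) (act i (lv k (src g) (tgt g)) (s \<otimes>\<^sub>e t) (act (i + src (s \<otimes>\<^sub>e t) + j) k g x))"
    unfolding q(1) sg_add using 1[unfolded 3 4 5 2] by (simp add: act_simps mult.commute add.assoc)
qed

lemma fc_comp_left:
  assumes f: "fc p s h" "fc p t h" and w: "wf_expr s" "wf_expr t" "src s = tgt t" "wf_expr h"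
    and e: "even (src h + tgt h)" "even (src s + tgt s)" "even (src t + tgt t)"
  shows "fc p (s \<circ>\<^sub>e t) h"
  unfolding fc_def
proof (intro allI impI)
  fix q' q i j k and x :: "'k vec"
  assume h: "homog p (s \<circ>\<^sub>e t) q'" "homog p h q" "i + src h + j + src (s \<circ>\<^sub>e t) <= 2 * k" and x: "x \<in> NN k"
  obtain q1 q2 where q: "q' = q1 + q2" "homog p s q1" "homog p t q2" using h(1) by auto
  let ?k2 = "lv k (src t) (tgt t)" and ?y = "act (i + src h + j) k t x"
  have l: "2 * ?k2 + src t = 2 * k + tgt t" using e h(3) by (intro lv_even) simp_all
  have y: "?y \<in> NN ?k2" using w h(3) x by (intro act_NN) simp_all
  have 1: "act (i + tgt h + j) (lv k (src h) (tgt h)) t (act i k h x) = sc (sg q2 q) (act i ?k2 h ?y)"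
    using h(3) by (intro fcD[OF f(2) q(3) h(2) _ x]) simp
  have 2: "act (i + tgt h + j) (lv ?k2 (src h) (tgt h)) s (act i ?k2 h ?y) = sc (sg q1 q) (act i (lv ?k2 (src s) (tgt s)) h (act (i + src h + j) ?k2 s ?y))"
    using l w h(3) by (intro fcD[OF f(1) q(2) h(2) _ y]) simp
  have 3: "lv ?k2 (src s) (tgt s) = lv k (src t) (tgt s)" using lv_comp[of "src t" "tgt t" k "tgt s"] e w h(3) by simp
  have 4: "lv ?k2 (src h) (tgt h) = lv (lv k (src h) (tgt h)) (src t) (tgt t)"
    using lv_swap[of "src t" "tgt t" "src h" "tgt h" k] lv_swap[of "src h" "tgt h" "src t" "tgt t" k] e h(3) by (simp add: add.commute)
  show "act (i + tgt h + j) (lv k (src h) (tgt h)) (s \<circ>\<^sub>e t) (act i k h x) =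
      sc (sg q' q) (act i (lv k (src (s \<circ>\<^sub>e t)) (tgt (s \<circ>\<^sub>e t))) h (act (i + src h + j) k (s \<circ>\<^sub>e t) x))"
    unfolding q(1) sg_add using 1 2[unfolded 3 4] by (simp add: act_simps mult.commute)
qed

lemma fc_tens_left:
  assumes f: "fc p s h" "fc p t h" and w: "wf_expr s" "wf_expr t" "wf_expr h"
    and e: "even (src h + tgt h)" "even (src s + tgt s)" "even (src t + tgt t)"
  shows "fc p (s \<otimes>\<^sub>e t) h"
  unfolding fc_def
proof (intro allI impI)
  fix q' q i j k and x :: "'k vec"
  assume h: "homog p (s \<otimes>\<^sub>e t) q'" "homog p h q" "i + src h + j + src (s \<otimes>\<^sub>e t) <= 2 * k" and x: "x \<in> NN k"
  obtain q1 q2 where q: "q' = q1 + q2" "homog p s q1" "homog p t q2" using h(1) by auto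
  let ?k2 = "lv k (src t) (tgt t)" and ?y = "act (i + src h + (j + src s)) k t x"
  have l: "2 * ?k2 + src t = 2 * k + tgt t" using e h(3) by (intro lv_even) simp_all
  have y: "?y \<in> NN ?k2" using w h(3) x by (intro act_NN) simp_all
  have 1: "act (i + tgt h + (j + src s)) (lv k (src h) (tgt h)) t (act i k h x) = sc (sg q2 q) (act i ?k2 h ?y)"
    using h(3) by (intro fcD[OF f(2) q(3) h(2) _ x]) simp
  have 2: "act (i + tgt h + j) (lv ?k2 (src h) (tgt h)) s (act i ?k2 h ?y) = sc (sg q1 q) (act i (lv ?k2 (src s) (tgt s)) h (act (i + src h + j) ?k2 s ?y))"
    using l w h(3) by (intro fcD[OF f(1) q(2) h(2) _ y]) simp
  have 3: "lv ?k2 (src s) (tgt s) = lv k (src s + src t) (tgt s + tgt t)" using e w h(3) by (intro lv_swap) simp_all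
  have 4: "lv ?k2 (src h) (tgt h) = lv (lv k (src h) (tgt h)) (src t) (tgt t)"
    using lv_swap[of "src t" "tgt t" "src h" "tgt h" k] lv_swap[of "src h" "tgt h" "src t" "tgt t" k] e h(3) by (simp add: add.commute)
  show "act (i + tgt h + j) (lv k (src h) (tgt h)) (s \<otimes>\<^sub>e t) (act i k h x) =
      sc (sg q' q) (act i (lv k (src (s \<otimes>\<^sub>e t)) (tgt (s \<otimes>\<^sub>e t))) h (act (i + src h + j) k (s \<otimes>\<^sub>e t) x))"
    unfolding q(1) sg_add using 1 2[unfolded 3 4] by (simp add: act_simps mult.commute add.assoc)
qed

lemma fc_right:
  assumes p: "\<epsilon> = psign p" and g: "g \<in> {GenH, GenA, GenU}"
  shows "wf_expr h ==> fc p g h"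
proof (induction h)
  case (Comp s t)
  have e: "even (src g + tgt g)" and wg: "wf_expr g" using g by auto
  show ?case
  proof (cases "even (src s + tgt s) \<and> even (src t + tgt t)")
    case True
    then show ?thesis using Comp e by (intro fc_comp_right) simp_all
  next
    case False
    then show ?thesis
      unfolding fc_def using act_odd[of s] act_odd[of t] Comp.prems by (auto simp: act_simps)
  qed
next
  case (Tens s t)
  have e: "even (src g + tgt g)" and wg: "wf_expr g" using g by auto
  show ?case
  proof (cases "even (src s + tgt s) \<and> even (src t + tgt t)")
    case True
    then show ?thesis using Tens e by (intro fc_tens_right) simp_all
  next
    case False
    then show ?thesis
      unfolding fc_def using act_odd[of s] act_odd[of t] Tens.prems by (auto simp: act_simps)
  qed
next
  case (Add s t)
  have F: "fc p g s" "fc p g t" "src s = src t" "tgt s = tgt t" using Add by simp_all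
  show ?case unfolding fc_def
  proof (intro allI impI)
    fix q' q i j k and x :: "'k vec"
    assume h: "homog p g q'" "homog p (s +\<^sub>e t) q" "i + src (s +\<^sub>e t) + j + src g <= 2 * k" "x \<in> NN k"
    have hs: "homog p s q" "homog p t q" using h(2) by simp_all
    show "act (i + tgt (s +\<^sub>e t) + j) (lv k (src (s +\<^sub>e t)) (tgt (s +\<^sub>e t))) g (act i k (s +\<^sub>e t) x) =
      sc (sg q' q) (act i (lv k (src g) (tgt g)) (s +\<^sub>e t) (act (i + src (s +\<^sub>e t) + j) k g x))"
      using fcD[OF F(1) h(1) hs(1) _ h(4), of i j] fcD[OF F(2) h(1) hs(2) _ h(4), of i j] h(3) F(3,4) by (simp add: act_simps)
  qed
next
  case (Scale c t)
  then have "fc p g t" by simp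
  then show ?case unfolding fc_def by (simp add: act_simps mult.commute)
next
  case GenH show ?case by (rule fc_gen[OF p g]) simp
next
  case GenA show ?case by (rule fc_gen[OF p g]) simp
next
  case GenU show ?case by (rule fc_gen[OF p g]) simp
qed (simp_all add: fc_def act_simps sg_0)

lemma fc_all:
  assumes p: "\<epsilon> = psign p" and h: "wf_expr h"
  shows "wf_expr g ==> fc p g h"
proof (induction g)
  case (Comp s t)
  show ?case
  proof (cases "even (src s + tgt s) \<and> even (src t + tgt t) \<and> even (src h + tgt h)")
    case True
    then show ?thesis using Comp h by (intro fc_comp_left) simp_all
  next
    case False
    then show ?thesis
      unfolding fc_def using act_odd[of s] act_odd[of t] act_odd[OF h] Comp.prems by (auto simp: act_simps)
  qed
next
  case (Tens s t)
  show ?case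
  proof (cases "even (src s + tgt s) \<and> even (src t + tgt t) \<and> even (src h + tgt h)")
    case True
    then show ?thesis using Tens h by (intro fc_tens_left) simp_all
  next
    case False
    then show ?thesis
      unfolding fc_def using act_odd[of s] act_odd[of t] act_odd[OF h] Tens.prems by (auto simp: act_simps)
  qed
next
  case (Add s t)
  have F: "fc p s h" "fc p t h" "src s = src t" "tgt s = tgt t" using Add by simp_all
  show ?case unfolding fc_def
  proof (intro allI impI)
    fix q' q i j k and x :: "'k vec"
    assume h: "homog p (s +\<^sub>e t) q'" "homog p h q" "i + src h + j + src (s +\<^sub>e t) <= 2 * k" "x \<in> NN k"
    have hs: "homog p s q'" "homog p t q'" using h(1) by simp_all
    show "act (i + tgt h + j) (lv k (src h) (tgt h)) (s +\<^sub>e t) (act i k h x) =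
      sc (sg q' q) (act i (lv k (src (s +\<^sub>e t)) (tgt (s +\<^sub>e t))) h (act (i + src h + j) k (s +\<^sub>e t) x))"
      using fcD[OF F(1) hs(1) h(2) _ h(4), of i j] fcD[OF F(2) hs(2) h(2) _ h(4), of i j] h(3) F(3,4) by (simp add: act_simps)
  qed
next
  case (Scale c t)
  then have "fc p t h" by simp
  then show ?case unfolding fc_def by (simp add: act_simps mult.commute)
next
  case GenH show ?case by (rule fc_right[OF p _ h]) simp
next
  case GenA show ?case by (rule fc_right[OF p _ h]) simp
next
  case GenU show ?case by (rule fc_right[OF p _ h]) simp
qed (simp_all add: fc_def act_simps sg_0)

lemma act_interchange:
  assumes p: "\<epsilon> = psign p" and w: "wf_expr (f \<circ>\<^sub>e h)" "wf_expr (g \<circ>\<^sub>e t)" and hg: "homog p g q'" "homog p h q"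
    and x: "x \<in> NN k" and k: "i + (src h + src t) <= 2 * k"
  shows "act i k ((f \<otimes>\<^sub>e g) \<circ>\<^sub>e (h \<otimes>\<^sub>e t)) x = sc (sg q' q) (act i k ((f \<circ>\<^sub>e h) \<otimes>\<^sub>e (g \<circ>\<^sub>e t)) x)"
proof (cases "even (src h + tgt h) \<and> even (src t + tgt t) \<and> even (src g + tgt g) \<and> even (src f + tgt f)")
  case True
  let ?k2 = "lv k (src t) (tgt t)" and ?y = "act (i + src h) k t x"
  have l: "2 * ?k2 + src t = 2 * k + tgt t" using True k by (intro lv_even) simp_all
  have y: "?y \<in> NN ?k2" using w k x by (intro act_NN) simp_all
  have "act (i + tgt h + 0) (lv ?k2 (src h) (tgt h)) g (act i ?k2 h ?y) =
      sc (sg q' q) (act i (lv ?k2 (src g) (tgt g)) h (act (i + src h + 0) ?k2 g ?y))"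
    using l w k by (intro fcD[OF fc_all[OF p] hg _ y]) simp_all
  moreover have "lv ?k2 (src h) (tgt h) = lv k (src h + src t) (tgt h + tgt t)" using True k by (intro lv_swap) simp_all
  moreover have "lv ?k2 (src g) (tgt g) = lv k (src t) (tgt g)" using lv_comp[of "src t" "tgt t" k "tgt g"] True w k by simp
  moreover have "lv (lv k (src h + src t) (tgt h + tgt t)) (src g) (tgt g) = lv (lv k (src t) (tgt g)) (src h) (tgt h)"
  proof -
    have "2 * lv k (src h + src t) (tgt h + tgt t) + (src h + src t) = 2 * k + (tgt h + tgt t)" using True k by (intro lv_even) simp_all
    moreover have "2 * lv k (src t) (tgt g) + src t = 2 * k + tgt g" using True w k by (intro lv_even) simp_all
    ultimately have "2 * lv k (src h + src t) (tgt h + tgt t) + tgt g - src g = 2 * lv k (src t) (tgt g) + tgt h - src h"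
      using w k by simp
    then show ?thesis
      unfolding lv_def[of "lv k (src h + src t) (tgt h + tgt t)" "src g"] lv_def[of "lv k (src t) (tgt g)" "src h"] by (rule arg_cong)
  qed
  ultimately show ?thesis using w by (simp add: act_simps)
next
  case False
  then show ?thesis using act_odd[of h] act_odd[of t] act_odd[of f] act_odd[of g] w by (auto simp: act_simps)
qed

lemma act_cong:
  assumes p: "\<epsilon> = psign p"
    and R: "\<And>s t i k x. (s, t) \<in> R ==> i + src s <= 2 * k ==> x \<in> NN k ==> act i k s x = act i k t x"
  shows "cong_expr p R s t ==> i + src s <= 2 * k ==> x \<in> NN k ==> act i k s x = act i k t x"
proof (induction arbitrary: i k x rule: cong_expr.induct)
  case (relI s t)
  then show ?case by (intro R) simp_all
next
  case (sym s t)
  have "src s = src t" using cong_expr_wf[OF sym.hyps] by simp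
  then show ?case using sym.IH[of i k x] sym.prems by simp
next
  case (trans s t u)
  have "src s = src t" using cong_expr_wf[OF trans.hyps(1)] by simp
  then show ?case using trans.IH[of i k x] trans.prems by simp
next
  case (cong_add s s' t t')
  then show ?case by simp
next
  case (cong_comp s s' t t')
  have w: "src t = src t'" "tgt t = tgt t'" "wf_expr t" "wf_expr t'" "src s = tgt t" using cong_expr_wf[OF cong_comp.hyps(2)] cong_comp.hyps(3) by simp_all
  have e: "act i k t x = act i k t' x" using cong_comp.IH(2)[of i k x] cong_comp.prems by simp
  show ?case
  proof (cases "even (src t + tgt t)")
    case True
    have "2 * lv k (src t) (tgt t) + src t = 2 * k + tgt t" using True cong_comp.prems by (intro lv_even) simp_all
    moreover have "act i k t x \<in> NN (lv k (src t) (tgt t))" using w cong_comp.prems by (intro act_NN) simp_all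
    ultimately show ?thesis using cong_comp.IH(1)[of i "lv k (src t) (tgt t)" "act i k t x"] cong_comp.prems w e by simp
  qed (use w act_odd[of t] act_odd[of t'] in \<open>simp add: act_simps\<close>)
next
  case (cong_tens s s' t t')
  have w: "src t = src t'" "tgt t = tgt t'" "wf_expr t" "wf_expr t'" "src s = src s'" using cong_expr_wf[OF cong_tens.hyps(2)] cong_expr_wf[OF cong_tens.hyps(1)] by simp_all
  have e: "act (i + src s) k t x = act (i + src s) k t' x" using cong_tens.IH(2)[of "i + src s" k x] cong_tens.prems by simp
  show ?case
  proof (cases "even (src t + tgt t)")
    case True
    have "2 * lv k (src t) (tgt t) + src t = 2 * k + tgt t" using True cong_tens.prems by (intro lv_even) simp_all
    moreover have "act (i + src s) k t x \<in> NN (lv k (src t) (tgt t))" using w cong_tens.prems by (intro act_NN) simp_all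
    ultimately show ?thesis using cong_tens.IH(1)[of i "lv k (src t) (tgt t)" "act (i + src s) k t x"] cong_tens.prems w e by simp
  qed (use w act_odd[of t] act_odd[of t'] in \<open>simp add: act_simps\<close>)
next
  case (comp_assoc s t u)
  then show ?case
    using act_odd[of u] by (cases "even (src u + tgt u)") (simp_all add: lv_comp act_simps)
next
  case (tens_assoc s t u)
  show ?case
  proof (cases "even (src u + tgt u) \<and> even (src t + tgt t)")
    case True
    then have "lv (lv k (src u) (tgt u)) (src t) (tgt t) = lv k (src t + src u) (tgt t + tgt u)"
      using tens_assoc.prems by (intro lv_swap) simp_all
    then show ?thesis by (simp add: add.assoc)
  qed (use tens_assoc.hyps act_odd[of u] act_odd[of t] in \<open>auto simp: act_simps add.assoc\<close>)
next
  case (scale_add_left t c d)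
  show ?case by (simp add: vec_eq_iff distrib_right)
next
  case (interchange f h g k' q' q)
  then show ?case using act_interchange[OF p, of f h g k' q' q x k i] by (simp add: sg_def)
qed (simp_all add: act_simps algebra_simps)

definition PR :: "'k params" where
  "PR = \<lparr> p_lam = lam, p_lam' = lam', p_del = \<epsilon> * e * sig * (lam + lam' - b) / b, p_sig = sig, p_sig' = \<epsilon> * sig,
     p_rho = \<epsilon> * e * sig * (lam - b), p_a = a, p_b = b, p_c = 0, p_d = - e * b, p_e = e, p_f = 0,
     p_D = (lam - b) * b, p_E = b, p_F = - \<epsilon> * e * a, p_d' = 0, p_e' = - \<epsilon> * e, p_f' = b,
     p_D' = 0, p_E' = 0, p_F' = e * a \<rparr>"

lemma sc_neg: "sc (- c) x = - sc c x" by (simp add: vec_eq_iff)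

lemma lv_num: "lv k 2 2 = k" "lv k 0 2 = Suc k" "lv (Suc k) 2 0 = k" "lv k (Suc 0) 3 = Suc k" "lv (Suc k) 3 (Suc 0) = k" "lv k 3 3 = k" "lv k 0 0 = k"
  "lv k 3 (Suc (Suc (Suc 0))) = k" "lv k (Suc (Suc (Suc 0))) 3 = k"
  "lv k (Suc 0) (Suc (Suc (Suc 0))) = Suc k" "lv (Suc k) (Suc (Suc (Suc 0))) (Suc 0) = k" by (simp_all add: lv_def)

lemma act_rel:
  assumes st: "(s, t) \<in> relations PR" and i: "i + src s <= 2 * k" and x: "x \<in> NN k"
  shows "act i k s x = act i k t x"
proof -
  have kS: "\<exists>k'. k = Suc k'" if "0 < m" "i + m <= 2 * k" for m using that by (cases k) simp_all
  note sm = lv_num PR_def sc_neg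
  consider "(s, t) = braid_relation"
    | "(s, t) = (GenH \<circ>\<^sub>e GenU, p_lam PR *\<^sub>e GenU)"
    | "(s, t) = (GenA \<circ>\<^sub>e GenH, p_lam' PR *\<^sub>e GenA)"
    | "(s, t) = (GenA \<circ>\<^sub>e GenU, p_del PR *\<^sub>e Ident 0)"
    | "(s, t) = ((GenA \<otimes>\<^sub>e I1) \<circ>\<^sub>e (I1 \<otimes>\<^sub>e GenU), p_sig PR *\<^sub>e I1)"
    | "(s, t) = ((I1 \<otimes>\<^sub>e GenA) \<circ>\<^sub>e (GenU \<otimes>\<^sub>e I1), p_sig' PR *\<^sub>e I1)"
    | "(s, t) = ((GenA \<otimes>\<^sub>e I1) \<circ>\<^sub>e (I1 \<otimes>\<^sub>e GenH) \<circ>\<^sub>e (GenU \<otimes>\<^sub>e I1), p_rho PR *\<^sub>e I1)"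
    | "(s, t) = (GenH \<circ>\<^sub>e GenH, p_a PR *\<^sub>e Ident 2 +\<^sub>e p_b PR *\<^sub>e GenH +\<^sub>e p_c PR *\<^sub>e (GenU \<circ>\<^sub>e GenA))"
    | "(s, t) = ((GenH \<otimes>\<^sub>e I1) \<circ>\<^sub>e (I1 \<otimes>\<^sub>e GenU),
      p_d PR *\<^sub>e (GenU \<otimes>\<^sub>e I1) +\<^sub>e p_e PR *\<^sub>e ((I1 \<otimes>\<^sub>e GenH) \<circ>\<^sub>e (GenU \<otimes>\<^sub>e I1)) +\<^sub>e p_f PR *\<^sub>e (I1 \<otimes>\<^sub>e GenU))"
    | "(s, t) = ((GenH \<otimes>\<^sub>e I1) \<circ>\<^sub>e (I1 \<otimes>\<^sub>e GenH) \<circ>\<^sub>e (GenU \<otimes>\<^sub>e I1),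
      p_D PR *\<^sub>e (GenU \<otimes>\<^sub>e I1) +\<^sub>e p_E PR *\<^sub>e ((I1 \<otimes>\<^sub>e GenH) \<circ>\<^sub>e (GenU \<otimes>\<^sub>e I1)) +\<^sub>e p_F PR *\<^sub>e (I1 \<otimes>\<^sub>e GenU))"
    | "(s, t) = ((I1 \<otimes>\<^sub>e GenA) \<circ>\<^sub>e (GenH \<otimes>\<^sub>e I1),
      p_d' PR *\<^sub>e (GenA \<otimes>\<^sub>e I1) +\<^sub>e p_e' PR *\<^sub>e ((GenA \<otimes>\<^sub>e I1) \<circ>\<^sub>e (I1 \<otimes>\<^sub>e GenH)) +\<^sub>e p_f' PR *\<^sub>e (I1 \<otimes>\<^sub>e GenA))"
    | "(s, t) = ((GenA \<otimes>\<^sub>e I1) \<circ>\<^sub>e (I1 \<otimes>\<^sub>e GenH) \<circ>\<^sub>e (GenH \<otimes>\<^sub>e I1),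
      p_D' PR *\<^sub>e (GenA \<otimes>\<^sub>e I1) +\<^sub>e p_E' PR *\<^sub>e ((GenA \<otimes>\<^sub>e I1) \<circ>\<^sub>e (I1 \<otimes>\<^sub>e GenH)) +\<^sub>e p_F' PR *\<^sub>e (I1 \<otimes>\<^sub>e GenA))"
    using st unfolding relations_def by (elim insertE emptyE) simp_all
  then show ?thesis
  proof cases
    case 1
    then show ?thesis using braid[of "Suc i" k x] i x by (simp add: braid_relation_def sm)
  next
    case 2
    then show ?thesis using s_up[of "Suc i" k x] i x by (simp add: sm)
  next
    case 3
    then obtain k' where "k = Suc k'" using i kS[of 2] by auto
    then show ?thesis using dn_s[of "Suc i" k' x] 3 i x by (simp add: sm)
  next
    case 4
    then show ?thesis using dn_up[of "Suc i" k x] i x by (simp add: sm)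
  next
    case 5
    then show ?thesis using dn_up1[of "Suc i" k x] i x by (simp add: sm)
  next
    case 6
    then show ?thesis using dn1_up[of "Suc i" k x] i x by (simp add: sm)
  next
    case 7
    then show ?thesis using dn_s_up[of "Suc i" k x] i x by (simp add: sm)
  next
    case 8
    then show ?thesis using quad[of "Suc i" k x] i x by (simp add: sm)
  next
    case 9
    then show ?thesis using s_up1[of "Suc i" k x] i x by (simp add: sm mult.commute)
  next
    case 10
    then show ?thesis using s_up2[of "Suc i" k x] i x by (simp add: sm)
  next
    case 11
    then obtain k' where "k = Suc k'" using i kS[of 3] by auto
    then show ?thesis using dn_Suc_s[of "Suc i" k' x] 11 i x by (simp add: sm)
  next
    case 12
    then obtain k' where "k = Suc k'" using i kS[of 3] by auto
    then show ?thesis using dn_s_s[of "Suc i" k' x] 12 i x by (simp add: sm)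
  qed
qed

lemma act_sound: "\<epsilon> = psign p ==> cong_expr p (relations PR) s t ==> i + src s <= 2 * k ==> x \<in> NN k ==> act i k s x = act i k t x"
  by (rule act_cong[OF _ act_rel])

primrec om :: "nat => 'k vec" where
  "om 0 = Vec (\<lambda>xs. if xs = [] then 1 else 0)"
| "om (Suc m) = up m (Suc m) (om m)"

lemma om_NN: "om m \<in> NN m"
proof (induction m)
  case 0
  show ?case by (simp add: NN_def Vec_inverse)
next
  case (Suc m)
  then show ?case using NN_up[of "Suc m" m "om m"] by simp
qed

lemma act_surj0: "v \<in> NN k ==> \<exists>t. wf_expr t \<and> src t = 0 \<and> tgt t = 2 * k \<and> act 0 0 t (om 0) = v"
proof (induction k arbitrary: v)
  case 0
  have "v = sc (co v []) (om 0)" using 0 by (auto simp: vec_eq_iff NN_def Vec_inverse)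
  then show ?case by (intro exI[of _ "co v [] *\<^sub>e Ident 0"]) simp
next
  case (Suc k)
  have lvk: "lv 0 0 (2 * k) = k" for k by (simp add: lv_def)
  have ins: "\<exists>t. wf_expr t \<and> src t = 0 \<and> tgt t = 2 * Suc k \<and> act 0 0 t (om 0) = ins j f" if f: "f \<in> NN k" and j: "2 <= j" "j <= 2 * k + 2" for j f
    using j(1) j(2)
  proof (induction j rule: dec_induct)
    case base
    obtain t where t: "wf_expr t" "src t = 0" "tgt t = 2 * k" "act 0 0 t (om 0) = f" using Suc.IH[OF f] by blast
    let ?t = "(GenU \<otimes>\<^sub>e Ident (2 * k)) \<circ>\<^sub>e t"
    have "act 0 0 ?t (om 0) = ins 2 f" using t by (simp add: lvk lv_num)
    then show ?case using t by (intro exI[of _ ?t]) simp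
  next
    case (step j)
    then obtain t where t: "wf_expr t" "src t = 0" "tgt t = 2 * Suc k" "act 0 0 t (om 0) = ins j f" by auto
    let ?t = "(Ident (j - 1) \<otimes>\<^sub>e GenH \<otimes>\<^sub>e Ident (2 * k + 1 - j)) \<circ>\<^sub>e t"
    have "act 0 0 ?t (om 0) = ss (Suc k) j (ins j f)" using t step lvk[of "Suc k"] by (simp add: lv_num)
    also have "... = ins (Suc j) f" using step by simp
    finally show ?case using t step by (intro exI[of _ ?t]) simp
  qed
  have sums: "\<exists>t. wf_expr t \<and> src t = 0 \<and> tgt t = 2 * Suc k \<and> act 0 0 t (om 0) = (\<Sum>j\<in>A. ins j (slice j v))"
    if "finite A" "A \<subseteq> {2..2 * k + 2}" for A
    using that
  proof (induction A rule: finite_induct)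
    case empty
    show ?case by (intro exI[of _ "Zero 0 (2 * Suc k)"]) simp
  next
    case (insert j A)
    obtain t where t: "wf_expr t" "src t = 0" "tgt t = 2 * Suc k" "act 0 0 t (om 0) = (\<Sum>j\<in>A. ins j (slice j v))" using insert by auto
    obtain t' where t': "wf_expr t'" "src t' = 0" "tgt t' = 2 * Suc k" "act 0 0 t' (om 0) = ins j (slice j v)"
      using ins[of "slice j v" j] NN_slice Suc.prems insert.prems by auto
    show ?case using t t' insert by (intro exI[of _ "t' +\<^sub>e t"]) simp
  qed
  show ?case using sums[of "{2..2 * k + 2}"] NN_decomp[OF Suc.prems] by simp
qed

lemma act_surj:
  assumes p: "\<epsilon> = psign p"
  shows "v \<in> NN k ==> 2 * k = m + n ==> \<exists>t. wf_expr t \<and> src t = m \<and> tgt t = n \<and> act 0 m t (om m) = v"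
proof (induction m arbitrary: n)
  case 0
  then show ?case using act_surj0[of v k] by simp
next
  case (Suc m)
  obtain t where t: "wf_expr t" "src t = m" "tgt t = Suc n" "act 0 m t (om m) = v" using Suc.IH[of "Suc n"] Suc.prems by auto
  obtain q where q: "homog p t q" using pres.homog_ex[OF t(1), of p] by blast
  let ?t = "(Ident n \<otimes>\<^sub>e GenA) \<circ>\<^sub>e (t \<otimes>\<^sub>e I1)"
  have lk: "lv m m (Suc n) = k" "lv (Suc m) m (Suc n) = Suc k" "lv (Suc m) (Suc m) (Suc (Suc n)) = Suc k" using Suc.prems(2) by (simp_all add: lv_def)
  have "act (0 + tgt t + 0) (lv m (src t) (tgt t)) GenU (act 0 m t (om m)) =
      sc (sg p q) (act 0 (lv m (src (GenU :: 'k expr)) (tgt (GenU :: 'k expr))) t (act (0 + src t + 0) m GenU (om m)))"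
    using t by (intro fcD[OF fc_all[OF p t(1)] _ q _ om_NN]) simp_all
  then have c: "up k (Suc (Suc n)) v = sc (sg p q) (act 0 (Suc m) t (om (Suc m)))" using t lk by (simp add: lv_num)
  have s2: "sg p q * sg p q = 1" by (simp add: sg_def psign_def)
  have "act 0 (Suc m) t (om (Suc m)) = sc (sg p q * sg p q) (act 0 (Suc m) t (om (Suc m)))" unfolding s2 by simp
  also have "... = sc (sg p q) (up k (Suc (Suc n)) v)" unfolding c by simp
  finally have e: "act 0 (Suc m) t (om (Suc m)) = sc (sg p q) (up k (Suc (Suc n)) v)" .
  have d: "dn k (Suc n) (up k (Suc (Suc n)) v) = sc sig v" using Suc.prems by (intro dn_up1) simp_all
  have "act 0 (Suc m) ?t (om (Suc m)) = sc (sg p q * sig) v" using t e lk d by (simp add: lv_num act_simps del: om.simps)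
  then have "act 0 (Suc m) ((sg p q / sig) *\<^sub>e ?t) (om (Suc m)) = sc (sg p q * sg p q) v" using nz(3) by (simp del: om.simps)
  then have "act 0 (Suc m) ((sg p q / sig) *\<^sub>e ?t) (om (Suc m)) = v" unfolding s2 by simp
  then show ?case using t by (intro exI[of _ "(sg p q / sig) *\<^sub>e ?t"]) simp
qed

end

section \<open>Counting standard expressions\<close>

fun cc :: "nat => nat => nat" where
  "cc r 0 = (if r = 0 then 1 else 0)"
| "cc 0 (Suc n) = cc 1 n"
| "cc (Suc r) (Suc n) = cc r n + (r + 2) * cc (r + 2) n"

lemma cc_0: "n < r ==> cc r n = 0"
  by (induction r n rule: cc.induct) auto

lemma cc_shift: "(r + 1) * cc (r + 1) (n + 1) = (n + 1) * cc r n"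
proof (induction n arbitrary: r)
  case (Suc n)
  have a: "cc (r + 1) (Suc n + 1) = cc r (Suc n) + (r + 2) * cc (r + 2) (Suc n)" by simp
  have b: "(r + 2) * cc (r + 2) (Suc n) = (n + 1) * cc (r + 1) n" using Suc.IH[of "r + 1"] by simp
  have c: "r * cc r (Suc n) + (n + 1) * ((r + 1) * cc (r + 1) n) = (n + 1) * cc r (Suc n)"
  proof (cases r)
    case (Suc r')
    have "r * cc r (Suc n) = (n + 1) * cc r' n" using Suc.IH[of r'] Suc by simp
    then show ?thesis using Suc by (simp add: algebra_simps)
  qed simp
  have "(r + 1) * cc (r + 1) (Suc n + 1) = cc r (Suc n) + (r * cc r (Suc n) + (n + 1) * ((r + 1) * cc (r + 1) n))"
    unfolding a b by (simp add: algebra_simps)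
  then show ?case unfolding c by simp
qed simp

lemma cc_even: "cc 0 (2 * Suc k) = (2 * k + 1) * cc 0 (2 * k)"
  using cc_shift[of 0 "2 * k"] by simp

lemma cc_sum_step:
  assumes "m + n + 1 < M"
  shows "(\<Sum>r<M. cc r (Suc n) * fact r * cc r m) = (\<Sum>r<M. cc r n * fact r * cc r (Suc m) :: nat)"
proof -
  have e: "(\<Sum>r<M. cc r (Suc n') * fact r * cc r m') = (\<Sum>r<M. cc r n' * fact (Suc r) * cc (Suc r) m') + (\<Sum>r<M. cc (Suc r) n' * fact (Suc r) * cc r m')"
    if mn: "m' + n' + 1 < M" for m' n' :: nat
  proof -
    define g :: "nat => nat" where "g r = (case r of 0 => 0 | Suc s => cc s n' * fact r * cc r m')" for r
    have s: "cc r (Suc n') * fact r * cc r m' = g r + cc (Suc r) n' * fact (Suc r) * cc r m'" for r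
      unfolding g_def by (cases r) (simp_all add: algebra_simps)
    obtain M' where M: "M = Suc M'" using mn by (cases M) simp_all
    have "(\<Sum>r<M. g r) = (\<Sum>r<M'. cc r n' * fact (Suc r) * cc (Suc r) m')" unfolding M sum.lessThan_Suc_shift g_def by simp
    also have "... = (\<Sum>r<M. cc r n' * fact (Suc r) * cc (Suc r) m')" unfolding M using mn M by (simp add: cc_0)
    finally show ?thesis unfolding s sum.distrib by simp
  qed
  have swap: "v * w * z = z * w * v" for v w z :: nat by (simp add: ac_simps)
  have comm: "(\<Sum>r<M. h r * k r * l r) = (\<Sum>r<M. l r * k r * h r)" for h k l :: "nat => nat"
    by (rule sum.cong[OF HOL.refl swap])
  have "(\<Sum>r<M. cc r n * fact r * cc r (Suc m)) = (\<Sum>r<M. cc r (Suc m) * fact r * cc r n)" by (rule comm)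
  also have "... = (\<Sum>r<M. cc r m * fact (Suc r) * cc (Suc r) n) + (\<Sum>r<M. cc (Suc r) m * fact (Suc r) * cc r n)"
    using assms by (intro e) simp
  also have "... = (\<Sum>r<M. cc (Suc r) n * fact (Suc r) * cc r m) + (\<Sum>r<M. cc r n * fact (Suc r) * cc (Suc r) m)"
    by (intro arg_cong2[of _ _ _ _ "(+)"] comm)
  also have "... = (\<Sum>r<M. cc r (Suc n) * fact r * cc r m)" using e[of m n] assms by simp
  finally show ?thesis ..
qed

lemma cc_sum: "m + n < M ==> (\<Sum>r<M. cc r n * fact r * cc r m) = cc 0 (m + n)"
proof (induction m arbitrary: n)
  case 0
  obtain M' where M: "M = Suc M'" using 0 by (cases M) simp_all
  show ?case unfolding M sum.lessThan_Suc_shift by simp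
next
  case (Suc m)
  then show ?case using cc_sum_step[of m n M] Suc.IH[of "Suc n"] by simp
qed

definition shl :: "(nat \<times> nat) list => (nat \<times> nat) list" where "shl = map (\<lambda>(p, t). (p - 1, t))"

lemma cups_indexD:
  assumes "us \<in> cups_index r n"
  shows "n = r + 2 * length us" "sorted_wrt (>) (map fst us)"
    "i < length us ==> 1 <= fst (us ! i)" "i < length us ==> fst (us ! i) + snd (us ! i) <= (n - 2 * (i + 1)) + 1"
  using assms unfolding cups_index_def by blast+

lemma shl_mem:
  assumes n: "Suc n = r + 2 * l" "length us = l'" "l' <= l" "n = r' + 2 * l'" and s: "sorted_wrt (>) (map fst us)"
    and a: "\<And>i. i < l' ==> 2 <= fst (us ! i)" "\<And>i. i < l' ==> fst (us ! i) + snd (us ! i) <= (Suc n - 2 * (i + 1)) + 1"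
  shows "shl us \<in> cups_index r' n"
proof -
  have f: "fst (shl us ! i) = fst (us ! i) - 1" "snd (shl us ! i) = snd (us ! i)" if "i < l'" for i
    using that n(2) by (simp_all add: shl_def case_prod_beta)
  have sn: "fst (us ! j) < fst (us ! i)" if "i < j" "j < l'" for i j
    using s that n(2) by (simp add: sorted_wrt_iff_nth_less)
  have "sorted_wrt (>) (map fst (shl us))"
    unfolding sorted_wrt_iff_nth_less
  proof (intro allI impI)
    fix i j assume h: "i < j" "j < length (map fst (shl us))"
    then have l: "i < l'" "j < l'" using n(2) by (simp_all add: shl_def)
    then show "map fst (shl us) ! j < map fst (shl us) ! i" using f[of i] f[of j] sn[OF h(1) l(2)] a(1)[of i] a(1)[of j] n(2) by (simp add: shl_def)
  qed
  moreover have "length (shl us) = l'" using n by (simp add: shl_def)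
  moreover have "1 <= fst (shl us ! i) \<and> fst (shl us ! i) + snd (shl us ! i) <= (n - 2 * (i + 1)) + 1" if "i < l'" for i
    proof -
    have "2 * (i + 1) <= n" using n that by simp
    then show ?thesis unfolding f[OF that] using a(1)[OF that] a(2)[OF that] by arith
  qed
  ultimately show ?thesis using n unfolding cups_index_def by simp
qed

lemma shl_inj: "(\<And>y. y \<in> set us ==> 1 <= fst y) ==> (\<And>y. y \<in> set vs ==> 1 <= fst y) ==> shl us = shl vs ==> us = vs"
proof (induction us arbitrary: vs)
  case Nil
  then show ?case by (simp add: shl_def)
next
  case (Cons y us)
  obtain z vs' where vs: "vs = z # vs'" using Cons.prems(3) by (cases vs) (simp_all add: shl_def)
  have "us = vs'" using Cons.prems vs by (intro Cons.IH) (simp_all add: shl_def)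
  moreover have "y = z" using Cons.prems(1)[of y] Cons.prems(2)[of z] Cons.prems(3) vs
    by (cases y; cases z) (simp add: shl_def, linarith)
  ultimately show ?case using vs by simp
qed

lemma cups_ge1: "us \<in> cups_index r n ==> y \<in> set us ==> 1 <= fst y"
  using cups_indexD(3)[of us r n] by (auto simp: in_set_conv_nth)

lemma cups_split:
  assumes us: "us \<in> cups_index r (Suc n)"
  shows "(r > 0 \<and> shl us \<in> cups_index (r - 1) n) \<or> (\<exists>vs t. us = vs @ [(1, t)] \<and> t <= r \<and> shl vs \<in> cups_index (r + 1) n)"
proof -
  note d = cups_indexD[OF us]
  have sn: "fst (us ! j) < fst (us ! i)" if "i < j" "j < length us" for i j
    using d(2) that by (simp add: sorted_wrt_iff_nth_less)
  show ?thesis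
  proof (cases "us \<noteq> [] \<and> fst (last us) = 1")
    case True
    then obtain vs y where uy: "us = vs @ [y]" by (cases us rule: rev_cases) auto
    obtain t where "y = (1, t)" using True uy by (cases y) auto
    with uy have u: "us = vs @ [(1, t)]" by simp
    have t: "t <= r" using d(4)[of "length vs"] d(1) by (simp add: u)
    have "shl vs \<in> cups_index (r + 1) n"
    proof (rule shl_mem[OF d(1)])
      show "length vs = length vs" "length vs <= length us" "n = r + 1 + 2 * length vs" using u d(1) by simp_all
      show "sorted_wrt (>) (map fst vs)" using d(2) by (simp add: u sorted_wrt_append)
      fix i assume i: "i < length vs"
      show "2 <= fst (vs ! i)" using sn[of i "length vs"] i by (simp add: u nth_append)
      show "fst (vs ! i) + snd (vs ! i) <= (Suc n - 2 * (i + 1)) + 1" using d(4)[of i] i by (simp add: u nth_append)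
    qed
    then show ?thesis using u t by blast
  next
    case False
    have ge: "2 <= fst (us ! i)" if "i < length us" for i
    proof (cases "i = length us - 1")
      case True
      have "us \<noteq> []" using that by auto
      then have "fst (us ! i) \<noteq> 1" using False last_conv_nth[of us] True by simp
      then show ?thesis using d(3)[OF that] by simp
    next
      case F: False
      have l: "length us - 1 < length us" "i < length us - 1" using that F by simp_all
      then show ?thesis using sn[OF l(2,1)] d(3)[OF l(1)] by simp
    qed
    have r: "r > 0"
    proof (cases us)
      case Nil
      then show ?thesis using d(1) by simp
    next
      case (Cons y ys)
      then have l: "length us - 1 < length us" by simp
      show ?thesis using ge[OF l] d(4)[OF l] d(1) Cons by simp
    qed
    have "shl us \<in> cups_index (r - 1) n"
      by (rule shl_mem[OF d(1) _ order_refl _ d(2) ge d(4)]) (use d(1) r in simp_all)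
    then show ?thesis using r by blast
  qed
qed

lemma cups_card: "finite (cups_index r n) \<and> card (cups_index r n) <= cc r n"
proof (induction n arbitrary: r)
  case 0
  have "cups_index r 0 = (if r = 0 then {[]} else {})" by (auto simp: cups_index_def)
  then show ?case by simp
next
  case (Suc n)
  define A where "A = (if r = 0 then {} else cups_index (r - 1) n)"
  define B where "B = {..r} \<times> cups_index (r + 1) n"
  define g where "g us = (if r > 0 \<and> shl us \<in> cups_index (r - 1) n then Inl (shl us) else Inr (snd (last us), shl (butlast us)))" for us
  have fin: "finite A" "finite B" using Suc.IH by (simp_all add: A_def B_def)
  have gl: "g us = Inl (shl us)" if "r > 0 \<and> shl us \<in> cups_index (r - 1) n" for us unfolding g_def using that by (rule if_P)
  have gr: "g us = Inr (snd (last us), shl (butlast us))" if "\<not> (r > 0 \<and> shl us \<in> cups_index (r - 1) n)" for us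
    unfolding g_def using that by (rule if_not_P)
  have sp: "\<exists>us' t. us = us' @ [(1, t)] \<and> t <= r \<and> shl us' \<in> cups_index (r + 1) n"
    if "us \<in> cups_index r (Suc n)" "\<not> (r > 0 \<and> shl us \<in> cups_index (r - 1) n)" for us
    by (rule mp[OF disj_imp[THEN iffD1, OF cups_split[OF that(1)]] that(2)])
  have gr': "g (us' @ [(1, t)]) = Inr (t, shl us')" if "\<not> (r > 0 \<and> shl (us' @ [(1, t)]) \<in> cups_index (r - 1) n)" for us' t
    using gr[OF that] by simp
  have img: "g us \<in> A <+> B" if us: "us \<in> cups_index r (Suc n)" for us
  proof (cases "r > 0 \<and> shl us \<in> cups_index (r - 1) n")
    case True
    then have "shl us \<in> A" unfolding A_def by simp
    then show ?thesis unfolding gl[OF True] by (rule InlI)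
  next
    case False
    obtain us' t where v: "us = us' @ [(1, t)]" "t <= r" "shl us' \<in> cups_index (r + 1) n" using sp[OF us False] by (elim exE conjE)
    have "(t, shl us') \<in> B" unfolding B_def by (rule SigmaI) (use v(2,3) in simp_all)
    then show ?thesis unfolding v(1) gr'[OF False[unfolded v(1)]] by (rule InrI)
  qed
  then have img: "g ` cups_index r (Suc n) \<subseteq> A <+> B" by (rule image_subsetI)
  have inj: "inj_on g (cups_index r (Suc n))"
  proof (rule inj_onI)
    fix us vs assume h: "us \<in> cups_index r (Suc n)" "vs \<in> cups_index r (Suc n)" "g us = g vs"
    show "us = vs"
    proof (cases "r > 0 \<and> shl us \<in> cups_index (r - 1) n")
      case T: True
      show ?thesis
      proof (cases "r > 0 \<and> shl vs \<in> cups_index (r - 1) n")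
        case True
        have e: "shl us = shl vs" using h(3) unfolding gl[OF T] gl[OF True] by (rule Inl_inject)
        show ?thesis by (rule shl_inj[OF _ _ e], erule cups_ge1[OF h(1)], erule cups_ge1[OF h(2)])
      next
        case False
        then show ?thesis using h(3) unfolding gl[OF T] gr[OF False] by (elim Inl_not_Inr[THEN notE])
      qed
    next
      case F: False
      show ?thesis
      proof (cases "r > 0 \<and> shl vs \<in> cups_index (r - 1) n")
        case True
        then show ?thesis using h(3) unfolding gl[OF True] gr[OF F] by (elim Inr_not_Inl[THEN notE])
      next
        case False
        obtain us' t where u: "us = us' @ [(1, t)]" using sp[OF h(1) F] by (elim exE conjE)
        obtain vs' t' where v: "vs = vs' @ [(1, t')]" using sp[OF h(2) False] by (elim exE conjE)
        have "(t, shl us') = (t', shl vs')"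
          using h(3) unfolding u v gr'[OF F[unfolded u]] gr'[OF False[unfolded v]] by (rule Inr_inject)
        then have e: "t = t'" "shl us' = shl vs'" by simp_all
        have "us' = vs'"
          by (rule shl_inj[OF _ _ e(2)]) (simp_all add: cups_ge1[OF h(1), unfolded One_nat_def] cups_ge1[OF h(2), unfolded One_nat_def] u v)
        then show ?thesis using u v e(1) by simp
      qed
    qed
  qed
  have fAB: "finite (A <+> B)" using fin by simp
  have "finite (g ` cups_index r (Suc n))" by (rule finite_subset[OF img fAB])
  then have f: "finite (cups_index r (Suc n))" using inj by (rule finite_imageD)
  have "card (cups_index r (Suc n)) <= card (A <+> B)" by (rule card_inj_on_le[OF inj img fAB])
  also have "... = card A + (r + 1) * card (cups_index (r + 1) n)" using fin by (simp add: card_Plus B_def card_cartesian_product)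
  also have "... <= cc r (Suc n)"
  proof (cases r)
    case 0
    then show ?thesis using Suc.IH[of 1] by (simp add: A_def)
  next
    case (Suc r')
    have "card A <= cc r' n" using Suc.IH[of r'] Suc by (simp add: A_def)
    moreover have "(r + 1) * card (cups_index (r + 1) n) <= (r' + 2) * cc (r' + 2) n"
      using Suc.IH[of "r + 1"] Suc by (intro mult_le_mono) simp_all
    ultimately show ?thesis using Suc by simp
  qed
  finally show ?case using f by blast
qed

lemma caps_rev: "js \<in> caps_index m r ==> rev js \<in> cups_index r m"
proof -
  assume js: "js \<in> caps_index m r"
  have m: "m = r + 2 * length js" and s: "sorted_wrt (<) (map fst js)" using js by (simp_all add: caps_index_def)
  have n: "1 <= fst (js ! i) \<and> fst (js ! i) + snd (js ! i) <= (r + 2 * i) + 1" if "i < length js" for i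
    using js that unfolding caps_index_def by blast
  have "1 <= fst (rev js ! i) \<and> fst (rev js ! i) + snd (rev js ! i) <= (m - 2 * (i + 1)) + 1" if i: "i < length (rev js)" for i
  proof -
    have l: "length js - Suc i < length js" using i by simp
    have "(r + 2 * (length js - Suc i)) + 1 = (m - 2 * (i + 1)) + 1" using i m by simp
    then show ?thesis using n[OF l] i by (simp add: rev_nth)
  qed
  moreover have "sorted_wrt (>) (map fst (rev js))" using s by (simp add: rev_map[symmetric] sorted_wrt_rev)
  ultimately show ?thesis unfolding cups_index_def using m by simp
qed

lemma caps_card: "finite (caps_index m r) \<and> card (caps_index m r) <= cc r m"
proof -
  have i: "inj_on rev (caps_index m r)" by (simp add: inj_on_def)
  have s: "rev ` caps_index m r \<subseteq> cups_index r m" using caps_rev by blast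
  have "finite (rev ` caps_index m r)" using s cups_card finite_subset by blast
  then have "finite (caps_index m r)" using i by (rule finite_imageD)
  moreover have "card (caps_index m r) <= card (cups_index r m)" using card_inj_on_le[OF i s] cups_card by blast
  ultimately show ?thesis using cups_card[of r m] by simp
qed

lemma W_card:
  assumes W: "reduced_word_system W"
  shows "finite (W r) \<and> card (W r) <= fact r"
proof -
  have sub: "word_perm ` W r \<subseteq> {\<pi>. \<pi> permutes {1..r}}"
    using word_perm_permutes[OF reduced_wordD(1)[OF reduced_systemD(1)[OF W]]] by blast
  have inj: "inj_on word_perm (W r)"
  proof (rule inj_onI)
    fix v w assume h: "v \<in> W r" "w \<in> W r" "word_perm v = word_perm w"
    have "word_perm v permutes {1..r}" using sub h(1) by blast
    from reduced_systemD(2)[OF W this] obtain u where u: "\<And>x. x \<in> W r \<and> word_perm x = word_perm v ==> x = u"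
      by (elim ex1E) blast
    have "v = u" "w = u" using h by (auto intro: u)
    then show "v = w" by simp
  qed
  have f: "finite {\<pi>. \<pi> permutes {1..r}}" by (rule finite_permutations) simp
  have c: "card {\<pi>. \<pi> permutes {1..r}} = fact r" by (rule card_permutations) simp_all
  show ?thesis using finite_imageD[OF finite_subset[OF sub f] inj] card_inj_on_le[OF inj sub f] unfolding c by simp
qed

lemma std_card:
  assumes W: "reduced_word_system W"
  shows "finite (std_index W m n) \<and> card (std_index W m n) <= cc 0 (m + n)"
proof -
  let ?M = "m + n + 1"
  let ?T = "\<lambda>r. cups_index r n \<times> W r \<times> caps_index m r"
  have e: "std_index W m n = (\<Union>r<?M. ?T r)"
  proof -
    have "?T r = {}" if "\<not> r < ?M" for r
    proof -
      have "cups_index r n = {}" using that by (auto simp: cups_index_def)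
      then show ?thesis by simp
    qed
    then show ?thesis unfolding std_index_def by blast
  qed
  have f: "finite (?T r)" for r using cups_card caps_card W_card[OF W] by blast
  have "card (?T r) <= cc r n * fact r * cc r m" for r
    unfolding card_cartesian_product mult.assoc using cups_card[of r n] caps_card[of m r] W_card[OF W, of r] by (intro mult_le_mono) simp_all
  then have "card (std_index W m n) <= (\<Sum>r<?M. cc r n * fact r * cc r m)"
    unfolding e by (intro order_trans[OF card_UN_le sum_mono]) simp_all
  also have "... = cc 0 (m + n)" by (rule cc_sum) simp
  finally show ?thesis unfolding e using f by simp
qed

lemma codes_card: "finite (codes k) \<and> card (codes k) = cc 0 (2 * k)"
proof (induction k)
  case (Suc k)
  have e: "codes (Suc k) = (\<lambda>(j, xs). j # xs) ` ({2..2 * k + 2} \<times> codes k)"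
    unfolding codes.simps(2) by (auto simp: image_iff)
  have i: "inj_on (\<lambda>(j, xs). j # xs) ({2..2 * k + 2} \<times> codes k)" by (auto simp: inj_on_def)
  have "card (codes (Suc k)) = (2 * k + 1) * card (codes k)"
    unfolding e card_image[OF i] by (simp add: card_cartesian_product)
  then show ?case using Suc.IH cc_even[of k] unfolding e by simp
qed simp

section \<open>Linear independence\<close>

lemma vector_space_sc: "vector_space (sc :: 'k::field => 'k vec => 'k vec)"
  by (standard; simp add: vec_eq_iff algebra_simps)

definition unit_vec :: "nat list => 'k::field vec" where "unit_vec c = Vec (\<lambda>xs. if xs = c then 1 else 0)"

lemma co_unit_vec: "co (unit_vec c) xs = (if xs = c then 1 else 0)" by (simp add: unit_vec_def Vec_inverse)

lemma NN_dim:
  fixes T :: "'k::field vec set"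
  assumes T: "finite T" "NN k \<subseteq> module.span sc T"
  shows "card (codes k) <= card T"
proof -
  interpret V: vector_space "sc :: 'k => 'k vec => 'k vec" by (rule vector_space_sc)
  let ?E = "(unit_vec :: nat list => 'k vec) ` codes k"
  have inj: "inj_on (unit_vec :: nat list => 'k vec) (codes k)"
  proof (rule inj_onI)
    fix c c' assume "(unit_vec c :: 'k vec) = unit_vec c'"
    then have "co (unit_vec c :: 'k vec) c = co (unit_vec c' :: 'k vec) c" by simp
    then show "c = c'" by (simp add: co_unit_vec split: if_splits)
  qed
  have fin: "finite ?E" using codes_card by blast
  have ind: "V.independent ?E"
  proof (rule V.independent_if_scalars_zero[OF fin])
    fix g x assume z: "(\<Sum>x\<in>?E. sc (g x) x) = 0" and x: "x \<in> ?E"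
    obtain c where c: "x = unit_vec c" "c \<in> codes k" using x by blast
    have "0 = co (\<Sum>x\<in>?E. sc (g x) x) c" unfolding z by simp
    also have "... = (\<Sum>x\<in>?E. g x * co x c)" by (simp add: co_sum)
    also have "... = (\<Sum>d\<in>codes k. g (unit_vec d) * (if c = d then 1 else 0))"
      by (subst sum.reindex[OF inj]) (simp add: co_unit_vec)
    also have "... = (\<Sum>d\<in>codes k. if c = d then g (unit_vec d) else 0)" by (rule sum.cong) simp_all
    also have "... = g x" using c codes_card[of k] by (simp add: sum.delta')
    finally show "g x = 0" by simp
  qed
  have "?E \<subseteq> NN k" by (auto simp: NN_def co_unit_vec)
  then have "card ?E <= card T" using V.independent_span_bound[OF T(1) ind] T(2) by blast
  then show ?thesis using card_image[OF inj] by simp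
qed

context chord_params
begin

lemma good_PR:
  assumes p: "\<epsilon> = psign p"
  shows "good_pres p PR"
proof -
  have "lam \<noteq> b" using nz(4) a_eq by (auto simp: power2_eq_square)
  then have "lam' \<noteq> 0" using lam' nz(1) by auto
  then show ?thesis
    by unfold_locales (use nz e2 in \<open>simp_all add: PR_def p[symmetric] power2_eq_square\<close>)
qed

definition LL :: "nat => 'k expr set => 'k vec" where
  "LL m X = act 0 m (SOME t. t \<in> X) (om m)"

lemma presented_brauer:
  assumes p: "\<epsilon> = psign p" and W: "reduced_word_system W"
  shows "brauer_type W (presented p (relations PR)) p (cls p (relations PR) GenH) (cls p (relations PR) GenA) (cls p (relations PR) GenU)"
proof -
  interpret G: good_pres p PR by (rule good_PR[OF p])
  interpret V: vector_space "sc :: 'k => 'k vec => 'k vec" by (rule vector_space_sc)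
  let ?C = "presented p (relations PR)"
  let ?ev = "ev ?C (G.cl GenH) (G.cl GenA) (G.cl GenU)"
  have LLc: "LL m (G.cl t) = act 0 m t (om m)" if "wf_expr t" "src t = m" for m t
  proof -
    have "(SOME s. s \<in> G.cl t) \<in> G.cl t" using someI[of "\<lambda>s. s \<in> G.cl t" t] G.cl_self[OF that(1)] by blast
    then have "cong_expr p (relations PR) t (SOME s. s \<in> G.cl t)" by (rule G.cl_mem)
    then have "act 0 m t (om m) = act 0 m (SOME s. s \<in> G.cl t) (om m)"
      using that om_NN by (intro act_sound[OF p]) simp_all
    then show ?thesis unfolding LL_def by simp
  qed
  have LL_AD: "LL m (G.AD X Y) = LL m X + LL m Y" if "X \<in> G.TT m n" "Y \<in> G.TT m n" for m n X Y
    using that by (elim G.TTE, hypsubst) (simp add: G.cl_add LLc)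
  have LL_SC: "LL m (G.SC c X) = sc c (LL m X)" if "X \<in> G.TT m n" for m n c X
    using that by (elim G.TTE, hypsubst) (simp add: G.cl_scale LLc)
  have LL_ZE: "LL m (G.ZE m n) = 0" for m n by (simp add: LLc)
  have evc: "?ev (std_expr n x) = G.cl (std_expr n x)" and stdT: "G.cl (std_expr n x) \<in> G.TT m n" if "x \<in> std_index W m n" for m n x
  proof -
    have "wf_expr (std_expr n x :: 'k expr) \<and> src (std_expr n x :: 'k expr) = m \<and> tgt (std_expr n x :: 'k expr) = n"
      by (rule std_expr_wf[OF W that])
    then show "?ev (std_expr n x) = G.cl (std_expr n x)" "G.cl (std_expr n x) \<in> G.TT m n" by (simp_all add: G.ev_presented G.cl_TTI)
  qed
  define f where "f m n x = LL m (G.cl (std_expr n x :: 'k expr))" for m n x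
  have key: "J = std_index W m n"
    if J: "J \<subseteq> std_index W m n" "f m n ` std_index W m n \<subseteq> V.span (f m n ` J)" and mn: "even (m + n)" for J m n
  proof -
    obtain k where k: "m + n = 2 * k" using mn by (rule evenE)
    have fin: "finite (std_index W m n)" "card (std_index W m n) <= card (codes k)"
      using std_card[OF W, of m n] codes_card[of k] k by simp_all
    have fJ: "finite J" by (rule finite_subset[OF J(1) fin(1)])
    have sp: "LL m X \<in> V.span (f m n ` std_index W m n)" if "X \<in> G.TT m n" for X
      using G.std_span[OF W that]
    proof (induction rule: G.spn.induct)
      case (spn_gen x)
      then show ?case unfolding f_def by (intro V.span_base) blast
    next
      case spn_zero
      then show ?case by (simp add: LL_ZE V.span_zero)
    next
      case (spn_add x y)
      have T: "(\<lambda>x. G.cl (std_expr n x)) ` std_index W m n \<subseteq> G.TT m n" using stdT by blast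
      show ?case using spn_add.IH G.spn_TT[OF T spn_add.hyps(1)] G.spn_TT[OF T spn_add.hyps(2)] by (simp add: LL_AD[of _ m n] V.span_add)
    next
      case (spn_scl x c)
      have T: "(\<lambda>x. G.cl (std_expr n x)) ` std_index W m n \<subseteq> G.TT m n" using stdT by blast
      show ?case using spn_scl.IH G.spn_TT[OF T spn_scl.hyps] by (simp add: LL_SC[of _ m n] V.span_scale)
    qed
    have "NN k \<subseteq> V.span (f m n ` J)"
    proof
      fix v :: "'k vec" assume "v \<in> NN k"
      then obtain t where t: "wf_expr t" "src t = m" "tgt t = n" "act 0 m t (om m) = v" using act_surj[OF p, of v k m n] k by auto
      have "v \<in> V.span (f m n ` std_index W m n)" using sp[OF G.cl_TTI[OF t(1-3)]] t LLc by simp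
      then show "v \<in> V.span (f m n ` J)" using V.span_minimal[OF J(2) V.subspace_span] by blast
    qed
    then have "card (codes k) <= card (f m n ` J)" using fJ by (intro NN_dim) simp_all
    also have "... <= card J" by (rule card_image_le[OF fJ])
    finally show ?thesis using fin J(1) by (intro card_subset_eq) (simp_all add: card_mono le_antisym)
  qed
  have odd_empty: "std_index W m n = {}" if "odd (m + n)" for m n
    using that by (auto simp: std_index_def cups_index_def caps_index_def)
  have key': False if s: "s \<in> std_index W m n" and sp: "f m n s \<in> V.span (f m n ` (std_index W m n - {s}))" for s m n
  proof (cases "even (m + n)")
    case True
    have "f m n ` std_index W m n \<subseteq> V.span (f m n ` (std_index W m n - {s}))"
    proof
      fix v assume "v \<in> f m n ` std_index W m n"
      then obtain s' where "v = f m n s'" "s' \<in> std_index W m n" by blast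
      then show "v \<in> V.span (f m n ` (std_index W m n - {s}))" using sp by (cases "s' = s") (auto intro: V.span_base)
    qed
    then have "std_index W m n - {s} = std_index W m n" using True by (intro key) auto
    then show False using s by blast
  qed (use odd_empty s in blast)
  have inj: "inj_on (\<lambda>x. ?ev (std_expr n x)) (std_index W m n)" for m n
  proof (rule inj_onI, rule ccontr)
    fix x y assume h: "x \<in> std_index W m n" "y \<in> std_index W m n" "?ev (std_expr n x) = ?ev (std_expr n y)" "x \<noteq> y"
    then have "f m n x = f m n y" unfolding f_def using evc by simp
    then have "f m n x \<in> V.span (f m n ` (std_index W m n - {x}))" using h by (auto intro!: V.span_base)
    then show False by (rule key'[OF h(1)])
  qed
  have basis: "vectorspace.basis class_ring (hom ?C m n) ((\<lambda>x. ?ev (std_expr n x)) ` std_index W m n)" for m n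
  proof -
    interpret H: vectorspace class_ring "hom ?C m n" by (rule G.presented_vs)
    let ?S = "(\<lambda>x. G.cl (std_expr n x)) ` std_index W m n"
    have S: "(\<lambda>x. ?ev (std_expr n x)) ` std_index W m n = ?S" using evc by (intro image_cong) simp_all
    have sub: "?S \<subseteq> carrier (hom ?C m n)" using stdT by auto
    have sm: "submodule class_ring (H.span ?S) (hom ?C m n)" by (rule H.span_is_submodule[OF sub])
    have "X \<in> H.span ?S" if "X \<in> G.TT m n" for X
      using G.std_span[OF W that]
    proof (induction rule: G.spn.induct)
      case (spn_gen x)
      then show ?case using H.in_own_span[OF sub] by blast
    next
      case spn_zero
      then show ?case using submodule.zero_closed[OF sm] by simp
    next
      case (spn_add x y)
      then show ?case using submodule.m_closed[OF sm, of x y] by simp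
    next
      case (spn_scl x c)
      then show ?case using submodule.smult_closed[OF sm, of c x] by simp
    qed
    then have gen: "H.span ?S = carrier (hom ?C m n)" using H.span_is_subset2[OF sub] by auto
    have ind: "\<not> H.lin_dep ?S"
    proof
      assume "H.lin_dep ?S"
      then obtain A g v where A: "finite A" "A \<subseteq> ?S" "H.lincomb g A = \<zero>\<^bsub>hom ?C m n\<^esub>" "v \<in> A" "g v \<noteq> 0"
        unfolding H.lin_dep_def by auto
      have AT: "A \<subseteq> G.TT m n" using A(2) sub by simp
      have lc: "B \<subseteq> G.TT m n ==> LL m (H.lincomb g B) = (\<Sum>w\<in>B. sc (g w) (LL m w)) \<and> H.lincomb g B \<in> G.TT m n" if "finite B" for B
        using that
      proof (induction B rule: finite_induct)
        case empty
        then show ?case by (simp add: H.lincomb_def LL_ZE)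
      next
        case (insert w B)
        have "H.lincomb g (insert w B) = G.AD (G.SC (g w) w) (H.lincomb g B)"
          unfolding H.lincomb_def using insert by (subst H.M.finsum_insert) (auto simp: Pi_def subset_iff)
        then show ?case using insert LL_AD[of "G.SC (g w) w" m n] LL_SC[of w m n] by simp
      qed
      have z: "(\<Sum>w\<in>A. sc (g w) (LL m w)) = 0" using lc[OF A(1) AT] A(3) by (simp add: LL_ZE)
      obtain s where s: "v = G.cl (std_expr n s)" "s \<in> std_index W m n" using A(2,4) by blast
      have "sc (g v) (LL m v) + (\<Sum>w\<in>A - {v}. sc (g w) (LL m w)) = 0"
        using z sum.remove[OF A(1,4), of "\<lambda>w. sc (g w) (LL m w)"] by simp
      then have "sc (g v) (LL m v) = - (\<Sum>w\<in>A - {v}. sc (g w) (LL m w))" by (simp add: eq_neg_iff_add_eq_0)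
      moreover have "(\<Sum>w\<in>A - {v}. sc (g w) (LL m w)) \<in> V.span (f m n ` (std_index W m n - {s}))"
      proof (intro V.span_sum V.span_scale V.span_base)
        fix w assume w: "w \<in> A - {v}"
        then obtain s' where s': "w = G.cl (std_expr n s')" "s' \<in> std_index W m n" using A(2) by blast
        then have "s' \<noteq> s" using w s(1) by blast
        then show "LL m w \<in> f m n ` (std_index W m n - {s})" using s' unfolding f_def by blast
      qed
      ultimately have "sc (g v) (LL m v) \<in> V.span (f m n ` (std_index W m n - {s}))" by (simp add: V.span_neg)
      then have "sc (1 / g v) (sc (g v) (LL m v)) \<in> V.span (f m n ` (std_index W m n - {s}))" by (rule V.span_scale)
      then have "f m n s \<in> V.span (f m n ` (std_index W m n - {s}))" unfolding f_def s(1)[symmetric] using A(5) by simp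
      then show False by (rule key'[OF s(2)])
    qed
    show ?thesis unfolding S H.basis_def using sub gen ind by simp
  qed
  have H: "G.sG 2 1 = G.cl GenH" by (simp add: G.sG_def G.wh_def)
  have inv: "\<exists>X\<in>carrier (hom ?C 2 2). cmp ?C 2 2 2 X (G.cl GenH) = idm ?C 2 \<and> cmp ?C 2 2 2 (G.cl GenH) X = idm ?C 2"
    using G.tS[of 1 2] G.TT_tG[of 1 2] unfolding H by (intro bexI[of _ "G.tG 2 1"]) simp_all
  have surj: "\<exists>t. wf_expr t \<and> src t = m \<and> tgt t = n \<and> ?ev t = x" if "x \<in> carrier (hom ?C m n)" for m n x
  proof -
    have "x \<in> G.TT m n" using that by simp
    then obtain t where "x = G.cl t" "wf_expr t" "src t = m" "tgt t = n" by (rule G.TTE)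
    then show ?thesis using G.ev_presented by (intro exI[of _ t]) simp
  qed
  have br: "satisfies ?C (G.cl GenH) (G.cl GenA) (G.cl GenU) {braid_relation}"
  proof -
    obtain s t where st: "braid_relation = (s, t :: 'k expr)" by force
    have r: "(s, t) \<in> relations PR" unfolding st[symmetric] relations_def by simp
    have w: "wf_expr s" "wf_expr t" using relations_wf[OF r] by simp_all
    have "?ev s = ?ev t" using G.rel[OF r] w by (simp add: G.ev_presented)
    then show ?thesis unfolding satisfies_def st by simp
  qed
  show ?thesis unfolding brauer_type_def
    using G.presented_supercategory G.presented_gens surj inv br inj basis by (intro conjI allI ballI) simp_all
qed

end

theorem proposition7p7:
  fixes W :: "nat \<Rightarrow> nat list set"
  assumes char: "(2 :: 'k::field) \<noteq> 0"
    and W: "reduced_word_system W"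
  shows
    "(\<forall>(C :: ('k, 'h) supercat) p H A U (P :: 'k params) (\<epsilon> :: 'k).
        brauer_type W C p H A U \<and> satisfies C H A U (relations P) \<and> \<epsilon> = psign p \<and>
        p_f P = 0 \<and> p_f' P = p_b P \<and> p_b P \<noteq> 0 \<and> p_sig P \<noteq> 0 \<longrightarrow>
        (p_lam' P = p_lam P \<or> p_lam' P \<noteq> p_lam P \<and> p_lam' P = p_b P - p_lam P) \<and>
        (p_e P)\<^sup>2 = - \<epsilon> \<and>
        p_a P = (p_lam P)\<^sup>2 - p_b P * p_lam P \<and>
        p_c P = 0 \<and>
        p_sig' P = \<epsilon> * p_sig P \<and>
        p_rho P = \<epsilon> * p_e P * p_sig P * (p_lam P - p_b P) \<and>
        p_del P = \<epsilon> * p_e P * p_sig P * (p_lam P + p_lam' P - p_b P) / p_b P \<and>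
        p_e' P = - \<epsilon> * p_e P \<and>
        p_d P = - p_e P * p_b P \<and>
        p_d' P = 0 \<and>
        p_D P = (p_lam P - p_b P) * p_b P \<and>
        p_E P = p_b P \<and>
        p_D' P = 0 \<and>
        p_E' P = 0 \<and>
        p_F P = - \<epsilon> * p_e P * p_a P \<and>
        p_F' P = p_e P * p_a P)
     \<and>
     (\<forall>p (\<epsilon> :: 'k) lam b sig a e lam'.
        \<epsilon> = psign p \<and> lam \<noteq> 0 \<and> b \<noteq> 0 \<and> sig \<noteq> 0 \<and>
        a = lam\<^sup>2 - b * lam \<and> a \<noteq> 0 \<and> e\<^sup>2 = - \<epsilon> \<and> lam' \<in> {lam, b - lam} \<longrightarrow>
        (let R = relations \<lparr>
             p_lam = lam, p_lam' = lam',
             p_del = \<epsilon> * e * sig * (lam + lam' - b) / b,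
             p_sig = sig, p_sig' = \<epsilon> * sig,
             p_rho = \<epsilon> * e * sig * (lam - b),
             p_a = a, p_b = b, p_c = 0,
             p_d = - e * b, p_e = e, p_f = 0,
             p_D = (lam - b) * b, p_E = b, p_F = - \<epsilon> * e * a,
             p_d' = 0, p_e' = - \<epsilon> * e, p_f' = b,
             p_D' = 0, p_E' = 0, p_F' = e * a \<rparr>
         in brauer_type W (presented p R) p (cls p R GenH) (cls p R GenA) (cls p R GenU)))"
proof (rule conjI; (intro allI impI)?)
  fix C :: "('k, 'h) supercat" and p H A U and P :: "'k params" and \<epsilon> :: 'k
  assume h: "brauer_type W C p H A U \<and> satisfies C H A U (relations P) \<and> \<epsilon> = psign p \<and>
        p_f P = 0 \<and> p_f' P = p_b P \<and> p_b P \<noteq> 0 \<and> p_sig P \<noteq> 0"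
  then have B: "brauer_type W C p H A U" "satisfies C H A U (relations P)" "\<epsilon> = psign p" "p_f P = 0" "p_f' P = p_b P" "p_b P \<noteq> 0" "p_sig P \<noteq> 0"
    by simp_all
  show "(p_lam' P = p_lam P \<or> p_lam' P \<noteq> p_lam P \<and> p_lam' P = p_b P - p_lam P) \<and>
        (p_e P)\<^sup>2 = - \<epsilon> \<and>
        p_a P = (p_lam P)\<^sup>2 - p_b P * p_lam P \<and>
        p_c P = 0 \<and>
        p_sig' P = \<epsilon> * p_sig P \<and>
        p_rho P = \<epsilon> * p_e P * p_sig P * (p_lam P - p_b P) \<and>
        p_del P = \<epsilon> * p_e P * p_sig P * (p_lam P + p_lam' P - p_b P) / p_b P \<and>
        p_e' P = - \<epsilon> * p_e P \<and>
        p_d P = - p_e P * p_b P \<and>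
        p_d' P = 0 \<and>
        p_D P = (p_lam P - p_b P) * p_b P \<and>
        p_E P = p_b P \<and>
        p_D' P = 0 \<and>
        p_E' P = 0 \<and>
        p_F P = - \<epsilon> * p_e P * p_a P \<and>
        p_F' P = p_e P * p_a P"
    using brauer_parameters[OF W B] by blast
next
  fix p and \<epsilon> lam b sig a e lam' :: 'k
  assume h: "\<epsilon> = psign p \<and> lam \<noteq> 0 \<and> b \<noteq> 0 \<and> sig \<noteq> 0 \<and>
        a = lam\<^sup>2 - b * lam \<and> a \<noteq> 0 \<and> e\<^sup>2 = - \<epsilon> \<and> lam' \<in> {lam, b - lam}"
  have "\<epsilon> * \<epsilon> = 1" using h by (simp add: psign_def)
  then interpret chord_params lam lam' b e sig a \<epsilon> using h by unfold_locales auto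
  have p: "\<epsilon> = psign p" using h by simp
  show "let R = relations \<lparr>
             p_lam = lam, p_lam' = lam',
             p_del = \<epsilon> * e * sig * (lam + lam' - b) / b,
             p_sig = sig, p_sig' = \<epsilon> * sig,
             p_rho = \<epsilon> * e * sig * (lam - b),
             p_a = a, p_b = b, p_c = 0,
             p_d = - e * b, p_e = e, p_f = 0,
             p_D = (lam - b) * b, p_E = b, p_F = - \<epsilon> * e * a,
             p_d' = 0, p_e' = - \<epsilon> * e, p_f' = b,
             p_D' = 0, p_E' = 0, p_F' = e * a \<rparr>
         in brauer_type W (presented p R) p (cls p R GenH) (cls p R GenA) (cls p R GenU)"
    unfolding Let_def using presented_brauer[OF p W] unfolding PR_def .
qed

end
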